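(* Let $\mathcal{G}=(\Gamma,G)$ be a locally finite nonsingular graph of countable groups. Then $E_{\mathcal{G}}=(E_{\mathcal{G}}^0:=\mathcal{G}^1,\ E_{\mathcal{G}}^1:=\mathcal{G}^2,\ r_E,s_E)$, where $s_E:\mathcal{G}^2\to\mathcal{G}^1$ is $s_E(g_1e_1g_2e_2)=g_2e_2$ and $r_E:\mathcal{G}^2\to\mathcal{G}^1$ is $r_E(g_1e_1g_2e_2)=g_1e_1$, is a row-finite directed graph with no sources. Let $\{p_\nu:\nu\in E_{\mathcal{G}}^0\}$ and $\{t_\mu:\mu\in E_{\mathcal{G}}^1\}$ be the Cuntz--Krieger $E_{\mathcal{G}}$-family generating $C^*(E_{\mathcal{G}})$, and $\{u_x,s_e\}$ the universal $\mathcal{G}$-family generating $C^*(\mathcal{G})$. There is an embedding (injective $*$-homomorphism) $\phi:C^*(E_{\mathcal{G}})\hookrightarrow C^*(\mathcal{G})$ satisfying $$\phi(p_\nu)=s_\nu s_\nu^*\quad\text{and}\quad\phi(t_\mu)=s_\mu s_{s_E(\mu)}^*$$ for all $\nu\in E_{\mathcal{G}}^0$, $\mu\in E_{\mathcal{G}}^1$. Moreover, if $G_e=\{1\}$ for each $e\in\Gamma^1$, then $\phi$ maps onto $C^*(\mathcal{G})$.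
   Context: Graphs. A graph $\Gamma=(\Gamma^0,\Gamma^1,r,s)$ consists of countable sets $\Gamma^0$ (vertices) and $\Gamma^1$ (edges), maps $r,s:\Gamma^1\to\Gamma^0$ (range, source), and a map $e\mapsto\overline e$ on $\Gamma^1$ with $\overline e\neq e$, $\overline{\overline e}=e$, $s(e)=r(\overline e)$. Graphs of groups. A graph of groups $\mathcal{G}=(\Gamma,G)$ consists of a connected graph $\Gamma$, groups $G_x$ ($x\in\Gamma^0$) and $G_e=G_{\overline e}$ ($e\in\Gamma^1$), and monomorphisms $\alpha_e:G_e\to G_{r(e)}$. It is locally finite if $|r^{-1}(x)|<\infty$ for all $x\in\Gamma^0$ and $[G_{r(e)}:\alpha_e(G_e)]<\infty$ for all $e\in\Gamma^1$; nonsingular if $[G_{r(e)}:\alpha_e(G_e)]>1$ whenever $r^{-1}(r(e))=\{e\}$; a graph of countable groups if every $G_x$ is countable. For each $e$ fix a transversal $\Sigma_e\ni 1$ for $G_{r(e)}/\alpha_e(G_e)$. $\mathcal{G}$-paths. For $n\ge1$, $\mathcal{G}^n$ is the set of sequences $g_1e_1\cdots g_ne_n$ (the $\mathcal{G}$-paths of length $n$) with $e_i\in\Gamma^1$, $s(e_i)=r(e_{i+1})$, $g_j\in\Sigma_{e_j}$, and $g_{i+1}\neq1$ whenever $e_i=\overline{e_{i+1}}$. $\mathcal{G}$-families. A $\mathcal{G}$-family in a $C^*$-algebra consists of partial isometries $S_e$ ($e\in\Gamma^1$) and, for each $x\in\Gamma^0$, a representation $g\mapsto U_{x,g}$ of $G_x$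 by partial unitaries (unitaries of the corner at the projection $U_{x,1}$) such that: (G1) $U_{x,1}U_{y,1}=0$ for $x\ne y$; (G2) $U_{r(e),\alpha_e(g)}S_e=S_eU_{s(e),\alpha_{\overline e}(g)}$ for $e\in\Gamma^1$, $g\in G_e$; (G3) $U_{s(e),1}=S_e^*S_e+S_{\overline e}S_{\overline e}^*$ for $e\in\Gamma^1$; (G4) $S_e^*S_e=\sum U_{s(e),h}S_fS_f^*U_{s(e),h}^*$, the sum over all $f\in\Gamma^1$ with $r(f)=s(e)$ and $h\in\Sigma_f$ with $hf\neq1\overline e$, for $e\in\Gamma^1$. $C^*(\mathcal{G})$ is the universal $C^*$-algebra generated by a $\mathcal{G}$-family $\{u_x,s_e\}$. For a $\mathcal{G}$-path $\mu=g_1e_1\cdots g_ne_n$ put $s_\mu=u_{r(e_1),g_1}s_{e_1}\cdots u_{r(e_n),g_n}s_{e_n}$. Directed graph algebras. A directed graph $E=(E^0,E^1,r_E,s_E)$ is row-finite if each $r_E^{-1}(\nu)$ is finite and has no sources if each $r_E^{-1}(\nu)$ is nonempty. For such $E$, a Cuntz--Krieger $E$-family consists of mutually orthogonal projections $\{P_\nu:\nu\in E^0\}$ and partial isometries $\{T_\mu:\mu\in E^1\}$ with $T_\mu^*T_\mu=P_{s_E(\mu)}$ for all $\mu\in E^1$ and $P_\nu=\sum_{r_E(\mu)=\nu}T_\mu T_\mu^*$ for all $\nu\in E^0$; $C^*(E)$ is the universal $C^*$-algebra generated by a Cuntz--Krieger $E$-family.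
   Formalization: In the "Moreover" part it is additionally assumed that Γ^1 is nonempty: for a single vertex x without edges the condition on G_e is vacuous, C*(E_G)=0 and C*(G)=C*(G_x) is nonzero, so φ is not onto. *)

theory Defs
  imports "HOL-Algebra.Module" "HOL-Algebra.Left_Coset" "Graph_Theory.Graph_Theory"
begin

section \<open>C*-algebras\<close>

text \<open>
  C*-algebras are not assumed to be unital: the field \<open>one\<close> inherited from the ring record is
  not constrained and not used.
\<close>

record 'a cstar = "(complex, 'a) module" +
  adj :: "'a \<Rightarrow> 'a"  (\<open>(_\<^sup>\<star>\<index>)\<close> [1000] 999)
  nrm :: "'a \<Rightarrow> real"  (\<open>\<parallel>_\<parallel>\<index>\<close>)

locale cstar_algebra = abelian_group A for A :: "'a cstar" (structure) +
  assumes m_closed: "\<lbrakk> x \<in> carrier A; y \<in> carrier A \<rbrakk> \<Longrightarrow> x \<otimes> y \<in> carrier A"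
    and m_assoc: "\<lbrakk> x \<in> carrier A; y \<in> carrier A; z \<in> carrier A \<rbrakk>
      \<Longrightarrow> (x \<otimes> y) \<otimes> z = x \<otimes> (y \<otimes> z)"
    and l_distr: "\<lbrakk> x \<in> carrier A; y \<in> carrier A; z \<in> carrier A \<rbrakk>
      \<Longrightarrow> (x \<oplus> y) \<otimes> z = x \<otimes> z \<oplus> y \<otimes> z"
    and r_distr: "\<lbrakk> x \<in> carrier A; y \<in> carrier A; z \<in> carrier A \<rbrakk>
      \<Longrightarrow> z \<otimes> (x \<oplus> y) = z \<otimes> x \<oplus> z \<otimes> y"
    and smult_closed: "x \<in> carrier A \<Longrightarrow> c \<odot> x \<in> carrier A"
    and smult_l_distr: "x \<in> carrier A \<Longrightarrow> (c + d) \<odot> x = c \<odot> x \<oplus> d \<odot> x"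
    and smult_r_distr: "\<lbrakk> x \<in> carrier A; y \<in> carrier A \<rbrakk> \<Longrightarrow> c \<odot> (x \<oplus> y) = c \<odot> x \<oplus> c \<odot> y"
    and smult_assoc: "x \<in> carrier A \<Longrightarrow> (c * d) \<odot> x = c \<odot> (d \<odot> x)"
    and smult_one: "x \<in> carrier A \<Longrightarrow> 1 \<odot> x = x"
    and smult_m_l: "\<lbrakk> x \<in> carrier A; y \<in> carrier A \<rbrakk> \<Longrightarrow> (c \<odot> x) \<otimes> y = c \<odot> (x \<otimes> y)"
    and smult_m_r: "\<lbrakk> x \<in> carrier A; y \<in> carrier A \<rbrakk> \<Longrightarrow> x \<otimes> (c \<odot> y) = c \<odot> (x \<otimes> y)"
    and adj_closed: "x \<in> carrier A \<Longrightarrow> x\<^sup>\<star> \<in> carrier A"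
    and adj_adj: "x \<in> carrier A \<Longrightarrow> (x\<^sup>\<star>)\<^sup>\<star> = x"
    and adj_add: "\<lbrakk> x \<in> carrier A; y \<in> carrier A \<rbrakk> \<Longrightarrow> (x \<oplus> y)\<^sup>\<star> = x\<^sup>\<star> \<oplus> y\<^sup>\<star>"
    and adj_smult: "x \<in> carrier A \<Longrightarrow> (c \<odot> x)\<^sup>\<star> = cnj c \<odot> x\<^sup>\<star>"
    and adj_mult: "\<lbrakk> x \<in> carrier A; y \<in> carrier A \<rbrakk> \<Longrightarrow> (x \<otimes> y)\<^sup>\<star> = y\<^sup>\<star> \<otimes> x\<^sup>\<star>"
    and nrm_nonneg: "x \<in> carrier A \<Longrightarrow> 0 \<le> \<parallel>x\<parallel>"
    and nrm_eq_0: "x \<in> carrier A \<Longrightarrow> \<parallel>x\<parallel> = 0 \<longleftrightarrow> x = \<zero>"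
    and nrm_triangle: "\<lbrakk> x \<in> carrier A; y \<in> carrier A \<rbrakk> \<Longrightarrow> \<parallel>x \<oplus> y\<parallel> \<le> \<parallel>x\<parallel> + \<parallel>y\<parallel>"
    and nrm_smult: "x \<in> carrier A \<Longrightarrow> \<parallel>c \<odot> x\<parallel> = cmod c * \<parallel>x\<parallel>"
    and nrm_mult: "\<lbrakk> x \<in> carrier A; y \<in> carrier A \<rbrakk> \<Longrightarrow> \<parallel>x \<otimes> y\<parallel> \<le> \<parallel>x\<parallel> * \<parallel>y\<parallel>"
    and cstar_identity: "x \<in> carrier A \<Longrightarrow> \<parallel>x\<^sup>\<star> \<otimes> x\<parallel> = \<parallel>x\<parallel>\<^sup>2"
    and complete: "\<lbrakk> \<And>n::nat. \<sigma> n \<in> carrier A;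
        \<And>\<epsilon>. \<epsilon> > 0 \<Longrightarrow> \<exists>N. \<forall>m\<ge>N. \<forall>n\<ge>N. \<parallel>\<sigma> m \<ominus> \<sigma> n\<parallel> < \<epsilon> \<rbrakk>
      \<Longrightarrow> \<exists>x\<in>carrier A. (\<lambda>n. \<parallel>\<sigma> n \<ominus> x\<parallel>) \<longlonglongrightarrow> 0"

definition star_hom :: "'a cstar \<Rightarrow> 'b cstar \<Rightarrow> ('a \<Rightarrow> 'b) set" where
  "star_hom A B = {\<phi> \<in> carrier A \<rightarrow> carrier B.
     (\<forall>x\<in>carrier A. \<forall>y\<in>carrier A. \<phi> (x \<oplus>\<^bsub>A\<^esub> y) = \<phi> x \<oplus>\<^bsub>B\<^esub> \<phi> y) \<and>
     (\<forall>c. \<forall>x\<in>carrier A. \<phi> (c \<odot>\<^bsub>A\<^esub> x) = c \<odot>\<^bsub>B\<^esub> \<phi> x) \<and>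
     (\<forall>x\<in>carrier A. \<forall>y\<in>carrier A. \<phi> (x \<otimes>\<^bsub>A\<^esub> y) = \<phi> x \<otimes>\<^bsub>B\<^esub> \<phi> y) \<and>
     (\<forall>x\<in>carrier A. \<phi> (x\<^sup>\<star>\<^bsub>A\<^esub>) = (\<phi> x)\<^sup>\<star>\<^bsub>B\<^esub>)}"

definition cstar_subalgebra :: "'a cstar \<Rightarrow> 'a set \<Rightarrow> bool" where
  "cstar_subalgebra A S \<longleftrightarrow> S \<subseteq> carrier A \<and> \<zero>\<^bsub>A\<^esub> \<in> S \<and>
     (\<forall>x\<in>S. \<forall>y\<in>S. x \<oplus>\<^bsub>A\<^esub> y \<in> S \<and> x \<otimes>\<^bsub>A\<^esub> y \<in> S) \<and>
     (\<forall>c. \<forall>x\<in>S. c \<odot>\<^bsub>A\<^esub> x \<in> S) \<and>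
     (\<forall>x\<in>S. x\<^sup>\<star>\<^bsub>A\<^esub> \<in> S) \<and>
     (\<forall>\<sigma>. \<forall>x\<in>carrier A. (\<forall>n::nat. \<sigma> n \<in> S) \<and> (\<lambda>n. \<parallel>\<sigma> n \<ominus>\<^bsub>A\<^esub> x\<parallel>\<^bsub>A\<^esub>) \<longlonglongrightarrow> 0 \<longrightarrow> x \<in> S)"

definition cstar_generated_by :: "'a cstar \<Rightarrow> 'a set \<Rightarrow> bool" where
  "cstar_generated_by A X \<longleftrightarrow> X \<subseteq> carrier A \<and>
     (\<forall>S. cstar_subalgebra A S \<and> X \<subseteq> S \<longrightarrow> S = carrier A)"

definition projection :: "'a cstar \<Rightarrow> 'a \<Rightarrow> bool" where
  "projection A p \<longleftrightarrow> p \<in> carrier A \<and> p \<otimes>\<^bsub>A\<^esub> p = p \<and> p\<^sup>\<star>\<^bsub>A\<^esub> = p"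

definition partial_isometry :: "'a cstar \<Rightarrow> 'a \<Rightarrow> bool" where
  "partial_isometry A w \<longleftrightarrow> w \<in> carrier A \<and> w \<otimes>\<^bsub>A\<^esub> w\<^sup>\<star>\<^bsub>A\<^esub> \<otimes>\<^bsub>A\<^esub> w = w"

definition corner_unitary :: "'a cstar \<Rightarrow> 'a \<Rightarrow> 'a \<Rightarrow> bool" where
  "corner_unitary A p w \<longleftrightarrow> w \<in> carrier A \<and> p \<otimes>\<^bsub>A\<^esub> w \<otimes>\<^bsub>A\<^esub> p = w \<and>
     w\<^sup>\<star>\<^bsub>A\<^esub> \<otimes>\<^bsub>A\<^esub> w = p \<and> w \<otimes>\<^bsub>A\<^esub> w\<^sup>\<star>\<^bsub>A\<^esub> = p"

text \<open>
  A universal property quantifies over all C*-algebras, whereas a formula can only quantify over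
  those with carrier in one fixed type. The type below contains the bounded operators on
  \<open>\<ell>\<^sup>2\<close>, hence an isomorphic copy of every separable C*-algebra. Since a map out of a C*-algebra
  generated by a countable family only meets the (separable) C*-subalgebra generated by the
  image of that family, testing universality of countable families on this type is the same as
  testing it on all C*-algebras.
\<close>

type_synonym test_cstar = "((nat \<Rightarrow> complex) \<Rightarrow> (nat \<Rightarrow> complex)) cstar"


section \<open>Directed graph algebras\<close>

text \<open>The range map \<open>r\<^sub>E\<close> is \<open>head\<close> and the source map \<open>s\<^sub>E\<close> is \<open>tail\<close>.\<close>

definition row_finite :: "('v, 'e) pre_digraph \<Rightarrow> bool" where
  "row_finite E \<longleftrightarrow> (\<forall>v\<in>verts E. finite {a \<in> arcs E. head E a = v})"

definition no_sources :: "('v, 'e) pre_digraph \<Rightarrow> bool" where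
  "no_sources E \<longleftrightarrow> (\<forall>v\<in>verts E. {a \<in> arcs E. head E a = v} \<noteq> {})"

text \<open>Intended for row-finite graphs without sources: \<^const>\<open>finsum\<close> over an infinite set is zero.\<close>

definition ck_family ::
  "('v, 'e) pre_digraph \<Rightarrow> 'a cstar \<Rightarrow> ('v \<Rightarrow> 'a) \<Rightarrow> ('e \<Rightarrow> 'a) \<Rightarrow> bool" where
  "ck_family E A P T \<longleftrightarrow>
     (\<forall>v\<in>verts E. projection A (P v)) \<and>
     (\<forall>v\<in>verts E. \<forall>w\<in>verts E. v \<noteq> w \<longrightarrow> P v \<otimes>\<^bsub>A\<^esub> P w = \<zero>\<^bsub>A\<^esub>) \<and>
     (\<forall>a\<in>arcs E. partial_isometry A (T a)) \<and>
     (\<forall>a\<in>arcs E. (T a)\<^sup>\<star>\<^bsub>A\<^esub> \<otimes>\<^bsub>A\<^esub> T a = P (tail E a)) \<and>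
     (\<forall>v\<in>verts E. P v = (\<Oplus>\<^bsub>A\<^esub>a\<in>{a \<in> arcs E. head E a = v}. T a \<otimes>\<^bsub>A\<^esub> (T a)\<^sup>\<star>\<^bsub>A\<^esub>))"

text \<open>
  \<open>A\<close> is the C*-algebra of the countable directed graph \<open>E\<close>, with generating Cuntz--Krieger
  family \<open>p\<close>, \<open>t\<close>.
\<close>

definition is_graph_algebra ::
  "('v, 'e) pre_digraph \<Rightarrow> 'a cstar \<Rightarrow> ('v \<Rightarrow> 'a) \<Rightarrow> ('e \<Rightarrow> 'a) \<Rightarrow> bool" where
  "is_graph_algebra E A p t \<longleftrightarrow>
     cstar_algebra A \<and> ck_family E A p t \<and>
     cstar_generated_by A (p ` verts E \<union> t ` arcs E) \<and>
     (\<forall>(B :: test_cstar) P T. cstar_algebra B \<and> ck_family E B P T \<longrightarrow>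
       (\<exists>\<psi>\<in>star_hom A B. (\<forall>v\<in>verts E. \<psi> (p v) = P v) \<and> (\<forall>a\<in>arcs E. \<psi> (t a) = T a)))"


section \<open>Graphs of groups\<close>

text \<open>
  The underlying graph is a digraph with head \<open>r\<close> and tail \<open>s\<close>, and \<open>bar\<close> is its
  edge-reversing involution. The locale \<^locale>\<open>bidirected_digraph\<close> moreover lets \<open>bar\<close> be the
  identity off the set of edges. Library connectedness includes having a vertex.
\<close>

record ('v, 'e, 'g, 'h) gog =
  gr :: "('v, 'e) pre_digraph"
  bar :: "'e \<Rightarrow> 'e"
  vgrp :: "'v \<Rightarrow> 'g monoid"
  egrp :: "'e \<Rightarrow> 'h monoid"
  emb :: "'e \<Rightarrow> 'h \<Rightarrow> 'g"

abbreviation rng :: "('v, 'e, 'g, 'h) gog \<Rightarrow> 'e \<Rightarrow> 'v" where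
  "rng \<G> e \<equiv> head (gr \<G>) e"

abbreviation src :: "('v, 'e, 'g, 'h) gog \<Rightarrow> 'e \<Rightarrow> 'v" where
  "src \<G> e \<equiv> tail (gr \<G>) e"

definition graph_of_groups :: "('v, 'e, 'g, 'h) gog \<Rightarrow> bool" where
  "graph_of_groups \<G> \<longleftrightarrow>
     bidirected_digraph (gr \<G>) (bar \<G>) \<and>
     countable (verts (gr \<G>)) \<and> countable (arcs (gr \<G>)) \<and>
     Digraph_Component.connected (gr \<G>) \<and>
     (\<forall>x\<in>verts (gr \<G>). group (vgrp \<G> x)) \<and>
     (\<forall>e\<in>arcs (gr \<G>). group (egrp \<G> e) \<and> egrp \<G> (bar \<G> e) = egrp \<G> e \<and>
        emb \<G> e \<in> mon (egrp \<G> e) (vgrp \<G> (rng \<G> e)))"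

text \<open>\<open>G\<^bsub>r(e)\<^esub>/\<alpha>\<^sub>e(G\<^sub>e)\<close>\<close>

definition edge_cosets :: "('v, 'e, 'g, 'h) gog \<Rightarrow> 'e \<Rightarrow> 'g set set" where
  "edge_cosets \<G> e = lcosets\<^bsub>vgrp \<G> (rng \<G> e)\<^esub> (emb \<G> e ` carrier (egrp \<G> e))"

definition locally_finite :: "('v, 'e, 'g, 'h) gog \<Rightarrow> bool" where
  "locally_finite \<G> \<longleftrightarrow>
     (\<forall>x\<in>verts (gr \<G>). finite {e \<in> arcs (gr \<G>). rng \<G> e = x}) \<and>
     (\<forall>e\<in>arcs (gr \<G>). finite (edge_cosets \<G> e))"

text \<open>An infinite index also counts as greater than one, although its \<^const>\<open>card\<close> is zero.\<close>

definition nonsingular :: "('v, 'e, 'g, 'h) gog \<Rightarrow> bool" where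
  "nonsingular \<G> \<longleftrightarrow>
     (\<forall>e\<in>arcs (gr \<G>). {f \<in> arcs (gr \<G>). rng \<G> f = rng \<G> e} = {e} \<longrightarrow>
        infinite (edge_cosets \<G> e) \<or> 1 < card (edge_cosets \<G> e))"

definition countable_groups :: "('v, 'e, 'g, 'h) gog \<Rightarrow> bool" where
  "countable_groups \<G> \<longleftrightarrow> (\<forall>x\<in>verts (gr \<G>). countable (carrier (vgrp \<G> x)))"

definition transversals :: "('v, 'e, 'g, 'h) gog \<Rightarrow> ('e \<Rightarrow> 'g set) \<Rightarrow> bool" where
  "transversals \<G> \<Sigma> \<longleftrightarrow>
     (\<forall>e\<in>arcs (gr \<G>). \<Sigma> e \<subseteq> carrier (vgrp \<G> (rng \<G> e)) \<and>
        \<one>\<^bsub>vgrp \<G> (rng \<G> e)\<^esub> \<in> \<Sigma> e \<and>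
        (\<forall>C\<in>edge_cosets \<G> e. \<exists>!h. h \<in> \<Sigma> e \<and> h \<in> C))"

text \<open>The path \<open>g\<^sub>1e\<^sub>1\<dots>g\<^sub>ne\<^sub>n\<close> is the list \<open>[(g\<^sub>1,e\<^sub>1), \<dots>, (g\<^sub>n,e\<^sub>n)]\<close>; \<open>n \<ge> 1\<close> is intended.\<close>

definition gpaths ::
  "('v, 'e, 'g, 'h) gog \<Rightarrow> ('e \<Rightarrow> 'g set) \<Rightarrow> nat \<Rightarrow> ('g \<times> 'e) list set" where
  "gpaths \<G> \<Sigma> n = {\<mu>. length \<mu> = n \<and>
     (\<forall>i<n. snd (\<mu> ! i) \<in> arcs (gr \<G>) \<and> fst (\<mu> ! i) \<in> \<Sigma> (snd (\<mu> ! i))) \<and>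
     (\<forall>i. Suc i < n \<longrightarrow>
        src \<G> (snd (\<mu> ! i)) = rng \<G> (snd (\<mu> ! Suc i)) \<and>
        (snd (\<mu> ! i) = bar \<G> (snd (\<mu> ! Suc i)) \<longrightarrow>
           fst (\<mu> ! Suc i) \<noteq> \<one>\<^bsub>vgrp \<G> (rng \<G> (snd (\<mu> ! Suc i)))\<^esub>))}"

text \<open>
  The sum in the last condition ranges over pairs \<open>(h, f)\<close>, encoding \<open>hf\<close>; it is finite for
  locally finite graphs of groups, for which the definition is intended.
\<close>

definition g_family ::
  "('v, 'e, 'g, 'h) gog \<Rightarrow> ('e \<Rightarrow> 'g set) \<Rightarrow> 'a cstar \<Rightarrow> ('v \<Rightarrow> 'g \<Rightarrow> 'a) \<Rightarrow> ('e \<Rightarrow> 'a) \<Rightarrow> bool" where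
  "g_family \<G> \<Sigma> A U S \<longleftrightarrow>
     (\<forall>e\<in>arcs (gr \<G>). partial_isometry A (S e)) \<and>
     (\<forall>x\<in>verts (gr \<G>).
        projection A (U x \<one>\<^bsub>vgrp \<G> x\<^esub>) \<and>
        (\<forall>g\<in>carrier (vgrp \<G> x). corner_unitary A (U x \<one>\<^bsub>vgrp \<G> x\<^esub>) (U x g)) \<and>
        (\<forall>g\<in>carrier (vgrp \<G> x). \<forall>h\<in>carrier (vgrp \<G> x).
           U x (g \<otimes>\<^bsub>vgrp \<G> x\<^esub> h) = U x g \<otimes>\<^bsub>A\<^esub> U x h)) \<and>
     (\<forall>x\<in>verts (gr \<G>). \<forall>y\<in>verts (gr \<G>). x \<noteq> y \<longrightarrow>
        U x \<one>\<^bsub>vgrp \<G> x\<^esub> \<otimes>\<^bsub>A\<^esub> U y \<one>\<^bsub>vgrp \<G> y\<^esub> = \<zero>\<^bsub>A\<^esub>) \<and>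
     (\<forall>e\<in>arcs (gr \<G>). \<forall>g\<in>carrier (egrp \<G> e).
        U (rng \<G> e) (emb \<G> e g) \<otimes>\<^bsub>A\<^esub> S e = S e \<otimes>\<^bsub>A\<^esub> U (src \<G> e) (emb \<G> (bar \<G> e) g)) \<and>
     (\<forall>e\<in>arcs (gr \<G>). U (src \<G> e) \<one>\<^bsub>vgrp \<G> (src \<G> e)\<^esub> =
        (S e)\<^sup>\<star>\<^bsub>A\<^esub> \<otimes>\<^bsub>A\<^esub> S e \<oplus>\<^bsub>A\<^esub> S (bar \<G> e) \<otimes>\<^bsub>A\<^esub> (S (bar \<G> e))\<^sup>\<star>\<^bsub>A\<^esub>) \<and>
     (\<forall>e\<in>arcs (gr \<G>). (S e)\<^sup>\<star>\<^bsub>A\<^esub> \<otimes>\<^bsub>A\<^esub> S e =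
        finsum A
          (\<lambda>(h, f). U (src \<G> e) h \<otimes>\<^bsub>A\<^esub> S f \<otimes>\<^bsub>A\<^esub> (S f)\<^sup>\<star>\<^bsub>A\<^esub> \<otimes>\<^bsub>A\<^esub> (U (src \<G> e) h)\<^sup>\<star>\<^bsub>A\<^esub>)
          {(h, f). f \<in> arcs (gr \<G>) \<and> rng \<G> f = src \<G> e \<and> h \<in> \<Sigma> f \<and>
             (h, f) \<noteq> (\<one>\<^bsub>vgrp \<G> (src \<G> e)\<^esub>, bar \<G> e)})"

text \<open>\<open>A\<close> is the C*-algebra of \<open>\<G>\<close>, with universal family \<open>u\<close>, \<open>s\<close>.\<close>

definition is_gog_algebra ::
  "('v, 'e, 'g, 'h) gog \<Rightarrow> ('e \<Rightarrow> 'g set) \<Rightarrow> 'a cstar \<Rightarrow> ('v \<Rightarrow> 'g \<Rightarrow> 'a) \<Rightarrow> ('e \<Rightarrow> 'a) \<Rightarrow> bool" where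
  "is_gog_algebra \<G> \<Sigma> A u s \<longleftrightarrow>
     cstar_algebra A \<and> g_family \<G> \<Sigma> A u s \<and>
     cstar_generated_by A ((\<Union>x\<in>verts (gr \<G>). u x ` carrier (vgrp \<G> x)) \<union> s ` arcs (gr \<G>)) \<and>
     (\<forall>(B :: test_cstar) U S. cstar_algebra B \<and> g_family \<G> \<Sigma> B U S \<longrightarrow>
       (\<exists>\<psi>\<in>star_hom A B.
          (\<forall>x\<in>verts (gr \<G>). \<forall>g\<in>carrier (vgrp \<G> x). \<psi> (u x g) = U x g) \<and>
          (\<forall>e\<in>arcs (gr \<G>). \<psi> (s e) = S e)))"

text \<open>\<open>s\<^sub>\<mu>\<close> for a nonempty path \<open>\<mu>\<close>; the value at the empty list is irrelevant.\<close>

fun path_elt ::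
  "('v, 'e, 'g, 'h) gog \<Rightarrow> 'a cstar \<Rightarrow> ('v \<Rightarrow> 'g \<Rightarrow> 'a) \<Rightarrow> ('e \<Rightarrow> 'a) \<Rightarrow> ('g \<times> 'e) list \<Rightarrow> 'a" where
  "path_elt \<G> A u s [] = undefined"
| "path_elt \<G> A u s [(g, e)] = u (rng \<G> e) g \<otimes>\<^bsub>A\<^esub> s e"
| "path_elt \<G> A u s ((g, e) # a # \<mu>) =
     u (rng \<G> e) g \<otimes>\<^bsub>A\<^esub> s e \<otimes>\<^bsub>A\<^esub> path_elt \<G> A u s (a # \<mu>)"

text \<open>
  On a path of length two, \<open>take 1\<close> gives \<open>g\<^sub>1e\<^sub>1\<close> (the range) and \<open>drop 1\<close> gives \<open>g\<^sub>2e\<^sub>2\<close> (the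
  source).
\<close>

definition path_digraph ::
  "('v, 'e, 'g, 'h) gog \<Rightarrow> ('e \<Rightarrow> 'g set) \<Rightarrow> (('g \<times> 'e) list, ('g \<times> 'e) list) pre_digraph" where
  "path_digraph \<G> \<Sigma> =
     \<lparr> verts = gpaths \<G> \<Sigma> 1, arcs = gpaths \<G> \<Sigma> 2, tail = drop 1, head = take 1 \<rparr>"

end

theory Submission
  imports Defs "HOL-Analysis.Analysis"
begin

text \<open>
  In \<open>C*(\<G>)\<close> the projections \<open>s\<^sub>\<nu>s\<^sub>\<nu>\<^sup>\<star>\<close>, for \<open>\<nu>\<close> of length one with range \<open>x\<close>, add up to \<open>u\<^sub>x\<^sub>,\<^sub>1\<close> by (G3)
  and (G4), hence are orthogonal, and the elements \<open>s\<^sub>\<mu>s\<^sup>\<star>\<^bsub>s(\<mu>)\<^esub>\<close> complete them to a Cuntz--Krieger family.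
  The resulting map \<open>\<phi>\<close> is not only injective but isometric. It is isometric on the core because its
  vertex projections do not vanish: there is a \<open>\<G>\<close>-family of partial bijections of the set of triples
  \<open>(g, e, n)\<close> with \<open>g \<in> G\<^bsub>r(e)\<^esub>\<close>, \<open>n \<in> \<nat>\<close>, all of whose \<open>S\<^sub>e\<close> are nonzero. Averaging the gauge action of
  \<open>C*(\<G>)\<close> over roots of unity gives \<open>\<parallel>y\<parallel> \<le> (2d+1) \<parallel>\<phi>(y)\<parallel>\<close> for \<open>y\<close> of degree at most \<open>d\<close>, and applying
  this to the powers of a self-adjoint \<open>y\<close> removes the constant. So the image of \<open>\<phi>\<close> is closed, and for
  trivial edge groups it contains all generators.
\<close>

section \<open>Elementary theory of C*-algebras\<close>

text \<open>The axioms of \<open>cstar_algebra\<close> provide no unit, no spectrum and no order,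
  and this shapes the analytic part. Two facts have to come out of the C*-identity: homomorphisms
  are contractive, and projections whose sum is a projection are orthogonal. Both rest on one
  inequality for commuting self-adjoint a and b, namely that the square of the norm of a is at most
  the norm of a^2 + b^2. It stands in for positivity, and it is fed with square roots of 1 - k found
  by a contracting iteration. Universality is assumed against a single test type only, so families
  in other algebras are first moved into copies of separable subalgebras inside that type. Roots of
  unity stand in for an integral over the circle, so only finitely many gauge automorphisms act at a
  time. The resulting constant is harmless because the degree of y^(2^j) grows only by the factor
  2^j. The core is treated by the same device: each induction step loses the square of the size of a
  finite edge set, and one such set serves all powers of y. The coordinate n of the triples makes
  both sides of the matching behind S_e consist of infinitely many free orbits, whatever the indices
  of the edge groups are.\<close>

no_notation vwalk_join (infixr \<open>\<oplus>\<close> 65)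

context cstar_algebra
begin

declare m_closed [simp, intro] smult_closed [simp, intro] adj_closed [simp, intro]
  adj_adj [simp] smult_one [simp]

lemma smult_zero_l [simp]: "x \<in> carrier A \<Longrightarrow> 0 \<odot> x = \<zero>"
  using smult_l_distr[of x 0 0] by (metis add.r_cancel_one' add_0 smult_closed)

lemma smult_zero_r [simp]: "c \<odot> \<zero> = \<zero>"
  using smult_r_distr[of \<zero> \<zero> c] by (metis add.r_cancel_one' local.add.one_closed local.add.r_one smult_closed)

lemma mult_zero_l [simp]: "x \<in> carrier A \<Longrightarrow> \<zero> \<otimes> x = \<zero>"
  using smult_m_l[of \<zero> x 0] by (metis local.add.one_closed m_closed smult_zero_l)

lemma mult_zero_r [simp]: "x \<in> carrier A \<Longrightarrow> x \<otimes> \<zero> = \<zero>"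
  using smult_m_r[of x \<zero> 0] by (metis local.add.one_closed m_closed smult_zero_l)

lemma minus_eq_smult: "x \<in> carrier A \<Longrightarrow> \<ominus> x = (-1) \<odot> x"
  using smult_l_distr[of x 1 "-1"] by (simp add: minus_equality a_comm)

lemma diff_eq_smult: "\<lbrakk>x \<in> carrier A; y \<in> carrier A\<rbrakk> \<Longrightarrow> x \<ominus> y = x \<oplus> (-1) \<odot> y"
  by (simp add: a_minus_def minus_eq_smult)

lemma diff_closed [simp, intro]: "\<lbrakk>x \<in> carrier A; y \<in> carrier A\<rbrakk> \<Longrightarrow> x \<ominus> y \<in> carrier A"
  by simp

lemma diff_self [simp]: "x \<in> carrier A \<Longrightarrow> x \<ominus> x = \<zero>"
  by (simp add: a_minus_def r_neg)

lemma diff_eq_zero_iff: "\<lbrakk>x \<in> carrier A; y \<in> carrier A\<rbrakk> \<Longrightarrow> x \<ominus> y = \<zero> \<longleftrightarrow> x = y"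
  by (metis a_minus_def add.inv_closed add.inv_comm diff_self minus_equality minus_minus)

lemma mult_diff_distr_l: "\<lbrakk>x \<in> carrier A; y \<in> carrier A; z \<in> carrier A\<rbrakk> \<Longrightarrow> (x \<ominus> y) \<otimes> z = x \<otimes> z \<ominus> y \<otimes> z"
  by (simp add: diff_eq_smult l_distr smult_m_l)

lemma mult_diff_distr_r: "\<lbrakk>x \<in> carrier A; y \<in> carrier A; z \<in> carrier A\<rbrakk> \<Longrightarrow> z \<otimes> (x \<ominus> y) = z \<otimes> x \<ominus> z \<otimes> y"
  by (simp add: diff_eq_smult r_distr smult_m_r)

lemma smult_diff_distr: "\<lbrakk>x \<in> carrier A; y \<in> carrier A\<rbrakk> \<Longrightarrow> c \<odot> (x \<ominus> y) = c \<odot> x \<ominus> c \<odot> y"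
  by (simp add: diff_eq_smult smult_r_distr flip: smult_assoc)

lemma adj_zero [simp]: "\<zero>\<^sup>\<star> = \<zero>"
  using adj_smult[of \<zero> 0] by simp

lemma adj_diff: "\<lbrakk>x \<in> carrier A; y \<in> carrier A\<rbrakk> \<Longrightarrow> (x \<ominus> y)\<^sup>\<star> = x\<^sup>\<star> \<ominus> y\<^sup>\<star>"
  by (simp add: diff_eq_smult adj_add adj_smult)

lemma nrm_zero [simp]: "\<parallel>\<zero>\<parallel> = 0"
  by (simp add: nrm_eq_0)

lemma nrm_minus [simp]: "x \<in> carrier A \<Longrightarrow> \<parallel>\<ominus> x\<parallel> = \<parallel>x\<parallel>"
  by (simp add: minus_eq_smult nrm_smult)

lemma diff_swap: "\<lbrakk>x \<in> carrier A; y \<in> carrier A\<rbrakk> \<Longrightarrow> x \<ominus> y = \<ominus> (y \<ominus> x)"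
  by (simp add: a_minus_def minus_add a_comm)

lemma nrm_diff_commute: "\<lbrakk>x \<in> carrier A; y \<in> carrier A\<rbrakk> \<Longrightarrow> \<parallel>x \<ominus> y\<parallel> = \<parallel>y \<ominus> x\<parallel>"
  using diff_swap by (metis diff_closed nrm_minus)

lemma diff_add_cancel [simp]: "\<lbrakk>x \<in> carrier A; y \<in> carrier A\<rbrakk> \<Longrightarrow> (x \<ominus> y) \<oplus> y = x"
  by (simp add: a_minus_def a_assoc l_neg)

lemma diff_add_diff: "\<lbrakk>x \<in> carrier A; y \<in> carrier A; z \<in> carrier A\<rbrakk> \<Longrightarrow> (x \<ominus> y) \<oplus> (y \<ominus> z) = x \<ominus> z"
  by (simp add: a_minus_def a_assoc r_neg1)

lemma nrm_diff_triangle: "\<lbrakk>x \<in> carrier A; y \<in> carrier A; z \<in> carrier A\<rbrakk> \<Longrightarrow> \<parallel>x \<ominus> z\<parallel> \<le> \<parallel>x \<ominus> y\<parallel> + \<parallel>y \<ominus> z\<parallel>"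
  using nrm_triangle[of "x \<ominus> y" "y \<ominus> z"] by (simp add: diff_add_diff)

lemma nrm_le_diff_add: "\<lbrakk>x \<in> carrier A; y \<in> carrier A\<rbrakk> \<Longrightarrow> \<parallel>x\<parallel> \<le> \<parallel>x \<ominus> y\<parallel> + \<parallel>y\<parallel>"
  using nrm_triangle[of "x \<ominus> y" y] by simp

lemma nrm_adj [simp]: 
  assumes "x \<in> carrier A" shows "\<parallel>x\<^sup>\<star>\<parallel> = \<parallel>x\<parallel>"
proof -
  have *: "\<parallel>y\<parallel> \<le> \<parallel>y\<^sup>\<star>\<parallel>" if "y \<in> carrier A" for y
  proof -
    have "\<parallel>y\<parallel>\<^sup>2 \<le> \<parallel>y\<^sup>\<star>\<parallel> * \<parallel>y\<parallel>"
      using that cstar_identity[of y] nrm_mult[of "y\<^sup>\<star>" y] by simp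
    then show ?thesis
      using nrm_nonneg[OF that] nrm_nonneg[OF adj_closed[OF that]]
      by (cases "\<parallel>y\<parallel> = 0") (auto simp: power2_eq_square mult_le_cancel_right)
  qed
  show ?thesis using *[OF assms] *[OF adj_closed[OF assms]] assms by simp
qed

lemma cstar_identity': "x \<in> carrier A \<Longrightarrow> \<parallel>x \<otimes> x\<^sup>\<star>\<parallel> = \<parallel>x\<parallel>\<^sup>2"
  using cstar_identity[of "x\<^sup>\<star>"] by simp

lemma adj_mult_self_eq_0: "x \<in> carrier A \<Longrightarrow> x\<^sup>\<star> \<otimes> x = \<zero> \<longleftrightarrow> x = \<zero>"
  by (metis adj_closed cstar_identity m_closed mult_zero_r nrm_eq_0 power_eq_0_iff zero_neq_numeral zero_power2)

text \<open>The elements form a carrier set without a topology, so convergence is always stated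
  through the real sequence of distances. This lemma and the following ones are the limit calculus
  in that form.\<close>

lemma limit_unique:
  assumes "\<And>n::nat. \<sigma> n \<in> carrier A" "x \<in> carrier A" "y \<in> carrier A"
    and "(\<lambda>n. \<parallel>\<sigma> n \<ominus> x\<parallel>) \<longlonglongrightarrow> 0" "(\<lambda>n. \<parallel>\<sigma> n \<ominus> y\<parallel>) \<longlonglongrightarrow> 0"
  shows "x = y"
proof -
  have "(\<lambda>n. \<parallel>\<sigma> n \<ominus> x\<parallel> + \<parallel>\<sigma> n \<ominus> y\<parallel>) \<longlonglongrightarrow> 0"
    using tendsto_add[OF assms(4,5)] by simp
  moreover have "\<parallel>x \<ominus> y\<parallel> \<le> \<parallel>\<sigma> n \<ominus> x\<parallel> + \<parallel>\<sigma> n \<ominus> y\<parallel>" for n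
    using nrm_diff_triangle[of x "\<sigma> n" y] assms(1-3) nrm_diff_commute[of x "\<sigma> n"] by auto
  ultimately have "\<parallel>x \<ominus> y\<parallel> \<le> 0"
    by (meson LIMSEQ_le_const)
  then have "\<parallel>x \<ominus> y\<parallel> = 0" using nrm_nonneg assms by (meson antisym diff_closed)
  then show ?thesis using assms by (simp add: nrm_eq_0 diff_eq_zero_iff)
qed

lemma limit_mult_left:
  assumes "\<And>n::nat. \<sigma> n \<in> carrier A" "x \<in> carrier A" "z \<in> carrier A"
    and "(\<lambda>n. \<parallel>\<sigma> n \<ominus> x\<parallel>) \<longlonglongrightarrow> 0"
  shows "(\<lambda>n. \<parallel>z \<otimes> \<sigma> n \<ominus> z \<otimes> x\<parallel>) \<longlonglongrightarrow> 0"
proof (rule Lim_null_comparison)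
  show "\<forall>\<^sub>F n in sequentially. norm \<parallel>z \<otimes> \<sigma> n \<ominus> z \<otimes> x\<parallel> \<le> \<parallel>z\<parallel> * \<parallel>\<sigma> n \<ominus> x\<parallel>"
    using assms nrm_mult[of z "\<sigma> _ \<ominus> x"]
    by (intro always_eventually allI) (simp add: mult_diff_distr_r nrm_nonneg)
  show "(\<lambda>n. \<parallel>z\<parallel> * \<parallel>\<sigma> n \<ominus> x\<parallel>) \<longlonglongrightarrow> 0"
    using tendsto_mult_left[OF assms(4), of "\<parallel>z\<parallel>"] by simp
qed

lemma limit_mult_right:
  assumes "\<And>n::nat. \<sigma> n \<in> carrier A" "x \<in> carrier A" "z \<in> carrier A"
    and "(\<lambda>n. \<parallel>\<sigma> n \<ominus> x\<parallel>) \<longlonglongrightarrow> 0"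
  shows "(\<lambda>n. \<parallel>\<sigma> n \<otimes> z \<ominus> x \<otimes> z\<parallel>) \<longlonglongrightarrow> 0"
proof (rule Lim_null_comparison)
  show "\<forall>\<^sub>F n in sequentially. norm \<parallel>\<sigma> n \<otimes> z \<ominus> x \<otimes> z\<parallel> \<le> \<parallel>\<sigma> n \<ominus> x\<parallel> * \<parallel>z\<parallel>"
    using assms nrm_mult[of "\<sigma> _ \<ominus> x" z]
    by (intro always_eventually allI) (simp add: mult_diff_distr_l nrm_nonneg)
  show "(\<lambda>n. \<parallel>\<sigma> n \<ominus> x\<parallel> * \<parallel>z\<parallel>) \<longlonglongrightarrow> 0"
    using tendsto_mult_right[OF assms(4), of "\<parallel>z\<parallel>"] by simp
qed

lemma add_diff_add:
  "\<lbrakk>a \<in> carrier A; b \<in> carrier A; c \<in> carrier A; d \<in> carrier A\<rbrakk> \<Longrightarrow>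
   (a \<oplus> b) \<ominus> (c \<oplus> d) = (a \<ominus> c) \<oplus> (b \<ominus> d)"
  by (simp add: diff_eq_smult smult_r_distr a_ac)

lemma limit_add:
  assumes "\<And>n::nat. \<sigma> n \<in> carrier A" "x \<in> carrier A" "\<And>n::nat. \<tau> n \<in> carrier A" "y \<in> carrier A"
    and "(\<lambda>n. \<parallel>\<sigma> n \<ominus> x\<parallel>) \<longlonglongrightarrow> 0" "(\<lambda>n. \<parallel>\<tau> n \<ominus> y\<parallel>) \<longlonglongrightarrow> 0"
  shows "(\<lambda>n. \<parallel>(\<sigma> n \<oplus> \<tau> n) \<ominus> (x \<oplus> y)\<parallel>) \<longlonglongrightarrow> 0"
proof (rule Lim_null_comparison)
  show "\<forall>\<^sub>F n in sequentially. norm \<parallel>(\<sigma> n \<oplus> \<tau> n) \<ominus> (x \<oplus> y)\<parallel> \<le> \<parallel>\<sigma> n \<ominus> x\<parallel> + \<parallel>\<tau> n \<ominus> y\<parallel>"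
    using assms
    by (intro always_eventually allI) (simp add: add_diff_add nrm_nonneg nrm_triangle)
  show "(\<lambda>n. \<parallel>\<sigma> n \<ominus> x\<parallel> + \<parallel>\<tau> n \<ominus> y\<parallel>) \<longlonglongrightarrow> 0"
    using tendsto_add[OF assms(5,6)] by simp
qed

lemma limit_smult:
  assumes "\<And>n::nat. \<sigma> n \<in> carrier A" "x \<in> carrier A"
    and "(\<lambda>n. \<parallel>\<sigma> n \<ominus> x\<parallel>) \<longlonglongrightarrow> 0"
  shows "(\<lambda>n. \<parallel>c \<odot> \<sigma> n \<ominus> c \<odot> x\<parallel>) \<longlonglongrightarrow> 0"
proof -
  have "\<parallel>c \<odot> \<sigma> n \<ominus> c \<odot> x\<parallel> = cmod c * \<parallel>\<sigma> n \<ominus> x\<parallel>" for n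
    using assms by (simp flip: smult_diff_distr add: nrm_smult)
  then show ?thesis using tendsto_mult_left[OF assms(3), of "cmod c"] by simp
qed

lemma limit_adj:
  assumes "\<And>n::nat. \<sigma> n \<in> carrier A" "x \<in> carrier A"
    and "(\<lambda>n. \<parallel>\<sigma> n \<ominus> x\<parallel>) \<longlonglongrightarrow> 0"
  shows "(\<lambda>n. \<parallel>(\<sigma> n)\<^sup>\<star> \<ominus> x\<^sup>\<star>\<parallel>) \<longlonglongrightarrow> 0"
  using assms by (simp flip: adj_diff)

lemma limit_mult:
  assumes "\<And>n::nat. \<sigma> n \<in> carrier A" "x \<in> carrier A" "\<And>n::nat. \<tau> n \<in> carrier A" "y \<in> carrier A"
    and "(\<lambda>n. \<parallel>\<sigma> n \<ominus> x\<parallel>) \<longlonglongrightarrow> 0" "(\<lambda>n. \<parallel>\<tau> n \<ominus> y\<parallel>) \<longlonglongrightarrow> 0"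
  shows "(\<lambda>n. \<parallel>(\<sigma> n \<otimes> \<tau> n) \<ominus> (x \<otimes> y)\<parallel>) \<longlonglongrightarrow> 0"
proof (rule Lim_null_comparison)
  have "\<parallel>(\<sigma> n \<otimes> \<tau> n) \<ominus> (x \<otimes> y)\<parallel>
      \<le> \<parallel>\<sigma> n \<ominus> x\<parallel> * (\<parallel>\<tau> n \<ominus> y\<parallel> + \<parallel>y\<parallel>) + \<parallel>x\<parallel> * \<parallel>\<tau> n \<ominus> y\<parallel>" for n
  proof -
    have "\<parallel>(\<sigma> n \<otimes> \<tau> n) \<ominus> (x \<otimes> y)\<parallel> \<le> \<parallel>(\<sigma> n \<otimes> \<tau> n) \<ominus> (x \<otimes> \<tau> n)\<parallel> + \<parallel>(x \<otimes> \<tau> n) \<ominus> (x \<otimes> y)\<parallel>"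
      using assms by (intro nrm_diff_triangle) auto
    also have "\<dots> = \<parallel>(\<sigma> n \<ominus> x) \<otimes> \<tau> n\<parallel> + \<parallel>x \<otimes> (\<tau> n \<ominus> y)\<parallel>"
      using assms by (simp add: mult_diff_distr_l mult_diff_distr_r)
    also have "\<dots> \<le> \<parallel>\<sigma> n \<ominus> x\<parallel> * \<parallel>\<tau> n\<parallel> + \<parallel>x\<parallel> * \<parallel>\<tau> n \<ominus> y\<parallel>"
      using assms by (intro add_mono nrm_mult) auto
    also have "\<dots> \<le> \<parallel>\<sigma> n \<ominus> x\<parallel> * (\<parallel>\<tau> n \<ominus> y\<parallel> + \<parallel>y\<parallel>) + \<parallel>x\<parallel> * \<parallel>\<tau> n \<ominus> y\<parallel>"
      using assms by (intro add_mono mult_left_mono nrm_le_diff_add nrm_nonneg) auto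
    finally show ?thesis .
  qed
  then show "\<forall>\<^sub>F n in sequentially. norm \<parallel>(\<sigma> n \<otimes> \<tau> n) \<ominus> (x \<otimes> y)\<parallel>
      \<le> \<parallel>\<sigma> n \<ominus> x\<parallel> * (\<parallel>\<tau> n \<ominus> y\<parallel> + \<parallel>y\<parallel>) + \<parallel>x\<parallel> * \<parallel>\<tau> n \<ominus> y\<parallel>"
    using assms by (intro always_eventually allI) (simp add: nrm_nonneg)
  have "(\<lambda>n. \<parallel>\<sigma> n \<ominus> x\<parallel> * (\<parallel>\<tau> n \<ominus> y\<parallel> + \<parallel>y\<parallel>) + \<parallel>x\<parallel> * \<parallel>\<tau> n \<ominus> y\<parallel>) \<longlonglongrightarrow> 0 * (0 + \<parallel>y\<parallel>) + \<parallel>x\<parallel> * 0"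
    by (intro tendsto_intros assms)
  then show "(\<lambda>n. \<parallel>\<sigma> n \<ominus> x\<parallel> * (\<parallel>\<tau> n \<ominus> y\<parallel> + \<parallel>y\<parallel>) + \<parallel>x\<parallel> * \<parallel>\<tau> n \<ominus> y\<parallel>) \<longlonglongrightarrow> 0"
    by simp
qed


text \<open>The equation for \<open>c\<close> says (1 - c)^2 = 1 - k without mentioning a unit. The
  solution is the fixed point of x \<mapsto> (k + x^2)/2. Started at zero, the iterates are real
  polynomials in \<open>k\<close> without constant term, so they are self-adjoint and commute with
  all that commutes with \<open>k\<close>; both properties pass to the limit.\<close>

lemma sqrt_one_minus_exists:
  assumes k: "k \<in> carrier A" "k\<^sup>\<star> = k" and k1: "\<parallel>k\<parallel> < 1"
  shows "\<exists>c\<in>carrier A. c\<^sup>\<star> = c \<and> c \<oplus> c = k \<oplus> c \<otimes> c \<and>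
    (\<forall>z\<in>carrier A. z \<otimes> k = k \<otimes> z \<longrightarrow> z \<otimes> c = c \<otimes> z)"
proof -
  define q where "q = \<parallel>k\<parallel>"
  have q: "0 \<le> q" "q < 1" using k1 nrm_nonneg[OF k(1)] by (auto simp: q_def)
  define F where "F x = (1/2) \<odot> (k \<oplus> x \<otimes> x)" for x
  define \<sigma> where "\<sigma> n = (F ^^ n) \<zero>" for n
  have F: "F x \<in> carrier A" if "x \<in> carrier A" for x
    using that k by (simp add: F_def)
  have \<sigma>0: "\<sigma> 0 = \<zero>" and \<sigma>S: "\<sigma> (Suc n) = F (\<sigma> n)" for n
    by (auto simp: \<sigma>_def)
  have inv: "\<sigma> n \<in> carrier A \<and> (\<sigma> n)\<^sup>\<star> = \<sigma> n \<and> \<parallel>\<sigma> n\<parallel> \<le> q \<and>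
      (\<forall>z\<in>carrier A. z \<otimes> k = k \<otimes> z \<longrightarrow> z \<otimes> \<sigma> n = \<sigma> n \<otimes> z)" for n
  proof (induction n)
    case 0 then show ?case by (simp add: \<sigma>0 q)
  next
    case (Suc n)
    let ?x = "\<sigma> n"
    have x: "?x \<in> carrier A" "?x\<^sup>\<star> = ?x" "\<parallel>?x\<parallel> \<le> q" using Suc by auto
    have "\<parallel>F ?x\<parallel> \<le> (1/2) * (\<parallel>k\<parallel> + \<parallel>?x\<parallel> * \<parallel>?x\<parallel>)"
      using nrm_triangle[of k "?x \<otimes> ?x"] nrm_mult[of ?x ?x] x k by (simp add: F_def nrm_smult)
    also have "\<dots> \<le> (1/2) * (q + q * 1)"
      using x q nrm_nonneg[OF x(1)] unfolding q_def[symmetric]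
      by (intro mult_left_mono add_mono mult_mono) auto
    finally have "\<parallel>F ?x\<parallel> \<le> q" by simp
    moreover have "z \<otimes> F ?x = F ?x \<otimes> z" if z: "z \<in> carrier A" "z \<otimes> k = k \<otimes> z" for z
    proof -
      have zx: "z \<otimes> ?x = ?x \<otimes> z" using Suc z by auto
      have "z \<otimes> (?x \<otimes> ?x) = (?x \<otimes> ?x) \<otimes> z"
        by (metis zx z(1) x(1) m_assoc)
      then show ?thesis using z x k by (simp add: F_def smult_m_r smult_m_l r_distr l_distr)
    qed
    ultimately show ?case using x k
      by (simp add: \<sigma>S F adj_smult adj_add adj_mult F_def)
  qed
  have \<sigma>c: "\<sigma> n \<in> carrier A" for n using inv by blast
  \<comment> \<open>Writing x^2 - y^2 as x (x - y) + (x - y) y turns the bound q on both norms into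
    the Lipschitz constant (q + q)/2 = q < 1.\<close>
  have contr: "\<parallel>F x \<ominus> F y\<parallel> \<le> q * \<parallel>x \<ominus> y\<parallel>"
    if "x \<in> carrier A" "y \<in> carrier A" "\<parallel>x\<parallel> \<le> q" "\<parallel>y\<parallel> \<le> q" for x y
  proof -
    have "F x \<ominus> F y = (1/2) \<odot> (x \<otimes> x \<ominus> y \<otimes> y)"
      using that k by (simp add: F_def add_diff_add l_zero flip: smult_diff_distr)
    also have "x \<otimes> x \<ominus> y \<otimes> y = x \<otimes> (x \<ominus> y) \<oplus> (x \<ominus> y) \<otimes> y"
      using that by (simp add: mult_diff_distr_l mult_diff_distr_r diff_add_diff)
    finally have "\<parallel>F x \<ominus> F y\<parallel> = (1/2) * \<parallel>x \<otimes> (x \<ominus> y) \<oplus> (x \<ominus> y) \<otimes> y\<parallel>"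
      using that by (simp add: nrm_smult)
    also have "\<dots> \<le> (1/2) * (\<parallel>x\<parallel> * \<parallel>x \<ominus> y\<parallel> + \<parallel>x \<ominus> y\<parallel> * \<parallel>y\<parallel>)"
      using that by (intro mult_left_mono order_trans[OF nrm_triangle] add_mono nrm_mult) auto
    also have "\<dots> \<le> (1/2) * (q * \<parallel>x \<ominus> y\<parallel> + \<parallel>x \<ominus> y\<parallel> * q)"
      using that by (intro mult_left_mono add_mono mult_right_mono mult_left_mono nrm_nonneg) auto
    finally show ?thesis by simp
  qed
  have step: "\<parallel>\<sigma> (Suc n) \<ominus> \<sigma> n\<parallel> \<le> q ^ n" for n
  proof (induction n)
    case 0
    then show ?case using inv[of "Suc 0"] inv[of 0] q by (simp add: \<sigma>0 diff_eq_smult r_zero)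
  next
    case (Suc n)
    have "\<parallel>\<sigma> (Suc (Suc n)) \<ominus> \<sigma> (Suc n)\<parallel> \<le> q * \<parallel>\<sigma> (Suc n) \<ominus> \<sigma> n\<parallel>"
      using contr[of "\<sigma> (Suc n)" "\<sigma> n"] inv[of "Suc n"] inv[of n] by (simp add: \<sigma>S)
    also have "\<dots> \<le> q * q ^ n" using Suc q by (intro mult_left_mono)
    finally show ?case by simp
  qed
  \<comment> \<open>The bound is the exact partial sum of the geometric series from n to n + m, so
    that the induction on m closes.\<close>
  have dist: "\<parallel>\<sigma> (n + m) \<ominus> \<sigma> n\<parallel> \<le> (q ^ n - q ^ (n + m)) / (1 - q)" for n m
  proof (induction m)
    case 0 then show ?case using inv by simp
  next
    case (Suc m)
    have "\<parallel>\<sigma> (n + Suc m) \<ominus> \<sigma> n\<parallel> \<le> \<parallel>\<sigma> (Suc (n + m)) \<ominus> \<sigma> (n + m)\<parallel> + \<parallel>\<sigma> (n + m) \<ominus> \<sigma> n\<parallel>"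
      using inv nrm_diff_triangle by (simp del: \<sigma>S)
    also have "\<dots> \<le> q ^ (n + m) + (q ^ n - q ^ (n + m)) / (1 - q)"
      using step Suc by (intro add_mono)
    also have "\<dots> = (q ^ n - q ^ (n + Suc m)) / (1 - q)"
      using q by (simp add: field_simps)
    finally show ?case .
  qed
  have dist': "\<parallel>\<sigma> m \<ominus> \<sigma> n\<parallel> \<le> q ^ n / (1 - q)" if "n \<le> m" for m n
  proof -
    have "(q ^ n - q ^ m) / (1 - q) \<le> q ^ n / (1 - q)"
      using q by (intro divide_right_mono) auto
    then show ?thesis using dist[of n "m - n"] that by simp
  qed
  have "\<exists>N. \<forall>m\<ge>N. \<forall>n\<ge>N. \<parallel>\<sigma> m \<ominus> \<sigma> n\<parallel> < \<epsilon>" if "\<epsilon> > 0" for \<epsilon>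
  proof -
    have "(\<lambda>n. q ^ n) \<longlonglongrightarrow> 0" using q by (intro LIMSEQ_realpow_zero)
    moreover have "0 < \<epsilon> * (1 - q)" using that q by simp
    ultimately have "\<forall>\<^sub>F n in sequentially. q ^ n < \<epsilon> * (1 - q)" by (rule order_tendstoD(2))
    then obtain N where N: "\<And>n. n \<ge> N \<Longrightarrow> q ^ n < \<epsilon> * (1 - q)"
      by (auto simp: eventually_sequentially)
    have less: "\<parallel>\<sigma> m \<ominus> \<sigma> n\<parallel> < \<epsilon>" if "N \<le> n" "n \<le> m" for m n
      using dist'[OF that(2)] N[OF that(1)] q by (smt (verit) pos_divide_less_eq)
    show ?thesis
    proof (intro exI[of _ N] allI impI)
      fix m n assume "m \<ge> N" "n \<ge> N"
      then show "\<parallel>\<sigma> m \<ominus> \<sigma> n\<parallel> < \<epsilon>"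
        using less[of n m] less[of m n] inv nrm_diff_commute[of "\<sigma> m" "\<sigma> n"] by (cases "n \<le> m") auto
    qed
  qed
  then obtain c where c: "c \<in> carrier A" "(\<lambda>n. \<parallel>\<sigma> n \<ominus> c\<parallel>) \<longlonglongrightarrow> 0"
    using complete[of \<sigma>] inv by blast
  have "(\<lambda>n. \<parallel>\<sigma> n \<otimes> \<sigma> n \<ominus> c \<otimes> c\<parallel>) \<longlonglongrightarrow> 0"
    using inv c by (intro limit_mult) auto
  then have "(\<lambda>n. \<parallel>(k \<oplus> \<sigma> n \<otimes> \<sigma> n) \<ominus> (k \<oplus> c \<otimes> c)\<parallel>) \<longlonglongrightarrow> 0"
    using limit_add[of "\<lambda>_. k" k "\<lambda>n. \<sigma> n \<otimes> \<sigma> n" "c \<otimes> c"] \<sigma>c c(1) k(1) by simp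
  then have "(\<lambda>n. \<parallel>F (\<sigma> n) \<ominus> F c\<parallel>) \<longlonglongrightarrow> 0"
    unfolding F_def using limit_smult[of "\<lambda>n. k \<oplus> \<sigma> n \<otimes> \<sigma> n" "k \<oplus> c \<otimes> c" "1/2"] \<sigma>c c(1) k(1) by simp
  then have "(\<lambda>n. \<parallel>\<sigma> (Suc n) \<ominus> F c\<parallel>) \<longlonglongrightarrow> 0" by (simp add: \<sigma>S)
  then have "c = F c"
    using limit_unique[of "\<lambda>n. \<sigma> (Suc n)" c "F c"] inv c(1) F[OF c(1)] LIMSEQ_Suc[OF c(2)] by blast
  then have "2 \<odot> c = 2 \<odot> F c" by simp
  also have "\<dots> = k \<oplus> c \<otimes> c" using c k by (simp add: F_def flip: smult_assoc)
  also have "2 \<odot> c = c \<oplus> c" using smult_l_distr[of c 1 1] c by simp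
  finally have eq: "c \<oplus> c = k \<oplus> c \<otimes> c" .
  have sa: "c\<^sup>\<star> = c"
    using limit_unique[of \<sigma> "c\<^sup>\<star>" c] limit_adj[OF _ c(1) c(2)] inv c by simp
  have comm: "z \<otimes> c = c \<otimes> z" if "z \<in> carrier A" "z \<otimes> k = k \<otimes> z" for z
    using limit_unique[of "\<lambda>n. z \<otimes> \<sigma> n" "z \<otimes> c" "c \<otimes> z"] limit_mult_left[OF _ c(1) that(1) c(2)]
      limit_mult_right[OF _ c(1) that(1) c(2)] inv c that by simp
  show ?thesis using c(1) sa eq comm by blast
qed

text \<open>Both \<open>a + ib\<close> and \<open>a - ib\<close> have square norm \<open>\<parallel>a\<^sup>\<star>a + b\<^sup>\<star>b\<parallel>\<close>, and \<open>2a\<close> is their sum.\<close>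

lemma nrm_le_of_commuting_squares:
  assumes a: "a \<in> carrier A" and b: "b \<in> carrier A" and ab: "a\<^sup>\<star> \<otimes> b = b\<^sup>\<star> \<otimes> a"
  shows "\<parallel>a\<parallel>\<^sup>2 \<le> \<parallel>a\<^sup>\<star> \<otimes> a \<oplus> b\<^sup>\<star> \<otimes> b\<parallel>"
proof -
  have *: "\<parallel>a \<oplus> z \<odot> b\<parallel>\<^sup>2 = \<parallel>a\<^sup>\<star> \<otimes> a \<oplus> b\<^sup>\<star> \<otimes> b\<parallel>" if z: "z = \<i> \<or> z = - \<i>" for z
  proof -
    have zz: "cnj z = - z" "z * z = -1" using z by auto
    have "(a \<oplus> z \<odot> b)\<^sup>\<star> \<otimes> (a \<oplus> z \<odot> b) =
        (a\<^sup>\<star> \<otimes> a \<oplus> (- z) \<odot> (b\<^sup>\<star> \<otimes> a)) \<oplus> (z \<odot> (a\<^sup>\<star> \<otimes> b) \<oplus> (- (z * z)) \<odot> (b\<^sup>\<star> \<otimes> b))"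
      using a b by (simp add: adj_add adj_smult l_distr r_distr smult_m_l smult_m_r smult_r_distr zz(1) flip: smult_assoc)
    also have "\<dots> = (a\<^sup>\<star> \<otimes> a \<oplus> b\<^sup>\<star> \<otimes> b) \<oplus> ((- z) \<odot> (b\<^sup>\<star> \<otimes> a) \<oplus> z \<odot> (b\<^sup>\<star> \<otimes> a))"
      using a b by (simp add: ab zz a_ac)
    also have "(- z) \<odot> (b\<^sup>\<star> \<otimes> a) \<oplus> z \<odot> (b\<^sup>\<star> \<otimes> a) = \<zero>"
      using a b smult_l_distr[of "b\<^sup>\<star> \<otimes> a" "-z" z] by simp
    finally have "(a \<oplus> z \<odot> b)\<^sup>\<star> \<otimes> (a \<oplus> z \<odot> b) = a\<^sup>\<star> \<otimes> a \<oplus> b\<^sup>\<star> \<otimes> b"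
      using a b by (simp add: r_zero)
    then show ?thesis using cstar_identity[of "a \<oplus> z \<odot> b"] a b by simp
  qed
  have 2: "(a \<oplus> \<i> \<odot> b) \<oplus> (a \<oplus> (-\<i>) \<odot> b) = 2 \<odot> a"
  proof -
    have "(a \<oplus> \<i> \<odot> b) \<oplus> (a \<oplus> (-\<i>) \<odot> b) = (a \<oplus> a) \<oplus> (\<i> \<odot> b \<oplus> (-\<i>) \<odot> b)"
      using a b by (simp add: a_ac)
    also have "\<dots> = 2 \<odot> a"
      using a b smult_l_distr[of b "\<i>" "-\<i>"] smult_l_distr[of a 1 1] by (simp add: r_zero)
    finally show ?thesis .
  qed
  define m where "m = sqrt \<parallel>a\<^sup>\<star> \<otimes> a \<oplus> b\<^sup>\<star> \<otimes> b\<parallel>"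
  have m: "\<parallel>a \<oplus> \<i> \<odot> b\<parallel> = m" "\<parallel>a \<oplus> (-\<i>) \<odot> b\<parallel> = m"
    using * a b by (auto simp: m_def nrm_nonneg intro!: real_sqrt_unique[symmetric])
  have "2 * \<parallel>a\<parallel> \<le> m + m"
    using nrm_triangle[of "a \<oplus> \<i> \<odot> b" "a \<oplus> (-\<i>) \<odot> b"] a b m unfolding 2 by (simp add: nrm_smult)
  then have "\<parallel>a\<parallel>\<^sup>2 \<le> m\<^sup>2" using nrm_nonneg[OF a] by (intro power_mono) auto
  then show ?thesis using a b by (simp add: m_def nrm_nonneg)
qed


lemma nrm_projection_le_1: 
  assumes "projection A e" shows "\<parallel>e\<parallel> \<le> 1"
proof -
  have "\<parallel>e\<parallel>\<^sup>2 = \<parallel>e\<parallel>" and "0 \<le> \<parallel>e\<parallel>"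
    using assms cstar_identity[of e] by (auto simp: projection_def nrm_nonneg)
  then show ?thesis by (auto simp: power2_eq_square)
qed

text \<open>
  In the corner with unit \<open>e\<close> both \<open>(e - h)/(1 + \<epsilon>)\<close> and \<open>(e + h)/(1 + \<epsilon>)\<close> are of norm less than
  one, so both \<open>\<epsilon>e + h\<close> and \<open>\<epsilon>e - h\<close> have self-adjoint square roots; these commute and their
  squares add up to \<open>2\<epsilon>e\<close>.
\<close>

lemma sandwiched_eq_zero:
  assumes e: "projection A e" and h: "h \<in> carrier A" "h\<^sup>\<star> = h" "e \<otimes> h = h" "h \<otimes> e = h"
    and le: "\<parallel>e \<ominus> h\<parallel> \<le> 1" "\<parallel>e \<oplus> h\<parallel> \<le> 1"
  shows "h = \<zero>"
proof -
  have e': "e \<in> carrier A" "e \<otimes> e = e" "e\<^sup>\<star> = e" using e by (auto simp: projection_def)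
  have e1: "\<parallel>e\<parallel> \<le> 1" by (rule nrm_projection_le_1[OF e])
  \<comment> \<open>The square root of e - k in the corner is e - ec, where 1 - c is the formal
    square root of 1 - k. It commutes with whatever commutes with both k and e.\<close>
  have sqrt: "\<exists>d\<in>carrier A. d\<^sup>\<star> = d \<and> d \<otimes> d = e \<ominus> k \<and>
      (\<forall>z\<in>carrier A. z \<otimes> k = k \<otimes> z \<and> z \<otimes> e = e \<otimes> z \<longrightarrow> z \<otimes> d = d \<otimes> z)"
    if k: "k \<in> carrier A" "k\<^sup>\<star> = k" "\<parallel>k\<parallel> < 1" "e \<otimes> k = k" "k \<otimes> e = k" for k
  proof -
    obtain c where c: "c \<in> carrier A" "c\<^sup>\<star> = c" "c \<oplus> c = k \<oplus> c \<otimes> c"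
      "\<forall>z\<in>carrier A. z \<otimes> k = k \<otimes> z \<longrightarrow> z \<otimes> c = c \<otimes> z"
      using sqrt_one_minus_exists[OF k(1-3)] by blast
    have ec: "e \<otimes> c = c \<otimes> e" using c(4) k e' by simp
    have ecc: "e \<otimes> (c \<otimes> c) = c \<otimes> (e \<otimes> c)" by (metis ec m_assoc c(1) e'(1))
    have ece: "e \<otimes> (c \<otimes> e) = e \<otimes> c" "c \<otimes> (e \<otimes> (e \<otimes> c)) = e \<otimes> (c \<otimes> c)"
      using ec ecc e' c by (metis m_assoc m_closed)+
    let ?d = "e \<ominus> e \<otimes> c"
    have "?d \<otimes> ?d = e \<ominus> (e \<otimes> c \<oplus> e \<otimes> c) \<oplus> e \<otimes> (c \<otimes> c)"
    proof -
      have "(e \<otimes> c) \<otimes> e = e \<otimes> c" "e \<otimes> (e \<otimes> c) = e \<otimes> c" "(e \<otimes> c) \<otimes> (e \<otimes> c) = e \<otimes> (c \<otimes> c)"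
        using e' c ec by (metis m_assoc m_closed)+
      then show ?thesis using e' c
        by (simp add: mult_diff_distr_l mult_diff_distr_r)
           (simp add: diff_eq_smult smult_r_distr a_ac flip: smult_assoc)
    qed
    also have "e \<otimes> c \<oplus> e \<otimes> c = k \<oplus> e \<otimes> (c \<otimes> c)"
      using c(1,3) e' k by (simp flip: r_distr) (simp add: r_distr)
    also have "e \<ominus> (k \<oplus> e \<otimes> (c \<otimes> c)) \<oplus> e \<otimes> (c \<otimes> c) = e \<ominus> k"
      using e' c(1) k by (simp add: a_minus_def minus_add a_assoc l_neg r_zero)
    finally have "?d \<otimes> ?d = e \<ominus> k" .
    moreover have "?d\<^sup>\<star> = ?d" using e' c ec by (simp add: adj_diff adj_mult)
    moreover have "z \<otimes> ?d = ?d \<otimes> z" if z: "z \<in> carrier A" "z \<otimes> k = k \<otimes> z" "z \<otimes> e = e \<otimes> z" for z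
    proof -
      have "z \<otimes> (e \<otimes> c) = (e \<otimes> c) \<otimes> z"
        using bspec[OF c(4) z(1)] z e' c(1) by (metis m_assoc)
      then show ?thesis using z e' c by (simp add: mult_diff_distr_l mult_diff_distr_r)
    qed
    ultimately show ?thesis using e' c by (intro bexI[of _ ?d]) auto
  qed
  \<comment> \<open>The 5 is 2 * 2 + 1: the element e - t(e - h) has norm at most 2\<epsilon>, it is
    multiplied by 1 + \<epsilon> < 2, and removing the remaining term \<epsilon>e costs another
    \<epsilon>.\<close>
  have bound: "\<parallel>h\<parallel> \<le> \<epsilon> * 5" if \<epsilon>: "0 < \<epsilon>" "\<epsilon> < 1" for \<epsilon> :: real
  proof -
    define t where "t = complex_of_real (inverse (1 + \<epsilon>))"
    have t: "cmod t = inverse (1 + \<epsilon>)" "cnj t = t" using \<epsilon> by (auto simp: t_def abs_of_nonneg simp del: of_real_inverse)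
    have tm: "inverse (1 + \<epsilon>) * x < 1" if "x \<le> 1" for x :: real
      using that \<epsilon> by (simp add: field_simps)
    have "t \<odot> (e \<ominus> h) \<in> carrier A" "(t \<odot> (e \<ominus> h))\<^sup>\<star> = t \<odot> (e \<ominus> h)" "\<parallel>t \<odot> (e \<ominus> h)\<parallel> < 1"
        "e \<otimes> (t \<odot> (e \<ominus> h)) = t \<odot> (e \<ominus> h)" "t \<odot> (e \<ominus> h) \<otimes> e = t \<odot> (e \<ominus> h)"
      using e' h tm[OF le(1)]
      by (simp_all add: adj_smult adj_diff adj_add t nrm_smult smult_m_l smult_m_r mult_diff_distr_l
          mult_diff_distr_r l_distr r_distr)
    from sqrt[OF this] obtain d1 where d1: "d1 \<in> carrier A" "d1\<^sup>\<star> = d1" "d1 \<otimes> d1 = e \<ominus> t \<odot> (e \<ominus> h)"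
      "\<forall>z\<in>carrier A. z \<otimes> (t \<odot> (e \<ominus> h)) = (t \<odot> (e \<ominus> h)) \<otimes> z \<and> z \<otimes> e = e \<otimes> z \<longrightarrow> z \<otimes> d1 = d1 \<otimes> z"
      by blast
    have "t \<odot> (e \<oplus> h) \<in> carrier A" "(t \<odot> (e \<oplus> h))\<^sup>\<star> = t \<odot> (e \<oplus> h)" "\<parallel>t \<odot> (e \<oplus> h)\<parallel> < 1"
        "e \<otimes> (t \<odot> (e \<oplus> h)) = t \<odot> (e \<oplus> h)" "t \<odot> (e \<oplus> h) \<otimes> e = t \<odot> (e \<oplus> h)"
      using e' h tm[OF le(2)]
      by (simp_all add: adj_smult adj_diff adj_add t nrm_smult smult_m_l smult_m_r mult_diff_distr_l
          mult_diff_distr_r l_distr r_distr)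
    from sqrt[OF this] obtain d2 where d2: "d2 \<in> carrier A" "d2\<^sup>\<star> = d2" "d2 \<otimes> d2 = e \<ominus> t \<odot> (e \<oplus> h)"
      "\<forall>z\<in>carrier A. z \<otimes> (t \<odot> (e \<oplus> h)) = (t \<odot> (e \<oplus> h)) \<otimes> z \<and> z \<otimes> e = e \<otimes> z \<longrightarrow> z \<otimes> d2 = d2 \<otimes> z"
      by blast
    have d1h: "h \<otimes> d1 = d1 \<otimes> h" and d1e: "e \<otimes> d1 = d1 \<otimes> e"
      using bspec[OF d1(4), of h] bspec[OF d1(4), of e] e' h
      by (simp_all add: smult_m_l smult_m_r mult_diff_distr_l mult_diff_distr_r)
    have "d1 \<otimes> d2 = d2 \<otimes> d1"
      using bspec[OF d2(4), of d1] d1(1) d1h d1e e' h by (simp add: smult_m_l smult_m_r l_distr r_distr)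
    then have "\<parallel>d1\<parallel>\<^sup>2 \<le> \<parallel>d1\<^sup>\<star> \<otimes> d1 \<oplus> d2\<^sup>\<star> \<otimes> d2\<parallel>"
      using d1 d2 by (intro nrm_le_of_commuting_squares) auto
    also have "d1\<^sup>\<star> \<otimes> d1 \<oplus> d2\<^sup>\<star> \<otimes> d2 = (2 * (1 - t)) \<odot> e"
    proof -
      have "d1\<^sup>\<star> \<otimes> d1 \<oplus> d2\<^sup>\<star> \<otimes> d2 = (e \<oplus> e) \<oplus> ((- t) \<odot> e \<oplus> (- t) \<odot> e) \<oplus> (t \<odot> h \<oplus> (- t) \<odot> h)"
        using d1 d2 e' h by (simp add: diff_eq_smult smult_r_distr a_ac flip: smult_assoc)
      also have "\<dots> = (1 \<odot> e \<oplus> 1 \<odot> e) \<oplus> ((- t) \<odot> e \<oplus> (- t) \<odot> e) \<oplus> (t \<odot> h \<oplus> (- t) \<odot> h)"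
        using e' by simp
      also have "\<dots> = (2 * (1 - t)) \<odot> e"
        using e' h by (simp add: r_zero algebra_simps flip: smult_l_distr del: smult_one)
      finally show ?thesis .
    qed
    also have "\<parallel>(2 * (1 - t)) \<odot> e\<parallel> \<le> 2 * \<epsilon>"
    proof -
      have "1 - t = complex_of_real (1 - inverse (1 + \<epsilon>))" by (simp add: t_def)
      then have "cmod (1 - t) = 1 - inverse (1 + \<epsilon>)" using \<epsilon>
        by (metis norm_of_real abs_of_nonneg tm[of 1] mult.right_neutral diff_ge_0_iff_ge less_imp_le order_refl real_norm_def)
      also have "\<dots> \<le> \<epsilon>" using \<epsilon> by (simp add: field_simps)
      finally have "cmod (2 * (1 - t)) \<le> 2 * \<epsilon>" unfolding norm_mult by simp
      then have "cmod (2 * (1 - t)) * \<parallel>e\<parallel> \<le> (2 * \<epsilon>) * 1"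
        using e' e1 \<epsilon> by (intro mult_mono) (auto simp: nrm_nonneg)
      then show ?thesis using e' by (simp add: nrm_smult)
    qed
    finally have "\<parallel>d1\<parallel>\<^sup>2 \<le> 2 * \<epsilon>" .
    then have n1: "\<parallel>e \<ominus> t \<odot> (e \<ominus> h)\<parallel> \<le> 2 * \<epsilon>"
      using cstar_identity[of d1] d1 by simp
    have "complex_of_real ((1 + \<epsilon>) * inverse (1 + \<epsilon>)) = 1" using \<epsilon> by simp
    then have tt: "(1 + complex_of_real \<epsilon>) * t = 1"
      unfolding t_def of_real_mult of_real_add by simp
    have "h = (1 + complex_of_real \<epsilon>) \<odot> (e \<ominus> t \<odot> (e \<ominus> h)) \<oplus> (- complex_of_real \<epsilon>) \<odot> e"
    proof -
      have "(1 + complex_of_real \<epsilon>) \<odot> (e \<ominus> t \<odot> (e \<ominus> h)) = (1 + complex_of_real \<epsilon>) \<odot> e \<ominus> (e \<ominus> h)"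
        using e' h tt by (simp add: smult_diff_distr flip: smult_assoc)
      then have "(1 + complex_of_real \<epsilon>) \<odot> (e \<ominus> t \<odot> (e \<ominus> h)) \<oplus> (- complex_of_real \<epsilon>) \<odot> e
         = h \<oplus> ((1 + complex_of_real \<epsilon>) \<odot> e \<oplus> (-1) \<odot> e \<oplus> (- complex_of_real \<epsilon>) \<odot> e)"
        using e' h by (simp add: diff_eq_smult smult_r_distr a_ac flip: smult_assoc)
      also have "\<dots> = h" using e' h by (simp add: r_zero flip: smult_l_distr)
      finally show ?thesis by simp
    qed
    then have "\<parallel>h\<parallel> \<le> cmod (1 + complex_of_real \<epsilon>) * \<parallel>e \<ominus> t \<odot> (e \<ominus> h)\<parallel> + cmod (- complex_of_real \<epsilon>) * \<parallel>e\<parallel>"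
      using nrm_triangle[of "(1 + complex_of_real \<epsilon>) \<odot> (e \<ominus> t \<odot> (e \<ominus> h))" "(- complex_of_real \<epsilon>) \<odot> e"] e' h
      by (simp add: nrm_smult)
    also have "cmod (1 + complex_of_real \<epsilon>) = 1 + \<epsilon>"
      using \<epsilon> by (metis norm_of_real of_real_1 of_real_add abs_of_pos add_pos_pos zero_less_one)
    also have "(1 + \<epsilon>) * \<parallel>e \<ominus> t \<odot> (e \<ominus> h)\<parallel> + cmod (- complex_of_real \<epsilon>) * \<parallel>e\<parallel> \<le> 2 * (2 * \<epsilon>) + \<epsilon> * 1"
      using \<epsilon> n1 e1 e' h by (intro add_mono mult_mono) (auto simp: nrm_nonneg)
    finally show ?thesis by simp
  qed
  have "\<parallel>h\<parallel> \<le> 0"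
  proof (rule ccontr)
    assume "\<not> \<parallel>h\<parallel> \<le> 0"
    then have "0 < min (1/2) (\<parallel>h\<parallel> / 6)" by simp
    then have "\<parallel>h\<parallel> \<le> min (1/2) (\<parallel>h\<parallel> / 6) * 5" by (intro bound) auto
    then show False using \<open>\<not> \<parallel>h\<parallel> \<le> 0\<close> by (auto simp: min_def split: if_splits)
  qed
  then show ?thesis using nrm_eq_0[OF h(1)] nrm_nonneg[OF h(1)] by simp
qed

end

section \<open>Homomorphisms of C*-algebras are contractive\<close>

locale cstar_hom = B: cstar_algebra B + A: cstar_algebra A
  for B :: "'b cstar" (structure) and A :: "'a cstar" (structure) +
  fixes \<phi>
  assumes hom: "\<phi> \<in> star_hom B A"
begin

lemma closed [simp, intro]: "x \<in> carrier B \<Longrightarrow> \<phi> x \<in> carrier A"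
  and add: "\<lbrakk>x \<in> carrier B; y \<in> carrier B\<rbrakk> \<Longrightarrow> \<phi> (x \<oplus> y) = \<phi> x \<oplus>\<^bsub>A\<^esub> \<phi> y"
  and smult: "x \<in> carrier B \<Longrightarrow> \<phi> (c \<odot> x) = c \<odot>\<^bsub>A\<^esub> \<phi> x"
  and mult: "\<lbrakk>x \<in> carrier B; y \<in> carrier B\<rbrakk> \<Longrightarrow> \<phi> (x \<otimes> y) = \<phi> x \<otimes>\<^bsub>A\<^esub> \<phi> y"
  and adj: "x \<in> carrier B \<Longrightarrow> \<phi> (x\<^sup>\<star>) = (\<phi> x)\<^sup>\<star>\<^bsub>A\<^esub>"
  using hom by (auto simp: star_hom_def)

lemma zero [simp]: "\<phi> \<zero> = \<zero>\<^bsub>A\<^esub>"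
  using smult[of \<zero> 0] by simp

lemma diff: "\<lbrakk>x \<in> carrier B; y \<in> carrier B\<rbrakk> \<Longrightarrow> \<phi> (x \<ominus> y) = \<phi> x \<ominus>\<^bsub>A\<^esub> \<phi> y"
  by (simp add: A.diff_eq_smult B.diff_eq_smult add smult)

lemma finsum: "f \<in> I \<rightarrow> carrier B \<Longrightarrow> \<phi> (finsum B f I) = finsum A (\<lambda>i. \<phi> (f i)) I"
proof (induction I rule: infinite_finite_induct)
  case (infinite I)
  then show ?case by (simp add: finsum_def finprod_def)
next
  case empty
  then show ?case by simp
next
  case (insert i I)
  then have "f i \<in> carrier B" "f \<in> I \<rightarrow> carrier B" by auto
  with insert show ?case
    by (simp add: B.finsum_insert A.finsum_insert add B.finsum_closed Pi_iff)
qed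

text \<open>Let y be the image of \<open>h\<close> and let 1 - C be the image of the formal square
  root of 1 - h^2. Then a = y^2 and b = (1 - C) y commute, and a^2 + b^2 = y^4 + (1 - y^2) y^2 =
  y^2. The inequality for commuting squares therefore bounds the fourth power of the norm of y by
  its square.\<close>

lemma nrm_le_1_if_sa:
  assumes h: "h \<in> carrier B" "h\<^sup>\<star> = h" "\<parallel>h\<parallel> < 1"
  shows "\<parallel>\<phi> h\<parallel>\<^bsub>A\<^esub> \<le> 1"
proof -
  have hh: "\<parallel>h \<otimes> h\<parallel> < 1"
    using B.cstar_identity[OF h(1)] h B.nrm_nonneg[OF h(1)] by (simp add: power_less_one_iff)
  obtain c where c: "c \<in> carrier B" "c\<^sup>\<star> = c" "c \<oplus> c = h \<otimes> h \<oplus> c \<otimes> c"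
      "\<forall>z\<in>carrier B. z \<otimes> (h \<otimes> h) = h \<otimes> h \<otimes> z \<longrightarrow> z \<otimes> c = c \<otimes> z"
    using B.sqrt_one_minus_exists[OF B.m_closed[OF h(1) h(1)] _ hh] h(2) B.adj_mult[OF h(1) h(1)]
    by auto
  define y C where "y = \<phi> h" and "C = \<phi> c"
  have y: "y \<in> carrier A" "y\<^sup>\<star>\<^bsub>A\<^esub> = y" and C: "C \<in> carrier A" "C\<^sup>\<star>\<^bsub>A\<^esub> = C"
    using h(1,2) c(1,2) by (auto simp: y_def C_def simp flip: adj)
  have yC: "y \<otimes>\<^bsub>A\<^esub> C = C \<otimes>\<^bsub>A\<^esub> y"
    using bspec[OF c(4) h(1)] h(1) c(1) by (simp add: y_def C_def B.m_assoc flip: mult)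
  have CC: "C \<oplus>\<^bsub>A\<^esub> C = y \<otimes>\<^bsub>A\<^esub> y \<oplus>\<^bsub>A\<^esub> C \<otimes>\<^bsub>A\<^esub> C"
    using c(1,3) h by (simp add: y_def C_def flip: mult add)
  define a b where "a = y \<otimes>\<^bsub>A\<^esub> y" and "b = y \<ominus>\<^bsub>A\<^esub> C \<otimes>\<^bsub>A\<^esub> y"
  have ab: "a \<in> carrier A" "b \<in> carrier A" "a\<^sup>\<star>\<^bsub>A\<^esub> = a" "b\<^sup>\<star>\<^bsub>A\<^esub> = b"
    using y C yC by (auto simp: a_def b_def A.adj_diff A.adj_mult)
  have "C \<otimes>\<^bsub>A\<^esub> (y \<otimes>\<^bsub>A\<^esub> y) = y \<otimes>\<^bsub>A\<^esub> (C \<otimes>\<^bsub>A\<^esub> y)" by (metis yC A.m_assoc y(1) C(1))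
  then have "a \<otimes>\<^bsub>A\<^esub> b = b \<otimes>\<^bsub>A\<^esub> a"
    using y C by (simp add: a_def b_def A.mult_diff_distr_l A.mult_diff_distr_r A.m_assoc)
       (metis A.m_assoc A.m_closed yC)
  then have "\<parallel>a\<parallel>\<^bsub>A\<^esub>\<^sup>2 \<le> \<parallel>a \<otimes>\<^bsub>A\<^esub> a \<oplus>\<^bsub>A\<^esub> b \<otimes>\<^bsub>A\<^esub> b\<parallel>\<^bsub>A\<^esub>"
    using A.nrm_le_of_commuting_squares[of a b] ab by simp
  also have "a \<otimes>\<^bsub>A\<^esub> a \<oplus>\<^bsub>A\<^esub> b \<otimes>\<^bsub>A\<^esub> b = y \<otimes>\<^bsub>A\<^esub> y"
  proof -
    have "b \<otimes>\<^bsub>A\<^esub> b = y \<otimes>\<^bsub>A\<^esub> y \<ominus>\<^bsub>A\<^esub> y \<otimes>\<^bsub>A\<^esub> (C \<oplus>\<^bsub>A\<^esub> C) \<otimes>\<^bsub>A\<^esub> y \<oplus>\<^bsub>A\<^esub> y \<otimes>\<^bsub>A\<^esub> (C \<otimes>\<^bsub>A\<^esub> C) \<otimes>\<^bsub>A\<^esub> y"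
    proof -
      have "C \<otimes>\<^bsub>A\<^esub> y \<otimes>\<^bsub>A\<^esub> y = y \<otimes>\<^bsub>A\<^esub> (C \<otimes>\<^bsub>A\<^esub> y)" 
        "C \<otimes>\<^bsub>A\<^esub> y \<otimes>\<^bsub>A\<^esub> (C \<otimes>\<^bsub>A\<^esub> y) = y \<otimes>\<^bsub>A\<^esub> (C \<otimes>\<^bsub>A\<^esub> C) \<otimes>\<^bsub>A\<^esub> y"
        by (metis yC A.m_assoc A.m_closed y(1) C(1))+
      then show ?thesis using y C
        by (simp add: b_def A.mult_diff_distr_l A.mult_diff_distr_r A.l_distr A.r_distr A.m_assoc)
           (simp add: A.diff_eq_smult A.smult_r_distr A.a_ac flip: A.smult_assoc)
    qed
    also have "\<dots> = y \<otimes>\<^bsub>A\<^esub> y \<ominus>\<^bsub>A\<^esub> a \<otimes>\<^bsub>A\<^esub> a"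
      unfolding CC using y C
      by (simp add: a_def a_minus_def A.minus_add A.l_distr A.r_distr A.m_assoc A.a_assoc A.l_neg A.r_zero)
    finally have bb: "b \<otimes>\<^bsub>A\<^esub> b = y \<otimes>\<^bsub>A\<^esub> y \<ominus>\<^bsub>A\<^esub> a \<otimes>\<^bsub>A\<^esub> a" .
    show ?thesis unfolding bb using y ab A.diff_add_cancel[of "y \<otimes>\<^bsub>A\<^esub> y" "a \<otimes>\<^bsub>A\<^esub> a"] by (simp add: A.a_comm)
  qed
  also have "\<parallel>y \<otimes>\<^bsub>A\<^esub> y\<parallel>\<^bsub>A\<^esub> = \<parallel>y\<parallel>\<^bsub>A\<^esub>\<^sup>2"
    using A.cstar_identity[of y] y by simp
  also have "\<parallel>a\<parallel>\<^bsub>A\<^esub> = \<parallel>y\<parallel>\<^bsub>A\<^esub>\<^sup>2"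
    using A.cstar_identity[of y] y by (simp add: a_def)
  finally have "(\<parallel>y\<parallel>\<^bsub>A\<^esub>\<^sup>2)\<^sup>2 \<le> \<parallel>y\<parallel>\<^bsub>A\<^esub>\<^sup>2" .
  then have "\<parallel>y\<parallel>\<^bsub>A\<^esub>\<^sup>2 \<le> 1"
    by (cases "\<parallel>y\<parallel>\<^bsub>A\<^esub> = 0") (auto simp: power2_eq_square mult_le_cancel_left2)
  then show ?thesis using A.nrm_nonneg[OF y(1)] by (simp add: y_def abs_square_le_1)
qed

text \<open>Scaling brings self-adjoint elements to norm below 1, and the C*-identity reduces an
  arbitrary \<open>x\<close> to the self-adjoint element
  \<open>x\<^sup>\<star> \<otimes> x\<close>.\<close>

lemma nrm_le:
  assumes x: "x \<in> carrier B" shows "\<parallel>\<phi> x\<parallel>\<^bsub>A\<^esub> \<le> \<parallel>x\<parallel>"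
proof -
  have sa: "\<parallel>\<phi> h\<parallel>\<^bsub>A\<^esub> \<le> \<parallel>h\<parallel>" if h: "h \<in> carrier B" "h\<^sup>\<star> = h" for h
  proof (rule dense_ge)
    fix t assume t: "\<parallel>h\<parallel> < t"
    then have t0: "0 < t" using B.nrm_nonneg[OF h(1)] by simp
    then have "\<parallel>\<phi> (complex_of_real (inverse t) \<odot> h)\<parallel>\<^bsub>A\<^esub> \<le> 1"
      using h t by (intro nrm_le_1_if_sa) (auto simp: B.adj_smult B.nrm_smult norm_inverse norm_divide divide_simps simp del: of_real_inverse)
    then show "\<parallel>\<phi> h\<parallel>\<^bsub>A\<^esub> \<le> t"
      using h t0 by (simp add: smult A.nrm_smult norm_inverse norm_divide divide_simps del: of_real_inverse)
  qed
  have "\<parallel>\<phi> x\<parallel>\<^bsub>A\<^esub>\<^sup>2 = \<parallel>\<phi> (x\<^sup>\<star> \<otimes> x)\<parallel>\<^bsub>A\<^esub>" using x by (simp add: mult adj A.cstar_identity)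
  also have "\<dots> \<le> \<parallel>x\<^sup>\<star> \<otimes> x\<parallel>" using x by (intro sa) (auto simp: B.adj_mult)
  also have "\<dots> = \<parallel>x\<parallel>\<^sup>2" using x by (simp add: B.cstar_identity)
  finally show ?thesis using x B.nrm_nonneg power2_le_imp_le by blast
qed

end

section \<open>Separable subalgebras and universal properties\<close>

context cstar_algebra
begin

definition seq_closure :: "'a set \<Rightarrow> 'a set" where
  "seq_closure D = {x \<in> carrier A. \<exists>\<sigma>::nat \<Rightarrow> 'a. (\<forall>n. \<sigma> n \<in> D) \<and> (\<lambda>n. \<parallel>\<sigma> n \<ominus> x\<parallel>) \<longlonglongrightarrow> 0}"

lemma seq_closure_subset: "seq_closure D \<subseteq> carrier A"
  by (auto simp: seq_closure_def)

lemma subset_seq_closure: "D \<subseteq> carrier A \<Longrightarrow> D \<subseteq> seq_closure D"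
proof
  fix x assume "D \<subseteq> carrier A" "x \<in> D"
  then show "x \<in> seq_closure D" unfolding seq_closure_def
    by (auto intro!: exI[of _ "\<lambda>_. x"])
qed

lemma seq_closure_iff:
  assumes "D \<subseteq> carrier A" "x \<in> carrier A"
  shows "x \<in> seq_closure D \<longleftrightarrow> (\<forall>\<epsilon>>0. \<exists>y\<in>D. \<parallel>x \<ominus> y\<parallel> < \<epsilon>)"
proof
  assume "x \<in> seq_closure D"
  then obtain \<sigma> :: "nat \<Rightarrow> 'a" where \<sigma>: "\<And>n. \<sigma> n \<in> D" "(\<lambda>n. \<parallel>\<sigma> n \<ominus> x\<parallel>) \<longlonglongrightarrow> 0"
    by (auto simp: seq_closure_def)
  show "\<forall>\<epsilon>>0. \<exists>y\<in>D. \<parallel>x \<ominus> y\<parallel> < \<epsilon>"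
  proof (intro allI impI)
    fix \<epsilon> :: real assume "0 < \<epsilon>"
    then obtain n where "\<parallel>\<sigma> n \<ominus> x\<parallel> < \<epsilon>"
      using order_tendstoD(2)[OF \<sigma>(2)] by (auto simp: eventually_sequentially)
    then show "\<exists>y\<in>D. \<parallel>x \<ominus> y\<parallel> < \<epsilon>"
      using \<sigma>(1)[of n] assms nrm_diff_commute[of x "\<sigma> n"] by (intro bexI[of _ "\<sigma> n"]) auto
  qed
next
  assume R: "\<forall>\<epsilon>>0. \<exists>y\<in>D. \<parallel>x \<ominus> y\<parallel> < \<epsilon>"
  have "\<exists>y\<in>D. \<parallel>x \<ominus> y\<parallel> < inverse (real (Suc n))" for n using R by simp
  then obtain \<sigma> where \<sigma>: "\<And>n. \<sigma> n \<in> D" "\<And>n. \<parallel>x \<ominus> \<sigma> n\<parallel> < inverse (real (Suc n))" by metis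
  have "(\<lambda>n. \<parallel>\<sigma> n \<ominus> x\<parallel>) \<longlonglongrightarrow> 0"
  proof (rule Lim_null_comparison[OF _ LIMSEQ_inverse_real_of_nat])
    have "norm \<parallel>\<sigma> n \<ominus> x\<parallel> \<le> inverse (real (Suc n))" for n
    proof -
      have "\<sigma> n \<in> carrier A" using \<sigma>(1) assms(1) by blast
      then show ?thesis
        using \<sigma>(2)[of n] assms(2) by (simp add: nrm_nonneg nrm_diff_commute[of x "\<sigma> n"])
    qed
    then show "\<forall>\<^sub>F n in sequentially. norm \<parallel>\<sigma> n \<ominus> x\<parallel> \<le> inverse (real (Suc n))"
      by (intro always_eventually allI)
  qed
  then show "x \<in> seq_closure D" using \<sigma>(1) assms(2) by (auto simp: seq_closure_def)
qed

text \<open>Scalars come from a dense set \<open>R\<close> so that one lemma serves two kinds of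
  \<open>D\<close>: a countable one, closed only under rational complex scalars, and a complex
  subspace with \<open>R = UNIV\<close>.\<close>

lemma cstar_subalgebra_seq_closure:
  assumes D: "D \<subseteq> carrier A" "\<zero> \<in> D"
    "\<And>x y. \<lbrakk>x \<in> D; y \<in> D\<rbrakk> \<Longrightarrow> x \<oplus> y \<in> D" "\<And>x y. \<lbrakk>x \<in> D; y \<in> D\<rbrakk> \<Longrightarrow> x \<otimes> y \<in> D"
    "\<And>x. x \<in> D \<Longrightarrow> x\<^sup>\<star> \<in> D" "\<And>c x. \<lbrakk>c \<in> R; x \<in> D\<rbrakk> \<Longrightarrow> c \<odot> x \<in> D"
    and R: "\<And>c. \<exists>r::nat \<Rightarrow> complex. (\<forall>n. r n \<in> R) \<and> r \<longlonglongrightarrow> c"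
  shows "cstar_subalgebra A (seq_closure D)"
  unfolding cstar_subalgebra_def
proof (intro conjI ballI allI impI)
  show "seq_closure D \<subseteq> carrier A" by (rule seq_closure_subset)
  show "\<zero> \<in> seq_closure D" using subset_seq_closure[OF D(1)] D(2) by blast
next
  fix x y assume "x \<in> seq_closure D" "y \<in> seq_closure D"
  then obtain \<sigma> \<tau> :: "nat \<Rightarrow> 'a" where
    *: "x \<in> carrier A" "\<And>n. \<sigma> n \<in> D" "(\<lambda>n. \<parallel>\<sigma> n \<ominus> x\<parallel>) \<longlonglongrightarrow> 0"
       "y \<in> carrier A" "\<And>n. \<tau> n \<in> D" "(\<lambda>n. \<parallel>\<tau> n \<ominus> y\<parallel>) \<longlonglongrightarrow> 0"
    unfolding seq_closure_def by blast
  have c: "\<sigma> n \<in> carrier A" "\<tau> n \<in> carrier A" for n using * D(1) by auto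
  show "x \<oplus> y \<in> seq_closure D" unfolding seq_closure_def
    using * D(3) limit_add[OF c(1) *(1) c(2) *(4,3,6)]
    by (auto intro!: exI[of _ "\<lambda>n. \<sigma> n \<oplus> \<tau> n"])
  show "x \<otimes> y \<in> seq_closure D" unfolding seq_closure_def
    using * D(4) limit_mult[OF c(1) *(1) c(2) *(4,3,6)]
    by (auto intro!: exI[of _ "\<lambda>n. \<sigma> n \<otimes> \<tau> n"])
next
  fix c x assume "x \<in> seq_closure D"
  then obtain \<sigma> :: "nat \<Rightarrow> 'a" where
    *: "x \<in> carrier A" "\<And>n. \<sigma> n \<in> D" "(\<lambda>n. \<parallel>\<sigma> n \<ominus> x\<parallel>) \<longlonglongrightarrow> 0"
    unfolding seq_closure_def by blast
  have \<sigma>: "\<sigma> n \<in> carrier A" for n using * D(1) by auto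
  from R[of c] obtain r where r: "\<And>n. r n \<in> R" "r \<longlonglongrightarrow> c" by blast
  have "(\<lambda>n. \<parallel>r n \<odot> \<sigma> n \<ominus> c \<odot> x\<parallel>) \<longlonglongrightarrow> 0"
  proof (rule Lim_null_comparison)
    have "\<parallel>r n \<odot> \<sigma> n \<ominus> c \<odot> x\<parallel> \<le> cmod (r n) * \<parallel>\<sigma> n \<ominus> x\<parallel> + cmod (r n - c) * \<parallel>x\<parallel>" for n
    proof -
      have "\<parallel>r n \<odot> \<sigma> n \<ominus> c \<odot> x\<parallel> \<le> \<parallel>r n \<odot> \<sigma> n \<ominus> r n \<odot> x\<parallel> + \<parallel>r n \<odot> x \<ominus> c \<odot> x\<parallel>"
        using \<sigma> *(1) by (intro nrm_diff_triangle) auto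
      also have "r n \<odot> x \<ominus> c \<odot> x = (r n - c) \<odot> x"
        using *(1) smult_l_distr[of x "r n" "- c"] by (simp add: diff_eq_smult flip: smult_assoc)
      finally show ?thesis using \<sigma> *(1) by (simp add: nrm_smult flip: smult_diff_distr)
    qed
    then show "\<forall>\<^sub>F n in sequentially. norm \<parallel>r n \<odot> \<sigma> n \<ominus> c \<odot> x\<parallel>
        \<le> cmod (r n) * \<parallel>\<sigma> n \<ominus> x\<parallel> + cmod (r n - c) * \<parallel>x\<parallel>"
      using \<sigma> *(1) by (intro always_eventually allI) (simp add: nrm_nonneg)
    have "(\<lambda>n. cmod (r n) * \<parallel>\<sigma> n \<ominus> x\<parallel> + cmod (r n - c) * \<parallel>x\<parallel>) \<longlonglongrightarrow> cmod c * 0 + cmod (c - c) * \<parallel>x\<parallel>"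
      by (intro tendsto_intros r *)
    then show "(\<lambda>n. cmod (r n) * \<parallel>\<sigma> n \<ominus> x\<parallel> + cmod (r n - c) * \<parallel>x\<parallel>) \<longlonglongrightarrow> 0" by simp
  qed
  then show "c \<odot> x \<in> seq_closure D" unfolding seq_closure_def
    using * r(1) D(6) by (auto intro!: exI[of _ "\<lambda>n. r n \<odot> \<sigma> n"])
next
  fix x assume "x \<in> seq_closure D"
  then obtain \<sigma> :: "nat \<Rightarrow> 'a" where
    *: "x \<in> carrier A" "\<And>n. \<sigma> n \<in> D" "(\<lambda>n. \<parallel>\<sigma> n \<ominus> x\<parallel>) \<longlonglongrightarrow> 0"
    unfolding seq_closure_def by blast
  have \<sigma>: "\<sigma> n \<in> carrier A" for n using * D(1) by auto
  show "x\<^sup>\<star> \<in> seq_closure D" unfolding seq_closure_def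
    using * D(5) limit_adj[OF \<sigma> *(1,3)]
    by (auto intro!: exI[of _ "\<lambda>n. (\<sigma> n)\<^sup>\<star>"])
next
  fix \<sigma> :: "nat \<Rightarrow> 'a" and x
  assume x: "x \<in> carrier A" and \<sigma>: "(\<forall>n. \<sigma> n \<in> seq_closure D) \<and> (\<lambda>n. \<parallel>\<sigma> n \<ominus> x\<parallel>) \<longlonglongrightarrow> 0"
  have \<sigma>c: "\<sigma> n \<in> carrier A" for n using \<sigma> seq_closure_subset by blast
  show "x \<in> seq_closure D" unfolding seq_closure_iff[OF D(1) x]
  proof (intro allI impI)
    fix \<epsilon> :: real assume \<epsilon>: "0 < \<epsilon>"
    have "\<forall>\<^sub>F n in sequentially. \<parallel>\<sigma> n \<ominus> x\<parallel> < \<epsilon> / 2" 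
      using \<sigma> order_tendstoD(2)[of "\<lambda>n. \<parallel>\<sigma> n \<ominus> x\<parallel>" 0 sequentially "\<epsilon> / 2"] \<epsilon> by simp
    then obtain n where n: "\<parallel>\<sigma> n \<ominus> x\<parallel> < \<epsilon> / 2" by (auto simp: eventually_sequentially)
    obtain y where y: "y \<in> D" "\<parallel>\<sigma> n \<ominus> y\<parallel> < \<epsilon> / 2"
      using \<sigma> seq_closure_iff[OF D(1) \<sigma>c] \<epsilon> by (meson half_gt_zero)
    have "\<parallel>x \<ominus> y\<parallel> \<le> \<parallel>x \<ominus> \<sigma> n\<parallel> + \<parallel>\<sigma> n \<ominus> y\<parallel>"
      using x \<sigma>c y D(1) by (intro nrm_diff_triangle) auto
    then show "\<exists>y\<in>D. \<parallel>x \<ominus> y\<parallel> < \<epsilon>" using n y nrm_diff_commute[OF x \<sigma>c, of n] by (intro bexI[of _ y]) auto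
  qed
qed

text \<open>Transport of structure: identities and norm inequalities are reflected along the
  injection \<open>g\<close>, and completeness comes from the closedness of \<open>S\<close>.
  Negatives are not among the data; they are recovered as multiples by -1.\<close>

lemma cstar_algebra_pullback:
  fixes C :: "'c cstar" and g :: "'c \<Rightarrow> 'a"
  assumes S: "cstar_subalgebra A S" and g: "bij_betw g (carrier C) S"
    and zero: "\<zero>\<^bsub>C\<^esub> \<in> carrier C" "g \<zero>\<^bsub>C\<^esub> = \<zero>"
    and add: "\<And>x y. \<lbrakk>x \<in> carrier C; y \<in> carrier C\<rbrakk> \<Longrightarrow> x \<oplus>\<^bsub>C\<^esub> y \<in> carrier C \<and> g (x \<oplus>\<^bsub>C\<^esub> y) = g x \<oplus> g y"
    and mult: "\<And>x y. \<lbrakk>x \<in> carrier C; y \<in> carrier C\<rbrakk> \<Longrightarrow> x \<otimes>\<^bsub>C\<^esub> y \<in> carrier C \<and> g (x \<otimes>\<^bsub>C\<^esub> y) = g x \<otimes> g y"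
    and smult: "\<And>c x. x \<in> carrier C \<Longrightarrow> c \<odot>\<^bsub>C\<^esub> x \<in> carrier C \<and> g (c \<odot>\<^bsub>C\<^esub> x) = c \<odot> g x"
    and adj: "\<And>x. x \<in> carrier C \<Longrightarrow> x\<^sup>\<star>\<^bsub>C\<^esub> \<in> carrier C \<and> g (x\<^sup>\<star>\<^bsub>C\<^esub>) = (g x)\<^sup>\<star>"
    and nrm: "\<And>x. x \<in> carrier C \<Longrightarrow> \<parallel>x\<parallel>\<^bsub>C\<^esub> = \<parallel>g x\<parallel>"
  shows "cstar_algebra C"
proof -
  have gc: "g x \<in> carrier A" if "x \<in> carrier C" for x
    using g S that by (auto simp: bij_betw_def cstar_subalgebra_def)
  have eq: "x = y \<longleftrightarrow> g x = g y" if "x \<in> carrier C" "y \<in> carrier C" for x y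
    using g that by (auto simp: bij_betw_def inj_on_def)
  have ag: "abelian_group C"
  proof (rule abelian_groupI)
    fix x assume x: "x \<in> carrier C"
    have "(-1) \<odot>\<^bsub>C\<^esub> x \<oplus>\<^bsub>C\<^esub> x = \<zero>\<^bsub>C\<^esub>"
      using x gc[OF x] smult_l_distr[of "g x" "-1" 1] by (subst eq) (auto simp: add smult zero)
    then show "\<exists>y\<in>carrier C. y \<oplus>\<^bsub>C\<^esub> x = \<zero>\<^bsub>C\<^esub>" using smult x by blast
  qed (use gc in \<open>auto simp: eq zero add a_ac l_zero\<close>)
  interpret C: abelian_group C by (rule ag)
  have minus: "x \<ominus>\<^bsub>C\<^esub> y \<in> carrier C \<and> g (x \<ominus>\<^bsub>C\<^esub> y) = g x \<ominus> g y" if xy: "x \<in> carrier C" "y \<in> carrier C" for x y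
  proof -
    have "\<ominus>\<^bsub>C\<^esub> y = (-1) \<odot>\<^bsub>C\<^esub> y"
      using xy gc smult_l_distr[of "g y" "-1" 1]
      by (intro C.minus_equality) (auto simp: eq add smult zero C.add.m_closed)
    then show ?thesis using xy gc by (simp add: a_minus_def[of C] add smult diff_eq_smult)
  qed
  show ?thesis
  proof (intro cstar_algebra.intro[OF ag] cstar_algebra_axioms.intro)
    fix \<sigma> :: "nat \<Rightarrow> 'c"
    assume \<sigma>: "\<And>n. \<sigma> n \<in> carrier C"
      and "\<And>\<epsilon>. 0 < \<epsilon> \<Longrightarrow> \<exists>N. \<forall>m\<ge>N. \<forall>n\<ge>N. \<parallel>\<sigma> m \<ominus>\<^bsub>C\<^esub> \<sigma> n\<parallel>\<^bsub>C\<^esub> < \<epsilon>"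
    then have "\<And>\<epsilon>. 0 < \<epsilon> \<Longrightarrow> \<exists>N. \<forall>m\<ge>N. \<forall>n\<ge>N. \<parallel>g (\<sigma> m) \<ominus> g (\<sigma> n)\<parallel> < \<epsilon>"
      by (simp add: nrm minus)
    then obtain x where x: "x \<in> carrier A" "(\<lambda>n. \<parallel>g (\<sigma> n) \<ominus> x\<parallel>) \<longlonglongrightarrow> 0"
      using complete[of "\<lambda>n. g (\<sigma> n)"] gc \<sigma> by blast
    have gS: "g (\<sigma> n) \<in> S" for n using g \<sigma> by (auto simp: bij_betw_def)
    have "\<forall>\<sigma>. \<forall>x\<in>carrier A. (\<forall>n::nat. \<sigma> n \<in> S) \<and> (\<lambda>n. \<parallel>\<sigma> n \<ominus> x\<parallel>) \<longlonglongrightarrow> 0 \<longrightarrow> x \<in> S"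
      using S by (simp add: cstar_subalgebra_def)
    from this[rule_format, of x "\<lambda>n. g (\<sigma> n)"] have "x \<in> S" using x gS by simp
    then obtain y where "y \<in> carrier C" "x = g y" using g by (auto simp: bij_betw_def)
    then show "\<exists>x\<in>carrier C. (\<lambda>n. \<parallel>\<sigma> n \<ominus>\<^bsub>C\<^esub> x\<parallel>\<^bsub>C\<^esub>) \<longlonglongrightarrow> 0"
      using x \<sigma> by (intro bexI[of _ y]) (auto simp: nrm minus)
  qed (use gc in \<open>auto simp: eq add mult smult adj nrm zero m_assoc l_distr r_distr smult_l_distr
      smult_r_distr smult_assoc smult_m_l smult_m_r adj_add adj_smult adj_mult nrm_nonneg nrm_eq_0
      nrm_triangle nrm_smult nrm_mult cstar_identity\<close>)
qed

text \<open>Closing \<open>X\<close> under the operations with scalars from Q + iQ adds only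
  countably many elements at each of countably many stages. The remaining complex scalars come back
  in the closure.\<close>

lemma countable_dense_subset:
  assumes X: "countable X" "X \<subseteq> carrier A"
  obtains D where "countable D" "D \<subseteq> carrier A" "X \<subseteq> D" "\<zero> \<in> D" "cstar_subalgebra A (seq_closure D)"
proof -
  define R where "R = {Complex a b | a b. a \<in> \<rat> \<and> b \<in> \<rat>}"
  have R_eq: "R = (\<lambda>(a, b). Complex a b) ` (\<rat> \<times> \<rat>)" by (auto simp: R_def)
  have cR: "countable R" unfolding R_eq using countable_rat by blast
  define step where "step Q = Q \<union> (\<lambda>(x, y). x \<oplus> y) ` (Q \<times> Q) \<union> (\<lambda>(x, y). x \<otimes> y) ` (Q \<times> Q) \<union>
    (\<lambda>x. x\<^sup>\<star>) ` Q \<union> (\<lambda>(c, x). c \<odot> x) ` (R \<times> Q)" for Q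
  define Q where "Q n = (step ^^ n) (insert \<zero> X)" for n
  have QS: "Q (Suc n) = step (Q n)" for n by (simp add: Q_def)
  have Q: "countable (Q n) \<and> Q n \<subseteq> carrier A" for n
  proof (induction n)
    case 0 then show ?case using X by (auto simp: Q_def)
  next
    case (Suc n) then show ?case unfolding QS by (auto simp: step_def cR)
  qed
  have "mono Q" by (rule incseq_SucI) (auto simp: QS step_def)
  define D where "D = (\<Union>n. Q n)"
  have two: "\<exists>n. x \<in> Q n \<and> y \<in> Q n" if "x \<in> D" "y \<in> D" for x y
  proof -
    from that obtain m n where "x \<in> Q m" "y \<in> Q n" by (auto simp: D_def)
    then have "x \<in> Q (max m n)" "y \<in> Q (max m n)"
      using monoD[OF \<open>mono Q\<close>, of m "max m n"] monoD[OF \<open>mono Q\<close>, of n "max m n"] by auto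
    then show ?thesis by blast
  qed
  have S: "step (Q n) \<subseteq> D" for n using QS[of n] unfolding D_def by blast
  have cl: "x \<oplus> y \<in> D" "x \<otimes> y \<in> D" if "x \<in> D" "y \<in> D" for x y
    using two[OF that] S unfolding step_def by blast+
  have cl1: "x\<^sup>\<star> \<in> D" "c \<in> R \<Longrightarrow> c \<odot> x \<in> D" if "x \<in> D" for x c
    using two[OF that that] S unfolding step_def by blast+
  have Dc: "D \<subseteq> carrier A" using Q by (auto simp: D_def)
  have D0: "insert \<zero> X \<subseteq> D" unfolding D_def using UN_upper[of 0 UNIV Q] by (simp add: Q_def)
  have dense: "\<exists>r::nat \<Rightarrow> complex. (\<forall>n. r n \<in> R) \<and> r \<longlonglongrightarrow> c" for c
  proof -
    have rat: "\<exists>a::nat\<Rightarrow>real. (\<forall>n. a n \<in> \<rat>) \<and> a \<longlonglongrightarrow> t" for t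
    proof -
      have "t \<in> closure \<rat>" by (simp add: Rats_closure_real)
      then show ?thesis unfolding closure_sequential by blast
    qed
    obtain a b where "\<forall>n. a n \<in> \<rat>" "a \<longlonglongrightarrow> Re c" "\<forall>n. b n \<in> \<rat>" "b \<longlonglongrightarrow> Im c"
      using rat by meson
    then show ?thesis unfolding R_def
      by (intro exI[of _ "\<lambda>n. Complex (a n) (b n)"]) (use tendsto_Complex in fastforce)
  qed
  have "cstar_subalgebra A (seq_closure D)"
    using Dc D0 cl cl1 dense by (intro cstar_subalgebra_seq_closure[where R = R]) auto
  moreover have "countable D" using Q by (auto simp: D_def)
  ultimately show ?thesis using that Dc D0 by blast
qed

text \<open>
  An element of a separable subalgebra is determined by its distances to a countable dense set,
  so the subalgebra has a copy inside any type of the cardinality of the continuum.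
\<close>

lemma countable_subset_test_cstar:
  assumes X: "countable X" "X \<subseteq> carrier A"
  obtains C :: test_cstar and \<theta> where "cstar_hom C A \<theta>" "inj_on \<theta> (carrier C)" "X \<subseteq> \<theta> ` carrier C"
proof -
  obtain D where D: "countable D" "D \<subseteq> carrier A" "X \<subseteq> D" "\<zero> \<in> D" "cstar_subalgebra A (seq_closure D)"
    using countable_dense_subset[OF X] by blast
  define S where "S = seq_closure D"
  have S: "cstar_subalgebra A S" and DS: "D \<subseteq> S" and Sc: "S \<subseteq> carrier A"
    using D subset_seq_closure seq_closure_subset by (auto simp: S_def)
  define d where "d = from_nat_into D"
  have d: "range d = D" using D by (simp add: d_def) (metis empty_iff range_from_nat_into)
  \<comment> \<open>The sequence of distances to the dense set becomes the constant map with that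
    value, because the elements of the test type are maps between sequence spaces.\<close>
  define enc :: "'a \<Rightarrow> (nat \<Rightarrow> complex) \<Rightarrow> nat \<Rightarrow> complex"
    where "enc x = (\<lambda>_ n. complex_of_real \<parallel>x \<ominus> d n\<parallel>)" for x
  have inj: "inj_on enc S"
  proof (rule inj_onI)
    fix x y assume xy: "x \<in> S" "y \<in> S" "enc x = enc y"
    then have "complex_of_real \<parallel>x \<ominus> d n\<parallel> = complex_of_real \<parallel>y \<ominus> d n\<parallel>" for n
      by (metis enc_def)
    then have eq: "\<parallel>x \<ominus> z\<parallel> = \<parallel>y \<ominus> z\<parallel>" if "z \<in> D" for z using d that by auto
    have xyc: "x \<in> carrier A" "y \<in> carrier A" using xy Sc by auto
    have "\<parallel>x \<ominus> y\<parallel> \<le> \<epsilon>" if \<epsilon>: "\<epsilon> > 0" for \<epsilon>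
    proof -
      obtain z where z: "z \<in> D" "\<parallel>x \<ominus> z\<parallel> < \<epsilon> / 2"
        using xy(1) seq_closure_iff[OF D(2) xyc(1)] \<epsilon> unfolding S_def by (meson half_gt_zero)
      then show ?thesis
        using nrm_diff_triangle[of x z y] nrm_diff_commute[of z y] xyc D(2) eq[OF z(1)] by auto
    qed
    then have "\<parallel>x \<ominus> y\<parallel> \<le> 0" by (metis dense_ge)
    then have "\<parallel>x \<ominus> y\<parallel> = 0" using nrm_nonneg[of "x \<ominus> y"] xyc by simp
    then show "x = y" using xyc by (simp add: nrm_eq_0 diff_eq_zero_iff)
  qed
  define \<theta> where "\<theta> = inv_into S enc"
  define C :: test_cstar where "C = cstar.make (enc ` S) (\<lambda>x y. enc (\<theta> x \<otimes> \<theta> y)) (enc \<zero>) (enc \<zero>)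
      (\<lambda>x y. enc (\<theta> x \<oplus> \<theta> y)) (\<lambda>c x. enc (c \<odot> \<theta> x)) (\<lambda>x. enc ((\<theta> x)\<^sup>\<star>)) (\<lambda>x. \<parallel>\<theta> x\<parallel>)"
  have \<theta>: "bij_betw \<theta> (carrier C) S"
    using inj by (simp add: \<theta>_def C_def cstar.defs bij_betw_inv_into inj_on_imp_bij_betw)
  have \<theta>S: "\<theta> x \<in> S" if "x \<in> carrier C" for x using \<theta> that by (auto simp: bij_betw_def)
  have \<theta>e: "\<theta> (enc x) = x" if "x \<in> S" for x using inj that by (simp add: \<theta>_def)
  have Scl: "x \<oplus> y \<in> S" "x \<otimes> y \<in> S" "c \<odot> x \<in> S" "x\<^sup>\<star> \<in> S" if "x \<in> S" "y \<in> S" for x y c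
    using S that unfolding cstar_subalgebra_def by auto
  have S0: "\<zero> \<in> S" using S by (simp add: cstar_subalgebra_def)
  have ops: "\<And>x y. \<lbrakk>x \<in> carrier C; y \<in> carrier C\<rbrakk> \<Longrightarrow> x \<oplus>\<^bsub>C\<^esub> y \<in> carrier C \<and> \<theta> (x \<oplus>\<^bsub>C\<^esub> y) = \<theta> x \<oplus> \<theta> y"
    "\<And>x y. \<lbrakk>x \<in> carrier C; y \<in> carrier C\<rbrakk> \<Longrightarrow> x \<otimes>\<^bsub>C\<^esub> y \<in> carrier C \<and> \<theta> (x \<otimes>\<^bsub>C\<^esub> y) = \<theta> x \<otimes> \<theta> y"
    "\<And>c x. x \<in> carrier C \<Longrightarrow> c \<odot>\<^bsub>C\<^esub> x \<in> carrier C \<and> \<theta> (c \<odot>\<^bsub>C\<^esub> x) = c \<odot> \<theta> x"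
    "\<And>x. x \<in> carrier C \<Longrightarrow> x\<^sup>\<star>\<^bsub>C\<^esub> \<in> carrier C \<and> \<theta> (x\<^sup>\<star>\<^bsub>C\<^esub>) = (\<theta> x)\<^sup>\<star>"
    "\<And>x. x \<in> carrier C \<Longrightarrow> \<parallel>x\<parallel>\<^bsub>C\<^esub> = \<parallel>\<theta> x\<parallel>"
    "\<zero>\<^bsub>C\<^esub> \<in> carrier C" "\<theta> \<zero>\<^bsub>C\<^esub> = \<zero>"
    using \<theta>S Scl S0 by (simp_all add: C_def cstar.defs \<theta>e)
  have cC: "cstar_algebra C" by (rule cstar_algebra_pullback[OF S \<theta>]) (use ops in auto)
  have hom: "\<theta> \<in> star_hom C A" unfolding star_hom_def using ops \<theta>S Sc by auto
  show ?thesis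
  proof
    show "cstar_hom C A \<theta>" using cC hom cstar_algebra_axioms
      by (simp add: cstar_hom_def cstar_hom_axioms_def)
    show "inj_on \<theta> (carrier C)" using \<theta> by (simp add: bij_betw_def)
    show "X \<subseteq> \<theta> ` carrier C" using \<theta> D(3) DS by (auto simp: bij_betw_def)
  qed
qed

end

context cstar_hom
begin

lemma image_subalgebra_if_isometric:
  assumes iso: "\<And>x. x \<in> carrier B \<Longrightarrow> \<parallel>\<phi> x\<parallel>\<^bsub>A\<^esub> = \<parallel>x\<parallel>"
  shows "cstar_subalgebra A (\<phi> ` carrier B)"
  unfolding cstar_subalgebra_def
proof (intro conjI ballI allI impI)
  fix \<sigma> :: "nat \<Rightarrow> 'a" and x
  assume x: "x \<in> carrier A" and \<sigma>: "(\<forall>n. \<sigma> n \<in> \<phi> ` carrier B) \<and> (\<lambda>n. \<parallel>\<sigma> n \<ominus>\<^bsub>A\<^esub> x\<parallel>\<^bsub>A\<^esub>) \<longlonglongrightarrow> 0"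
  from \<sigma> have "\<forall>n. \<exists>y. y \<in> carrier B \<and> \<sigma> n = \<phi> y" by blast
  then obtain \<tau> where \<tau>: "\<And>n. \<tau> n \<in> carrier B" "\<And>n. \<sigma> n = \<phi> (\<tau> n)" by metis
  have "\<exists>N. \<forall>m\<ge>N. \<forall>n\<ge>N. \<parallel>\<tau> m \<ominus> \<tau> n\<parallel> < \<epsilon>" if \<epsilon>: "0 < \<epsilon>" for \<epsilon>
  proof -
    have "\<forall>\<^sub>F n in sequentially. \<parallel>\<sigma> n \<ominus>\<^bsub>A\<^esub> x\<parallel>\<^bsub>A\<^esub> < \<epsilon> / 2"
      using \<sigma> order_tendstoD(2)[of "\<lambda>n. \<parallel>\<sigma> n \<ominus>\<^bsub>A\<^esub> x\<parallel>\<^bsub>A\<^esub>" 0 sequentially "\<epsilon> / 2"] \<epsilon> by simp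
    then obtain N where N: "\<And>n. n \<ge> N \<Longrightarrow> \<parallel>\<sigma> n \<ominus>\<^bsub>A\<^esub> x\<parallel>\<^bsub>A\<^esub> < \<epsilon> / 2"
      by (auto simp: eventually_sequentially)
    show ?thesis
    proof (intro exI[of _ N] allI impI)
      fix m n assume "N \<le> m" "N \<le> n"
      have "\<parallel>\<tau> m \<ominus> \<tau> n\<parallel> = \<parallel>\<sigma> m \<ominus>\<^bsub>A\<^esub> \<sigma> n\<parallel>\<^bsub>A\<^esub>" using \<tau> iso by (simp flip: iso add: diff)
      also have "\<dots> \<le> \<parallel>\<sigma> m \<ominus>\<^bsub>A\<^esub> x\<parallel>\<^bsub>A\<^esub> + \<parallel>x \<ominus>\<^bsub>A\<^esub> \<sigma> n\<parallel>\<^bsub>A\<^esub>"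
        using x \<tau> by (intro A.nrm_diff_triangle) auto
      also have "\<dots> < \<epsilon>"
        using N[OF \<open>N \<le> m\<close>] N[OF \<open>N \<le> n\<close>] A.nrm_diff_commute[OF x, of "\<sigma> n"] \<tau> by simp
      finally show "\<parallel>\<tau> m \<ominus> \<tau> n\<parallel> < \<epsilon>" .
    qed
  qed
  then obtain y where y: "y \<in> carrier B" "(\<lambda>n. \<parallel>\<tau> n \<ominus> y\<parallel>) \<longlonglongrightarrow> 0"
    using B.complete[of \<tau>] \<tau> by blast
  have "\<parallel>\<tau> n \<ominus> y\<parallel> = \<parallel>\<sigma> n \<ominus>\<^bsub>A\<^esub> \<phi> y\<parallel>\<^bsub>A\<^esub>" for n using \<tau> y iso by (simp flip: iso add: diff)
  then have "x = \<phi> y" using A.limit_unique[of \<sigma> x "\<phi> y"] x \<sigma> \<tau> y by simp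
  then show "x \<in> \<phi> ` carrier B" using y by blast
next
  show "\<zero>\<^bsub>A\<^esub> \<in> \<phi> ` carrier B" using zero by (metis B.zero_closed imageI)
qed (auto simp flip: add mult smult adj)

end

section \<open>Universal properties against arbitrary C*-algebras\<close>

lemma cstar_hom_compose:
  assumes "cstar_hom B C \<psi>" "cstar_hom C A \<theta>"
  shows "cstar_hom B A (\<theta> \<circ> \<psi>)"
proof -
  interpret p: cstar_hom B C \<psi> by fact
  interpret t: cstar_hom C A \<theta> by fact
  show ?thesis
    by unfold_locales
      (auto simp: star_hom_def p.add p.mult p.smult p.adj t.add t.mult t.smult t.adj)
qed

lemma ck_familyD:
  assumes "ck_family E A P T"
  shows "\<forall>v\<in>verts E. projection A (P v)" "\<forall>a\<in>arcs E. partial_isometry A (T a)"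
    "\<forall>v\<in>verts E. \<forall>w\<in>verts E. v \<noteq> w \<longrightarrow> P v \<otimes>\<^bsub>A\<^esub> P w = \<zero>\<^bsub>A\<^esub>"
    "\<forall>a\<in>arcs E. (T a)\<^sup>\<star>\<^bsub>A\<^esub> \<otimes>\<^bsub>A\<^esub> T a = P (tail E a)"
    "\<forall>v\<in>verts E. P v = (\<Oplus>\<^bsub>A\<^esub>a\<in>{a \<in> arcs E. head E a = v}. T a \<otimes>\<^bsub>A\<^esub> (T a)\<^sup>\<star>\<^bsub>A\<^esub>)"
proof -
  note * = assms[unfolded ck_family_def]
  show "\<forall>v\<in>verts E. projection A (P v)" by (rule *[THEN conjunct1])
  show "\<forall>v\<in>verts E. \<forall>w\<in>verts E. v \<noteq> w \<longrightarrow> P v \<otimes>\<^bsub>A\<^esub> P w = \<zero>\<^bsub>A\<^esub>"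
    by (rule *[THEN conjunct2, THEN conjunct1])
  show "\<forall>a\<in>arcs E. partial_isometry A (T a)" by (rule *[THEN conjunct2, THEN conjunct2, THEN conjunct1])
  show "\<forall>a\<in>arcs E. (T a)\<^sup>\<star>\<^bsub>A\<^esub> \<otimes>\<^bsub>A\<^esub> T a = P (tail E a)"
    by (rule *[THEN conjunct2, THEN conjunct2, THEN conjunct2, THEN conjunct1])
  show "\<forall>v\<in>verts E. P v = (\<Oplus>\<^bsub>A\<^esub>a\<in>{a \<in> arcs E. head E a = v}. T a \<otimes>\<^bsub>A\<^esub> (T a)\<^sup>\<star>\<^bsub>A\<^esub>)"
    by (rule *[THEN conjunct2, THEN conjunct2, THEN conjunct2, THEN conjunct2])
qed

lemma graph_of_groups_closed:
  assumes \<G>: "graph_of_groups \<G>"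
  shows "x \<in> verts (gr \<G>) \<Longrightarrow> \<one>\<^bsub>vgrp \<G> x\<^esub> \<in> carrier (vgrp \<G> x)"
    "\<lbrakk>x \<in> verts (gr \<G>); g \<in> carrier (vgrp \<G> x); h \<in> carrier (vgrp \<G> x)\<rbrakk> \<Longrightarrow>
      g \<otimes>\<^bsub>vgrp \<G> x\<^esub> h \<in> carrier (vgrp \<G> x)"
    "\<lbrakk>e \<in> arcs (gr \<G>); k \<in> carrier (egrp \<G> e)\<rbrakk> \<Longrightarrow> emb \<G> e k \<in> carrier (vgrp \<G> (rng \<G> e))"
    "\<lbrakk>e \<in> arcs (gr \<G>); k \<in> carrier (egrp \<G> e)\<rbrakk> \<Longrightarrow> emb \<G> (bar \<G> e) k \<in> carrier (vgrp \<G> (src \<G> e))"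
proof -
  interpret bidirected_digraph "gr \<G>" "bar \<G>" using \<G> by (simp add: graph_of_groups_def)
  show "x \<in> verts (gr \<G>) \<Longrightarrow> \<one>\<^bsub>vgrp \<G> x\<^esub> \<in> carrier (vgrp \<G> x)"
    "\<lbrakk>x \<in> verts (gr \<G>); g \<in> carrier (vgrp \<G> x); h \<in> carrier (vgrp \<G> x)\<rbrakk> \<Longrightarrow>
      g \<otimes>\<^bsub>vgrp \<G> x\<^esub> h \<in> carrier (vgrp \<G> x)"
    using \<G> by (auto simp: graph_of_groups_def group.is_monoid monoid.m_closed)
  have emb: "emb \<G> e k \<in> carrier (vgrp \<G> (rng \<G> e))"
    if "e \<in> arcs (gr \<G>)" "k \<in> carrier (egrp \<G> e)" for e k
    using \<G> that by (auto simp: graph_of_groups_def mon_def hom_def Pi_iff)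
  then show "\<lbrakk>e \<in> arcs (gr \<G>); k \<in> carrier (egrp \<G> e)\<rbrakk> \<Longrightarrow> emb \<G> e k \<in> carrier (vgrp \<G> (rng \<G> e))" .
  assume e: "e \<in> arcs (gr \<G>)" and k: "k \<in> carrier (egrp \<G> e)"
  have "egrp \<G> (bar \<G> e) = egrp \<G> e" using \<G> e by (auto simp: graph_of_groups_def)
  then show "emb \<G> (bar \<G> e) k \<in> carrier (vgrp \<G> (src \<G> e))" using emb[of "bar \<G> e" k] e k by simp
qed

context cstar_hom
begin

text \<open>All relations are equations between elements built from the family by the algebra
  operations, so an injective homomorphism reflects them. This moves a family in \<open>A\<close>
  into a copy, inside the test type, of a subalgebra of \<open>A\<close>.\<close>

lemma ck_family_reflect:
  assumes inj: "inj_on \<phi> (carrier B)" and wf: "wf_digraph E"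
    and P: "\<And>v. v \<in> verts E \<Longrightarrow> P v \<in> carrier B" and T: "\<And>a. a \<in> arcs E \<Longrightarrow> T a \<in> carrier B"
    and ck: "ck_family E A (\<phi> \<circ> P) (\<phi> \<circ> T)"
  shows "ck_family E B P T"
proof -
  interpret wf_digraph E by (rule wf)
  have eq: "x = y \<longleftrightarrow> \<phi> x = \<phi> y" if "x \<in> carrier B" "y \<in> carrier B" for x y
    using inj that by (auto simp: inj_on_def)
  have sum: "\<phi> (finsum B (\<lambda>a. T a \<otimes> (T a)\<^sup>\<star>) {a \<in> arcs E. head E a = v}) =
      finsum A (\<lambda>a. (\<phi> \<circ> T) a \<otimes>\<^bsub>A\<^esub> ((\<phi> \<circ> T) a)\<^sup>\<star>\<^bsub>A\<^esub>) {a \<in> arcs E. head E a = v}" for v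
    using T by (subst finsum) (auto intro!: A.finsum_cong' simp: mult adj)
  have "finsum B (\<lambda>a. T a \<otimes> (T a)\<^sup>\<star>) {a \<in> arcs E. head E a = v} \<in> carrier B" for v
    using T by (intro B.finsum_closed) auto
  then have "P v = finsum B (\<lambda>a. T a \<otimes> (T a)\<^sup>\<star>) {a \<in> arcs E. head E a = v}" if "v \<in> verts E" for v
    using ck that P by (subst eq) (auto simp: ck_family_def sum)
  moreover have "\<forall>v\<in>verts E. projection B (P v)" "\<forall>a\<in>arcs E. partial_isometry B (T a)"
    "\<forall>v\<in>verts E. \<forall>w\<in>verts E. v \<noteq> w \<longrightarrow> P v \<otimes> P w = \<zero>" "\<forall>a\<in>arcs E. (T a)\<^sup>\<star> \<otimes> T a = P (tail E a)"
  proof -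
    have "\<forall>v\<in>verts E. projection A (\<phi> (P v))" "\<forall>a\<in>arcs E. partial_isometry A (\<phi> (T a))"
      "\<forall>v\<in>verts E. \<forall>w\<in>verts E. v \<noteq> w \<longrightarrow> \<phi> (P v) \<otimes>\<^bsub>A\<^esub> \<phi> (P w) = \<zero>\<^bsub>A\<^esub>"
      "\<forall>a\<in>arcs E. (\<phi> (T a))\<^sup>\<star>\<^bsub>A\<^esub> \<otimes>\<^bsub>A\<^esub> \<phi> (T a) = \<phi> (P (tail E a))"
      using ck_familyD(1-4)[OF ck] unfolding o_apply .
    then show "\<forall>v\<in>verts E. projection B (P v)" "\<forall>a\<in>arcs E. partial_isometry B (T a)"
      "\<forall>v\<in>verts E. \<forall>w\<in>verts E. v \<noteq> w \<longrightarrow> P v \<otimes> P w = \<zero>" "\<forall>a\<in>arcs E. (T a)\<^sup>\<star> \<otimes> T a = P (tail E a)"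
      using P T unfolding projection_def partial_isometry_def by (simp_all add: eq mult adj)
  qed
  ultimately show ?thesis unfolding ck_family_def by blast
qed

lemma g_family_reflect:
  assumes inj: "inj_on \<phi> (carrier B)" and \<G>: "graph_of_groups \<G>" and \<Sigma>: "transversals \<G> \<Sigma>"
    and U: "\<And>x g. \<lbrakk>x \<in> verts (gr \<G>); g \<in> carrier (vgrp \<G> x)\<rbrakk> \<Longrightarrow> U x g \<in> carrier B"
    and S: "\<And>e. e \<in> arcs (gr \<G>) \<Longrightarrow> S e \<in> carrier B"
    and fam: "g_family \<G> \<Sigma> A (\<lambda>x g. \<phi> (U x g)) (\<lambda>e. \<phi> (S e))"
  shows "g_family \<G> \<Sigma> B U S"
proof -
  interpret bidirected_digraph "gr \<G>" "bar \<G>" using \<G> by (simp add: graph_of_groups_def)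
  have eq: "x = y \<longleftrightarrow> \<phi> x = \<phi> y" if "x \<in> carrier B" "y \<in> carrier B" for x y
    using inj that by (auto simp: inj_on_def)
  note gog = graph_of_groups_closed[OF \<G>]
  have Sig: "h \<in> carrier (vgrp \<G> (rng \<G> f))" if "f \<in> arcs (gr \<G>)" "h \<in> \<Sigma> f" for f h
    using \<Sigma> that by (auto simp: transversals_def)
  have sum: "\<phi> (finsum B (\<lambda>(h, f). U (src \<G> e) h \<otimes> S f \<otimes> (S f)\<^sup>\<star> \<otimes> (U (src \<G> e) h)\<^sup>\<star>) I) =
      finsum A (\<lambda>(h, f). \<phi> (U (src \<G> e) h) \<otimes>\<^bsub>A\<^esub> \<phi> (S f) \<otimes>\<^bsub>A\<^esub> (\<phi> (S f))\<^sup>\<star>\<^bsub>A\<^esub> \<otimes>\<^bsub>A\<^esub> (\<phi> (U (src \<G> e) h))\<^sup>\<star>\<^bsub>A\<^esub>) I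
     \<and> finsum B (\<lambda>(h, f). U (src \<G> e) h \<otimes> S f \<otimes> (S f)\<^sup>\<star> \<otimes> (U (src \<G> e) h)\<^sup>\<star>) I \<in> carrier B"
    if e: "e \<in> arcs (gr \<G>)"
    and I: "I = {(h, f). f \<in> arcs (gr \<G>) \<and> rng \<G> f = src \<G> e \<and> h \<in> \<Sigma> f \<and>
             (h, f) \<noteq> (\<one>\<^bsub>vgrp \<G> (src \<G> e)\<^esub>, bar \<G> e)}" for e I
  proof -
    have *: "U (src \<G> e) h \<in> carrier B \<and> S f \<in> carrier B" if "(h, f) \<in> I" for h f
      using that Sig e U S unfolding I by fastforce
    then have "(\<lambda>(h, f). U (src \<G> e) h \<otimes> S f \<otimes> (S f)\<^sup>\<star> \<otimes> (U (src \<G> e) h)\<^sup>\<star>) \<in> I \<rightarrow> carrier B" by auto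
    from finsum[OF this] B.finsum_closed[OF this] show ?thesis
      using * by (auto intro!: A.finsum_cong' simp: mult adj)
  qed
  show ?thesis using fam unfolding g_family_def projection_def partial_isometry_def corner_unitary_def
    by (intro conjI ballI) (use U S gog sum in \<open>auto simp: eq mult adj add\<close>)
qed

end

text \<open>\<open>is_graph_algebra\<close> promises homomorphisms into the test type only. The
  countably many members of the family lie in the image of an injective homomorphism
  \<open>\<theta>\<close> from a C*-algebra of that type. The family is pulled back along
  \<open>\<theta>\<close>, and the map obtained there is followed by
  \<open>\<theta>\<close>.\<close>

lemma graph_algebra_universal:
  fixes A :: "'a cstar"
  assumes B: "is_graph_algebra E B p t" and wf: "wf_digraph E"
    and count: "countable (verts E)" "countable (arcs E)"
    and A: "cstar_algebra A" and ck: "ck_family E A P T"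
  shows "\<exists>\<psi>\<in>star_hom B A. (\<forall>v\<in>verts E. \<psi> (p v) = P v) \<and> (\<forall>a\<in>arcs E. \<psi> (t a) = T a)"
proof -
  interpret A: cstar_algebra A by (rule A)
  have car: "P ` verts E \<union> T ` arcs E \<subseteq> carrier A"
    using ck by (auto simp: ck_family_def projection_def partial_isometry_def)
  obtain C :: test_cstar and \<theta> where \<theta>: "cstar_hom C A \<theta>" "inj_on \<theta> (carrier C)"
      "P ` verts E \<union> T ` arcs E \<subseteq> \<theta> ` carrier C"
    using A.countable_subset_test_cstar[OF _ car] count by auto
  interpret \<theta>: cstar_hom C A \<theta> by (rule \<theta>)
  define P' T' where "P' = inv_into (carrier C) \<theta> \<circ> P" and "T' = inv_into (carrier C) \<theta> \<circ> T"
  have P': "P' v \<in> carrier C" "\<theta> (P' v) = P v" if "v \<in> verts E" for v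
    using \<theta>(3) that by (auto simp: P'_def inv_into_into f_inv_into_f image_subset_iff)
  have T': "T' a \<in> carrier C" "\<theta> (T' a) = T a" if "a \<in> arcs E" for a
    using \<theta>(3) that by (auto simp: T'_def inv_into_into f_inv_into_f image_subset_iff)
  interpret wf_digraph E by (rule wf)
  have "ck_family E A (\<theta> \<circ> P') (\<theta> \<circ> T')"
  proof -
    have "finsum A (\<lambda>a. (\<theta> \<circ> T') a \<otimes>\<^bsub>A\<^esub> ((\<theta> \<circ> T') a)\<^sup>\<star>\<^bsub>A\<^esub>) {a \<in> arcs E. head E a = v} =
        finsum A (\<lambda>a. T a \<otimes>\<^bsub>A\<^esub> (T a)\<^sup>\<star>\<^bsub>A\<^esub>) {a \<in> arcs E. head E a = v}" for v
      using car by (intro A.finsum_cong') (auto simp: T')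
    moreover have "(\<theta> \<circ> P') v = P v" if "v \<in> verts E" for v using P' that by simp
    moreover have "(\<theta> \<circ> T') a = T a" if "a \<in> arcs E" for a using T' that by simp
    ultimately show ?thesis using ck head_in_verts tail_in_verts unfolding ck_family_def
      by (intro conjI ballI impI) (metis (no_types, lifting))+
  qed
  then have "ck_family E C P' T'"
    using \<theta>.ck_family_reflect[OF \<theta>(2) wf] P' T' by blast
  then obtain \<psi> where \<psi>: "\<psi> \<in> star_hom B C" "\<forall>v\<in>verts E. \<psi> (p v) = P' v" "\<forall>a\<in>arcs E. \<psi> (t a) = T' a"
    using B \<theta>.B.cstar_algebra_axioms unfolding is_graph_algebra_def by blast
  have "cstar_hom B C \<psi>"
    using \<psi>(1) B \<theta>.B.cstar_algebra_axioms
    by (simp add: cstar_hom_def cstar_hom_axioms_def is_graph_algebra_def)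
  then interpret c: cstar_hom B A "\<theta> \<circ> \<psi>" using cstar_hom_compose \<theta>(1) by blast
  show ?thesis using c.hom \<psi>(2,3) P' T' by (intro bexI[of _ "\<theta> \<circ> \<psi>"]) auto
qed


text \<open>Countability of the vertex groups enters here: it makes the set of all
  \<open>U x g\<close> and \<open>S e\<close> countable, so that the family lies in a separable
  subalgebra with a copy in the test type.\<close>

lemma gog_algebra_universal:
  fixes A :: "'a cstar"
  assumes B: "is_gog_algebra \<G> \<Sigma> B u s" and \<G>: "graph_of_groups \<G>" and count: "countable_groups \<G>"
    and \<Sigma>: "transversals \<G> \<Sigma>" and A: "cstar_algebra A" and fam: "g_family \<G> \<Sigma> A U S"
  shows "\<exists>\<psi>\<in>star_hom B A. (\<forall>x\<in>verts (gr \<G>). \<forall>g\<in>carrier (vgrp \<G> x). \<psi> (u x g) = U x g) \<and>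
    (\<forall>e\<in>arcs (gr \<G>). \<psi> (s e) = S e)"
proof -
  interpret A: cstar_algebra A by (rule A)
  interpret bidirected_digraph "gr \<G>" "bar \<G>" using \<G> by (simp add: graph_of_groups_def)
  let ?X = "(\<Union>x\<in>verts (gr \<G>). U x ` carrier (vgrp \<G> x)) \<union> S ` arcs (gr \<G>)"
  have car: "?X \<subseteq> carrier A"
    using fam by (auto simp: g_family_def partial_isometry_def corner_unitary_def)
  have cX: "countable ?X" using \<G> count
    by (auto simp: graph_of_groups_def countable_groups_def)
  obtain C :: test_cstar and \<theta> where \<theta>: "cstar_hom C A \<theta>" "inj_on \<theta> (carrier C)"
      "?X \<subseteq> \<theta> ` carrier C"
    using A.countable_subset_test_cstar[OF cX car] by blast
  interpret \<theta>: cstar_hom C A \<theta> by (rule \<theta>)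
  define U' S' where "U' = (\<lambda>x g. inv_into (carrier C) \<theta> (U x g))" and "S' = inv_into (carrier C) \<theta> \<circ> S"
  have U': "U' x g \<in> carrier C" "\<theta> (U' x g) = U x g" if "x \<in> verts (gr \<G>)" "g \<in> carrier (vgrp \<G> x)" for x g
  proof -
    have "U x g \<in> \<theta> ` carrier C" using \<theta>(3) that by blast
    then show "U' x g \<in> carrier C" "\<theta> (U' x g) = U x g" by (simp_all add: U'_def inv_into_into f_inv_into_f)
  qed
  have S': "S' e \<in> carrier C" "\<theta> (S' e) = S e" if "e \<in> arcs (gr \<G>)" for e
  proof -
    have "S e \<in> \<theta> ` carrier C" using \<theta>(3) that by blast
    then show "S' e \<in> carrier C" "\<theta> (S' e) = S e" by (simp_all add: S'_def inv_into_into f_inv_into_f)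
  qed
  note gog = graph_of_groups_closed[OF \<G>]
  have Sig: "h \<in> carrier (vgrp \<G> (rng \<G> f))" if "f \<in> arcs (gr \<G>)" "h \<in> \<Sigma> f" for f h
    using \<Sigma> that by (auto simp: transversals_def)
  have "g_family \<G> \<Sigma> A (\<lambda>x g. \<theta> (U' x g)) (\<lambda>e. \<theta> (S' e))"
  proof -
    have "finsum A (\<lambda>(h, f). \<theta> (U' (src \<G> e) h) \<otimes>\<^bsub>A\<^esub> \<theta> (S' f) \<otimes>\<^bsub>A\<^esub> (\<theta> (S' f))\<^sup>\<star>\<^bsub>A\<^esub> \<otimes>\<^bsub>A\<^esub> (\<theta> (U' (src \<G> e) h))\<^sup>\<star>\<^bsub>A\<^esub>) I
      = finsum A (\<lambda>(h, f). U (src \<G> e) h \<otimes>\<^bsub>A\<^esub> S f \<otimes>\<^bsub>A\<^esub> (S f)\<^sup>\<star>\<^bsub>A\<^esub> \<otimes>\<^bsub>A\<^esub> (U (src \<G> e) h)\<^sup>\<star>\<^bsub>A\<^esub>) I"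
      if e: "e \<in> arcs (gr \<G>)"
        and I: "I = {(h, f). f \<in> arcs (gr \<G>) \<and> rng \<G> f = src \<G> e \<and> h \<in> \<Sigma> f \<and>
             (h, f) \<noteq> (\<one>\<^bsub>vgrp \<G> (src \<G> e)\<^esub>, bar \<G> e)}" for e I
    proof -
      have *: "\<theta> (U' (src \<G> e) h) = U (src \<G> e) h \<and> \<theta> (S' f) = S f
          \<and> U (src \<G> e) h \<in> carrier A \<and> S f \<in> carrier A" if "(h, f) \<in> I" for h f
      proof -
        have fh: "f \<in> arcs (gr \<G>)" "h \<in> carrier (vgrp \<G> (src \<G> e))" using that Sig[of f h] unfolding I by auto
        from U'[OF tail_in_verts[OF e] fh(2)] S'[OF fh(1)] show ?thesis by (metis \<theta>.closed)
      qed
      show ?thesis by (rule A.finsum_cong') (use * in auto)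
    qed
    then show ?thesis using fam unfolding g_family_def
      by (simp add: U' S' gog)
  qed
  then have "g_family \<G> \<Sigma> C U' S'"
    using \<theta>.g_family_reflect[OF \<theta>(2) \<G> \<Sigma>] U' S' by blast
  then obtain \<psi> where \<psi>: "\<psi> \<in> star_hom B C"
      "\<forall>x\<in>verts (gr \<G>). \<forall>g\<in>carrier (vgrp \<G> x). \<psi> (u x g) = U' x g" "\<forall>e\<in>arcs (gr \<G>). \<psi> (s e) = S' e"
    using B \<theta>.B.cstar_algebra_axioms unfolding is_gog_algebra_def by blast
  have "cstar_hom B C \<psi>"
    using \<psi>(1) B \<theta>.B.cstar_algebra_axioms
    by (simp add: cstar_hom_def cstar_hom_axioms_def is_gog_algebra_def)
  then interpret c: cstar_hom B A "\<theta> \<circ> \<psi>" using cstar_hom_compose \<theta>(1) by blast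
  show ?thesis using c.hom \<psi>(2,3) U' S' by (intro bexI[of _ "\<theta> \<circ> \<psi>"]) auto
qed

section \<open>Sums of projections\<close>

context cstar_algebra
begin

lemma finsum_mult_right:
  "\<lbrakk>f \<in> I \<rightarrow> carrier A; x \<in> carrier A\<rbrakk> \<Longrightarrow> finsum A f I \<otimes> x = finsum A (\<lambda>i. f i \<otimes> x) I"
proof (induction I rule: infinite_finite_induct)
  case (insert i I)
  then have "f i \<in> carrier A" "f \<in> I \<rightarrow> carrier A" by auto
  with insert show ?case by (simp add: finsum_insert l_distr finsum_closed Pi_iff)
qed (simp_all add: finsum_infinite)

lemma finsum_mult_left:
  "\<lbrakk>f \<in> I \<rightarrow> carrier A; x \<in> carrier A\<rbrakk> \<Longrightarrow> x \<otimes> finsum A f I = finsum A (\<lambda>i. x \<otimes> f i) I"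
proof (induction I rule: infinite_finite_induct)
  case (insert i I)
  then have "f i \<in> carrier A" "f \<in> I \<rightarrow> carrier A" by auto
  with insert show ?case by (simp add: finsum_insert r_distr finsum_closed Pi_iff)
qed (simp_all add: finsum_infinite)

lemma finsum_smult_left:
  "x \<in> carrier A \<Longrightarrow> finsum A (\<lambda>i. c i \<odot> x) I = (\<Sum>i\<in>I. c i) \<odot> x"
proof (induction I rule: infinite_finite_induct)
  case (insert i I)
  then show ?case by (simp add: finsum_insert smult_l_distr)
qed (simp_all add: finsum_infinite)

lemma nrm_finsum_le:
  "f \<in> I \<rightarrow> carrier A \<Longrightarrow> \<parallel>finsum A f I\<parallel> \<le> (\<Sum>i\<in>I. \<parallel>f i\<parallel>)"
proof (induction I rule: infinite_finite_induct)
  case (insert i I)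
  then have *: "f i \<in> carrier A" "f \<in> I \<rightarrow> carrier A" by auto
  then have "\<parallel>finsum A f (insert i I)\<parallel> \<le> \<parallel>f i\<parallel> + \<parallel>finsum A f I\<parallel>"
    using insert by (simp add: finsum_insert nrm_triangle finsum_closed)
  then show ?case using insert * by simp
qed (simp_all add: finsum_infinite)

lemma finsum_single:
  assumes "finite I" "i \<in> I" "f \<in> I \<rightarrow> carrier A" "\<And>j. \<lbrakk>j \<in> I; j \<noteq> i\<rbrakk> \<Longrightarrow> f j = \<zero>"
  shows "finsum A f I = f i"
proof -
  have "finsum A f I = finsum A (\<lambda>j. if i = j then f j else \<zero>) I"
    using assms by (intro finsum_cong') auto
  also have "\<dots> = f i" using assms by (intro finsum_singleton) auto
  finally show ?thesis .
qed

text \<open>The element is a unit-free form of e(1 - q)e. With y = e - qe, standing for (1 - q)e, it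
  equals both ey and \<open>y\<^sup>\<star> \<otimes> y\<close>, and the C*-identity forces the norm
  of y to be at most 1.\<close>

lemma nrm_compression_le:
  assumes e: "projection A e" and q: "projection A q"
  shows "\<parallel>e \<ominus> e \<otimes> (q \<otimes> e)\<parallel> \<le> 1"
proof -
  have c: "e \<in> carrier A" "q \<in> carrier A" "e \<otimes> e = e" "q \<otimes> q = q" "e\<^sup>\<star> = e" "q\<^sup>\<star> = q"
    using e q by (auto simp: projection_def)
  have e1: "\<parallel>e\<parallel> \<le> 1" by (rule nrm_projection_le_1[OF e])
  define y where "y = e \<ominus> q \<otimes> e"
  have y: "y \<in> carrier A" using c by (simp add: y_def)
  have ey: "e \<otimes> y = e \<ominus> e \<otimes> (q \<otimes> e)" using c by (simp add: y_def mult_diff_distr_r)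
  have "y\<^sup>\<star> \<otimes> y = e \<otimes> y"
  proof -
    have "e \<otimes> q \<otimes> (q \<otimes> e) = e \<otimes> (q \<otimes> e)" using c by (metis m_assoc m_closed)
    then show ?thesis unfolding ey using c
      by (simp add: y_def adj_diff adj_mult mult_diff_distr_l mult_diff_distr_r m_assoc)
        (simp add: diff_eq_smult r_zero)
  qed
  then have "\<parallel>y\<parallel>\<^sup>2 \<le> \<parallel>e\<parallel> * \<parallel>y\<parallel>" using cstar_identity[OF y] nrm_mult[of e y] c y by simp
  also have "\<dots> \<le> 1 * \<parallel>y\<parallel>" using e1 y by (intro mult_right_mono nrm_nonneg)
  finally have "\<parallel>y\<parallel> \<le> 1" using nrm_nonneg[OF y]
    by (cases "\<parallel>y\<parallel> = 0") (auto simp: power2_eq_square)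
  then have "\<parallel>e\<parallel> * \<parallel>y\<parallel> \<le> 1" using e1 nrm_nonneg c y by (simp add: mult_le_one)
  then show ?thesis using nrm_mult[of e y] c y unfolding ey by linarith
qed

text \<open>Compress the sum by e = P i: it becomes e + h + eRe with h = e (P j) e and R the rest,
  and its norm is at most 1. If eRe were known to be positive, h would have to vanish. Norm
  estimates replace this: after division by a suitable N, both e + h and e - h turn into elements of
  norm at most 1, and \<open>sandwiched_eq_zero\<close> applies.\<close>

lemma projections_orthogonal:
  assumes fin: "finite I" and P: "\<And>i. i \<in> I \<Longrightarrow> projection A (P i)" and sum: "projection A (finsum A P I)"
    and ij: "i \<in> I" "j \<in> I" "i \<noteq> j"
  shows "P i \<otimes> P j = \<zero>"
proof -
  define e G h where "e = P i" and "G = I - {i, j}" and "h = e \<otimes> (P j \<otimes> e)"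
  have Pc: "P k \<in> carrier A" if "k \<in> I" for k using P[OF that] by (auto simp: projection_def)
  have e: "projection A e" and ec: "e \<in> carrier A" "e \<otimes> e = e" "e\<^sup>\<star> = e"
    using P ij by (auto simp: e_def projection_def)
  have q: "P j \<in> carrier A" "P j \<otimes> P j = P j" "(P j)\<^sup>\<star> = P j"
    using P ij by (auto simp: projection_def)
  have h: "h \<in> carrier A" "h\<^sup>\<star> = h" "e \<otimes> h = h" "h \<otimes> e = h"
  proof -
    show "e \<otimes> h = h" using ec q by (simp add: h_def flip: m_assoc)
    show "h \<otimes> e = h" using ec q by (simp add: h_def m_assoc)
  qed (use ec q in \<open>auto simp: h_def adj_mult m_assoc\<close>)
  have e1: "\<parallel>e\<parallel> \<le> 1" by (rule nrm_projection_le_1[OF e])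
  have G: "finite G" "G \<subseteq> I" "i \<notin> G" "j \<notin> G" using fin by (auto simp: G_def)
  define R where "R = finsum A P G"
  have Rc: "R \<in> carrier A" unfolding R_def using G Pc by (intro finsum_closed) auto
  have I: "I = insert i (insert j G)" using ij by (auto simp: G_def)
  have decomp: "finsum A P I = e \<oplus> (P j \<oplus> R)"
  proof -
    have "finsum A P (insert j G) = P j \<oplus> finsum A P G"
      using G Pc ij by (intro finsum_insert) auto
    moreover have "finsum A P (insert i (insert j G)) = P i \<oplus> finsum A P (insert j G)"
      using G Pc ij by (intro finsum_insert) auto
    ultimately show ?thesis by (simp add: I e_def R_def)
  qed
  \<comment> \<open>The trace of positivity of eRe that survives as a norm bound: every projection
    in R contributes at most 1, by \<open>nrm_compression_le\<close>.\<close>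
  have GR: "\<parallel>of_nat (card G) \<odot> e \<ominus> e \<otimes> (R \<otimes> e)\<parallel> \<le> card G"
    unfolding R_def using G(1,2)
  proof (induction G)
    case empty then show ?case using ec by simp
  next
    case (insert k G)
    have c: "P k \<in> carrier A" "finsum A P G \<in> carrier A" using insert Pc by (auto intro!: finsum_closed)
    have "of_nat (card (insert k G)) \<odot> e \<ominus> e \<otimes> (finsum A P (insert k G) \<otimes> e)
       = (e \<ominus> e \<otimes> (P k \<otimes> e)) \<oplus> (of_nat (card G) \<odot> e \<ominus> e \<otimes> (finsum A P G \<otimes> e))"
    proof -
      have "finsum A P (insert k G) = P k \<oplus> finsum A P G"
        using insert Pc by (intro finsum_insert) auto
      then show ?thesis using insert c ec
        by (simp add: l_distr r_distr smult_l_distr add_diff_add)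
    qed
    also have "\<parallel>\<dots>\<parallel> \<le> \<parallel>e \<ominus> e \<otimes> (P k \<otimes> e)\<parallel> + \<parallel>of_nat (card G) \<odot> e \<ominus> e \<otimes> (finsum A P G \<otimes> e)\<parallel>"
      using c ec by (intro nrm_triangle) auto
    also have "\<dots> \<le> 1 + real (card G)"
      using nrm_compression_le[OF e P, of k] insert.IH insert.prems by simp
    finally show ?case using insert by simp
  qed
  \<comment> \<open>One unit for each projection in R plus one for the compressed total sum, since
    Ne + h is that compression plus the element bounded in \<open>GR\<close>.\<close>
  define N where "N = card G + 1"
  have sumc: "finsum A P I \<in> carrier A" using sum by (simp add: projection_def)
  have Nh: "\<parallel>of_nat N \<odot> e \<oplus> h\<parallel> \<le> N"
  proof -
    have "e \<otimes> (finsum A P I \<otimes> e) = e \<oplus> (h \<oplus> e \<otimes> (R \<otimes> e))"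
      unfolding decomp using ec q Rc by (simp add: l_distr r_distr h_def)
    then have "of_nat N \<odot> e \<oplus> h = e \<otimes> (finsum A P I \<otimes> e) \<oplus> (of_nat (card G) \<odot> e \<ominus> e \<otimes> (R \<otimes> e))"
    proof -
      let ?r = "e \<otimes> (R \<otimes> e)" and ?n = "of_nat (card G) \<odot> e"
      have c: "?r \<in> carrier A" "?n \<in> carrier A" using ec Rc by auto
      have "(e \<oplus> (h \<oplus> ?r)) \<oplus> (?n \<ominus> ?r) = (?n \<oplus> e \<oplus> h) \<oplus> (?r \<ominus> ?r)"
        using c ec(1) h(1) by (simp add: a_minus_def a_ac)
      moreover have "of_nat N \<odot> e = ?n \<oplus> e" using ec(1) by (simp add: N_def smult_l_distr a_comm)
      ultimately show ?thesis using c ec(1) h(1) \<open>e \<otimes> (finsum A P I \<otimes> e) = e \<oplus> (h \<oplus> ?r)\<close>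
        by (simp add: r_zero)
    qed
    also have "\<parallel>\<dots>\<parallel> \<le> \<parallel>e \<otimes> (finsum A P I \<otimes> e)\<parallel> + \<parallel>of_nat (card G) \<odot> e \<ominus> e \<otimes> (R \<otimes> e)\<parallel>"
      using ec Rc sumc by (intro nrm_triangle) auto
    also have "\<parallel>e \<otimes> (finsum A P I \<otimes> e)\<parallel> \<le> 1 * (1 * 1)"
      using ec sumc e1 nrm_projection_le_1[OF sum]
      by (intro order_trans[OF nrm_mult] mult_mono order_trans[OF nrm_mult] mult_nonneg_nonneg) (auto simp: nrm_nonneg)
    finally show ?thesis using GR by (simp add: N_def)
  qed
  define c where "c = inverse (of_nat N :: complex)"
  have N0: "N > 0" by (simp add: N_def)
  have cN: "c * of_nat N = 1" "of_nat N * c = 1" "cnj c = c" "cmod c = inverse (real N)"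
    using N0 by (auto simp: c_def norm_inverse)
  have "c \<odot> h = \<zero>"
  proof (rule sandwiched_eq_zero[OF e])
    have "e \<oplus> c \<odot> h = c \<odot> (of_nat N \<odot> e \<oplus> h)" using ec h by (simp add: smult_r_distr cN flip: smult_assoc)
    then show "\<parallel>e \<oplus> c \<odot> h\<parallel> \<le> 1" using Nh N0 ec h(1) by (simp add: nrm_smult cN field_simps)
    \<comment> \<open>With c = 1/N, e - ch is a convex combination of e and e - h, both of norm at
      most 1.\<close>
    have "e \<ominus> c \<odot> h = (1 - c) \<odot> e \<oplus> c \<odot> (e \<ominus> h)"
    proof -
      have "(1 - c) \<odot> e \<oplus> c \<odot> (e \<ominus> h) = ((1 - c) \<odot> e \<oplus> c \<odot> e) \<oplus> (- c) \<odot> h"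
        using ec h(1) by (simp add: diff_eq_smult smult_r_distr a_assoc flip: smult_assoc)
      also have "\<dots> = e \<ominus> c \<odot> h"
        using ec h(1) by (simp add: diff_eq_smult flip: smult_l_distr smult_assoc)
      finally show ?thesis by simp
    qed
    then have "\<parallel>e \<ominus> c \<odot> h\<parallel> \<le> cmod (1 - c) * \<parallel>e\<parallel> + cmod c * \<parallel>e \<ominus> h\<parallel>"
      using nrm_triangle[of "(1 - c) \<odot> e" "c \<odot> (e \<ominus> h)"] ec h(1) by (simp add: nrm_smult)
    also have "cmod (1 - c) = 1 - inverse (real N)"
    proof -
      have "1 - c = complex_of_real (1 - inverse (real N))" by (simp add: c_def)
      moreover have "inverse (real N) \<le> 1" using N0 by (simp add: field_simps)
      ultimately show ?thesis by (metis abs_of_nonneg diff_ge_0_iff_ge norm_of_real)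
    qed
    also have "(1 - inverse (real N)) * \<parallel>e\<parallel> + cmod c * \<parallel>e \<ominus> h\<parallel> \<le> (1 - inverse (real N)) * 1 + cmod c * 1"
      using e1 nrm_compression_le[OF e P[OF ij(2)]] N0
      by (intro add_mono mult_left_mono) (auto simp: h_def field_simps)
    finally show "\<parallel>e \<ominus> c \<odot> h\<parallel> \<le> 1" by (simp add: cN)
  qed (use h ec in \<open>auto simp: adj_smult cN smult_m_l smult_m_r\<close>)
  then have "of_nat N \<odot> (c \<odot> h) = \<zero>" by simp
  then have "h = \<zero>" using h(1) by (simp add: cN flip: smult_assoc)
  \<comment> \<open>Vanishing of h gives vanishing of (P j) e, because h is the product of its
    adjoint with itself.\<close>
  moreover have "(P j \<otimes> e)\<^sup>\<star> \<otimes> (P j \<otimes> e) = h"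
    using ec q by (simp add: h_def adj_mult m_assoc) (simp flip: m_assoc add: q)
  ultimately have "P j \<otimes> e = \<zero>" using adj_mult_self_eq_0[of "P j \<otimes> e"] ec q by simp
  then have "(P j \<otimes> e)\<^sup>\<star> = \<zero>" by simp
  then show ?thesis using ec q by (simp add: adj_mult e_def)
qed

lemma finsum_projections_absorb:
  assumes fin: "finite I" and P: "\<And>i. i \<in> I \<Longrightarrow> projection A (P i)" and sum: "projection A (finsum A P I)"
    and i: "i \<in> I"
  shows "finsum A P I \<otimes> P i = P i" "P i \<otimes> finsum A P I = P i"
proof -
  have c: "P j \<in> carrier A" "P j \<otimes> P j = P j" if "j \<in> I" for j using P[OF that] by (auto simp: projection_def)
  have "finsum A P I \<otimes> P i = finsum A (\<lambda>j. P j \<otimes> P i) I"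
    using c i by (intro finsum_mult_right) auto
  also have "\<dots> = P i \<otimes> P i"
    using c i projections_orthogonal[OF fin P sum] by (intro finsum_single fin) auto
  finally show "finsum A P I \<otimes> P i = P i" using c i by simp
  have "P i \<otimes> finsum A P I = finsum A (\<lambda>j. P i \<otimes> P j) I"
    using c i by (intro finsum_mult_left) auto
  also have "\<dots> = P i \<otimes> P i"
    using c i projections_orthogonal[OF fin P sum] by (intro finsum_single fin) auto
  finally show "P i \<otimes> finsum A P I = P i" using c i by simp
qed

lemma partial_isometry_range: "partial_isometry A w \<Longrightarrow> projection A (w \<otimes> w\<^sup>\<star>)"
  by (auto simp: partial_isometry_def projection_def adj_mult) (simp flip: m_assoc)

lemma partial_isometry_source: "partial_isometry A w \<Longrightarrow> projection A (w\<^sup>\<star> \<otimes> w)"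
  by (auto simp: partial_isometry_def projection_def adj_mult m_assoc)

lemma nrm_partial_isometry_le_1:
  assumes "partial_isometry A w" shows "\<parallel>w\<parallel> \<le> 1"
proof -
  have w: "w \<in> carrier A" using assms by (simp add: partial_isometry_def)
  have "\<parallel>w\<parallel>\<^sup>2 \<le> 1"
    using nrm_projection_le_1[OF partial_isometry_source[OF assms]] cstar_identity[OF w] by simp
  then show ?thesis using nrm_nonneg[OF w] by (simp add: abs_square_le_1)
qed

lemma nrm_projection_eq_1: 
  assumes "projection A e" "e \<noteq> \<zero>" shows "\<parallel>e\<parallel> = 1"
proof -
  have "\<parallel>e\<parallel>\<^sup>2 = \<parallel>e\<parallel>" "e \<in> carrier A"
    using assms cstar_identity[of e] by (auto simp: projection_def)
  then show ?thesis using assms(2) nrm_eq_0[of e] by (simp add: power2_eq_square)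
qed

end

text \<open>If b < a, put r = b/a. Then 1 \<le> K n r^n along n = 2^j, although n r^n tends to 0.
  The factor 2^j is tolerated because the degree of a 2^j-th power grows at that rate.\<close>

lemma le_if_powers_le:
  fixes a b K :: real
  assumes "0 \<le> a" "0 \<le> b" and le: "\<And>j::nat. a ^ (2 ^ j) \<le> K * 2 ^ j * b ^ (2 ^ j)"
  shows "a \<le> b"
proof (rule ccontr)
  assume "\<not> a \<le> b"
  then have ab: "b < a" by simp
  then have a0: "0 < a" using assms by simp
  define r where "r = b / a"
  have r: "0 \<le> r" "r < 1" using ab assms a0 by (auto simp: r_def)
  have "1 \<le> K * (2 ^ j * r ^ (2 ^ j))" for j :: nat
    using le[of j] a0 by (simp add: r_def power_divide field_simps)
  moreover have "(\<lambda>n. of_nat n * r ^ n) \<longlonglongrightarrow> 0" using r by (intro powser_times_n_limit_0) auto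
  then have "((\<lambda>n. of_nat n * r ^ n) \<circ> (\<lambda>j. 2 ^ j)) \<longlonglongrightarrow> 0"
    by (rule LIMSEQ_subseq_LIMSEQ) (auto simp: strict_mono_def)
  then have "(\<lambda>j. K * (2 ^ j * r ^ (2 ^ j))) \<longlonglongrightarrow> K * 0"
    by (intro tendsto_mult_left) (simp add: o_def)
  ultimately have "1 \<le> K * 0" by (meson LIMSEQ_le_const)
  then show False by simp
qed

context cstar_hom
begin

text \<open>
  For self-adjoint \<open>x\<close> the norm of \<open>x\<^bsup>2^j\<^esup>\<close> is the \<open>2^j\<close>-th power of the norm of \<open>x\<close>, so a lower
  bound for \<open>\<phi>\<close> along these powers whose constant grows subexponentially is an exact lower bound.
\<close>

lemma isometric_if_power_bounds:
  assumes D: "D \<subseteq> carrier B" "\<And>x. x \<in> D \<Longrightarrow> x\<^sup>\<star> \<otimes> x \<in> D"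
    and K: "\<And>x. \<lbrakk>x \<in> D; x\<^sup>\<star> = x\<rbrakk> \<Longrightarrow>
      \<exists>K::real. \<forall>j::nat. \<parallel>((\<lambda>y. y \<otimes> y) ^^ j) x\<parallel> \<le> K * 2 ^ j * \<parallel>\<phi> (((\<lambda>y. y \<otimes> y) ^^ j) x)\<parallel>\<^bsub>A\<^esub>"
    and x: "x \<in> D"
  shows "\<parallel>\<phi> x\<parallel>\<^bsub>A\<^esub> = \<parallel>x\<parallel>"
proof -
  have sa: "\<parallel>y\<parallel> \<le> \<parallel>\<phi> y\<parallel>\<^bsub>A\<^esub>" if y: "y \<in> D" "y\<^sup>\<star> = y" for y
  proof -
    let ?p = "\<lambda>j. ((\<lambda>y. y \<otimes> y) ^^ j) y"
    have yc: "y \<in> carrier B" using y D by auto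
    have pj: "?p j \<in> carrier B \<and> (?p j)\<^sup>\<star> = ?p j \<and> \<parallel>?p j\<parallel> = \<parallel>y\<parallel> ^ (2 ^ j)
        \<and> \<parallel>\<phi> (?p j)\<parallel>\<^bsub>A\<^esub> = \<parallel>\<phi> y\<parallel>\<^bsub>A\<^esub> ^ (2 ^ j)" for j
    proof (induction j)
      case 0 then show ?case using yc y by simp
    next
      case (Suc j)
      then have *: "?p j \<in> carrier B" "(?p j)\<^sup>\<star> = ?p j" by auto
      have "(\<phi> (?p j))\<^sup>\<star>\<^bsub>A\<^esub> = \<phi> (?p j)" using * by (simp flip: adj)
      then have "\<parallel>\<phi> (?p j \<otimes> ?p j)\<parallel>\<^bsub>A\<^esub> = (\<parallel>\<phi> y\<parallel>\<^bsub>A\<^esub> ^ (2 ^ j))\<^sup>2"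
        using Suc *(1) A.cstar_identity[OF closed[OF *(1)]] by (simp add: mult)
      moreover have "\<parallel>?p j \<otimes> ?p j\<parallel> = (\<parallel>y\<parallel> ^ (2 ^ j))\<^sup>2"
        using Suc B.cstar_identity[OF *(1)] by simp
      moreover have "(a ^ (2 ^ j))\<^sup>2 = a ^ (2 ^ Suc j)" for a :: real
        by (simp add: mult.commute flip: power_mult)
      ultimately show ?case using * by (simp add: B.adj_mult)
    qed
    obtain K :: real where "\<And>j. \<parallel>?p j\<parallel> \<le> K * 2 ^ j * \<parallel>\<phi> (?p j)\<parallel>\<^bsub>A\<^esub>" using K[OF y] by blast
    then have "\<parallel>y\<parallel> ^ (2 ^ j) \<le> K * 2 ^ j * \<parallel>\<phi> y\<parallel>\<^bsub>A\<^esub> ^ (2 ^ j)" for j using pj by metis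
    then show ?thesis by (rule le_if_powers_le[OF B.nrm_nonneg[OF yc] A.nrm_nonneg[OF closed[OF yc]]])
  qed
  have xc: "x \<in> carrier B" using x D by auto
  have "\<parallel>x\<parallel>\<^sup>2 = \<parallel>x\<^sup>\<star> \<otimes> x\<parallel>" using xc by (simp add: B.cstar_identity)
  also have "\<dots> \<le> \<parallel>\<phi> (x\<^sup>\<star> \<otimes> x)\<parallel>\<^bsub>A\<^esub>" using sa[OF D(2)[OF x]] xc by (simp add: B.adj_mult)
  also have "\<dots> = \<parallel>\<phi> x\<parallel>\<^bsub>A\<^esub>\<^sup>2" using xc by (simp add: mult adj A.cstar_identity)
  finally have "\<parallel>x\<parallel> \<le> \<parallel>\<phi> x\<parallel>\<^bsub>A\<^esub>" 
    by (rule power2_le_imp_le) (simp add: A.nrm_nonneg xc)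
  then show ?thesis using nrm_le[OF xc] by simp
qed

end

section \<open>Representations of graph algebras\<close>

locale ck_representation = wf_digraph E + cstar_algebra B
  for E :: "('v, 'e) pre_digraph" and B :: "'b cstar" (structure) +
  fixes p :: "'v \<Rightarrow> 'b" and t :: "'e \<Rightarrow> 'b"
  assumes ck: "ck_family E B p t" and row_finite: "row_finite E" and no_sources: "no_sources E"
begin

lemma p_projection: "v \<in> verts E \<Longrightarrow> projection B (p v)"
  and t_partial_isometry: "a \<in> arcs E \<Longrightarrow> partial_isometry B (t a)"
  using ck_familyD(1,2)[OF ck] by auto

lemma p_closed [simp, intro]: "v \<in> verts E \<Longrightarrow> p v \<in> carrier B"
  and p_adj [simp]: "v \<in> verts E \<Longrightarrow> (p v)\<^sup>\<star> = p v"
  and p_idem [simp]: "v \<in> verts E \<Longrightarrow> p v \<otimes> p v = p v"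
  using p_projection by (auto simp: projection_def)

lemma t_closed [simp, intro]: "a \<in> arcs E \<Longrightarrow> t a \<in> carrier B"
  and t_partial: "a \<in> arcs E \<Longrightarrow> t a \<otimes> (t a)\<^sup>\<star> \<otimes> t a = t a"
  using t_partial_isometry by (auto simp: partial_isometry_def)

lemma p_orthogonal: "\<lbrakk>v \<in> verts E; w \<in> verts E; v \<noteq> w\<rbrakk> \<Longrightarrow> p v \<otimes> p w = \<zero>"
  using ck_familyD(3)[OF ck] by auto

lemma t_adj_t: "a \<in> arcs E \<Longrightarrow> (t a)\<^sup>\<star> \<otimes> t a = p (tail E a)"
  using ck_familyD(4)[OF ck] by auto

lemma p_sum: "v \<in> verts E \<Longrightarrow> p v = (\<Oplus>a\<in>{a \<in> arcs E. head E a = v}. t a \<otimes> (t a)\<^sup>\<star>)"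
  using ck_familyD(5)[OF ck] by auto

lemma finite_in: "v \<in> verts E \<Longrightarrow> finite {a \<in> arcs E. head E a = v}"
  using row_finite by (auto simp: row_finite_def)

lemma range_absorb:
  assumes a: "a \<in> arcs E"
  shows "p (head E a) \<otimes> t a = t a"
proof -
  let ?I = "{b \<in> arcs E. head E b = head E a}"
  have "p (head E a) \<otimes> (t a \<otimes> (t a)\<^sup>\<star>) = t a \<otimes> (t a)\<^sup>\<star>"
    using finsum_projections_absorb(1)[of ?I "\<lambda>b. t b \<otimes> (t b)\<^sup>\<star>" a] finite_in[of "head E a"]
      partial_isometry_range[OF t_partial_isometry] p_projection[of "head E a"] p_sum[of "head E a"] a
    by auto
  then have "p (head E a) \<otimes> (t a \<otimes> (t a)\<^sup>\<star>) \<otimes> t a = t a \<otimes> (t a)\<^sup>\<star> \<otimes> t a" by simp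
  then show ?thesis using a t_partial[OF a] by (simp add: m_assoc)
qed

text \<open>For a common range the two range projections are summands of the projection
  \<open>p (head E a)\<close>, hence orthogonal. For different ranges the orthogonal vertex
  projections are inserted between the factors.\<close>

lemma t_orthogonal:
  assumes a: "a \<in> arcs E" and b: "b \<in> arcs E" and "a \<noteq> b"
  shows "(t a)\<^sup>\<star> \<otimes> t b = \<zero>"
proof (cases "head E a = head E b")
  case True
  let ?I = "{c \<in> arcs E. head E c = head E b}"
  have "(t a \<otimes> (t a)\<^sup>\<star>) \<otimes> (t b \<otimes> (t b)\<^sup>\<star>) = \<zero>"
    using projections_orthogonal[of ?I "\<lambda>b. t b \<otimes> (t b)\<^sup>\<star>" a b] finite_in[of "head E b"]
      partial_isometry_range[OF t_partial_isometry] p_projection[of "head E b"] p_sum[of "head E b"] assms True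
    by auto
  then have "(t a)\<^sup>\<star> \<otimes> ((t a \<otimes> (t a)\<^sup>\<star>) \<otimes> (t b \<otimes> (t b)\<^sup>\<star>)) \<otimes> t b = \<zero>" using a b by simp
  moreover have "(t a)\<^sup>\<star> \<otimes> (t a \<otimes> (t a)\<^sup>\<star>) = (t a)\<^sup>\<star>"
    using arg_cong[OF t_partial[OF a], of "adj B"] a by (simp add: adj_mult m_assoc)
  ultimately show ?thesis using a b t_partial[OF b]
    by (simp add: m_assoc) (metis adj_closed m_assoc m_closed t_closed)
next
  case False
  have "(t a)\<^sup>\<star> \<otimes> t b = (p (head E a) \<otimes> t a)\<^sup>\<star> \<otimes> (p (head E b) \<otimes> t b)"
    using a b range_absorb by simp
  also have "\<dots> = (t a)\<^sup>\<star> \<otimes> (p (head E a) \<otimes> p (head E b)) \<otimes> t b"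
    using a b by (simp add: adj_mult m_assoc del: range_absorb)
  also have "\<dots> = \<zero>" using a b False by (simp add: p_orthogonal)
  finally show ?thesis .
qed

lemma p_mult_t:
  assumes "v \<in> verts E" "a \<in> arcs E"
  shows "p v \<otimes> t a = (if v = head E a then t a else \<zero>)"
proof (cases "v = head E a")
  case False
  have "p v \<otimes> t a = p v \<otimes> (p (head E a) \<otimes> t a)" using assms by (simp add: range_absorb)
  also have "\<dots> = p v \<otimes> p (head E a) \<otimes> t a" using assms by (simp add: m_assoc)
  finally show ?thesis using False assms by (simp add: p_orthogonal)
qed (use assms in \<open>simp add: range_absorb\<close>)

text \<open>\<open>bidegree n m\<close> is the linear span of the \<open>t\<^sub>\<mu>t\<^sub>\<nu>\<^sup>\<star>\<close> with \<open>\<bar>\<mu>\<bar> = n\<close> and \<open>\<bar>\<nu>\<bar> = m\<close>.\<close>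

inductive bidegree :: "nat \<Rightarrow> nat \<Rightarrow> 'b \<Rightarrow> bool" where
  vert: "v \<in> verts E \<Longrightarrow> bidegree 0 0 (p v)"
| left: "a \<in> arcs E \<Longrightarrow> bidegree n m x \<Longrightarrow> bidegree (Suc n) m (t a \<otimes> x)"
| right: "bidegree n m x \<Longrightarrow> a \<in> arcs E \<Longrightarrow> bidegree n (Suc m) (x \<otimes> (t a)\<^sup>\<star>)"
| zero: "bidegree n m \<zero>"
| add: "bidegree n m x \<Longrightarrow> bidegree n m y \<Longrightarrow> bidegree n m (x \<oplus> y)"
| scale: "bidegree n m x \<Longrightarrow> bidegree n m (c \<odot> x)"

lemma bidegree_closed [simp, intro]: "bidegree n m x \<Longrightarrow> x \<in> carrier B"
  by (induction rule: bidegree.induct) auto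

lemma bidegree_adj: "bidegree n m x \<Longrightarrow> bidegree m n (x\<^sup>\<star>)"
proof (induction rule: bidegree.induct)
  case (left a n m x) then show ?case using bidegree.right[of m n "x\<^sup>\<star>" a] by (simp add: adj_mult)
next
  case (right n m x a) then show ?case using bidegree.left[of a m n "x\<^sup>\<star>"] by (simp add: adj_mult)
qed (auto simp: adj_add adj_smult intro: bidegree.intros)

lemma bidegree_p: "bidegree n m x \<Longrightarrow> v \<in> verts E \<Longrightarrow> bidegree n m (p v \<otimes> x)"
proof (induction rule: bidegree.induct)
  case (vert w) then show ?case
    by (cases "v = w") (auto simp: p_orthogonal intro: bidegree.intros)
next
  case (left a n m x)
  have "p v \<otimes> (t a \<otimes> x) = (p v \<otimes> t a) \<otimes> x" using left by (simp add: m_assoc)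
  then show ?case using left by (auto simp: p_mult_t intro: bidegree.intros)
next
  case (right n m x a)
  have "p v \<otimes> (x \<otimes> (t a)\<^sup>\<star>) = (p v \<otimes> x) \<otimes> (t a)\<^sup>\<star>" using right by (simp add: m_assoc)
  then show ?case using right by (auto intro: bidegree.intros)
qed (auto simp: r_distr smult_m_r intro: bidegree.intros)

text \<open>Strips the first edge of the left path: the product of
  \<open>(t a)\<^sup>\<star>\<close> with that edge is zero or a vertex projection. The length is a
  variable with an equation so that induction over \<open>bidegree\<close> stays possible; the
  equation excludes the vertex case.\<close>

lemma bidegree_t_adj: "bidegree k m x \<Longrightarrow> a \<in> arcs E \<Longrightarrow> k = Suc n \<Longrightarrow> bidegree n m ((t a)\<^sup>\<star> \<otimes> x)"
proof (induction rule: bidegree.induct)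
  case (left b k m x)
  have "(t a)\<^sup>\<star> \<otimes> (t b \<otimes> x) = ((t a)\<^sup>\<star> \<otimes> t b) \<otimes> x" using left by (simp add: m_assoc)
  then show ?case using left
    by (cases "a = b") (auto simp: t_adj_t t_orthogonal intro: bidegree.intros bidegree_p)
next
  case (right k m x b)
  have "(t a)\<^sup>\<star> \<otimes> (x \<otimes> (t b)\<^sup>\<star>) = ((t a)\<^sup>\<star> \<otimes> x) \<otimes> (t b)\<^sup>\<star>" using right by (simp add: m_assoc)
  then show ?case using right by (auto intro: bidegree.intros)
qed (auto simp: r_distr smult_m_r intro: bidegree.intros)

text \<open>The inner lengths agree, so every adjoint edge at the right end of \<open>x\<close>
  cancels against one edge at the left end of \<open>y\<close>.\<close>

lemma bidegree_mult: "bidegree n k x \<Longrightarrow> bidegree k m y \<Longrightarrow> bidegree n m (x \<otimes> y)"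
proof (induction arbitrary: y rule: bidegree.induct)
  case (vert v) then show ?case by (auto intro: bidegree_p)
next
  case (left a n k x) then show ?case by (simp add: m_assoc bidegree_closed bidegree.left)
next
  case (right n k x a)
  then show ?case using bidegree_t_adj[OF right.prems right.hyps(2) refl] by (simp add: m_assoc bidegree_closed)
qed (auto simp: l_distr smult_m_l bidegree_closed intro: bidegree.intros)

lemma bidegree_finsum: "(\<And>i. i \<in> I \<Longrightarrow> bidegree n m (f i)) \<Longrightarrow> bidegree n m (finsum B f I)"
proof (induction I rule: infinite_finite_induct)
  case (insert i I)
  then have "f i \<in> carrier B" "f \<in> I \<rightarrow> carrier B" by (auto intro!: bidegree_closed)
  with insert show ?case by (simp add: finsum_insert bidegree.add)
qed (auto simp: finsum_infinite intro: bidegree.zero)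

text \<open>The relation that expands \<open>p v\<close> over the edges with range \<open>v\<close>
  lengthens both paths by one edge. Elements with the same difference of lengths can thus be given
  the same lengths.\<close>

lemma bidegree_Suc: "bidegree n m x \<Longrightarrow> bidegree (Suc n) (Suc m) x"
proof (induction rule: bidegree.induct)
  case (vert v)
  have "bidegree (Suc 0) (Suc 0) (t a \<otimes> (t a)\<^sup>\<star>)" if a: "a \<in> arcs E" for a
  proof -
    have "bidegree (Suc 0) (Suc 0) (t a \<otimes> (p (tail E a) \<otimes> (t a)\<^sup>\<star>))"
      using a by (auto intro!: bidegree.intros)
    also have "p (tail E a) \<otimes> (t a)\<^sup>\<star> = (t a)\<^sup>\<star>"
      using a t_adj_t[OF a] arg_cong[OF t_partial[OF a], of "adj B"] by (simp add: adj_mult m_assoc)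
    finally show ?thesis .
  qed
  then show ?case using p_sum[OF vert] by (auto intro!: bidegree_finsum)
qed (auto intro: bidegree.intros)

lemma bidegree_add_nat: "bidegree n m x \<Longrightarrow> bidegree (n + j) (m + j) x"
  by (induction j) (auto intro: bidegree_Suc)

abbreviation range_proj :: "'e set \<Rightarrow> 'b" where
  "range_proj F \<equiv> finsum B (\<lambda>a. t a \<otimes> (t a)\<^sup>\<star>) F"

text \<open>Only finitely many first edges occur in an element, so a finite sum of range projections
  acts on it as a left unit. Allowing every larger finite set makes the supports of two summands
  unite.\<close>

lemma bidegree_support:
  "bidegree k m x \<Longrightarrow> k = Suc n \<Longrightarrow>
    \<exists>F. finite F \<and> F \<subseteq> arcs E \<and> (\<forall>G. finite G \<and> F \<subseteq> G \<and> G \<subseteq> arcs E \<longrightarrow> range_proj G \<otimes> x = x)"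
proof (induction rule: bidegree.induct)
  case (left a k m x)
  have "range_proj G \<otimes> (t a \<otimes> x) = t a \<otimes> x" if G: "finite G" "{a} \<subseteq> G" "G \<subseteq> arcs E" for G
  proof -
    have Gc: "(\<lambda>b. t b \<otimes> (t b)\<^sup>\<star>) \<in> G \<rightarrow> carrier B" using G by auto
    have "range_proj G \<otimes> t a = finsum B (\<lambda>b. t b \<otimes> (t b)\<^sup>\<star> \<otimes> t a) G"
      using G Gc left by (intro finsum_mult_right) auto
    also have "\<dots> = t a \<otimes> (t a)\<^sup>\<star> \<otimes> t a"
      using G left by (intro finsum_single) (auto simp: m_assoc t_orthogonal)
    finally have "range_proj G \<otimes> t a = t a" using t_partial left by simp
    moreover have "range_proj G \<in> carrier B" using Gc by (rule finsum_closed)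
    ultimately show ?thesis using left m_assoc[of "range_proj G" "t a" x] by (simp add: bidegree_closed)
  qed
  then show ?case using left by (intro exI[of _ "{a}"]) auto
next
  case (right k m x a)
  from right.IH[OF right.prems] obtain F where
    *: "finite F \<and> F \<subseteq> arcs E \<and> (\<forall>G. finite G \<and> F \<subseteq> G \<and> G \<subseteq> arcs E \<longrightarrow> range_proj G \<otimes> x = x)" ..
  then have F: "finite F" "F \<subseteq> arcs E" by simp_all
  have F3: "range_proj G \<otimes> x = x" if "finite G" "F \<subseteq> G" "G \<subseteq> arcs E" for G using * that by simp
  have "range_proj G \<otimes> (x \<otimes> (t a)\<^sup>\<star>) = x \<otimes> (t a)\<^sup>\<star>" if G: "finite G" "F \<subseteq> G" "G \<subseteq> arcs E" for G
  proof -
    have "range_proj G \<in> carrier B" using G by (intro finsum_closed) auto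
    then show ?thesis using F3[OF G] right.hyps m_assoc[of "range_proj G" x "(t a)\<^sup>\<star>"]
      by (simp add: bidegree_closed)
  qed
  then show ?case using F by (intro exI[of _ F]) simp
next
  case (zero k m)
  have "range_proj G \<otimes> \<zero> = \<zero>" if "G \<subseteq> arcs E" for G
    using that by (intro mult_zero_r finsum_closed) auto
  then show ?case by (intro exI[of _ "{}"]) auto
next
  case (add k m x y)
  from add.IH(1)[OF add.prems] obtain F where
    *: "finite F \<and> F \<subseteq> arcs E \<and> (\<forall>G. finite G \<and> F \<subseteq> G \<and> G \<subseteq> arcs E \<longrightarrow> range_proj G \<otimes> x = x)" ..
  then have F: "finite F" "F \<subseteq> arcs E" by simp_all
  have F3: "range_proj G \<otimes> x = x" if "finite G" "F \<subseteq> G" "G \<subseteq> arcs E" for G using * that by simp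
  from add.IH(2)[OF add.prems] obtain H where
    *: "finite H \<and> H \<subseteq> arcs E \<and> (\<forall>G. finite G \<and> H \<subseteq> G \<and> G \<subseteq> arcs E \<longrightarrow> range_proj G \<otimes> y = y)" ..
  then have H: "finite H" "H \<subseteq> arcs E" by simp_all
  have H3: "range_proj G \<otimes> y = y" if "finite G" "H \<subseteq> G" "G \<subseteq> arcs E" for G using * that by simp
  have "range_proj G \<otimes> (x \<oplus> y) = x \<oplus> y" if G: "finite G" "F \<union> H \<subseteq> G" "G \<subseteq> arcs E" for G
  proof -
    have "range_proj G \<in> carrier B" using G by (intro finsum_closed) auto
    then show ?thesis using F3[of G] H3[of G] G add.hyps by (simp add: r_distr bidegree_closed)
  qed
  then show ?case using F H by (intro exI[of _ "F \<union> H"]) auto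
next
  case (scale k m x c)
  from scale.IH[OF scale.prems] obtain F where
    *: "finite F \<and> F \<subseteq> arcs E \<and> (\<forall>G. finite G \<and> F \<subseteq> G \<and> G \<subseteq> arcs E \<longrightarrow> range_proj G \<otimes> x = x)" ..
  then have F: "finite F" "F \<subseteq> arcs E" by simp_all
  have F3: "range_proj G \<otimes> x = x" if "finite G" "F \<subseteq> G" "G \<subseteq> arcs E" for G using * that by simp
  have "range_proj G \<otimes> (c \<odot> x) = c \<odot> x" if G: "finite G" "F \<subseteq> G" "G \<subseteq> arcs E" for G
  proof -
    have "range_proj G \<in> carrier B" using G by (intro finsum_closed) auto
    then show ?thesis using F3[OF G] scale.hyps by (simp add: smult_m_r bidegree_closed)
  qed
  then show ?case using F by (intro exI[of _ F]) simp
qed auto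

text \<open>With both lengths zero only linear combinations of vertex projections arise, and each
  \<open>p v\<close> cuts out a multiple of itself. The second half again allows all larger finite
  sets, for the sake of sums.\<close>

lemma bidegree_0_0:
  "bidegree n m x \<Longrightarrow> n = 0 \<Longrightarrow> m = 0 \<Longrightarrow>
    (\<forall>v\<in>verts E. \<exists>c. p v \<otimes> x = c \<odot> p v) \<and>
    (\<exists>F. finite F \<and> F \<subseteq> verts E \<and> (\<forall>G. finite G \<and> F \<subseteq> G \<and> G \<subseteq> verts E \<longrightarrow> finsum B p G \<otimes> x = x))"
proof (induction rule: bidegree.induct)
  case (vert v)
  have "finsum B p G \<otimes> p v = p v" if G: "finite G" "{v} \<subseteq> G" "G \<subseteq> verts E" for G
  proof -
    have "finsum B p G \<otimes> p v = finsum B (\<lambda>w. p w \<otimes> p v) G"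
      using G vert by (intro finsum_mult_right) auto
    also have "\<dots> = p v \<otimes> p v"
      using G vert by (intro finsum_single) (auto simp: p_orthogonal)
    finally show ?thesis using vert by simp
  qed
  moreover have "\<exists>c. p w \<otimes> p v = c \<odot> p w" if "w \<in> verts E" for w
    using that vert p_orthogonal[of w v] 
    by (cases "w = v") (auto intro: exI[of _ 1] exI[of _ 0])
  ultimately show ?case using vert by (intro conjI exI[of _ "{v}"]) auto
next
  case (zero k m)
  have "finsum B p G \<otimes> \<zero> = \<zero>" if "G \<subseteq> verts E" for G
    using that by (intro mult_zero_r finsum_closed) auto
  then show ?case by (intro conjI exI[of _ "{}"]) (auto intro!: exI[of _ 0])
next
  case (add k m x y)
  note IH = add.IH(1)[OF add.prems] add.IH(2)[OF add.prems]
  from IH(1)[THEN conjunct2] obtain F where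
    *: "finite F \<and> F \<subseteq> verts E \<and> (\<forall>G. finite G \<and> F \<subseteq> G \<and> G \<subseteq> verts E \<longrightarrow> finsum B p G \<otimes> x = x)" ..
  then have F: "finite F" "F \<subseteq> verts E" by simp_all
  have F3: "finsum B p G \<otimes> x = x" if "finite G" "F \<subseteq> G" "G \<subseteq> verts E" for G using * that by simp
  from IH(2)[THEN conjunct2] obtain H where
    *: "finite H \<and> H \<subseteq> verts E \<and> (\<forall>G. finite G \<and> H \<subseteq> G \<and> G \<subseteq> verts E \<longrightarrow> finsum B p G \<otimes> y = y)" ..
  then have H: "finite H" "H \<subseteq> verts E" by simp_all
  have H3: "finsum B p G \<otimes> y = y" if "finite G" "H \<subseteq> G" "G \<subseteq> verts E" for G using * that by simp
  have "finsum B p G \<otimes> (x \<oplus> y) = x \<oplus> y" if G: "finite G" "F \<union> H \<subseteq> G" "G \<subseteq> verts E" for G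
  proof -
    have "finsum B p G \<in> carrier B" using G by (intro finsum_closed) auto
    then show ?thesis using F3[of G] H3[of G] G add.hyps by (simp add: r_distr bidegree_closed)
  qed
  moreover have "\<exists>c. p v \<otimes> (x \<oplus> y) = c \<odot> p v" if v: "v \<in> verts E" for v
  proof -
    obtain c d where "p v \<otimes> x = c \<odot> p v" "p v \<otimes> y = d \<odot> p v"
      using IH[THEN conjunct1] v by blast
    then show ?thesis using v add.hyps
      by (intro exI[of _ "c + d"]) (simp add: r_distr smult_l_distr bidegree_closed)
  qed
  ultimately show ?case using F H by (intro conjI exI[of _ "F \<union> H"]) auto
next
  case (scale k m x c)
  note IH = scale.IH[OF scale.prems]
  from IH[THEN conjunct2] obtain F where
    *: "finite F \<and> F \<subseteq> verts E \<and> (\<forall>G. finite G \<and> F \<subseteq> G \<and> G \<subseteq> verts E \<longrightarrow> finsum B p G \<otimes> x = x)" ..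
  then have F: "finite F" "F \<subseteq> verts E" by simp_all
  have F3: "finsum B p G \<otimes> x = x" if "finite G" "F \<subseteq> G" "G \<subseteq> verts E" for G using * that by simp
  have "finsum B p G \<otimes> (c \<odot> x) = c \<odot> x" if G: "finite G" "F \<subseteq> G" "G \<subseteq> verts E" for G
  proof -
    have "finsum B p G \<in> carrier B" using G by (intro finsum_closed) auto
    then show ?thesis using F3[OF G] scale.hyps by (simp add: smult_m_r bidegree_closed)
  qed
  moreover have "\<exists>d. p v \<otimes> (c \<odot> x) = d \<odot> p v" if v: "v \<in> verts E" for v
  proof -
    obtain d where "p v \<otimes> x = d \<odot> p v" using IH[THEN conjunct1] v by blast
    then show ?thesis using v scale.hyps
      by (intro exI[of _ "c * d"]) (simp add: smult_m_r smult_assoc bidegree_closed)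
  qed
  ultimately show ?case using F by (intro conjI exI[of _ F]) simp_all
qed auto

section \<open>Grading by the difference of path lengths\<close>

definition homogeneous :: "int \<Rightarrow> 'b \<Rightarrow> bool" where
  "homogeneous k x \<longleftrightarrow> (\<exists>n m. bidegree n m x \<and> int n - int m = k)"

lemma homogeneous_closed [simp, intro]: "homogeneous k x \<Longrightarrow> x \<in> carrier B"
  by (auto simp: homogeneous_def)

lemma homogeneous_zero: "homogeneous k \<zero>"
  unfolding homogeneous_def
  by (intro exI[of _ "nat k"] exI[of _ "nat (- k)"]) (auto intro: bidegree.zero)

text \<open>If n - m = n' - m', raising the first pair by n' and the second by n leads to the same
  lengths, so the two elements lie in one linear span.\<close>

lemma homogeneous_add:
  assumes "homogeneous k x" "homogeneous k y" shows "homogeneous k (x \<oplus> y)"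
proof -
  obtain n m n' m' where l: "bidegree n m x" "bidegree n' m' y" "int n - int m = k" "int n' - int m' = k"
    using assms by (auto simp: homogeneous_def)
  have "bidegree (n + n') (m + n') x" "bidegree (n' + n) (m' + n) y" using l bidegree_add_nat by auto
  moreover have "m' + n = m + n'" using l by linarith
  ultimately have "bidegree (n + n') (m + n') (x \<oplus> y)" using bidegree.add by (simp add: add.commute)
  then show ?thesis unfolding homogeneous_def using l
    by (intro exI[of _ "n + n'"] exI[of _ "m + n'"]) simp
qed

lemma homogeneous_smult: "homogeneous k x \<Longrightarrow> homogeneous k (c \<odot> x)"
  unfolding homogeneous_def by (blast intro: bidegree.scale)

lemma homogeneous_adj: "homogeneous k x \<Longrightarrow> homogeneous (- k) (x\<^sup>\<star>)"
  unfolding homogeneous_def using bidegree_adj by fastforce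

lemma homogeneous_mult:
  assumes "homogeneous k x" "homogeneous l y" shows "homogeneous (k + l) (x \<otimes> y)"
proof -
  obtain n m n' m' where l: "bidegree n m x" "bidegree n' m' y" "int n - int m = k" "int n' - int m' = l"
    using assms by (auto simp: homogeneous_def)
  have "bidegree (n + n') (m + n') x" "bidegree (n' + m) (m' + m) y" using l bidegree_add_nat by auto
  then have "bidegree (n + n') (m' + m) (x \<otimes> y)" using bidegree_mult by (simp add: add.commute)
  then show ?thesis unfolding homogeneous_def using l
    by (intro exI[of _ "n + n'"] exI[of _ "m' + m"]) simp
qed

text \<open>The counterpart of trigonometric polynomials of degree at most \<open>d\<close>. Sums
  are a rule of the definition, which keeps the closure properties short; the splitting into one
  component for each degree is recovered in \<open>degree_le_decompose\<close>.\<close>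

inductive degree_le :: "nat \<Rightarrow> 'b \<Rightarrow> bool" where
  hom: "homogeneous k x \<Longrightarrow> \<bar>k\<bar> \<le> int d \<Longrightarrow> degree_le d x"
| add: "degree_le d x \<Longrightarrow> degree_le d y \<Longrightarrow> degree_le d (x \<oplus> y)"

lemma degree_le_closed [simp, intro]: "degree_le d x \<Longrightarrow> x \<in> carrier B"
  by (induction rule: degree_le.induct) auto

lemma degree_le_mono: "degree_le d x \<Longrightarrow> d \<le> d' \<Longrightarrow> degree_le d' x"
  by (induction rule: degree_le.induct) (auto intro: degree_le.intros)

lemma degree_le_adj: "degree_le d x \<Longrightarrow> degree_le d (x\<^sup>\<star>)"
  by (induction rule: degree_le.induct)
    (auto simp: adj_add intro: degree_le.add degree_le.hom[OF homogeneous_adj])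

lemma degree_le_smult: "degree_le d x \<Longrightarrow> degree_le d (c \<odot> x)"
  by (induction rule: degree_le.induct)
    (auto simp: smult_r_distr intro: degree_le.add degree_le.hom[OF homogeneous_smult])

lemma degree_le_mult: "degree_le d x \<Longrightarrow> degree_le d' y \<Longrightarrow> degree_le (d + d') (x \<otimes> y)"
proof (induction rule: degree_le.induct)
  case (hom k x d)
  show ?case using hom(3,1,2)
  proof (induction rule: degree_le.induct)
    case (hom l y d')
    then show ?case by (intro degree_le.hom[OF homogeneous_mult]) auto
  next
    case (add d' y z)
    then show ?case by (simp add: r_distr degree_le.add)
  qed
qed (simp add: l_distr degree_le.add)

lemma degree_le_decompose:
  "degree_le d x \<Longrightarrow> \<exists>f. (\<forall>k. homogeneous k (f k)) \<and> x = finsum B f {- int d..int d}"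
proof (induction rule: degree_le.induct)
  case (hom k x d)
  define f where "f j = (if j = k then x else \<zero>)" for j
  have "finsum B f {- int d..int d} = f k"
    using hom by (intro finsum_single) (auto simp: f_def)
  also have "f k = x" by (simp add: f_def)
  finally have "x = finsum B f {- int d..int d}" by (rule sym)
  moreover have "\<forall>j. homogeneous j (f j)" using hom by (simp add: f_def homogeneous_zero)
  ultimately show ?case by blast
next
  case (add d x y)
  then obtain f g where *: "\<And>k. homogeneous k (f k)" "x = finsum B f {- int d..int d}"
    "\<And>k. homogeneous k (g k)" "y = finsum B g {- int d..int d}" by blast
  then have "x \<oplus> y = finsum B (\<lambda>k. f k \<oplus> g k) {- int d..int d}"
    by (subst finsum_addf) (auto intro: homogeneous_closed)
  then show ?case using * by (intro exI[of _ "\<lambda>k. f k \<oplus> g k"]) (auto intro: homogeneous_add)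
qed

end

section \<open>Gauge-invariant uniqueness: isometry on the core, on each degree, and on the whole
  algebra\<close>

locale gauge_equivariant = ck_representation E B p t + phi: cstar_hom B A \<phi>
  for E :: "('v, 'e) pre_digraph" and B :: "'b cstar" (structure) and A :: "'a cstar" and p t \<phi> +
  assumes nonzero: "\<And>v. v \<in> verts E \<Longrightarrow> \<phi> (p v) \<noteq> \<zero>\<^bsub>A\<^esub>"
    and gauge: "\<And>z. cmod z = 1 \<Longrightarrow> \<exists>\<gamma>\<in>star_hom A A. (\<forall>v\<in>verts E. \<gamma> (\<phi> (p v)) = \<phi> (p v)) \<and>
      (\<forall>a\<in>arcs E. \<gamma> (\<phi> (t a)) = z \<odot>\<^bsub>A\<^esub> \<phi> (t a))"
begin

lemma sq_power_bidegree: "bidegree n n x \<Longrightarrow> bidegree n n (((\<lambda>y. y \<otimes> y) ^^ j) x)"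
  by (induction j) (auto intro: bidegree_mult)

lemma sq_power_absorb:
  assumes "x \<in> carrier B" "q \<in> carrier B" "q \<otimes> x = x"
  shows "((\<lambda>y. y \<otimes> y) ^^ j) x \<in> carrier B \<and> q \<otimes> ((\<lambda>y. y \<otimes> y) ^^ j) x = ((\<lambda>y. y \<otimes> y) ^^ j) x"
proof (induction j)
  case (Suc j)
  then show ?case using assms(2) m_assoc[of q "((\<lambda>y. y \<otimes> y) ^^ j) x" "((\<lambda>y. y \<otimes> y) ^^ j) x"] by simp
qed (use assms in simp)

lemma sq_power_adj:
  "x \<in> carrier B \<Longrightarrow> x\<^sup>\<star> = x \<Longrightarrow> ((\<lambda>y. y \<otimes> y) ^^ j) x \<in> carrier B \<and> (((\<lambda>y. y \<otimes> y) ^^ j) x)\<^sup>\<star> = ((\<lambda>y. y \<otimes> y) ^^ j) x"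
  by (induction j) (auto simp: adj_mult)

lemma nrm_phi_mult_le:
  assumes "x \<in> carrier B" "y \<in> carrier B" "\<parallel>x\<parallel> \<le> 1"
  shows "\<parallel>\<phi> (x \<otimes> y)\<parallel>\<^bsub>A\<^esub> \<le> \<parallel>\<phi> y\<parallel>\<^bsub>A\<^esub>"
proof -
  have "\<parallel>\<phi> (x \<otimes> y)\<parallel>\<^bsub>A\<^esub> \<le> \<parallel>\<phi> x\<parallel>\<^bsub>A\<^esub> * \<parallel>\<phi> y\<parallel>\<^bsub>A\<^esub>"
    using assms by (simp add: phi.mult phi.A.nrm_mult)
  also have "\<dots> \<le> 1 * \<parallel>\<phi> y\<parallel>\<^bsub>A\<^esub>"
    using phi.nrm_le[OF assms(1)] assms
    by (intro mult_right_mono) (simp_all add: phi.A.nrm_nonneg)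
  finally show ?thesis by simp
qed

text \<open>A combination of vertex projections from a finite set F is estimated summand by summand;
  a nonzero image of \<open>p v\<close> has norm exactly 1, so no coefficient gets lost. The factor,
  the size of F, is the same for all powers of the element and therefore disappears.\<close>

lemma isometric_bidegree_0:
  assumes "bidegree 0 0 x" shows "\<parallel>\<phi> x\<parallel>\<^bsub>A\<^esub> = \<parallel>x\<parallel>"
proof (rule phi.isometric_if_power_bounds[where D = "{x. bidegree 0 0 x}"])
  fix x assume x: "x \<in> {x. bidegree 0 0 x}" "x\<^sup>\<star> = x"
  then have xl: "bidegree 0 0 x" by simp
  obtain F where F: "finite F" "F \<subseteq> verts E" "finsum B p F \<otimes> x = x"
    using bidegree_0_0[OF xl refl refl, THEN conjunct2] by blast
  have Fc: "p \<in> F \<rightarrow> carrier B" using F by auto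
  have "\<parallel>y\<parallel> \<le> real (card F) * \<parallel>\<phi> y\<parallel>\<^bsub>A\<^esub>" if y: "bidegree 0 0 y" "finsum B p F \<otimes> y = y" for y
  proof -
    have py: "\<parallel>p v \<otimes> y\<parallel> \<le> \<parallel>\<phi> y\<parallel>\<^bsub>A\<^esub>" if v: "v \<in> F" for v
    proof -
      have v': "v \<in> verts E" using v F by auto
      obtain c where c: "p v \<otimes> y = c \<odot> p v"
        using bidegree_0_0[OF y(1) refl refl, THEN conjunct1] v' by blast
      have "projection A (\<phi> (p v))"
        using v' unfolding projection_def by (simp flip: phi.mult phi.adj)
      then have "\<parallel>\<phi> (p v)\<parallel>\<^bsub>A\<^esub> = 1" using nonzero[OF v'] by (rule phi.A.nrm_projection_eq_1)
      then have "\<parallel>\<phi> (p v \<otimes> y)\<parallel>\<^bsub>A\<^esub> = cmod c"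
        using v' by (simp add: c phi.smult phi.A.nrm_smult)
      moreover have "\<parallel>p v \<otimes> y\<parallel> \<le> cmod c * 1"
        unfolding c using v' nrm_projection_le_1[OF p_projection[OF v']] by (simp add: nrm_smult mult_left_le)
      moreover have "\<parallel>\<phi> (p v \<otimes> y)\<parallel>\<^bsub>A\<^esub> \<le> \<parallel>\<phi> y\<parallel>\<^bsub>A\<^esub>"
        using v' y(1) nrm_projection_le_1[OF p_projection[OF v']] by (intro nrm_phi_mult_le) auto
      ultimately show ?thesis by simp
    qed
    have "\<parallel>y\<parallel> = \<parallel>finsum B (\<lambda>v. p v \<otimes> y) F\<parallel>"
      using finsum_mult_right[OF Fc, of y] y by (simp add: bidegree_closed)
    also have "\<dots> \<le> (\<Sum>v\<in>F. \<parallel>p v \<otimes> y\<parallel>)" using F y by (intro nrm_finsum_le) (auto intro: bidegree_closed)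
    also have "\<dots> \<le> (\<Sum>v\<in>F. \<parallel>\<phi> y\<parallel>\<^bsub>A\<^esub>)" by (intro sum_mono py)
    finally show ?thesis by simp
  qed
  then have "\<parallel>((\<lambda>y. y \<otimes> y) ^^ j) x\<parallel> \<le> real (card F) * \<parallel>\<phi> (((\<lambda>y. y \<otimes> y) ^^ j) x)\<parallel>\<^bsub>A\<^esub>" for j
    using sq_power_bidegree[OF xl] sq_power_absorb[OF bidegree_closed[OF xl] finsum_closed[OF Fc] F(3)] by blast
  moreover have "real (card F) * \<parallel>\<phi> (((\<lambda>y. y \<otimes> y) ^^ j) x)\<parallel>\<^bsub>A\<^esub>
      \<le> real (card F) * 2 ^ j * \<parallel>\<phi> (((\<lambda>y. y \<otimes> y) ^^ j) x)\<parallel>\<^bsub>A\<^esub>" for j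
  proof -
    have "((\<lambda>y. y \<otimes> y) ^^ j) x \<in> carrier B" using sq_power_bidegree[OF xl] by (rule bidegree_closed)
    then show ?thesis
      by (intro mult_right_mono) (simp_all add: phi.A.nrm_nonneg mult_le_cancel_left1)
  qed
  ultimately show "\<exists>K::real. \<forall>j::nat. \<parallel>((\<lambda>y. y \<otimes> y) ^^ j) x\<parallel> \<le> K * 2 ^ j * \<parallel>\<phi> (((\<lambda>y. y \<otimes> y) ^^ j) x)\<parallel>\<^bsub>A\<^esub>"
    by (meson order_trans)
qed (use assms in \<open>auto intro: bidegree_mult bidegree_adj\<close>)

text \<open>Let F be a finite set of first edges supporting the element x. The matrix entries
  \<open>(t b)\<^sup>\<star> \<otimes> (y \<otimes> t a)\<close> with a, b in F have lengths (n, n),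
  where \<phi> is isometric by induction. Summing them costs the square of the size of F, with the
  same F for all the powers y of x, and \<open>isometric_if_power_bounds\<close> removes the
  constant.\<close>

lemma isometric_bidegree_diag: "bidegree n n x \<Longrightarrow> \<parallel>\<phi> x\<parallel>\<^bsub>A\<^esub> = \<parallel>x\<parallel>"
proof (induction n arbitrary: x)
  case 0
  then show ?case by (rule isometric_bidegree_0)
next
  case (Suc n)
  show ?case
  proof (rule phi.isometric_if_power_bounds[where D = "{x. bidegree (Suc n) (Suc n) x}"])
    fix x assume x: "x \<in> {x. bidegree (Suc n) (Suc n) x}" "x\<^sup>\<star> = x"
    then have xl: "bidegree (Suc n) (Suc n) x" by simp
    obtain F where F: "finite F" "F \<subseteq> arcs E" "range_proj F \<otimes> x = x"
      using bidegree_support[OF xl refl] by blast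
    have Fc: "(\<lambda>a. t a \<otimes> (t a)\<^sup>\<star>) \<in> F \<rightarrow> carrier B" using F by auto
    note qc = finsum_closed[OF Fc]
    have norm_le: "\<parallel>w\<parallel> \<le> (\<Sum>a\<in>F. \<parallel>(t a)\<^sup>\<star> \<otimes> w\<parallel>)" if w: "w \<in> carrier B" "range_proj F \<otimes> w = w" for w
    proof -
      have "\<parallel>w\<parallel> = \<parallel>finsum B (\<lambda>a. t a \<otimes> (t a)\<^sup>\<star> \<otimes> w) F\<parallel>"
        using finsum_mult_right[OF Fc, of w] w by simp
      also have "\<dots> \<le> (\<Sum>a\<in>F. \<parallel>t a \<otimes> (t a)\<^sup>\<star> \<otimes> w\<parallel>)" using F w by (intro nrm_finsum_le) auto
      also have "\<dots> \<le> (\<Sum>a\<in>F. \<parallel>(t a)\<^sup>\<star> \<otimes> w\<parallel>)"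
      proof (rule sum_mono)
        fix a assume "a \<in> F"
        then have a: "a \<in> arcs E" using F by auto
        have "\<parallel>t a \<otimes> ((t a)\<^sup>\<star> \<otimes> w)\<parallel> \<le> \<parallel>t a\<parallel> * \<parallel>(t a)\<^sup>\<star> \<otimes> w\<parallel>" using a w by (intro nrm_mult) auto
        also have "\<dots> \<le> 1 * \<parallel>(t a)\<^sup>\<star> \<otimes> w\<parallel>"
          using nrm_partial_isometry_le_1[OF t_partial_isometry[OF a]] a w
          by (intro mult_right_mono) (simp_all add: nrm_nonneg)
        finally show "\<parallel>t a \<otimes> (t a)\<^sup>\<star> \<otimes> w\<parallel> \<le> \<parallel>(t a)\<^sup>\<star> \<otimes> w\<parallel>" using a w by (simp add: m_assoc)
      qed
      finally show ?thesis .
    qed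
    have bound: "\<parallel>y\<parallel> \<le> (real (card F))\<^sup>2 * \<parallel>\<phi> y\<parallel>\<^bsub>A\<^esub>"
      if y: "bidegree (Suc n) (Suc n) y" "range_proj F \<otimes> y = y" "y\<^sup>\<star> = y" for y
    proof -
      have yc: "y \<in> carrier B" using y(1) by (rule bidegree_closed)
      have entry: "\<parallel>(t b)\<^sup>\<star> \<otimes> (y \<otimes> t a)\<parallel> \<le> \<parallel>\<phi> y\<parallel>\<^bsub>A\<^esub>" if ab: "a \<in> F" "b \<in> F" for a b
      proof -
        have a: "a \<in> arcs E" and b: "b \<in> arcs E" using ab F by auto
        \<comment> \<open>\<open>bidegree_t_adj\<close> removes edges on the left only. The right
          factor \<open>t a\<close> is reached through the adjoint, which is why y is assumed
          self-adjoint.\<close>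
        have "bidegree (Suc n) n (((t a)\<^sup>\<star> \<otimes> y)\<^sup>\<star>)" using y(1) a by (intro bidegree_adj bidegree_t_adj[OF _ _ refl])
        also have "((t a)\<^sup>\<star> \<otimes> y)\<^sup>\<star> = y \<otimes> t a" using a yc y(3) by (simp add: adj_mult)
        finally have "bidegree n n ((t b)\<^sup>\<star> \<otimes> (y \<otimes> t a))" using b by (intro bidegree_t_adj[OF _ _ refl])
        then have "\<parallel>(t b)\<^sup>\<star> \<otimes> (y \<otimes> t a)\<parallel> = \<parallel>\<phi> ((t b)\<^sup>\<star> \<otimes> (y \<otimes> t a))\<parallel>\<^bsub>A\<^esub>"
          using Suc.IH by simp
        also have "\<dots> \<le> \<parallel>\<phi> (y \<otimes> t a)\<parallel>\<^bsub>A\<^esub>"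
          using a b yc nrm_partial_isometry_le_1[OF t_partial_isometry[OF b]] by (intro nrm_phi_mult_le) auto
        also have "\<dots> = \<parallel>\<phi> ((y \<otimes> t a)\<^sup>\<star>)\<parallel>\<^bsub>A\<^esub>" using a yc by (simp add: phi.adj)
        also have "(y \<otimes> t a)\<^sup>\<star> = (t a)\<^sup>\<star> \<otimes> y" using a yc y(3) by (simp add: adj_mult)
        also have "\<parallel>\<phi> ((t a)\<^sup>\<star> \<otimes> y)\<parallel>\<^bsub>A\<^esub> \<le> \<parallel>\<phi> y\<parallel>\<^bsub>A\<^esub>"
          using a yc nrm_partial_isometry_le_1[OF t_partial_isometry[OF a]] by (intro nrm_phi_mult_le) auto
        finally show ?thesis .
      qed
      have "\<parallel>y\<parallel> \<le> (\<Sum>a\<in>F. \<parallel>(t a)\<^sup>\<star> \<otimes> y\<parallel>)" by (rule norm_le[OF yc y(2)])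
      also have "\<dots> \<le> (\<Sum>a\<in>F. \<Sum>b\<in>F. \<parallel>\<phi> y\<parallel>\<^bsub>A\<^esub>)"
      proof (rule sum_mono)
        fix a assume aF: "a \<in> F"
        then have a: "a \<in> arcs E" using F by auto
        have "((t a)\<^sup>\<star> \<otimes> y)\<^sup>\<star> = y \<otimes> t a" using a yc y(3) by (simp add: adj_mult)
        then have "\<parallel>(t a)\<^sup>\<star> \<otimes> y\<parallel> = \<parallel>y \<otimes> t a\<parallel>" using nrm_adj[of "(t a)\<^sup>\<star> \<otimes> y"] a yc by simp
        \<comment> \<open>The left unit of y is also a left unit of \<open>y \<otimes> t a\<close>,
          so the expansion over F can be used a second time.\<close>
        also have "\<dots> \<le> (\<Sum>b\<in>F. \<parallel>(t b)\<^sup>\<star> \<otimes> (y \<otimes> t a)\<parallel>)"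
          using a yc y(2) qc m_assoc[of "range_proj F" y "t a"] by (intro norm_le) auto
        also have "\<dots> \<le> (\<Sum>b\<in>F. \<parallel>\<phi> y\<parallel>\<^bsub>A\<^esub>)" by (intro sum_mono entry aF)
        finally show "\<parallel>(t a)\<^sup>\<star> \<otimes> y\<parallel> \<le> (\<Sum>b\<in>F. \<parallel>\<phi> y\<parallel>\<^bsub>A\<^esub>)" .
      qed
      finally show ?thesis by (simp add: power2_eq_square)
    qed
    have "\<parallel>((\<lambda>y. y \<otimes> y) ^^ j) x\<parallel> \<le> (real (card F))\<^sup>2 * 2 ^ j * \<parallel>\<phi> (((\<lambda>y. y \<otimes> y) ^^ j) x)\<parallel>\<^bsub>A\<^esub>" for j
    proof -
      let ?y = "((\<lambda>y. y \<otimes> y) ^^ j) x"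
      have y: "bidegree (Suc n) (Suc n) ?y" "range_proj F \<otimes> ?y = ?y" "?y\<^sup>\<star> = ?y" "?y \<in> carrier B"
        using sq_power_bidegree[OF xl] sq_power_absorb[OF bidegree_closed[OF xl] qc F(3)]
          sq_power_adj[OF bidegree_closed[OF xl] x(2)] by blast+
      have "\<parallel>?y\<parallel> \<le> (real (card F))\<^sup>2 * \<parallel>\<phi> ?y\<parallel>\<^bsub>A\<^esub>" by (rule bound[OF y(1-3)])
      also have "\<dots> \<le> (real (card F))\<^sup>2 * 2 ^ j * \<parallel>\<phi> ?y\<parallel>\<^bsub>A\<^esub>"
        using y(4) by (intro mult_right_mono) (simp_all add: phi.A.nrm_nonneg mult_le_cancel_left1)
      finally show ?thesis .
    qed
    then show "\<exists>K::real. \<forall>j::nat. \<parallel>((\<lambda>y. y \<otimes> y) ^^ j) x\<parallel> \<le> K * 2 ^ j * \<parallel>\<phi> (((\<lambda>y. y \<otimes> y) ^^ j) x)\<parallel>\<^bsub>A\<^esub>"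
      by blast
  qed (use Suc.prems in \<open>auto intro: bidegree_mult bidegree_adj\<close>)
qed

text \<open>For x of lengths (n, m) the product \<open>x\<^sup>\<star> \<otimes> x\<close> has
  lengths (m, m), and the C*-identity compares the norms.\<close>

lemma isometric_homogeneous:
  assumes "homogeneous k x" shows "\<parallel>\<phi> x\<parallel>\<^bsub>A\<^esub> = \<parallel>x\<parallel>"
proof -
  obtain n m where l: "bidegree n m x" using assms by (auto simp: homogeneous_def)
  have xc: "x \<in> carrier B" using l by (rule bidegree_closed)
  have "\<parallel>\<phi> (x\<^sup>\<star> \<otimes> x)\<parallel>\<^bsub>A\<^esub> = \<parallel>x\<^sup>\<star> \<otimes> x\<parallel>"
    using bidegree_mult[OF bidegree_adj[OF l] l] by (rule isometric_bidegree_diag)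
  then have "\<parallel>\<phi> x\<parallel>\<^bsub>A\<^esub>\<^sup>2 = \<parallel>x\<parallel>\<^sup>2"
    using xc by (simp add: phi.mult phi.adj cstar_identity phi.A.cstar_identity)
  then show ?thesis using xc by (simp add: nrm_nonneg phi.A.nrm_nonneg)
qed

lemma gauge_homogeneous:
  assumes \<gamma>: "cstar_hom A A \<gamma>" and z: "cmod z = 1" and
    fix_p: "\<And>v. v \<in> verts E \<Longrightarrow> \<gamma> (\<phi> (p v)) = \<phi> (p v)" and
    rot_t: "\<And>a. a \<in> arcs E \<Longrightarrow> \<gamma> (\<phi> (t a)) = z \<odot>\<^bsub>A\<^esub> \<phi> (t a)" and x: "homogeneous k x"
  shows "\<gamma> (\<phi> x) = (z powi k) \<odot>\<^bsub>A\<^esub> \<phi> x"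
proof -
  interpret g: cstar_hom A A \<gamma> by (rule \<gamma>)
  have z0: "z \<noteq> 0" and cz: "cnj z = inverse z" using z
    by (auto simp: complex_cnj_inverse inverse_complex_def complex_eq_iff cmod_def)
  have "\<gamma> (\<phi> x) = (z powi (int n - int m)) \<odot>\<^bsub>A\<^esub> \<phi> x" if "bidegree n m x" for n m x
    using that
  proof (induction rule: bidegree.induct)
    case (vert v) then show ?case by (simp add: fix_p)
  next
    case (left a n m x)
    then show ?case using z0
      by (simp add: phi.mult g.mult rot_t phi.A.smult_m_l phi.A.smult_m_r bidegree_closed power_int_diff
          mult.commute del: of_nat_Suc flip: phi.A.smult_assoc)
  next
    case (right n m x a)
    then show ?case using z0
      by (simp add: phi.mult phi.adj g.mult g.adj rot_t phi.A.smult_m_l phi.A.smult_m_r bidegree_closed power_int_diff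
          phi.A.adj_smult cz field_simps del: of_nat_Suc flip: phi.A.smult_assoc)
  qed (auto simp: phi.add g.add phi.smult g.smult bidegree_closed phi.A.smult_r_distr mult.commute
      simp flip: phi.A.smult_assoc)
  then show ?thesis using x by (auto simp: homogeneous_def)
qed

lemma sum_roots_of_unity:
  fixes l :: int
  assumes "0 < M" "\<bar>l\<bar> < int M"
  shows "(\<Sum>j<M. (cis (2 * pi / M) ^ j) powi l) = (if l = 0 then of_nat M else 0)"
proof (cases "l = 0")
  case False
  define \<zeta> where "\<zeta> = cis (2 * pi / M) powi l"
  have \<zeta>: "\<zeta> = cis (2 * pi * l / M)" by (simp add: \<zeta>_def cis_power_int mult_ac)
  have "\<zeta> \<noteq> 1"
  proof
    assume "\<zeta> = 1"
    then have "cos (2 * pi * l / M) = 1" unfolding \<zeta> by (simp add: complex_eq_iff)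
    then obtain n :: int where "2 * pi * l / M = n * 2 * pi" by (auto simp: cos_one_2pi_int)
    then have "real_of_int l = real_of_int (n * int M)" using assms(1) by (simp add: field_simps)
    then have "l = n * int M" by linarith
    then show False using assms False by (auto simp: abs_mult)
  qed
  moreover have "\<zeta> ^ M = 1"
  proof -
    have "\<zeta> ^ M = cis (M * (2 * pi * l / M))" unfolding \<zeta> by (simp add: Complex.DeMoivre)
    also have "M * (2 * pi * l / M) = 2 * pi * l" using assms(1) by simp
    finally have "\<zeta> ^ M = cis (2 * pi * l)" .
    then show ?thesis by (simp add: cis_multiple_2pi)
  qed
  ultimately have "(\<Sum>j<M. \<zeta> ^ j) = 0" by (simp add: geometric_sum)
  moreover have "(cis (2 * pi / M) ^ j) powi l = \<zeta> ^ j" for j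
    by (simp add: \<zeta>_def power_int_power power_int_power' mult.commute)
  ultimately show ?thesis using False by simp
qed simp

text \<open>Averaging the gauge action over roots of unity of large order isolates one component.\<close>

lemma nrm_component_le:
  assumes f: "\<And>k. homogeneous k (f k)" and x: "x = finsum B f {- int d..int d}" and l: "\<bar>l\<bar> \<le> int d"
  shows "\<parallel>f l\<parallel> \<le> \<parallel>\<phi> x\<parallel>\<^bsub>A\<^esub>"
proof -
  \<comment> \<open>Differences of two degrees between -d and d have absolute value at most 2d, so
    roots of unity of order 2d + 1 separate all of these degrees.\<close>
  define M where "M = 2 * d + 1"
  define \<omega> where "\<omega> = cis (2 * pi / M)"
  have M: "0 < M" by (simp add: M_def)
  have \<omega>: "cmod (\<omega> ^ j) = 1" for j by (simp add: \<omega>_def norm_power)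
  have "\<exists>\<gamma>. cstar_hom A A \<gamma> \<and> (\<forall>v\<in>verts E. \<gamma> (\<phi> (p v)) = \<phi> (p v)) \<and>
      (\<forall>a\<in>arcs E. \<gamma> (\<phi> (t a)) = (\<omega> ^ j) \<odot>\<^bsub>A\<^esub> \<phi> (t a))" for j
    using gauge[OF \<omega>[of j]] phi.A.cstar_algebra_axioms
    by (auto simp: cstar_hom_def cstar_hom_axioms_def)
  then obtain \<gamma> where \<gamma>: "\<And>j. cstar_hom A A (\<gamma> j)"
    "\<And>j v. v \<in> verts E \<Longrightarrow> \<gamma> j (\<phi> (p v)) = \<phi> (p v)"
    "\<And>j a. a \<in> arcs E \<Longrightarrow> \<gamma> j (\<phi> (t a)) = (\<omega> ^ j) \<odot>\<^bsub>A\<^esub> \<phi> (t a)" by metis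
  have \<gamma>c: "\<gamma> j w \<in> carrier A" "\<parallel>\<gamma> j w\<parallel>\<^bsub>A\<^esub> \<le> \<parallel>w\<parallel>\<^bsub>A\<^esub>" if "w \<in> carrier A" for j w
    using cstar_hom.closed[OF \<gamma>(1)] cstar_hom.nrm_le[OF \<gamma>(1)] that by auto
  \<comment> \<open>The weights of a Fourier coefficient. The averaged map \<open>\<Phi>\<close>
    keeps degree l and kills the other degrees up to d; it is contractive because the M weights have
    modulus 1/M.\<close>
  define c where "c j = inverse (of_nat M) * (\<omega> ^ j) powi (- l)" for j
  have nc: "cmod (c j) = inverse (real M)" for j
    using \<omega> by (simp add: c_def norm_mult norm_inverse norm_power_int)
  define \<Phi> where "\<Phi> w = finsum A (\<lambda>j. c j \<odot>\<^bsub>A\<^esub> \<gamma> j w) {..<M}" for w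
  have \<Phi>_le: "\<parallel>\<Phi> w\<parallel>\<^bsub>A\<^esub> \<le> \<parallel>w\<parallel>\<^bsub>A\<^esub>" if w: "w \<in> carrier A" for w
  proof -
    have "\<parallel>\<Phi> w\<parallel>\<^bsub>A\<^esub> \<le> (\<Sum>j<M. \<parallel>c j \<odot>\<^bsub>A\<^esub> \<gamma> j w\<parallel>\<^bsub>A\<^esub>)"
      unfolding \<Phi>_def using w \<gamma>c(1) by (intro phi.A.nrm_finsum_le) auto
    also have "\<dots> \<le> (\<Sum>j<M. inverse (real M) * \<parallel>w\<parallel>\<^bsub>A\<^esub>)"
      using w \<gamma>c by (intro sum_mono) (simp add: phi.A.nrm_smult nc mult_left_mono)
    also have "\<dots> = \<parallel>w\<parallel>\<^bsub>A\<^esub>" using M by simp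
    finally show ?thesis .
  qed
  have \<Phi>_c: "\<Phi> w \<in> carrier A" if "w \<in> carrier A" for w
    unfolding \<Phi>_def using that \<gamma>c(1) by (intro phi.A.finsum_closed) auto
  have \<Phi>_add: "\<Phi> (w \<oplus>\<^bsub>A\<^esub> w') = \<Phi> w \<oplus>\<^bsub>A\<^esub> \<Phi> w'" if w: "w \<in> carrier A" "w' \<in> carrier A" for w w'
  proof -
    have "\<Phi> (w \<oplus>\<^bsub>A\<^esub> w') = finsum A (\<lambda>j. c j \<odot>\<^bsub>A\<^esub> \<gamma> j w \<oplus>\<^bsub>A\<^esub> c j \<odot>\<^bsub>A\<^esub> \<gamma> j w') {..<M}"
      unfolding \<Phi>_def using w \<gamma>c(1) cstar_hom.add[OF \<gamma>(1)]
      by (intro phi.A.finsum_cong') (auto simp: phi.A.smult_r_distr)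
    also have "\<dots> = \<Phi> w \<oplus>\<^bsub>A\<^esub> \<Phi> w'"
      unfolding \<Phi>_def using w \<gamma>c(1) by (intro phi.A.finsum_addf) auto
    finally show ?thesis .
  qed
  have \<Phi>_0: "\<Phi> \<zero>\<^bsub>A\<^esub> = \<zero>\<^bsub>A\<^esub>"
    unfolding \<Phi>_def using cstar_hom.zero[OF \<gamma>(1)] by simp
  have \<Phi>_sum: "\<Phi> (finsum A g I) = finsum A (\<lambda>k. \<Phi> (g k)) I" if "finite I" "g \<in> I \<rightarrow> carrier A" for g :: "int \<Rightarrow> 'a" and I
    using that
  proof (induction I)
    case (insert i I)
    then have "g i \<in> carrier A" "g \<in> I \<rightarrow> carrier A" by auto
    with insert show ?case by (simp add: phi.A.finsum_insert \<Phi>_add \<Phi>_c phi.A.finsum_closed Pi_iff)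
  qed (simp add: \<Phi>_0)
  have \<Phi>_f: "\<Phi> (\<phi> (f k)) = (if k = l then \<phi> (f l) else \<zero>\<^bsub>A\<^esub>)" if k: "\<bar>k\<bar> \<le> int d" for k
  proof -
    have fk: "\<phi> (f k) \<in> carrier A" using f by auto
    have \<omega>0: "\<omega> \<noteq> 0" by (simp add: \<omega>_def)
    have "\<Phi> (\<phi> (f k)) = finsum A (\<lambda>j. (inverse (of_nat M) * (\<omega> ^ j) powi (k - l)) \<odot>\<^bsub>A\<^esub> \<phi> (f k)) {..<M}"
      unfolding \<Phi>_def
    proof (intro phi.A.finsum_cong' refl)
      fix j
      have "\<gamma> j (\<phi> (f k)) = ((\<omega> ^ j) powi k) \<odot>\<^bsub>A\<^esub> \<phi> (f k)"
        by (rule gauge_homogeneous[OF \<gamma>(1) \<omega> \<gamma>(2,3) f])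
      moreover have "c j * (\<omega> ^ j) powi k = inverse (of_nat M) * (\<omega> ^ j) powi (k - l)"
        using \<omega>0 by (simp add: c_def power_int_diff power_int_minus field_simps)
      ultimately show "c j \<odot>\<^bsub>A\<^esub> \<gamma> j (\<phi> (f k)) = (inverse (of_nat M) * (\<omega> ^ j) powi (k - l)) \<odot>\<^bsub>A\<^esub> \<phi> (f k)"
        using fk by (simp flip: phi.A.smult_assoc)
    qed (use fk in auto)
    also have "\<dots> = (inverse (of_nat M) * (\<Sum>j<M. (\<omega> ^ j) powi (k - l))) \<odot>\<^bsub>A\<^esub> \<phi> (f k)"
      using fk by (simp add: phi.A.finsum_smult_left sum_distrib_left)
    also have "(\<Sum>j<M. (\<omega> ^ j) powi (k - l)) = (if k - l = 0 then of_nat M else 0)"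
      unfolding \<omega>_def using M k l by (intro sum_roots_of_unity) (auto simp: M_def)
    finally show ?thesis using fk M f[of l] by simp
  qed
  have fc: "f \<in> {- int d..int d} \<rightarrow> carrier B" using f by auto
  have "\<Phi> (\<phi> x) = finsum A (\<lambda>k. \<Phi> (\<phi> (f k))) {- int d..int d}"
    unfolding x phi.finsum[OF fc] using fc by (intro \<Phi>_sum) auto
  also have "\<dots> = \<Phi> (\<phi> (f l))"
    using l f by (intro phi.A.finsum_single) (auto simp: \<Phi>_f intro!: \<Phi>_c)
  also have "\<dots> = \<phi> (f l)" using l by (simp add: \<Phi>_f)
  finally have "\<parallel>\<phi> (f l)\<parallel>\<^bsub>A\<^esub> \<le> \<parallel>\<phi> x\<parallel>\<^bsub>A\<^esub>"
    using \<Phi>_le[of "\<phi> x"] finsum_closed[OF fc] x by auto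
  then show ?thesis using isometric_homogeneous[OF f[of l]] by simp
qed

lemma sq_power_degree: "degree_le d x \<Longrightarrow> degree_le (2 ^ j * d) (((\<lambda>y. y \<otimes> y) ^^ j) x)"
proof (induction j)
  case (Suc j)
  then show ?case
    using degree_le_mult[of "2 ^ j * d" "((\<lambda>y. y \<otimes> y) ^^ j) x" "2 ^ j * d" "((\<lambda>y. y \<otimes> y) ^^ j) x"]
    by (simp add: mult_2 algebra_simps)
qed simp

text \<open>An element of degree at most d has 2d + 1 components, each bounded by the norm of the
  image. Its 2^j-th power has degree at most 2^j d, and the constant 2 * 2^j d + 1 is at most (2d +
  1) 2^j, the growth that \<open>isometric_if_power_bounds\<close> admits.\<close>

lemma isometric_degree_le:
  assumes "degree_le d x" shows "\<parallel>\<phi> x\<parallel>\<^bsub>A\<^esub> = \<parallel>x\<parallel>"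
proof (rule phi.isometric_if_power_bounds[where D = "{x. \<exists>d. degree_le d x}"])
  have bound: "\<parallel>y\<parallel> \<le> (2 * real d + 1) * \<parallel>\<phi> y\<parallel>\<^bsub>A\<^esub>" if y: "degree_le d y" for d y
  proof -
    obtain f where f: "\<And>k. homogeneous k (f k)" "y = finsum B f {- int d..int d}"
      using degree_le_decompose[OF y] by blast
    have "\<parallel>y\<parallel> \<le> (\<Sum>k\<in>{- int d..int d}. \<parallel>f k\<parallel>)"
      unfolding f(2) using f(1) by (intro nrm_finsum_le) auto
    also have "\<dots> \<le> (\<Sum>k\<in>{- int d..int d}. \<parallel>\<phi> y\<parallel>\<^bsub>A\<^esub>)"
      using f by (intro sum_mono nrm_component_le) auto
    also have "\<dots> = (2 * real d + 1) * \<parallel>\<phi> y\<parallel>\<^bsub>A\<^esub>" by simp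
    finally show ?thesis .
  qed
  fix x assume "x \<in> {x. \<exists>d. degree_le d x}"
  then obtain d where d: "degree_le d x" by blast
  have "\<parallel>((\<lambda>y. y \<otimes> y) ^^ j) x\<parallel> \<le> (2 * real d + 1) * 2 ^ j * \<parallel>\<phi> (((\<lambda>y. y \<otimes> y) ^^ j) x)\<parallel>\<^bsub>A\<^esub>" for j
  proof -
    let ?y = "((\<lambda>y. y \<otimes> y) ^^ j) x"
    have yd: "degree_le (2 ^ j * d) ?y" using d by (rule sq_power_degree)
    have "\<parallel>?y\<parallel> \<le> (2 * real (2 ^ j * d) + 1) * \<parallel>\<phi> ?y\<parallel>\<^bsub>A\<^esub>" by (rule bound[OF yd])
    also have "\<dots> \<le> (2 * real d + 1) * 2 ^ j * \<parallel>\<phi> ?y\<parallel>\<^bsub>A\<^esub>"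
      using degree_le_closed[OF yd]
      by (intro mult_right_mono) (simp_all add: phi.A.nrm_nonneg algebra_simps)
    finally show ?thesis .
  qed
  then show "\<exists>K::real. \<forall>j::nat. \<parallel>((\<lambda>y. y \<otimes> y) ^^ j) x\<parallel> \<le> K * 2 ^ j * \<parallel>\<phi> (((\<lambda>y. y \<otimes> y) ^^ j) x)\<parallel>\<^bsub>A\<^esub>"
    by blast
qed (use assms in \<open>auto intro: degree_le_mult degree_le_adj\<close>)

text \<open>The elements of finite degree form a *-subalgebra containing the generators, so they are
  dense; both norms are continuous because \<phi> is contractive.\<close>

lemma isometric:
  assumes gen: "cstar_generated_by B (p ` verts E \<union> t ` arcs E)" and x: "x \<in> carrier B"
  shows "\<parallel>\<phi> x\<parallel>\<^bsub>A\<^esub> = \<parallel>x\<parallel>"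
proof -
  define D where "D = {x. \<exists>d. degree_le d x}"
  have D: "D \<subseteq> carrier B" by (auto simp: D_def)
  have bidegree_D: "y \<in> D" if "bidegree n m y" for n m y
  proof -
    have "homogeneous (int n - int m) y" using that by (auto simp: homogeneous_def)
    then have "degree_le (n + m) y" by (rule degree_le.hom) auto
    then show ?thesis by (auto simp: D_def)
  qed
  have pD: "p v \<in> D" if "v \<in> verts E" for v using that by (intro bidegree_D) (rule bidegree.vert)
  have tD: "t a \<in> D" if a: "a \<in> arcs E" for a
  proof -
    have "t a \<otimes> p (tail E a) = t a" using a t_partial[OF a] by (simp add: m_assoc flip: t_adj_t)
    then show ?thesis using bidegree.left[OF a bidegree.vert[of "tail E a"]] a bidegree_D by simp
  qed
  have addD: "y \<oplus> w \<in> D" if yw: "y \<in> D" "w \<in> D" for y w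
  proof -
    obtain d d' where "degree_le d y" "degree_le d' w" using yw unfolding D_def by blast
    then have "degree_le (max d d') y" "degree_le (max d d') w" by (auto elim: degree_le_mono)
    then show ?thesis unfolding D_def by (auto intro: degree_le.add)
  qed
  have "cstar_subalgebra B (seq_closure D)"
  proof (rule cstar_subalgebra_seq_closure[OF D, where R = UNIV])
    show "\<zero> \<in> D" by (rule bidegree_D) (rule bidegree.zero)
    show "\<exists>r::nat \<Rightarrow> complex. (\<forall>n. r n \<in> UNIV) \<and> r \<longlonglongrightarrow> c" for c by (intro exI[of _ "\<lambda>_. c"]) simp
  qed (use addD in \<open>auto simp: D_def intro: degree_le_mult degree_le_adj degree_le_smult\<close>)
  moreover have "p ` verts E \<union> t ` arcs E \<subseteq> seq_closure D"
    using subset_seq_closure[OF D] pD tD by auto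
  ultimately have "seq_closure D = carrier B" using gen by (auto simp: cstar_generated_by_def)
  then have cl: "\<exists>y\<in>D. \<parallel>x \<ominus> y\<parallel> < \<epsilon>" if "\<epsilon> > 0" for \<epsilon>
    using seq_closure_iff[OF D x] x that by blast
  have "\<parallel>x\<parallel> \<le> \<parallel>\<phi> x\<parallel>\<^bsub>A\<^esub>"
  proof (rule field_le_epsilon)
    fix \<epsilon> :: real assume "0 < \<epsilon>"
    then obtain y where y: "y \<in> D" "\<parallel>x \<ominus> y\<parallel> < \<epsilon> / 2" using cl[of "\<epsilon> / 2"] by auto
    have yc: "y \<in> carrier B" using y D by auto
    have "\<parallel>x\<parallel> \<le> \<parallel>x \<ominus> y\<parallel> + \<parallel>y\<parallel>" by (rule nrm_le_diff_add[OF x yc])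
    also have "\<parallel>y\<parallel> = \<parallel>\<phi> y\<parallel>\<^bsub>A\<^esub>" using y(1) isometric_degree_le by (auto simp: D_def)
    also have "\<dots> \<le> \<parallel>\<phi> y \<ominus>\<^bsub>A\<^esub> \<phi> x\<parallel>\<^bsub>A\<^esub> + \<parallel>\<phi> x\<parallel>\<^bsub>A\<^esub>"
      using x yc by (intro phi.A.nrm_le_diff_add) auto
    also have "\<phi> y \<ominus>\<^bsub>A\<^esub> \<phi> x = \<phi> (y \<ominus> x)" using x yc by (simp add: phi.diff)
    also have "\<parallel>\<phi> (y \<ominus> x)\<parallel>\<^bsub>A\<^esub> \<le> \<parallel>y \<ominus> x\<parallel>" using x yc by (intro phi.nrm_le) auto
    also have "\<dots> = \<parallel>x \<ominus> y\<parallel>" by (rule nrm_diff_commute[OF yc x])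
    finally show "\<parallel>x\<parallel> \<le> \<parallel>\<phi> x\<parallel>\<^bsub>A\<^esub> + \<epsilon>" using y(2) by simp
  qed
  then show ?thesis using phi.nrm_le[OF x] by simp
qed

end

section \<open>Bounded operators on square-summable families\<close>

lemma summable_on_real_comparison:
  fixes f g :: "'i \<Rightarrow> real"
  assumes "g summable_on I" "\<And>i. i \<in> I \<Longrightarrow> \<bar>f i\<bar> \<le> g i"
  shows "f summable_on I"
proof -
  have "(\<lambda>i. norm (g i)) summable_on I" using assms(1) summable_on_iff_abs_summable_on_real by blast
  moreover have "norm (f i) \<le> norm (g i)" if "i \<in> I" for i using assms(2)[OF that] by simp
  ultimately have "(\<lambda>i. norm (f i)) summable_on I" by (rule Infinite_Sum.abs_summable_on_comparison_test)
  then show ?thesis by (rule abs_summable_summable)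
qed

text \<open>The inner product on the complex numbers is the real one, the real part of z times the
  conjugate of w. The space thus becomes a real Hilbert space, to which the theory of bounded linear
  maps applies, and complex scalars act through the separate map \<open>ell2_scale\<close>.\<close>

typedef 'i ell2 = "{x :: 'i \<Rightarrow> complex. (\<lambda>i. x i \<bullet> x i) summable_on UNIV}"
  morphisms ell2_nth Abs_ell2
  by (rule exI[of _ "\<lambda>_. 0"]) simp

lemma ell2_summable: "(\<lambda>i. ell2_nth x i \<bullet> ell2_nth x i) summable_on UNIV"
  using ell2_nth[of x] by simp

lemma ell2_nth_Abs:
  "(\<lambda>i. f i \<bullet> f i) summable_on UNIV \<Longrightarrow> ell2_nth (Abs_ell2 f) = f"
  by (simp add: Abs_ell2_inverse)

lemma ell2_eqI: "(\<And>i. ell2_nth x i = ell2_nth y i) \<Longrightarrow> x = y"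
  by (metis ell2_nth_inject ext)

lemma abs_inner_le: "\<bar>a \<bullet> b\<bar> \<le> (a \<bullet> a + b \<bullet> b) / 2" for a b :: complex
proof -
  have "0 \<le> (a - b) \<bullet> (a - b)" "0 \<le> (a + b) \<bullet> (a + b)" by (rule inner_ge_zero)+
  then show ?thesis by (simp add: inner_diff inner_add inner_commute)
qed

lemma ell2_inner_summable: "(\<lambda>i. ell2_nth x i \<bullet> ell2_nth y i) summable_on I"
proof (rule summable_on_subset_banach[OF _ subset_UNIV], rule summable_on_real_comparison)
  show "(\<lambda>i. (ell2_nth x i \<bullet> ell2_nth x i + ell2_nth y i \<bullet> ell2_nth y i) * (1/2)) summable_on UNIV"
    by (intro summable_on_cmult_left summable_on_add ell2_summable)
qed (use abs_inner_le in \<open>simp add: field_simps\<close>)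

lemma ell2_summable_scale:
  "(\<lambda>i. (c * ell2_nth x i) \<bullet> (c * ell2_nth x i)) summable_on UNIV"
proof -
  have "(c * z) \<bullet> (c * z) = (cmod c)\<^sup>2 * (z \<bullet> z)" for z
    by (simp add: dot_square_norm norm_mult power_mult_distrib)
  then show ?thesis by (simp add: summable_on_cmult_right ell2_summable)
qed

lemma ell2_summable_add:
  "(\<lambda>i. (ell2_nth x i + ell2_nth y i) \<bullet> (ell2_nth x i + ell2_nth y i)) summable_on UNIV"
proof -
  have "(\<lambda>i. ell2_nth x i \<bullet> ell2_nth x i + 2 * (ell2_nth x i \<bullet> ell2_nth y i) + ell2_nth y i \<bullet> ell2_nth y i) summable_on UNIV"
    by (intro summable_on_add summable_on_cmult_right ell2_inner_summable)
  then show ?thesis by (simp add: inner_add inner_commute algebra_simps)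
qed

definition ell2_scale :: "complex \<Rightarrow> 'i ell2 \<Rightarrow> 'i ell2" where
  "ell2_scale c x = Abs_ell2 (\<lambda>i. c * ell2_nth x i)"

lemma ell2_nth_scale [simp]: "ell2_nth (ell2_scale c x) i = c * ell2_nth x i"
  unfolding ell2_scale_def by (subst ell2_nth_Abs[OF ell2_summable_scale]) (rule refl)

instantiation ell2 :: (type) real_inner
begin

definition "0 = Abs_ell2 (\<lambda>_. 0)"
definition "x + y = Abs_ell2 (\<lambda>i. ell2_nth x i + ell2_nth y i)"
definition "- x = ell2_scale (- 1) x" for x :: "'a ell2"
definition "x - y = x + - y" for x y :: "'a ell2"
definition "r *\<^sub>R x = ell2_scale (complex_of_real r) x" for x :: "'a ell2"
definition "inner x y = (\<Sum>\<^sub>\<infinity>i. ell2_nth x i \<bullet> ell2_nth y i)"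
definition "norm x = sqrt (inner x x)" for x :: "'a ell2"
definition "dist x y = norm (x - y)" for x y :: "'a ell2"
definition "sgn x = inverse (norm x) *\<^sub>R x" for x :: "'a ell2"
definition "(uniformity :: ('a ell2 \<times> 'a ell2) filter) = (INF e\<in>{0<..}. principal {(x, y). dist x y < e})"
definition "open U \<longleftrightarrow> (\<forall>x\<in>U. eventually (\<lambda>(x', y). x' = x \<longrightarrow> y \<in> U) uniformity)" for U :: "'a ell2 set"

lemma ell2_nth_zero [simp]: "ell2_nth 0 i = 0"
  unfolding zero_ell2_def by (subst ell2_nth_Abs) auto

lemma ell2_nth_add [simp]: "ell2_nth (x + y) i = ell2_nth x i + ell2_nth y i"
  unfolding plus_ell2_def by (subst ell2_nth_Abs[OF ell2_summable_add]) (rule refl)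

lemma ell2_nth_uminus [simp]: "ell2_nth (- x) i = - ell2_nth x i"
  by (simp add: uminus_ell2_def)

lemma ell2_nth_diff [simp]: "ell2_nth (x - y) i = ell2_nth x i - ell2_nth y i"
  by (simp add: minus_ell2_def)

lemma ell2_nth_scaleR [simp]: "ell2_nth (r *\<^sub>R x) i = r *\<^sub>R ell2_nth x i"
  by (simp add: scaleR_ell2_def scaleR_conv_of_real)

instance
proof
  fix x y z :: "'a ell2" and r :: real
  show "inner x y = inner y x" by (simp add: inner_ell2_def inner_commute)
  show "inner (x + y) z = inner x z + inner y z"
    by (simp add: inner_ell2_def inner_add_left infsum_add ell2_inner_summable)
  show "inner (r *\<^sub>R x) y = r * inner x y"
    by (simp add: inner_ell2_def infsum_cmult_right')
  show "0 \<le> inner x x" by (simp add: inner_ell2_def infsum_nonneg)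
  show "inner x x = 0 \<longleftrightarrow> x = 0"
  proof
    assume "inner x x = 0"
    then have "ell2_nth x i \<bullet> ell2_nth x i = 0" for i
      using nonneg_infsum_le_0D[OF _ ell2_summable, of x i] by (simp add: inner_ell2_def)
    then show "x = 0" by (intro ell2_eqI) simp
  qed (simp add: inner_ell2_def)
qed (auto simp: norm_ell2_def dist_ell2_def sgn_ell2_def uniformity_ell2_def open_ell2_def minus_ell2_def
    algebra_simps intro!: ell2_eqI)

end

lemma ell2_norm_sq: "(norm x)\<^sup>2 = (\<Sum>\<^sub>\<infinity>i. ell2_nth x i \<bullet> ell2_nth x i)"
  by (metis dot_square_norm inner_ell2_def)

lemma norm_ell2_nth_le: "cmod (ell2_nth x i) \<le> norm x"
proof -
  have "(\<Sum>j\<in>{i}. ell2_nth x j \<bullet> ell2_nth x j) \<le> (norm x)\<^sup>2"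
    unfolding ell2_norm_sq by (intro finite_sum_le_infsum ell2_summable) auto
  then have "(cmod (ell2_nth x i))\<^sup>2 \<le> (norm x)\<^sup>2" by (simp add: dot_square_norm)
  then show ?thesis by (rule power2_le_imp_le) simp
qed

instance ell2 :: (type) banach
proof
  fix X :: "nat \<Rightarrow> 'a ell2"
  assume X: "Cauchy X"
  have "Cauchy (\<lambda>n. ell2_nth (X n) i)" for i
  proof (rule CauchyI)
    fix e :: real assume "0 < e"
    then obtain M where "\<forall>m\<ge>M. \<forall>n\<ge>M. norm (X m - X n) < e" using X CauchyD by blast
    then show "\<exists>M. \<forall>m\<ge>M. \<forall>n\<ge>M. norm (ell2_nth (X m) i - ell2_nth (X n) i) < e"
      using norm_ell2_nth_le[of "X _ - X _" i] by (metis ell2_nth_diff le_less_trans)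
  qed
  then have "\<forall>i. \<exists>c. (\<lambda>n. ell2_nth (X n) i) \<longlonglongrightarrow> c"
    by (simp add: Cauchy_convergent_iff convergent_def)
  then obtain l where "\<forall>i. (\<lambda>n. ell2_nth (X n) i) \<longlonglongrightarrow> l i" by (rule choice[THEN exE])
  then have l: "\<And>i. (\<lambda>n. ell2_nth (X n) i) \<longlonglongrightarrow> l i" by blast
  have bound: "\<exists>M. \<forall>n\<ge>M. \<forall>F. finite F \<longrightarrow> (\<Sum>i\<in>F. (ell2_nth (X n) i - l i) \<bullet> (ell2_nth (X n) i - l i)) \<le> e\<^sup>2"
    if e: "0 < e" for e :: real
  proof -
    obtain M where M: "\<And>m n. \<lbrakk>m \<ge> M; n \<ge> M\<rbrakk> \<Longrightarrow> norm (X m - X n) < e" using X CauchyD e by blast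
    have "(\<Sum>i\<in>F. (ell2_nth (X n) i - l i) \<bullet> (ell2_nth (X n) i - l i)) \<le> e\<^sup>2" if n: "n \<ge> M" and F: "finite F" for n F
    proof (rule LIMSEQ_le_const2)
      show "(\<lambda>m. \<Sum>i\<in>F. (ell2_nth (X n) i - ell2_nth (X m) i) \<bullet> (ell2_nth (X n) i - ell2_nth (X m) i)) \<longlonglongrightarrow>
          (\<Sum>i\<in>F. (ell2_nth (X n) i - l i) \<bullet> (ell2_nth (X n) i - l i))"
        by (intro tendsto_intros l)
      have "(\<Sum>i\<in>F. (ell2_nth (X n) i - ell2_nth (X m) i) \<bullet> (ell2_nth (X n) i - ell2_nth (X m) i)) \<le> e\<^sup>2" if "m \<ge> M" for m
      proof -
        have "(\<Sum>i\<in>F. ell2_nth (X n - X m) i \<bullet> ell2_nth (X n - X m) i) \<le> (norm (X n - X m))\<^sup>2"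
          unfolding ell2_norm_sq using F by (intro finite_sum_le_infsum ell2_summable) auto
        also have "\<dots> \<le> e\<^sup>2" using M[OF n that] by (intro power_mono) auto
        finally show ?thesis by simp
      qed
      then show "\<exists>N. \<forall>m\<ge>N. (\<Sum>i\<in>F. (ell2_nth (X n) i - ell2_nth (X m) i) \<bullet> (ell2_nth (X n) i - ell2_nth (X m) i)) \<le> e\<^sup>2"
        by blast
    qed
    then show ?thesis by blast
  qed
  have summ: "(\<lambda>i. (ell2_nth (X n) i - l i) \<bullet> (ell2_nth (X n) i - l i)) summable_on UNIV"
    if "\<And>F. finite F \<Longrightarrow> (\<Sum>i\<in>F. (ell2_nth (X n) i - l i) \<bullet> (ell2_nth (X n) i - l i)) \<le> e\<^sup>2" for n e
    using that by (intro nonneg_bdd_above_summable_on bdd_aboveI2) auto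
  obtain M1 where M1: "\<And>F. finite F \<Longrightarrow> (\<Sum>i\<in>F. (ell2_nth (X M1) i - l i) \<bullet> (ell2_nth (X M1) i - l i)) \<le> 1\<^sup>2"
    using bound[of 1] by auto
  \<comment> \<open>The pointwise limit l is not yet known to be square-summable, but its difference
    to the member \<open>X M1\<close> is, by the uniform bound on finite sums.\<close>
  define L where "L = X M1 - Abs_ell2 (\<lambda>i. ell2_nth (X M1) i - l i)"
  have L: "ell2_nth L i = l i" for i
    by (simp add: L_def ell2_nth_Abs[OF summ[OF M1]])
  have "X \<longlonglongrightarrow> L"
  proof (rule metric_LIMSEQ_I)
    fix r :: real assume r: "0 < r"
    obtain M where M: "\<And>n F. \<lbrakk>n \<ge> M; finite F\<rbrakk> \<Longrightarrow>
        (\<Sum>i\<in>F. (ell2_nth (X n) i - l i) \<bullet> (ell2_nth (X n) i - l i)) \<le> (r / 2)\<^sup>2"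
      using bound[of "r / 2"] r by auto
    have "dist (X n) L < r" if n: "n \<ge> M" for n
    proof -
      have "(norm (X n - L))\<^sup>2 \<le> (r / 2)\<^sup>2"
        unfolding ell2_norm_sq using M[OF n] summ[OF M[OF n]]
        by (intro infsum_le_finite_sums) (auto simp: L)
      then have "norm (X n - L) \<le> r / 2" using r by (simp add: power2_le_iff_abs_le)
      then show ?thesis using r by (simp add: dist_norm)
    qed
    then show "\<exists>no. \<forall>n\<ge>no. dist (X n) L < r" by blast
  qed
  then show "convergent X" by (rule convergentI)
qed

lemma ell2_scale_simps:
  "ell2_scale c (x + y) = ell2_scale c x + ell2_scale c y"
  "ell2_scale (c + d) x = ell2_scale c x + ell2_scale d x"
  "ell2_scale c (ell2_scale d x) = ell2_scale (c * d) x"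
  "ell2_scale 1 x = x"
  "ell2_scale c (r *\<^sub>R x) = r *\<^sub>R ell2_scale c x"
  by (auto intro!: ell2_eqI simp: algebra_simps)

lemma inner_ell2_scale: "ell2_scale c x \<bullet> y = x \<bullet> ell2_scale (cnj c) y"
proof -
  have "(c * a) \<bullet> b = a \<bullet> (cnj c * b)" for a b :: complex
    by (simp add: inner_complex_def algebra_simps)
  then show ?thesis by (simp add: inner_ell2_def)
qed

lemma norm_ell2_scale: "norm (ell2_scale c x) = cmod c * norm x"
proof -
  have "(c * z) \<bullet> (c * z) = (cmod c)\<^sup>2 * (z \<bullet> z)" for z
    by (simp add: dot_square_norm norm_mult power_mult_distrib)
  then have "(norm (ell2_scale c x))\<^sup>2 = (cmod c * norm x)\<^sup>2"
    by (simp add: ell2_norm_sq infsum_cmult_right' power_mult_distrib)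
  then show ?thesis by simp
qed

section \<open>The C*-algebra of operators with adjoint\<close>

definition blin_scale :: "complex \<Rightarrow> 'i ell2 \<Rightarrow>\<^sub>L 'i ell2" where
  "blin_scale c = Blinfun (ell2_scale c)"

lemma blin_scale_apply [simp]: "blinfun_apply (blin_scale c) x = ell2_scale c x"
proof -
  have "bounded_linear (ell2_scale c :: 'i ell2 \<Rightarrow> 'i ell2)"
    by (rule bounded_linear_intro[where K = "cmod c"])
      (auto simp: ell2_scale_simps norm_ell2_scale mult.commute)
  then show ?thesis unfolding blin_scale_def by (subst bounded_linear_Blinfun_apply) simp_all
qed

definition adjoint_of :: "('i ell2 \<Rightarrow>\<^sub>L 'i ell2) \<Rightarrow> ('i ell2 \<Rightarrow>\<^sub>L 'i ell2) \<Rightarrow> bool" where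
  "adjoint_of S T \<longleftrightarrow> (\<forall>x y. S x \<bullet> y = x \<bullet> T y)"

definition complex_linear :: "('i ell2 \<Rightarrow>\<^sub>L 'i ell2) \<Rightarrow> bool" where
  "complex_linear T \<longleftrightarrow> (\<forall>c x. T (ell2_scale c x) = ell2_scale c (T x))"

definition ell2_adj :: "('i ell2 \<Rightarrow>\<^sub>L 'i ell2) \<Rightarrow> 'i ell2 \<Rightarrow>\<^sub>L 'i ell2" where
  "ell2_adj T = (THE T'. adjoint_of T T')"

text \<open>Having an adjoint is a condition on the members, which saves a representation theorem:
  the operators used later come with explicit adjoints. The adjoint refers to the real inner
  product; for a complex linear map it is the usual one.\<close>

definition ell2_operators :: "('i ell2 \<Rightarrow>\<^sub>L 'i ell2) cstar" where
  "ell2_operators = cstar.make {T. complex_linear T \<and> (\<exists>T'. adjoint_of T T')}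
     (\<lambda>S T. S o\<^sub>L T) id_blinfun 0 (+) (\<lambda>c T. blin_scale c o\<^sub>L T) ell2_adj norm"

lemma adjoint_of_sym: "adjoint_of S T \<Longrightarrow> adjoint_of T S"
  unfolding adjoint_of_def by (metis inner_commute)

lemma ell2_adj_eq:
  assumes "adjoint_of S T" shows "ell2_adj S = T"
  unfolding ell2_adj_def
proof (rule the_equality)
  show "adjoint_of S T" by (rule assms)
  fix T' assume "adjoint_of S T'"
  then have "x \<bullet> T' y = x \<bullet> T y" for x y using assms by (metis adjoint_of_def)
  then show "T' = T" by (intro blinfun_eqI) (metis vector_eq_ldot)
qed

lemma adjoint_of_complex_linear: 
  assumes "adjoint_of S T" "complex_linear S" shows "complex_linear T"
  unfolding complex_linear_def
proof (intro allI)
  fix c y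
  have "x \<bullet> T (ell2_scale c y) = x \<bullet> ell2_scale c (T y)" for x
    using assms unfolding adjoint_of_def complex_linear_def
    by (metis complex_cnj_cnj inner_ell2_scale)
  then show "T (ell2_scale c y) = ell2_scale c (T y)" using vector_eq_ldot by blast
qed

lemma adjoint_of_norm_le: 
  assumes "adjoint_of S T" shows "norm T \<le> norm S"
proof (rule norm_blinfun_bound)
  fix y
  have "(norm (T y))\<^sup>2 = S (T y) \<bullet> y" using assms by (simp add: adjoint_of_def dot_square_norm)
  also have "\<dots> \<le> norm (S (T y)) * norm y" by (rule norm_cauchy_schwarz)
  also have "\<dots> \<le> (norm S * norm (T y)) * norm y" by (intro mult_right_mono norm_blinfun) auto
  finally show "norm (T y) \<le> norm S * norm y"
    by (cases "norm (T y) = 0") (auto simp: power2_eq_square mult_ac)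
qed simp

lemma adjoint_of_norm: "adjoint_of S T \<Longrightarrow> norm T = norm S"
  using adjoint_of_norm_le adjoint_of_sym by (metis antisym)

lemma adjoint_of_norm_sq:
  assumes "adjoint_of S T" shows "norm (T o\<^sub>L S) = (norm S)\<^sup>2"
proof (rule antisym)
  show "norm (T o\<^sub>L S) \<le> (norm S)\<^sup>2"
    using norm_blinfun_compose[of T S] adjoint_of_norm[OF assms] by (simp add: power2_eq_square)
  have "norm S \<le> sqrt (norm (T o\<^sub>L S))"
  proof (rule norm_blinfun_bound)
    fix x
    have "(norm (S x))\<^sup>2 = x \<bullet> (T o\<^sub>L S) x" using assms by (simp add: adjoint_of_def dot_square_norm[symmetric])
    also have "\<dots> \<le> norm x * norm ((T o\<^sub>L S) x)" by (rule norm_cauchy_schwarz)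
    also have "\<dots> \<le> norm x * (norm (T o\<^sub>L S) * norm x)" by (intro mult_left_mono norm_blinfun) auto
    finally have "(norm (S x))\<^sup>2 \<le> (sqrt (norm (T o\<^sub>L S)) * norm x)\<^sup>2"
      by (simp add: power_mult_distrib power2_eq_square mult_ac)
    then show "norm (S x) \<le> sqrt (norm (T o\<^sub>L S)) * norm x" by (rule power2_le_imp_le) simp
  qed simp
  then have "(norm S)\<^sup>2 \<le> (sqrt (norm (T o\<^sub>L S)))\<^sup>2" by (intro power_mono) auto
  then show "(norm S)\<^sup>2 \<le> norm (T o\<^sub>L S)" by simp
qed

lemma adjoint_of_ops:
  "adjoint_of 0 0"
  "\<lbrakk>adjoint_of S S'; adjoint_of T T'\<rbrakk> \<Longrightarrow> adjoint_of (S + T) (S' + T')"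
  "\<lbrakk>adjoint_of S S'; adjoint_of T T'\<rbrakk> \<Longrightarrow> adjoint_of (S o\<^sub>L T) (T' o\<^sub>L S')"
  "\<lbrakk>adjoint_of S S'; complex_linear S\<rbrakk> \<Longrightarrow> adjoint_of (blin_scale c o\<^sub>L S) (blin_scale (cnj c) o\<^sub>L S')"
  subgoal by (simp add: adjoint_of_def)
  subgoal by (simp add: adjoint_of_def blinfun.add_left inner_add)
  subgoal by (simp add: adjoint_of_def)
  subgoal premises prems
  proof -
    have "complex_linear S'" using adjoint_of_complex_linear prems by blast
    then show ?thesis using prems
      by (simp add: adjoint_of_def complex_linear_def inner_ell2_scale)
  qed
  done

lemma complex_linear_ops:
  "complex_linear 0"
  "\<lbrakk>complex_linear S; complex_linear T\<rbrakk> \<Longrightarrow> complex_linear (S + T)"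
  "\<lbrakk>complex_linear S; complex_linear T\<rbrakk> \<Longrightarrow> complex_linear (S o\<^sub>L T)"
  "complex_linear S \<Longrightarrow> complex_linear (blin_scale c o\<^sub>L S)"
  unfolding complex_linear_def
  by (auto simp: blinfun.add_left ell2_scale_simps mult.commute intro!: ell2_eqI)

lemma complex_linear_limit:
  assumes "\<And>n. complex_linear (S n)" "S \<longlonglongrightarrow> T" shows "complex_linear T"
  unfolding complex_linear_def
proof (intro allI)
  fix c x
  have *: "(\<lambda>n. S n y) \<longlonglongrightarrow> T y" for y by (intro tendsto_intros assms)
  have "(\<lambda>n. blin_scale c (S n x)) \<longlonglongrightarrow> blin_scale c (T x)" by (intro tendsto_intros assms)
  then have "(\<lambda>n. S n (ell2_scale c x)) \<longlonglongrightarrow> ell2_scale c (T x)"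
    using assms(1) by (simp add: complex_linear_def)
  then show "T (ell2_scale c x) = ell2_scale c (T x)" using * LIMSEQ_unique by blast
qed

lemma adjoint_of_limit:
  assumes "\<And>n. adjoint_of (S n) (S' n)" "S \<longlonglongrightarrow> T" "S' \<longlonglongrightarrow> T'" shows "adjoint_of T T'"
  unfolding adjoint_of_def
proof (intro allI)
  fix x y
  have "(\<lambda>n. S n x \<bullet> y) \<longlonglongrightarrow> T x \<bullet> y" by (intro tendsto_intros assms)
  moreover have "(\<lambda>n. x \<bullet> S' n y) \<longlonglongrightarrow> x \<bullet> T' y" by (intro tendsto_intros assms)
  ultimately show "T x \<bullet> y = x \<bullet> T' y"
    using assms(1) by (simp add: adjoint_of_def LIMSEQ_unique)
qed

lemma ell2_operators_sel:
  "T \<in> carrier ell2_operators \<longleftrightarrow> complex_linear T \<and> (\<exists>T'. adjoint_of T T')"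
  "S \<otimes>\<^bsub>ell2_operators\<^esub> T = S o\<^sub>L T" "\<zero>\<^bsub>ell2_operators\<^esub> = 0" "S \<oplus>\<^bsub>ell2_operators\<^esub> T = S + T"
  "c \<odot>\<^bsub>ell2_operators\<^esub> T = blin_scale c o\<^sub>L T" "T\<^sup>\<star>\<^bsub>ell2_operators\<^esub> = ell2_adj T"
  "\<parallel>T\<parallel>\<^bsub>ell2_operators\<^esub> = norm T"
  by (simp_all add: ell2_operators_def cstar.defs)

lemma cstar_algebra_ell2_operators: "cstar_algebra (ell2_operators :: ('i ell2 \<Rightarrow>\<^sub>L 'i ell2) cstar)"
proof -
  let ?A = "ell2_operators :: ('i ell2 \<Rightarrow>\<^sub>L 'i ell2) cstar"
  note sel = ell2_operators_sel
  have neg: "- S = blin_scale (-1) o\<^sub>L S" for S :: "'i ell2 \<Rightarrow>\<^sub>L 'i ell2"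
    by (auto intro!: blinfun_eqI ell2_eqI simp: blinfun.minus_left)
  have negc: "- S \<in> carrier ?A" if "S \<in> carrier ?A" for S
    using that unfolding neg sel by (auto intro: adjoint_of_ops complex_linear_ops)
  have ag: "abelian_group ?A"
  proof (rule abelian_groupI)
    fix x assume "x \<in> carrier ?A"
    then show "\<exists>y\<in>carrier ?A. y \<oplus>\<^bsub>?A\<^esub> x = \<zero>\<^bsub>?A\<^esub>"
      by (intro bexI[of _ "- x"] negc) (simp_all add: sel)
  qed (auto simp: sel add_ac intro: adjoint_of_ops complex_linear_ops)
  interpret A: abelian_group ?A by (rule ag)
  have minus: "x \<ominus>\<^bsub>?A\<^esub> y = x - y" if "x \<in> carrier ?A" "y \<in> carrier ?A" for x y
  proof -
    have "\<ominus>\<^bsub>?A\<^esub> y = - y"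
      using that negc by (intro A.minus_equality) (auto simp: sel(3,4))
    then show ?thesis by (simp add: a_minus_def sel(4))
  qed
  have adj: "adjoint_of T (ell2_adj T)" if "T \<in> carrier ?A" for T
    using that ell2_adj_eq unfolding sel by blast
  show ?thesis
  proof (intro cstar_algebra.intro[OF ag] cstar_algebra_axioms.intro)
    fix \<sigma> :: "nat \<Rightarrow> 'i ell2 \<Rightarrow>\<^sub>L 'i ell2"
    assume \<sigma>: "\<And>n. \<sigma> n \<in> carrier ?A"
      and C: "\<And>\<epsilon>. 0 < \<epsilon> \<Longrightarrow> \<exists>N. \<forall>m\<ge>N. \<forall>n\<ge>N. \<parallel>\<sigma> m \<ominus>\<^bsub>?A\<^esub> \<sigma> n\<parallel>\<^bsub>?A\<^esub> < \<epsilon>"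
    have C1: "Cauchy \<sigma>"
      by (rule CauchyI) (use C in \<open>simp add: minus[OF \<sigma> \<sigma>] sel(7)\<close>)
    \<comment> \<open>Taking adjoints preserves norms of differences, so the adjoints are a Cauchy
      sequence as well, and their limit is the adjoint of the limit.\<close>
    have *: "adjoint_of (\<sigma> m - \<sigma> n) (ell2_adj (\<sigma> m) - ell2_adj (\<sigma> n))" for m n
      using adj[OF \<sigma>] by (simp add: adjoint_of_def blinfun.diff_left inner_diff)
    have C2: "Cauchy (\<lambda>n. ell2_adj (\<sigma> n))"
      using C1 unfolding Cauchy_def dist_norm adjoint_of_norm[OF *] .
    obtain T T' where T: "\<sigma> \<longlonglongrightarrow> T" and T': "(\<lambda>n. ell2_adj (\<sigma> n)) \<longlonglongrightarrow> T'"
      using C1 C2 by (auto simp: Cauchy_convergent_iff convergent_def)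
    have "adjoint_of T T'" by (rule adjoint_of_limit[OF adj[OF \<sigma>] T T'])
    moreover have "complex_linear T" using \<sigma> by (intro complex_linear_limit[OF _ T]) (simp add: sel)
    ultimately have Tc: "T \<in> carrier ?A" by (auto simp: sel)
    have "(\<lambda>n. norm (\<sigma> n - T)) \<longlonglongrightarrow> 0" using T by (simp add: LIM_zero_iff tendsto_norm_zero_iff)
    then show "\<exists>x\<in>carrier ?A. (\<lambda>n. \<parallel>\<sigma> n \<ominus>\<^bsub>?A\<^esub> x\<parallel>\<^bsub>?A\<^esub>) \<longlonglongrightarrow> 0"
      using Tc \<sigma> by (intro bexI[of _ T]) (simp_all add: minus sel(7))
  next
    fix x y and c :: complex assume x: "x \<in> carrier ?A"
    show "(c \<odot>\<^bsub>?A\<^esub> x)\<^sup>\<star>\<^bsub>?A\<^esub> = cnj c \<odot>\<^bsub>?A\<^esub> x\<^sup>\<star>\<^bsub>?A\<^esub>"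
      using x adjoint_of_ops(4)[OF adj[OF x]] by (simp add: sel ell2_adj_eq)
    show "x\<^sup>\<star>\<^bsub>?A\<^esub> \<in> carrier ?A"
      using x adj[OF x] adjoint_of_sym adjoint_of_complex_linear unfolding sel by blast
    show "(x\<^sup>\<star>\<^bsub>?A\<^esub>)\<^sup>\<star>\<^bsub>?A\<^esub> = x"
      using adj[OF x] adjoint_of_sym ell2_adj_eq unfolding sel by blast
    show "\<parallel>x\<^sup>\<star>\<^bsub>?A\<^esub> \<otimes>\<^bsub>?A\<^esub> x\<parallel>\<^bsub>?A\<^esub> = \<parallel>x\<parallel>\<^bsub>?A\<^esub>\<^sup>2"
      using adjoint_of_norm_sq[OF adj[OF x]] by (simp add: sel)
    show "\<parallel>c \<odot>\<^bsub>?A\<^esub> x\<parallel>\<^bsub>?A\<^esub> = cmod c * \<parallel>x\<parallel>\<^bsub>?A\<^esub>"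
    proof -
      have "norm (blin_scale c o\<^sub>L x) \<le> cmod c * norm x" for c and x :: "'i ell2 \<Rightarrow>\<^sub>L 'i ell2"
        by (rule norm_blinfun_bound)
          (auto simp: norm_ell2_scale mult.assoc intro: mult_left_mono norm_blinfun)
      note le = this
      have "cmod c * norm x \<le> norm (blin_scale c o\<^sub>L x)"
      proof (cases "c = 0")
        case False
        have "x = blin_scale (inverse c) o\<^sub>L (blin_scale c o\<^sub>L x)"
          using False by (auto intro!: blinfun_eqI ell2_eqI)
        then have "norm x \<le> inverse (cmod c) * norm (blin_scale c o\<^sub>L x)"
          using le[of "inverse c" "blin_scale c o\<^sub>L x"] by (simp add: norm_inverse)
        then show ?thesis using False by (simp add: field_simps)
      qed simp
      then show ?thesis using le[of c x] by (simp add: sel)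
    qed
    show "c \<odot>\<^bsub>?A\<^esub> x \<in> carrier ?A" using x unfolding sel by (auto intro: adjoint_of_ops complex_linear_ops)
    assume y: "y \<in> carrier ?A"
    show "x \<otimes>\<^bsub>?A\<^esub> y \<in> carrier ?A" using x y unfolding sel by (auto intro: adjoint_of_ops complex_linear_ops)
    show "(x \<oplus>\<^bsub>?A\<^esub> y)\<^sup>\<star>\<^bsub>?A\<^esub> = x\<^sup>\<star>\<^bsub>?A\<^esub> \<oplus>\<^bsub>?A\<^esub> y\<^sup>\<star>\<^bsub>?A\<^esub>"
      using adjoint_of_ops(2)[OF adj[OF x] adj[OF y]] by (simp add: sel ell2_adj_eq)
    show "(x \<otimes>\<^bsub>?A\<^esub> y)\<^sup>\<star>\<^bsub>?A\<^esub> = y\<^sup>\<star>\<^bsub>?A\<^esub> \<otimes>\<^bsub>?A\<^esub> x\<^sup>\<star>\<^bsub>?A\<^esub>"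
      using adjoint_of_ops(3)[OF adj[OF x] adj[OF y]] by (simp add: sel ell2_adj_eq)
    show "x \<otimes>\<^bsub>?A\<^esub> (c \<odot>\<^bsub>?A\<^esub> y) = c \<odot>\<^bsub>?A\<^esub> (x \<otimes>\<^bsub>?A\<^esub> y)"
      using x by (auto intro!: blinfun_eqI simp: sel complex_linear_def)
  qed (auto simp: sel norm_triangle_ineq norm_blinfun_compose blinfun.add_left blinfun.add_right
      ell2_scale_simps intro!: blinfun_eqI)
qed


section \<open>Partial bijections and the partial isometries they induce\<close>

definition pinj :: "('i \<Rightarrow> 'i option) \<Rightarrow> bool" where
  "pinj q \<longleftrightarrow> (\<forall>i i' j. q i = Some j \<longrightarrow> q i' = Some j \<longrightarrow> i = i')"

definition pinv :: "('i \<Rightarrow> 'i option) \<Rightarrow> 'i \<Rightarrow> 'i option" where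
  "pinv q j = (if \<exists>i. q i = Some j then Some (THE i. q i = Some j) else None)"

definition partial_id :: "'i set \<Rightarrow> 'i \<Rightarrow> 'i option" where
  "partial_id S = (\<lambda>i. if i \<in> S then Some i else None)"

lemma pinv_iff: 
  assumes "pinj q" shows "pinv q j = Some i \<longleftrightarrow> q i = Some j"
proof -
  have "(THE i. q i = Some j) = i" if "q i = Some j" for i
    using that assms unfolding pinj_def by (intro the_equality) blast+
  then show ?thesis by (auto simp: pinv_def)
qed

lemma pinvI:
  assumes "\<And>i j. q i = Some j \<longleftrightarrow> r j = Some i"
  shows "pinj q" "pinv q = r"
proof -
  show q: "pinj q" unfolding pinj_def using assms by (metis option.inject)
  have "pinv q j = Some i \<longleftrightarrow> r j = Some i" for i j using assms pinv_iff[OF q] by simp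
  then show "pinv q = r" by (metis ext option.exhaust)
qed

lemma pinj_pinv: 
  assumes "pinj q" shows "pinj (pinv q)"
  unfolding pinj_def pinv_iff[OF assms] by auto

lemma pinj_map_comp: "pinj q \<Longrightarrow> pinj r \<Longrightarrow> pinj (r \<circ>\<^sub>m q)"
  unfolding pinj_def by (auto simp: map_comp_Some_iff)

lemma pinj_partial_id: "pinj (partial_id S)" and pinv_partial_id [simp]: "pinv (partial_id S) = partial_id S"
proof -
  have "partial_id S i = Some j \<longleftrightarrow> partial_id S j = Some i" for i j
    by (auto simp: partial_id_def)
  then show "pinj (partial_id S)" "pinv (partial_id S) = partial_id S" by (fact pinvI)+
qed

lemma map_comp_pinv:
  assumes "pinj q"
  shows "pinv q \<circ>\<^sub>m q = partial_id (dom q)" "q \<circ>\<^sub>m pinv q = partial_id (ran q)"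
proof -
  show "pinv q \<circ>\<^sub>m q = partial_id (dom q)"
    by (rule ext) (auto simp: map_comp_def partial_id_def dom_def pinv_iff[OF assms] split: option.splits)
  have "(q \<circ>\<^sub>m pinv q) j = partial_id (ran q) j" for j
  proof (cases "pinv q j")
    case None
    then have "j \<notin> ran q" using pinv_iff[OF assms, of j] by (auto simp: ran_def)
    then show ?thesis using None by (simp add: partial_id_def map_comp_def)
  next
    case (Some i)
    then have "q i = Some j" by (simp add: pinv_iff[OF assms])
    then show ?thesis using Some by (auto simp: partial_id_def map_comp_def ran_def)
  qed
  then show "q \<circ>\<^sub>m pinv q = partial_id (ran q)" by blast
qed

lemma partial_id_comp: "partial_id S \<circ>\<^sub>m partial_id T = partial_id (S \<inter> T)"
  by (auto simp: partial_id_def map_comp_def fun_eq_iff)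

text \<open>Precomposition with \<open>q\<close>, extended by zero: the basis vector at j goes to
  the one at the unique i with \<open>q i = Some j\<close>. Hence products reverse composition, the
  range projection belongs to \<open>dom q\<close> and the source projection to
  \<open>ran q\<close>.\<close>

definition pull :: "('i \<Rightarrow> 'i option) \<Rightarrow> 'i ell2 \<Rightarrow> 'i ell2" where
  "pull q x = Abs_ell2 (\<lambda>i. case q i of None \<Rightarrow> 0 | Some j \<Rightarrow> ell2_nth x j)"

lemma bij_betw_pinj:
  assumes "pinj q" shows "bij_betw (the \<circ> q) (dom q) (dom (pinv q))"
  by (rule bij_betw_byWitness[where f' = "the \<circ> pinv q"])
    (auto simp: pinv_iff[OF assms] dom_def; metis option.sel pinv_iff[OF assms])+

lemma ell2_pull:
  fixes x :: "'i ell2"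
  assumes q: "pinj q"
  defines "f \<equiv> (\<lambda>i. case q i of None \<Rightarrow> 0 | Some j \<Rightarrow> ell2_nth x j)"
  shows "(\<lambda>i. f i \<bullet> f i) summable_on UNIV" "(\<Sum>\<^sub>\<infinity>i. f i \<bullet> f i) \<le> (norm x)\<^sup>2"
proof -
  let ?g = "\<lambda>j. ell2_nth x j \<bullet> ell2_nth x j"
  have gs: "?g summable_on dom (pinv q)"
    by (rule summable_on_subset_banach[OF ell2_summable subset_UNIV])
  have "(\<lambda>i. f i \<bullet> f i) summable_on UNIV \<longleftrightarrow> (\<lambda>i. ?g ((the \<circ> q) i)) summable_on dom q"
    by (rule summable_on_cong_neutral) (auto simp: f_def split: option.splits)
  then show "(\<lambda>i. f i \<bullet> f i) summable_on UNIV"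
    using summable_on_reindex_bij_betw[OF bij_betw_pinj[OF q], of ?g] gs by simp
  have "(\<Sum>\<^sub>\<infinity>i. f i \<bullet> f i) = infsum (\<lambda>i. ?g ((the \<circ> q) i)) (dom q)"
    by (rule infsum_cong_neutral) (auto simp: f_def split: option.splits)
  also have "\<dots> = infsum ?g (dom (pinv q))" by (rule infsum_reindex_bij_betw[OF bij_betw_pinj[OF q]])
  also have "\<dots> \<le> infsum ?g UNIV" by (rule infsum_mono2[OF gs ell2_summable]) auto
  finally show "(\<Sum>\<^sub>\<infinity>i. f i \<bullet> f i) \<le> (norm x)\<^sup>2" by (simp add: ell2_norm_sq)
qed

lemma ell2_nth_pull:
  assumes "pinj q"
  shows "ell2_nth (pull q x) i = (case q i of None \<Rightarrow> 0 | Some j \<Rightarrow> ell2_nth x j)"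
  unfolding pull_def by (subst ell2_nth_Abs[OF ell2_pull(1)[OF assms]]) (rule refl)

lemma norm_pull_le:
  assumes "pinj q" shows "norm (pull q x) \<le> norm x"
proof -
  have "(norm (pull q x))\<^sup>2 \<le> (norm x)\<^sup>2"
    unfolding ell2_norm_sq[of "pull q x"] ell2_nth_pull[OF assms] by (rule ell2_pull(2)[OF assms])
  then show ?thesis by (rule power2_le_imp_le) simp
qed

lemma inner_pull:
  assumes q: "pinj q" shows "pull q x \<bullet> y = x \<bullet> pull (pinv q) y"
proof -
  let ?f = "\<lambda>j. ell2_nth x j \<bullet> ell2_nth y (the (pinv q j))"
  have "pull q x \<bullet> y = infsum (\<lambda>i. ?f ((the \<circ> q) i)) (dom q)"
    unfolding inner_ell2_def ell2_nth_pull[OF q]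
    by (rule infsum_cong_neutral) (auto simp: pinv_iff[OF q, THEN iffD2] split: option.splits)
  also have "\<dots> = infsum ?f (dom (pinv q))" by (rule infsum_reindex_bij_betw[OF bij_betw_pinj[OF q]])
  also have "\<dots> = x \<bullet> pull (pinv q) y"
    unfolding inner_ell2_def ell2_nth_pull[OF pinj_pinv[OF q]]
    by (rule infsum_cong_neutral) (auto split: option.splits)
  finally show ?thesis .
qed

definition pull_op :: "('i \<Rightarrow> 'i option) \<Rightarrow> 'i ell2 \<Rightarrow>\<^sub>L 'i ell2" where
  "pull_op q = Blinfun (pull q)"

lemma pull_op_apply:
  assumes q: "pinj q" shows "blinfun_apply (pull_op q) x = pull q x"
proof -
  have "bounded_linear (pull q)"
    by (rule bounded_linear_intro[where K = 1])
      (auto simp: ell2_nth_pull[OF q] norm_pull_le[OF q] intro!: ell2_eqI split: option.splits)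
  then show ?thesis unfolding pull_op_def by (subst bounded_linear_Blinfun_apply) simp_all
qed

lemma adjoint_of_pull_op: "pinj q \<Longrightarrow> adjoint_of (pull_op q) (pull_op (pinv q))"
  by (simp add: adjoint_of_def pull_op_apply pinj_pinv inner_pull)

lemma pull_op_closed: "pinj q \<Longrightarrow> pull_op q \<in> carrier ell2_operators"
  using adjoint_of_pull_op unfolding ell2_operators_sel complex_linear_def
  by (auto simp: pull_op_apply ell2_nth_pull intro!: ell2_eqI split: option.splits)

lemma pull_op_adj: "pinj q \<Longrightarrow> (pull_op q)\<^sup>\<star>\<^bsub>ell2_operators\<^esub> = pull_op (pinv q)"
  by (simp add: ell2_operators_sel ell2_adj_eq adjoint_of_pull_op)

lemma pull_op_mult:
  "pinj q \<Longrightarrow> pinj r \<Longrightarrow> pull_op q \<otimes>\<^bsub>ell2_operators\<^esub> pull_op r = pull_op (r \<circ>\<^sub>m q)"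
  unfolding ell2_operators_sel
  by (intro blinfun_eqI ell2_eqI)
    (simp add: pull_op_apply pinj_map_comp ell2_nth_pull, simp add: map_comp_def ell2_nth_pull split: option.splits)

lemma pull_op_empty: "pull_op (partial_id {}) = \<zero>\<^bsub>ell2_operators\<^esub>"
  unfolding ell2_operators_sel
  by (intro blinfun_eqI ell2_eqI)
    (simp add: pull_op_apply pinj_partial_id ell2_nth_pull, simp add: partial_id_def)

lemma pull_op_add:
  "S \<inter> T = {} \<Longrightarrow> pull_op (partial_id S) \<oplus>\<^bsub>ell2_operators\<^esub> pull_op (partial_id T) = pull_op (partial_id (S \<union> T))"
  unfolding ell2_operators_sel
  by (intro blinfun_eqI ell2_eqI)
    (simp add: pull_op_apply pinj_partial_id ell2_nth_pull blinfun.add_left, auto simp: partial_id_def)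

lemma pull_op_nonzero:
  assumes q: "pinj q" "q i = Some j" shows "pull_op q \<noteq> \<zero>\<^bsub>ell2_operators\<^esub>"
proof
  assume "pull_op q = \<zero>\<^bsub>ell2_operators\<^esub>"
  then have "pull q x = 0" for x using pull_op_apply[OF q(1), of x] by (simp add: ell2_operators_sel)
  then have *: "ell2_nth x j = 0" for x using ell2_nth_pull[OF q(1), of x i] q(2) by simp
  define f where "f k = (if k = j then 1 else 0 :: complex)" for k
  have "(\<lambda>k. f k \<bullet> f k) summable_on UNIV \<longleftrightarrow> (\<lambda>k. f k \<bullet> f k) summable_on {j}"
    by (rule summable_on_cong_neutral) (auto simp: f_def)
  then have "(\<lambda>k. f k \<bullet> f k) summable_on UNIV" by simp
  then have "ell2_nth (Abs_ell2 f) j = 1" by (simp add: ell2_nth_Abs) (simp add: f_def)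
  then show False using * by simp
qed

lemma pull_op_finsum:
  assumes "finite I" "\<And>k l. \<lbrakk>k \<in> I; l \<in> I; k \<noteq> l\<rbrakk> \<Longrightarrow> S k \<inter> S l = {}"
  shows "finsum ell2_operators (\<lambda>k. pull_op (partial_id (S k))) I = pull_op (partial_id (\<Union>k\<in>I. S k))"
proof -
  interpret cstar_algebra ell2_operators by (rule cstar_algebra_ell2_operators)
  show ?thesis using assms
  proof (induction I)
    case empty then show ?case by (simp add: pull_op_empty)
  next
    case (insert k I)
    have "S k \<inter> (\<Union>k\<in>I. S k) = {}" using insert.prems insert.hyps by blast
    then show ?case using insert
      by (subst finsum_insert) (auto simp: pull_op_closed pinj_partial_id pull_op_add)
  qed
qed

lemma partial_isometry_pull_op: "pinj q \<Longrightarrow> partial_isometry ell2_operators (pull_op q)"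
proof -
  assume q: "pinj q"
  have "q \<circ>\<^sub>m partial_id (dom q) = q" by (auto simp: fun_eq_iff map_comp_def partial_id_def dom_def)
  then show ?thesis using q unfolding partial_isometry_def
    by (simp add: pull_op_closed pull_op_adj pull_op_mult pinj_pinv pinj_map_comp map_comp_pinv pinj_partial_id)
qed

lemma projection_pull_op: "projection ell2_operators (pull_op (partial_id S))"
  by (simp add: projection_def pull_op_closed pinj_partial_id pull_op_mult partial_id_comp pull_op_adj)

section \<open>Paths in a graph of groups\<close>

locale graph_of_groups_setup =
  fixes \<G> :: "('v, 'e, 'g, 'h) gog" and \<Sigma> :: "'e \<Rightarrow> 'g set"
  assumes gog: "graph_of_groups \<G>"
    and locally_finite: "locally_finite \<G>"
    and nonsingular: "nonsingular \<G>"
    and countable_groups: "countable_groups \<G>"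
    and transversals: "transversals \<G> \<Sigma>"
begin

sublocale bidirected_digraph "gr \<G>" "bar \<G>"
  using gog by (simp add: graph_of_groups_def)

abbreviation edges :: "'e set" where "edges \<equiv> arcs (gr \<G>)"
abbreviation G :: "'v \<Rightarrow> 'g monoid" where "G \<equiv> vgrp \<G>"
abbreviation Ge :: "'e \<Rightarrow> 'h monoid" where "Ge \<equiv> egrp \<G>"
abbreviation r :: "'e \<Rightarrow> 'v" where "r \<equiv> head (gr \<G>)"
abbreviation s :: "'e \<Rightarrow> 'v" where "s \<equiv> tail (gr \<G>)"
abbreviation \<alpha> :: "'e \<Rightarrow> 'h \<Rightarrow> 'g" where "\<alpha> \<equiv> emb \<G>"
abbreviation ebar :: "'e \<Rightarrow> 'e" where "ebar \<equiv> bar \<G>"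

lemma G_group: "x \<in> verts (gr \<G>) \<Longrightarrow> group (G x)"
  and Ge_group: "e \<in> edges \<Longrightarrow> group (Ge e)"
  and Ge_bar [simp]: "e \<in> edges \<Longrightarrow> Ge (ebar e) = Ge e"
  and \<alpha>_mon: "e \<in> edges \<Longrightarrow> \<alpha> e \<in> mon (Ge e) (G (r e))"
  using gog by (auto simp: graph_of_groups_def)

lemma Gr_group: "e \<in> edges \<Longrightarrow> group (G (r e))"
  and Gs_group: "e \<in> edges \<Longrightarrow> group (G (s e))"
  by (simp_all add: G_group)

lemma \<alpha>_closed: "\<lbrakk>e \<in> edges; k \<in> carrier (Ge e)\<rbrakk> \<Longrightarrow> \<alpha> e k \<in> carrier (G (r e))"
  and \<alpha>_mult: "\<lbrakk>e \<in> edges; k \<in> carrier (Ge e); l \<in> carrier (Ge e)\<rbrakk> \<Longrightarrow>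
    \<alpha> e (k \<otimes>\<^bsub>Ge e\<^esub> l) = \<alpha> e k \<otimes>\<^bsub>G (r e)\<^esub> \<alpha> e l"
  and \<alpha>_inj: "e \<in> edges \<Longrightarrow> inj_on (\<alpha> e) (carrier (Ge e))"
  using \<alpha>_mon by (auto simp: mon_def hom_def Pi_iff)

lemma \<alpha>_group_hom: "e \<in> edges \<Longrightarrow> group_hom (Ge e) (G (r e)) (\<alpha> e)"
  using \<alpha>_mon[of e] Ge_group[of e] Gr_group[of e]
  by (simp add: group_hom_def group_hom_axioms_def mon_def)

lemma \<alpha>_one: "e \<in> edges \<Longrightarrow> \<alpha> e \<one>\<^bsub>Ge e\<^esub> = \<one>\<^bsub>G (r e)\<^esub>"
  using group_hom.hom_one[OF \<alpha>_group_hom] by blast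

lemma \<alpha>_inv: "\<lbrakk>e \<in> edges; k \<in> carrier (Ge e)\<rbrakk> \<Longrightarrow> \<alpha> e (inv\<^bsub>Ge e\<^esub> k) = inv\<^bsub>G (r e)\<^esub> \<alpha> e k"
  using group_hom.hom_inv[OF \<alpha>_group_hom] by blast

lemma \<Sigma>_closed: "\<lbrakk>e \<in> edges; h \<in> \<Sigma> e\<rbrakk> \<Longrightarrow> h \<in> carrier (G (r e))"
  and \<Sigma>_one: "e \<in> edges \<Longrightarrow> \<one>\<^bsub>G (r e)\<^esub> \<in> \<Sigma> e"
  and \<Sigma>_unique: "\<lbrakk>e \<in> edges; C \<in> edge_cosets \<G> e\<rbrakk> \<Longrightarrow> \<exists>!h. h \<in> \<Sigma> e \<and> h \<in> C"
  using transversals by (auto simp: transversals_def)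

definition coset :: "'e \<Rightarrow> 'g \<Rightarrow> 'g set" where
  "coset e g = {g \<otimes>\<^bsub>G (r e)\<^esub> \<alpha> e k | k. k \<in> carrier (Ge e)}"

lemma edge_cosets_eq: "edge_cosets \<G> e = coset e ` carrier (G (r e))"
  by (auto simp: edge_cosets_def coset_def LCOSETS_def l_coset_def)

lemma self_in_coset:
  assumes "e \<in> edges" "g \<in> carrier (G (r e))" shows "g \<in> coset e g"
proof -
  interpret group "G (r e)" by (rule Gr_group[OF assms(1)])
  interpret E: group "Ge e" by (rule Ge_group[OF assms(1)])
  have "g = g \<otimes>\<^bsub>G (r e)\<^esub> \<alpha> e \<one>\<^bsub>Ge e\<^esub>" using assms \<alpha>_one by simp
  then show ?thesis unfolding coset_def by blast
qed

lemma \<Sigma>_decompose: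
  assumes e: "e \<in> edges" and g: "g \<in> carrier (G (r e))"
  shows "\<exists>h\<in>\<Sigma> e. \<exists>k\<in>carrier (Ge e). g = h \<otimes>\<^bsub>G (r e)\<^esub> \<alpha> e k"
proof -
  interpret group "G (r e)" by (rule Gr_group[OF e])
  interpret E: group "Ge e" by (rule Ge_group[OF e])
  have "coset e g \<in> edge_cosets \<G> e" using g by (simp add: edge_cosets_eq)
  then obtain h where h: "h \<in> \<Sigma> e" "h \<in> coset e g" using \<Sigma>_unique[OF e] by blast
  then obtain k where k: "k \<in> carrier (Ge e)" "h = g \<otimes>\<^bsub>G (r e)\<^esub> \<alpha> e k" by (auto simp: coset_def)
  have "h \<otimes>\<^bsub>G (r e)\<^esub> \<alpha> e (inv\<^bsub>Ge e\<^esub> k) = g"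
    using k g e by (simp add: \<alpha>_inv \<alpha>_closed m_assoc)
  then show ?thesis using h(1) k(1) by (metis E.inv_closed)
qed

text \<open>Uniqueness of the normal form whose existence is \<open>\<Sigma>_decompose\<close>: the
  two representatives lie in one coset and hence agree, and then injectivity of \<alpha> settles the
  second factors.\<close>

lemma \<Sigma>_cancel:
  assumes e: "e \<in> edges" and h: "h \<in> \<Sigma> e" "h' \<in> \<Sigma> e" and k: "k \<in> carrier (Ge e)" "k' \<in> carrier (Ge e)"
    and eq: "h \<otimes>\<^bsub>G (r e)\<^esub> \<alpha> e k = h' \<otimes>\<^bsub>G (r e)\<^esub> \<alpha> e k'"
  shows "h = h' \<and> k = k'"
proof -
  interpret group "G (r e)" by (rule Gr_group[OF e])
  interpret E: group "Ge e" by (rule Ge_group[OF e])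
  note hc = \<Sigma>_closed[OF e h(1)] \<Sigma>_closed[OF e h(2)]
  note kc = \<alpha>_closed[OF e k(1)] \<alpha>_closed[OF e k(2)]
  have "h' = h \<otimes>\<^bsub>G (r e)\<^esub> \<alpha> e (k \<otimes>\<^bsub>Ge e\<^esub> inv\<^bsub>Ge e\<^esub> k')"
    using eq hc kc k e by (simp add: \<alpha>_mult \<alpha>_inv flip: m_assoc) (simp add: m_assoc)
  then have "h' \<in> coset e h" using k unfolding coset_def by blast
  moreover have "coset e h \<in> edge_cosets \<G> e" using hc by (simp add: edge_cosets_eq)
  ultimately have "h = h'" using \<Sigma>_unique[OF e] self_in_coset[OF e hc(1)] h by blast
  then have "\<alpha> e k = \<alpha> e k'" using eq hc kc by simp
  then show ?thesis using \<open>h = h'\<close> \<alpha>_inj[OF e] k by (auto simp: inj_on_def)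
qed

lemma finite_\<Sigma>: 
  assumes e: "e \<in> edges" shows "finite (\<Sigma> e)"
proof -
  have "inj_on (coset e) (\<Sigma> e)"
  proof (rule inj_onI)
    fix h h' assume h: "h \<in> \<Sigma> e" "h' \<in> \<Sigma> e" "coset e h = coset e h'"
    have "coset e h \<in> edge_cosets \<G> e" using \<Sigma>_closed[OF e h(1)] by (simp add: edge_cosets_eq)
    moreover have "h \<in> coset e h" "h' \<in> coset e h"
      using self_in_coset[OF e] \<Sigma>_closed[OF e] h by auto
    ultimately show "h = h'" using \<Sigma>_unique[OF e] h by blast
  qed
  moreover have "coset e ` \<Sigma> e \<subseteq> edge_cosets \<G> e" using \<Sigma>_closed[OF e] by (auto simp: edge_cosets_eq)
  ultimately show ?thesis
    using locally_finite e by (meson finite_imageD finite_subset locally_finite_def)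
qed

definition star :: "'v \<Rightarrow> ('g \<times> 'e) set" where
  "star x = {(h, f). f \<in> edges \<and> r f = x \<and> h \<in> \<Sigma> f}"

text \<open>The index set of (G4) and at the same time the set of letters that may come after
  \<open>e\<close> in a path. This coincidence makes the Cuntz--Krieger sums of the path digraph
  instances of (G4).\<close>

definition follow :: "'e \<Rightarrow> ('g \<times> 'e) set" where
  "follow e = {(h, f). f \<in> edges \<and> r f = s e \<and> h \<in> \<Sigma> f \<and> (h, f) \<noteq> (\<one>\<^bsub>G (s e)\<^esub>, ebar e)}"

lemma follow_eq: "follow e = star (s e) - {(\<one>\<^bsub>G (s e)\<^esub>, ebar e)}"
  by (auto simp: follow_def star_def)

lemma finite_star: 
  assumes "x \<in> verts (gr \<G>)" shows "finite (star x)"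
proof -
  have "finite {f \<in> edges. r f = x}" using locally_finite assms by (auto simp: locally_finite_def)
  then have "finite (\<Union>f\<in>{f \<in> edges. r f = x}. (\<lambda>h. (h, f)) ` \<Sigma> f)"
    using finite_\<Sigma> by (intro finite_UN_I) auto
  moreover have "star x = (\<Union>f\<in>{f \<in> edges. r f = x}. (\<lambda>h. (h, f)) ` \<Sigma> f)" by (auto simp: star_def)
  ultimately show ?thesis by simp
qed

lemma bar_in_star: "e \<in> edges \<Longrightarrow> (\<one>\<^bsub>G (s e)\<^esub>, ebar e) \<in> star (s e)"
  using \<Sigma>_one[of "ebar e"] by (simp add: star_def)

lemma finite_follow: "e \<in> edges \<Longrightarrow> finite (follow e)"
  by (simp add: follow_eq finite_star)

text \<open>The place where nonsingularity enters. If \<open>ebar e\<close> is the only edge with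
  range s(e), it has a nontrivial coset representative; otherwise another edge with that range
  follows, with the letter 1.\<close>

lemma follow_nonempty:
  assumes e: "e \<in> edges" shows "follow e \<noteq> {}"
proof (cases "{f \<in> edges. r f = s e} = {ebar e}")
  case True
  have be: "ebar e \<in> edges" "r (ebar e) = s e" using e by auto
  then have "infinite (edge_cosets \<G> (ebar e)) \<or> 1 < card (edge_cosets \<G> (ebar e))"
    using nonsingular[unfolded nonsingular_def, rule_format, of "ebar e"] True by simp
  then have card: "1 < card (edge_cosets \<G> (ebar e))"
    using locally_finite be by (auto simp: locally_finite_def)
  \<comment> \<open>If 1 were the only representative, every g would lie in the image of the edge
    group, and there would be just one coset.\<close>
  have "\<exists>h\<in>\<Sigma> (ebar e). h \<noteq> \<one>\<^bsub>G (s e)\<^esub>"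
  proof (rule ccontr)
    assume "\<not> ?thesis"
    then have one: "h = \<one>\<^bsub>G (s e)\<^esub>" if "h \<in> \<Sigma> (ebar e)" for h using that by blast
    interpret group "G (s e)" by (rule Gs_group[OF e])
    have "coset (ebar e) g = coset (ebar e) \<one>\<^bsub>G (s e)\<^esub>" if g: "g \<in> carrier (G (s e))" for g
    proof -
      obtain h k where hk: "h \<in> \<Sigma> (ebar e)" "k \<in> carrier (Ge e)" "g = h \<otimes>\<^bsub>G (s e)\<^esub> \<alpha> (ebar e) k"
        using \<Sigma>_decompose[OF be(1), of g] g be e by auto
      then have gk: "g = \<alpha> (ebar e) k" using one[OF hk(1)] \<alpha>_closed[OF be(1), of k] be e by simp
      interpret E: group "Ge e" by (rule Ge_group[OF e])
      have a: "\<alpha> (ebar e) l \<in> carrier (G (s e))" if "l \<in> carrier (Ge e)" for l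
        using \<alpha>_closed[OF be(1)] that be e by simp
      have m: "\<alpha> (ebar e) (l \<otimes>\<^bsub>Ge e\<^esub> l') = \<alpha> (ebar e) l \<otimes>\<^bsub>G (s e)\<^esub> \<alpha> (ebar e) l'"
        if "l \<in> carrier (Ge e)" "l' \<in> carrier (Ge e)" for l l'
        using \<alpha>_mult[OF be(1)] that be e by simp
      show ?thesis
      proof
        show "coset (ebar e) g \<subseteq> coset (ebar e) \<one>\<^bsub>G (s e)\<^esub>"
        proof
          fix y assume "y \<in> coset (ebar e) g"
          then obtain l where l: "l \<in> carrier (Ge e)" "y = g \<otimes>\<^bsub>G (s e)\<^esub> \<alpha> (ebar e) l"
            using be e by (auto simp: coset_def)
          then have "y = \<one>\<^bsub>G (s e)\<^esub> \<otimes>\<^bsub>G (s e)\<^esub> \<alpha> (ebar e) (k \<otimes>\<^bsub>Ge e\<^esub> l)" using a m gk hk by simp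
          then show "y \<in> coset (ebar e) \<one>\<^bsub>G (s e)\<^esub>" unfolding coset_def using be e l hk by auto
        qed
        show "coset (ebar e) \<one>\<^bsub>G (s e)\<^esub> \<subseteq> coset (ebar e) g"
        proof
          fix y assume "y \<in> coset (ebar e) \<one>\<^bsub>G (s e)\<^esub>"
          then obtain l where l: "l \<in> carrier (Ge e)" "y = \<alpha> (ebar e) l"
            using be e a by (auto simp: coset_def)
          have "y = g \<otimes>\<^bsub>G (s e)\<^esub> \<alpha> (ebar e) (inv\<^bsub>Ge e\<^esub> k \<otimes>\<^bsub>Ge e\<^esub> l)"
            using l hk gk by (simp flip: m) (simp flip: E.m_assoc)
          then show "y \<in> coset (ebar e) g" unfolding coset_def using be e l hk by auto
        qed
      qed
    qed
    then have "edge_cosets \<G> (ebar e) \<subseteq> {coset (ebar e) \<one>\<^bsub>G (s e)\<^esub>}"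
      unfolding edge_cosets_eq be(2) by blast
    then have "card (edge_cosets \<G> (ebar e)) \<le> card {coset (ebar e) \<one>\<^bsub>G (s e)\<^esub>}" by (intro card_mono) auto
    then show False using card by simp
  qed
  then show ?thesis using be by (auto simp: follow_def)
next
  case False
  have "ebar e \<in> {f \<in> edges. r f = s e}" using e by auto
  with False obtain f where "f \<in> edges" "r f = s e" "f \<noteq> ebar e" by blast
  then have "(\<one>\<^bsub>G (s e)\<^esub>, f) \<in> follow e" using \<Sigma>_one[of f] by (auto simp: follow_def)
  then show ?thesis by blast
qed

lemma gpaths_1: "gpaths \<G> \<Sigma> 1 = {[(g, e)] | g e. e \<in> edges \<and> g \<in> \<Sigma> e}"
  by (auto simp: gpaths_def length_Suc_conv)

lemma gpaths_2: "gpaths \<G> \<Sigma> 2 = {[(g, e), (h, f)] | g e h f. e \<in> edges \<and> g \<in> \<Sigma> e \<and> (h, f) \<in> follow e}"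
proof -
  have bar: "e = ebar f \<longleftrightarrow> f = ebar e" for e f by (metis arev_arev)
  have 2: "[(g, e), (h, f)] \<in> gpaths \<G> \<Sigma> 2 \<longleftrightarrow> e \<in> edges \<and> g \<in> \<Sigma> e \<and> (h, f) \<in> follow e" for g e h f
    by (auto simp: gpaths_def follow_def less_2_cases_iff bar)
  have "\<exists>g e h f. \<mu> = [(g, e), (h, f)]" if "\<mu> \<in> gpaths \<G> \<Sigma> 2" for \<mu>
  proof -
    have "length \<mu> = Suc (Suc 0)" using that by (simp add: gpaths_def)
    then show ?thesis by (auto simp: length_Suc_conv)
  qed
  then show ?thesis using 2 by blast
qed

definition EG :: "(('g \<times> 'e) list, ('g \<times> 'e) list) pre_digraph" where
  "EG = path_digraph \<G> \<Sigma>"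

lemma EG_sel [simp]:
  "verts EG = {[(g, e)] | g e. e \<in> edges \<and> g \<in> \<Sigma> e}"
  "arcs EG = {[(g, e), (h, f)] | g e h f. e \<in> edges \<and> g \<in> \<Sigma> e \<and> (h, f) \<in> follow e}"
  "tail EG = drop 1" "head EG = take 1"
  by (simp_all add: EG_def path_digraph_def gpaths_1 gpaths_2 del: One_nat_def)

lemma in_arcs_EG:
  assumes "e \<in> edges" "g \<in> \<Sigma> e"
  shows "{\<mu> \<in> arcs EG. head EG \<mu> = [(g, e)]} = (\<lambda>(h, f). [(g, e), (h, f)]) ` follow e"
  using assms by auto

lemma wf_EG: "wf_digraph EG"
  by unfold_locales (auto simp: follow_def)

lemma row_finite_EG: "row_finite EG"
  unfolding row_finite_def using in_arcs_EG finite_follow by (auto simp del: EG_sel(2-4))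

lemma no_sources_EG: "no_sources EG"
  unfolding no_sources_def
proof
  fix v assume "v \<in> verts EG"
  then obtain g e where v: "v = [(g, e)]" "e \<in> edges" "g \<in> \<Sigma> e" by auto
  then show "{\<mu> \<in> arcs EG. head EG \<mu> = v} \<noteq> {}"
    using in_arcs_EG[OF v(2,3)] follow_nonempty[OF v(2)] by simp
qed

lemma countable_EG: "countable (verts EG)" "countable (arcs EG)"
proof -
  have ce: "countable edges" using gog by (simp add: graph_of_groups_def)
  have "countable (\<Union>e\<in>edges. (\<lambda>g. [(g, e)]) ` \<Sigma> e)"
    using ce finite_\<Sigma> by (intro countable_UN countable_image) (auto intro: countable_finite)
  also have "(\<Union>e\<in>edges. (\<lambda>g. [(g, e)]) ` \<Sigma> e) = verts EG" by auto
  finally show "countable (verts EG)" .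
  have "countable (\<Union>e\<in>edges. \<Union>g\<in>\<Sigma> e. (\<lambda>hf. [(g, e), hf]) ` follow e)"
    using ce finite_\<Sigma> finite_follow by (intro countable_UN countable_image) (auto intro: countable_finite)
  also have "(\<Union>e\<in>edges. \<Union>g\<in>\<Sigma> e. (\<lambda>hf. [(g, e), hf]) ` follow e) = arcs EG" by auto
  finally show "countable (arcs EG)" .
qed


section \<open>A family of partial bijections satisfying the relations of a \<G>-family\<close>

definition rot :: "'v \<Rightarrow> 'g \<Rightarrow> 'g \<times> 'e \<times> nat \<Rightarrow> ('g \<times> 'e \<times> nat) option" where
  "rot x g = (\<lambda>(h, f, w). if f \<in> edges \<and> r f = x \<and> h \<in> carrier (G x)
     then Some (inv\<^bsub>G x\<^esub> g \<otimes>\<^bsub>G x\<^esub> h, f, w) else None)"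

text \<open>Copies of G_x under left translation, one for each edge f with range x and each number
  w. Cells of different vertices are disjoint, which is the source of (G1).\<close>

definition cell :: "'v \<Rightarrow> ('g \<times> 'e \<times> nat) set" where
  "cell x = {(h, f, w). f \<in> edges \<and> r f = x \<and> h \<in> carrier (G x)}"

definition range_cell :: "'e \<Rightarrow> ('g \<times> 'e \<times> nat) set" where
  "range_cell e = {(\<alpha> e k, e, w) | k w. k \<in> carrier (Ge e)}"

definition orbits :: "'e \<Rightarrow> ('g \<times> 'e \<times> nat) set" where
  "orbits e = {(c, f, w). f \<in> edges \<and> r f = s e \<and> c \<in> \<Sigma> (ebar e) \<and> (c, f) \<noteq> (\<one>\<^bsub>G (s e)\<^esub>, ebar e)}"

definition orbit_enum :: "'e \<Rightarrow> nat \<Rightarrow> 'g \<times> 'e \<times> nat" where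
  "orbit_enum e = (SOME \<beta>. bij_betw \<beta> UNIV (orbits e))"

text \<open>
  \<open>G\<^sub>e\<close> acts freely on the two sets that \<open>shift e\<close> has to match equivariantly, and with infinitely many
  orbits on each: those of \<open>cell (s e) - range_cell (ebar e)\<close> are indexed by \<open>orbits e\<close> via
  \<open>(\<alpha>(k)c\<^sup>-\<^sup>1, f, w) \<mapsto> (c, f, w)\<close>, and those of \<open>range_cell e\<close> by the third component. All maps here are
  the inverses of the intended ones, because \<open>pull_op\<close> is contravariant.
\<close>

definition shift :: "'e \<Rightarrow> 'g \<times> 'e \<times> nat \<Rightarrow> ('g \<times> 'e \<times> nat) option" where
  "shift e = (\<lambda>(a, f, w). if f = e \<and> a \<in> \<alpha> e ` carrier (Ge e)
     then (case orbit_enum e w of (c, f', w') \<Rightarrow>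
       Some (\<alpha> (ebar e) (inv_into (carrier (Ge e)) (\<alpha> e) a) \<otimes>\<^bsub>G (s e)\<^esub> inv\<^bsub>G (s e)\<^esub> c, f', w')) else None)"

text \<open>In \<open>orbits e\<close> the group element always comes from the transversal of
  \<open>ebar e\<close>, whereas in \<open>follow e\<close> it comes from that of f. The two agree
  when f is \<open>ebar e\<close>; for any other f the identity is available.\<close>

lemma orbits_nonempty:
  assumes e: "e \<in> edges" shows "\<exists>c f. \<forall>w. (c, f, w) \<in> orbits e"
proof -
  obtain h f where hf: "(h, f) \<in> follow e" using follow_nonempty[OF e] by auto
  show ?thesis
  proof (cases "f = ebar e")
    case True
    then show ?thesis using hf by (auto simp: follow_def orbits_def)
  next
    case False
    then have "(\<one>\<^bsub>G (s e)\<^esub>, f, w) \<in> orbits e" for w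
      using hf e \<Sigma>_one[of "ebar e"] by (auto simp: follow_def orbits_def)
    then show ?thesis by blast
  qed
qed

lemma orbit_enum: 
  assumes e: "e \<in> edges" shows "bij_betw (orbit_enum e) UNIV (orbits e)"
proof -
  obtain c f where cf: "\<And>w::nat. (c, f, w) \<in> orbits e" using orbits_nonempty[OF e] by blast
  then have "range (\<lambda>w::nat. (c, f, w)) \<subseteq> orbits e" by blast
  moreover have "infinite (range (\<lambda>w::nat. (c, f, w)))" by (intro range_inj_infinite) (auto simp: inj_def)
  ultimately have inf: "infinite (orbits e)" using finite_subset by blast
  have "countable edges" using gog by (simp add: graph_of_groups_def)
  then have "countable (\<Sigma> (ebar e) \<times> edges \<times> (UNIV :: nat set))"
    using finite_\<Sigma>[of "ebar e"] e by (intro countable_SIGMA) (auto intro: countable_finite)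
  moreover have "orbits e \<subseteq> \<Sigma> (ebar e) \<times> edges \<times> UNIV" by (auto simp: orbits_def)
  ultimately have "countable (orbits e)" using countable_subset by blast
  then have "bij_betw (from_nat_into (orbits e)) UNIV (orbits e)" using inf by (rule bij_betw_from_nat_into)
  then show ?thesis unfolding orbit_enum_def by (rule someI[where P = "\<lambda>\<beta>. bij_betw \<beta> UNIV (orbits e)"])
qed

lemma rot_iff:
  assumes "x \<in> verts (gr \<G>)" "g \<in> carrier (G x)"
  shows "rot x g i = Some j \<longleftrightarrow> rot x (inv\<^bsub>G x\<^esub> g) j = Some i"
proof -
  interpret group "G x" by (rule G_group[OF assms(1)])
  have "inv\<^bsub>G x\<^esub> g \<otimes>\<^bsub>G x\<^esub> (g \<otimes>\<^bsub>G x\<^esub> h) = h \<and> g \<otimes>\<^bsub>G x\<^esub> (inv\<^bsub>G x\<^esub> g \<otimes>\<^bsub>G x\<^esub> h) = h \<and>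
      g \<otimes>\<^bsub>G x\<^esub> h \<in> carrier (G x) \<and> inv\<^bsub>G x\<^esub> g \<otimes>\<^bsub>G x\<^esub> h \<in> carrier (G x)" if "h \<in> carrier (G x)" for h
    using that assms(2) by (simp flip: m_assoc)
  note closed = this
  obtain h f w h' f' w' where ij: "i = (h, f, w)" "j = (h', f', w')" by (metis prod_cases3)
  have "rot x g i = Some j \<longleftrightarrow> f \<in> edges \<and> r f = x \<and> h \<in> carrier (G x) \<and>
      inv\<^bsub>G x\<^esub> g \<otimes>\<^bsub>G x\<^esub> h = h' \<and> f = f' \<and> w = w'"
    by (auto simp: rot_def ij)
  also have "\<dots> \<longleftrightarrow> f' \<in> edges \<and> r f' = x \<and> h' \<in> carrier (G x) \<and> g \<otimes>\<^bsub>G x\<^esub> h' = h \<and> f' = f \<and> w' = w"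
    using closed by metis
  also have "\<dots> \<longleftrightarrow> rot x (inv\<^bsub>G x\<^esub> g) j = Some i"
    using assms(2) by (auto simp: rot_def ij)
  finally show ?thesis .
qed

lemma pinj_rot: 
  assumes "x \<in> verts (gr \<G>)" "g \<in> carrier (G x)"
  shows "pinj (rot x g)" "pinv (rot x g) = rot x (inv\<^bsub>G x\<^esub> g)"
  using pinvI[of "rot x g" "rot x (inv\<^bsub>G x\<^esub> g)"] rot_iff[OF assms] by auto

lemma rot_one: 
  assumes "x \<in> verts (gr \<G>)" shows "rot x \<one>\<^bsub>G x\<^esub> = partial_id (cell x)"
proof -
  interpret group "G x" by (rule G_group[OF assms(1)])
  show ?thesis by (auto simp: rot_def partial_id_def cell_def fun_eq_iff)
qed

lemma rot_comp:
  assumes "x \<in> verts (gr \<G>)" "g \<in> carrier (G x)" "h \<in> carrier (G x)"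
  shows "rot x h \<circ>\<^sub>m rot x g = rot x (g \<otimes>\<^bsub>G x\<^esub> h)"
proof -
  interpret group "G x" by (rule G_group[OF assms(1)])
  show ?thesis using assms
    by (auto simp: rot_def map_comp_def fun_eq_iff inv_mult_group m_assoc)
qed

lemma shift_iff:
  assumes e: "e \<in> edges"
  shows "shift e (a, f, w) = Some z \<longleftrightarrow> f = e \<and> (\<exists>k\<in>carrier (Ge e). a = \<alpha> e k \<and>
    z = (\<alpha> (ebar e) k \<otimes>\<^bsub>G (s e)\<^esub> inv\<^bsub>G (s e)\<^esub> fst (orbit_enum e w), snd (orbit_enum e w)))"
proof -
  have "inv_into (carrier (Ge e)) (\<alpha> e) (\<alpha> e k) = k" if "k \<in> carrier (Ge e)" for k
    using \<alpha>_inj[OF e] that by simp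
  then show ?thesis unfolding shift_def by (auto split: prod.splits)
qed

lemma \<alpha>_bar:
  assumes "e \<in> edges"
  shows "k \<in> carrier (Ge e) \<Longrightarrow> \<alpha> (ebar e) k \<in> carrier (G (s e))"
    "\<lbrakk>k \<in> carrier (Ge e); l \<in> carrier (Ge e)\<rbrakk> \<Longrightarrow>
      \<alpha> (ebar e) (k \<otimes>\<^bsub>Ge e\<^esub> l) = \<alpha> (ebar e) k \<otimes>\<^bsub>G (s e)\<^esub> \<alpha> (ebar e) l"
    "k \<in> carrier (Ge e) \<Longrightarrow> \<alpha> (ebar e) (inv\<^bsub>Ge e\<^esub> k) = inv\<^bsub>G (s e)\<^esub> \<alpha> (ebar e) k"
    "h \<in> \<Sigma> (ebar e) \<Longrightarrow> h \<in> carrier (G (s e))"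
  using \<alpha>_closed[of "ebar e" k] \<alpha>_mult[of "ebar e" k l] \<alpha>_inv[of "ebar e" k] \<Sigma>_closed[of "ebar e" h] assms
  by simp_all

lemma orbit_enum_mem: "e \<in> edges \<Longrightarrow> orbit_enum e w \<in> orbits e"
  using orbit_enum by (auto simp: bij_betw_def)

text \<open>Inverting an equation \<alpha>(k) c^-1 = \<alpha>(k') c'^-1 in the group at s(e) makes
  it an equality of normal forms c \<alpha>(k^-1), which determines c and k. The number w is then
  determined because \<open>orbit_enum e\<close> is injective.\<close>

lemma pinj_shift:
  assumes e: "e \<in> edges" shows "pinj (shift e)"
  unfolding pinj_def
proof (intro allI impI)
  fix i i' j assume ij: "shift e i = Some j" "shift e i' = Some j"
  interpret group "G (s e)" by (rule Gs_group[OF e])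
  interpret E: group "Ge e" by (rule Ge_group[OF e])
  obtain a w a' w' where i: "i = (a, e, w)" "i' = (a', e, w')"
    using ij shift_iff[OF e] by (metis prod_cases3)
  obtain k k' where k: "k \<in> carrier (Ge e)" "k' \<in> carrier (Ge e)" "a = \<alpha> e k" "a' = \<alpha> e k'"
    and j: "j = (\<alpha> (ebar e) k \<otimes>\<^bsub>G (s e)\<^esub> inv\<^bsub>G (s e)\<^esub> fst (orbit_enum e w), snd (orbit_enum e w))"
      "j = (\<alpha> (ebar e) k' \<otimes>\<^bsub>G (s e)\<^esub> inv\<^bsub>G (s e)\<^esub> fst (orbit_enum e w'), snd (orbit_enum e w'))"
    using ij unfolding i shift_iff[OF e] by blast
  let ?c = "fst (orbit_enum e w)" and ?c' = "fst (orbit_enum e w')"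
  have c: "?c \<in> \<Sigma> (ebar e)" "?c' \<in> \<Sigma> (ebar e)"
    using orbit_enum_mem[OF e, of w] orbit_enum_mem[OF e, of w'] by (auto simp: orbits_def)
  note cc = \<alpha>_bar(4)[OF e c(1)] \<alpha>_bar(4)[OF e c(2)]
  note ac = \<alpha>_bar(1)[OF e k(1)] \<alpha>_bar(1)[OF e k(2)]
  have "\<alpha> (ebar e) k \<otimes>\<^bsub>G (s e)\<^esub> inv\<^bsub>G (s e)\<^esub> ?c = \<alpha> (ebar e) k' \<otimes>\<^bsub>G (s e)\<^esub> inv\<^bsub>G (s e)\<^esub> ?c'"
    using j by simp
  then have "inv\<^bsub>G (s e)\<^esub> (\<alpha> (ebar e) k \<otimes>\<^bsub>G (s e)\<^esub> inv\<^bsub>G (s e)\<^esub> ?c)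
      = inv\<^bsub>G (s e)\<^esub> (\<alpha> (ebar e) k' \<otimes>\<^bsub>G (s e)\<^esub> inv\<^bsub>G (s e)\<^esub> ?c')" by simp
  then have "?c \<otimes>\<^bsub>G (s e)\<^esub> \<alpha> (ebar e) (inv\<^bsub>Ge e\<^esub> k) = ?c' \<otimes>\<^bsub>G (s e)\<^esub> \<alpha> (ebar e) (inv\<^bsub>Ge e\<^esub> k')"
    using cc ac k \<alpha>_bar(3)[OF e] by (simp add: inv_mult_group)
  then have "?c = ?c' \<and> inv\<^bsub>Ge e\<^esub> k = inv\<^bsub>Ge e\<^esub> k'"
    using \<Sigma>_cancel[of "ebar e" ?c ?c' "inv\<^bsub>Ge e\<^esub> k" "inv\<^bsub>Ge e\<^esub> k'"] c k e by simp
  then have "?c = ?c'" "k = k'" using k E.inv_inj by (auto simp: inj_on_def)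
  then have "orbit_enum e w = orbit_enum e w'" using j by (simp add: prod_eq_iff)
  then have "w = w'" using orbit_enum[OF e] by (auto simp: bij_betw_def inj_on_def)
  then show "i = i'" using i k \<open>k = k'\<close> by simp
qed

lemma dom_shift: 
  assumes e: "e \<in> edges" shows "dom (shift e) = range_cell e"
proof -
  have "i \<in> dom (shift e) \<longleftrightarrow> i \<in> range_cell e" for i
  proof (cases i)
    case (fields a f w)
    have "i \<in> dom (shift e) \<longleftrightarrow> (\<exists>z. shift e (a, f, w) = Some z)" using fields by auto
    also have "\<dots> \<longleftrightarrow> f = e \<and> (\<exists>k\<in>carrier (Ge e). a = \<alpha> e k)" unfolding shift_iff[OF e] by blast
    also have "\<dots> \<longleftrightarrow> i \<in> range_cell e" using fields by (auto simp: range_cell_def)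
    finally show ?thesis .
  qed
  then show ?thesis by blast
qed

text \<open>Normal forms of inverses show that every triple of the cell at s(e) belongs to an index
  (c, f, w). The index with c = 1 and f = \<open>ebar e\<close>, left out of
  \<open>orbits e\<close>, accounts exactly for \<open>range_cell (ebar e)\<close>. This complement
  is what (G3) asks for.\<close>

lemma ran_shift:
  assumes e: "e \<in> edges" shows "ran (shift e) = cell (s e) - range_cell (ebar e)"
proof -
  interpret group "G (s e)" by (rule Gs_group[OF e])
  interpret E: group "Ge e" by (rule Ge_group[OF e])
  have be: "ebar e \<in> edges" "r (ebar e) = s e" using e by auto
  show ?thesis
  proof (intro equalityI subsetI)
    fix z assume "z \<in> ran (shift e)"
    then obtain a f w where "shift e (a, f, w) = Some z" by (auto simp: ran_def)
    then obtain k where k: "k \<in> carrier (Ge e)"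
        "z = (\<alpha> (ebar e) k \<otimes>\<^bsub>G (s e)\<^esub> inv\<^bsub>G (s e)\<^esub> fst (orbit_enum e w), snd (orbit_enum e w))"
      unfolding shift_iff[OF e] by blast
    obtain c f' w' where cfw: "orbit_enum e w = (c, f', w')" by (metis prod_cases3)
    have o: "f' \<in> edges" "r f' = s e" "c \<in> \<Sigma> (ebar e)" "(c, f') \<noteq> (\<one>\<^bsub>G (s e)\<^esub>, ebar e)"
      using orbit_enum_mem[OF e, of w] by (auto simp: orbits_def cfw)
    note cc = \<alpha>_bar(4)[OF e o(3)] and ac = \<alpha>_bar(1)[OF e k(1)]
    have z: "z = (\<alpha> (ebar e) k \<otimes>\<^bsub>G (s e)\<^esub> inv\<^bsub>G (s e)\<^esub> c, f', w')" using k cfw by simp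
    have "z \<in> cell (s e)" unfolding z cell_def using o cc ac by simp
    moreover have "z \<notin> range_cell (ebar e)"
    proof
      assume "z \<in> range_cell (ebar e)"
      then obtain l where l: "l \<in> carrier (Ge e)" "f' = ebar e"
          "\<alpha> (ebar e) k \<otimes>\<^bsub>G (s e)\<^esub> inv\<^bsub>G (s e)\<^esub> c = \<alpha> (ebar e) l"
        unfolding z range_cell_def using e by auto
      note lc = \<alpha>_bar(1)[OF e l(1)]
      have "inv\<^bsub>G (s e)\<^esub> c = inv\<^bsub>G (s e)\<^esub> (\<alpha> (ebar e) k) \<otimes>\<^bsub>G (s e)\<^esub> \<alpha> (ebar e) l"
        using l(3)[symmetric] cc ac by (simp flip: m_assoc)
      then have "inv\<^bsub>G (s e)\<^esub> (inv\<^bsub>G (s e)\<^esub> c)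
          = inv\<^bsub>G (s e)\<^esub> (inv\<^bsub>G (s e)\<^esub> (\<alpha> (ebar e) k) \<otimes>\<^bsub>G (s e)\<^esub> \<alpha> (ebar e) l)" by simp
      then have "c = \<alpha> (ebar e) (inv\<^bsub>Ge e\<^esub> l \<otimes>\<^bsub>Ge e\<^esub> k)"
        using cc ac lc l(1) k(1) by (simp add: inv_mult_group \<alpha>_bar(2,3)[OF e])
      then have "c \<otimes>\<^bsub>G (s e)\<^esub> \<alpha> (ebar e) \<one>\<^bsub>Ge e\<^esub> = \<one>\<^bsub>G (s e)\<^esub> \<otimes>\<^bsub>G (s e)\<^esub> \<alpha> (ebar e) (inv\<^bsub>Ge e\<^esub> l \<otimes>\<^bsub>Ge e\<^esub> k)"
        using cc \<alpha>_one[OF be(1)] e by simp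
      then have "c = \<one>\<^bsub>G (s e)\<^esub>"
        using \<Sigma>_cancel[OF be(1) o(3), of "\<one>\<^bsub>G (s e)\<^esub>" "\<one>\<^bsub>Ge e\<^esub>" "inv\<^bsub>Ge e\<^esub> l \<otimes>\<^bsub>Ge e\<^esub> k"]
          \<Sigma>_one[OF be(1)] e l(1) k(1) by simp
      then show False using o(4) l(2) by simp
    qed
    ultimately show "z \<in> cell (s e) - range_cell (ebar e)" by blast
  next
    fix z assume z: "z \<in> cell (s e) - range_cell (ebar e)"
    then obtain g f w where gfw: "z = (g, f, w)" "f \<in> edges" "r f = s e" "g \<in> carrier (G (s e))"
      by (auto simp: cell_def)
    \<comment> \<open>The inverse of g is decomposed, not g itself, because G_e acts on the cell
      from the left whereas the transversal represents left cosets.\<close>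
    obtain c k where ck: "c \<in> \<Sigma> (ebar e)" "k \<in> carrier (Ge e)" "inv\<^bsub>G (s e)\<^esub> g = c \<otimes>\<^bsub>G (s e)\<^esub> \<alpha> (ebar e) k"
      using \<Sigma>_decompose[OF be(1), of "inv\<^bsub>G (s e)\<^esub> g"] gfw e by auto
    note cc = \<alpha>_bar(4)[OF e ck(1)] and ac = \<alpha>_bar(1)[OF e ck(2)]
    have "g = inv\<^bsub>G (s e)\<^esub> (c \<otimes>\<^bsub>G (s e)\<^esub> \<alpha> (ebar e) k)" using gfw(4) by (simp flip: ck(3))
    then have g: "g = \<alpha> (ebar e) (inv\<^bsub>Ge e\<^esub> k) \<otimes>\<^bsub>G (s e)\<^esub> inv\<^bsub>G (s e)\<^esub> c"
      using cc ac ck(2) by (simp add: inv_mult_group \<alpha>_bar(3)[OF e])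
    have "(c, f) \<noteq> (\<one>\<^bsub>G (s e)\<^esub>, ebar e)"
    proof
      assume *: "(c, f) = (\<one>\<^bsub>G (s e)\<^esub>, ebar e)"
      then have "g = \<alpha> (ebar e) (inv\<^bsub>Ge e\<^esub> k)" using g \<alpha>_bar(1)[OF e, of "inv\<^bsub>Ge e\<^esub> k"] ck(2) by simp
      then have "z \<in> range_cell (ebar e)" using * gfw(1) ck(2) e unfolding range_cell_def by auto
      then show False using z by blast
    qed
    then have "(c, f, w) \<in> orbits e" using gfw ck(1) by (simp add: orbits_def)
    then obtain w' where "orbit_enum e w' = (c, f, w)"
      using bij_betw_imp_surj_on[OF orbit_enum[OF e]] by (metis imageE)
    then have "shift e (\<alpha> e (inv\<^bsub>Ge e\<^esub> k), e, w') = Some z"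
      unfolding shift_iff[OF e] using g gfw(1) ck(2) by (auto intro!: bexI[of _ "inv\<^bsub>Ge e\<^esub> k"])
    then show "z \<in> ran (shift e)" by (auto simp: ran_def)
  qed
qed

text \<open>The form of (G2) for partial maps: translation by g replaces k by g^-1 k in the source
  triple and in its image alike, and the orbit index stays the same.\<close>

lemma rot_shift:
  assumes e: "e \<in> edges" and g: "g \<in> carrier (Ge e)"
  shows "shift e \<circ>\<^sub>m rot (r e) (\<alpha> e g) = rot (s e) (\<alpha> (ebar e) g) \<circ>\<^sub>m shift e"
proof
  fix i :: "'g \<times> 'e \<times> nat"
  interpret R: group "G (r e)" by (rule Gr_group[OF e])
  interpret S: group "G (s e)" by (rule Gs_group[OF e])
  interpret E: group "Ge e" by (rule Ge_group[OF e])
  obtain a f w where i: "i = (a, f, w)" by (metis prod_cases3)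
  show "(shift e \<circ>\<^sub>m rot (r e) (\<alpha> e g)) i = (rot (s e) (\<alpha> (ebar e) g) \<circ>\<^sub>m shift e) i"
  proof (cases "f = e \<and> a \<in> \<alpha> e ` carrier (Ge e)")
    case True
    then obtain k where k: "f = e" "k \<in> carrier (Ge e)" "a = \<alpha> e k" by auto
    obtain c f' w' where cfw: "orbit_enum e w = (c, f', w')" by (metis prod_cases3)
    have o: "f' \<in> edges" "r f' = s e" "c \<in> carrier (G (s e))"
      using orbit_enum_mem[OF e, of w] \<alpha>_bar(4)[OF e] by (auto simp: orbits_def cfw)
    have 1: "shift e (\<alpha> e l, e, w) = Some (\<alpha> (ebar e) l \<otimes>\<^bsub>G (s e)\<^esub> inv\<^bsub>G (s e)\<^esub> c, f', w')"
      if "l \<in> carrier (Ge e)" for l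
      unfolding shift_iff[OF e] using that cfw by auto
    have 2: "rot (r e) (\<alpha> e g) i = Some (\<alpha> e (inv\<^bsub>Ge e\<^esub> g \<otimes>\<^bsub>Ge e\<^esub> k), e, w)"
      unfolding i using k g e by (simp add: rot_def \<alpha>_closed \<alpha>_mult \<alpha>_inv)
    show ?thesis
      unfolding map_comp_def 2 using 1[of "inv\<^bsub>Ge e\<^esub> g \<otimes>\<^bsub>Ge e\<^esub> k"] 1[of k] k g e o
      by (simp add: i rot_def \<alpha>_bar[OF e] S.m_assoc)
  next
    \<comment> \<open>Left multiplication by \<alpha>(g) permutes the image of G_e, so both
      compositions are undefined on the same triples.\<close>
    case False
    then have "shift e i = None" unfolding i shift_def by auto
    moreover have "(shift e \<circ>\<^sub>m rot (r e) (\<alpha> e g)) i = None"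
    proof (cases "rot (r e) (\<alpha> e g) i")
      case (Some j)
      then have j: "f \<in> edges" "r f = r e" "a \<in> carrier (G (r e))"
          "j = (inv\<^bsub>G (r e)\<^esub> \<alpha> e g \<otimes>\<^bsub>G (r e)\<^esub> a, f, w)"
        by (auto simp: rot_def i split: if_splits)
      have "inv\<^bsub>G (r e)\<^esub> \<alpha> e g \<otimes>\<^bsub>G (r e)\<^esub> a \<notin> \<alpha> e ` carrier (Ge e)" if "f = e"
      proof
        assume "inv\<^bsub>G (r e)\<^esub> \<alpha> e g \<otimes>\<^bsub>G (r e)\<^esub> a \<in> \<alpha> e ` carrier (Ge e)"
        then obtain l where l: "l \<in> carrier (Ge e)" "inv\<^bsub>G (r e)\<^esub> \<alpha> e g \<otimes>\<^bsub>G (r e)\<^esub> a = \<alpha> e l" by blast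
        have "a = \<alpha> e g \<otimes>\<^bsub>G (r e)\<^esub> (inv\<^bsub>G (r e)\<^esub> \<alpha> e g \<otimes>\<^bsub>G (r e)\<^esub> a)"
          using j(3) \<alpha>_closed[OF e g] by (simp flip: R.m_assoc)
        then have "a = \<alpha> e (g \<otimes>\<^bsub>Ge e\<^esub> l)" using l g e by (simp add: \<alpha>_mult)
        then show False using False that l g by auto
      qed
      then have "shift e j = None" using j(4) by (auto simp: shift_def)
      then show ?thesis using Some by (simp add: map_comp_def)
    qed (simp add: map_comp_def)
    ultimately show ?thesis by (simp add: map_comp_def)
  qed
qed

end

context graph_of_groups_setup
begin

text \<open>The domain of the projection \<open>U_h S_f S_f^* U_h^*\<close> in the representation,
  that is the coset of h together with f and all numbers w; see
  \<open>rot_translate\<close>.\<close>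

definition trans_cell :: "'g \<Rightarrow> 'e \<Rightarrow> ('g \<times> 'e \<times> nat) set" where
  "trans_cell h f = {(h \<otimes>\<^bsub>G (r f)\<^esub> \<alpha> f k, f, w) | k w. k \<in> carrier (Ge f)}"

lemma trans_cell_one: 
  assumes f: "f \<in> edges" shows "trans_cell \<one>\<^bsub>G (r f)\<^esub> f = range_cell f"
proof -
  interpret group "G (r f)" by (rule Gr_group[OF f])
  have "\<one>\<^bsub>G (r f)\<^esub> \<otimes>\<^bsub>G (r f)\<^esub> \<alpha> f k = \<alpha> f k" if "k \<in> carrier (Ge f)" for k
    using \<alpha>_closed[OF f that] by simp
  then show ?thesis unfolding trans_cell_def range_cell_def by force
qed

lemma range_cell_subset: "f \<in> edges \<Longrightarrow> range_cell f \<subseteq> cell (r f)"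
  by (auto simp: range_cell_def cell_def \<alpha>_closed)

lemma rot_translate:
  assumes f: "f \<in> edges" and h: "h \<in> carrier (G (r f))"
  shows "rot (r f) (inv\<^bsub>G (r f)\<^esub> h) \<circ>\<^sub>m (partial_id (range_cell f) \<circ>\<^sub>m rot (r f) h) = partial_id (trans_cell h f)"
proof
  fix i :: "'g \<times> 'e \<times> nat"
  interpret group "G (r f)" by (rule Gr_group[OF f])
  have x: "r f \<in> verts (gr \<G>)" using f by simp
  obtain a e w where i: "i = (a, e, w)" by (metis prod_cases3)
  show "(rot (r f) (inv\<^bsub>G (r f)\<^esub> h) \<circ>\<^sub>m (partial_id (range_cell f) \<circ>\<^sub>m rot (r f) h)) i = partial_id (trans_cell h f) i"
  proof (cases "i \<in> trans_cell h f")
    case True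
    then obtain k where k: "k \<in> carrier (Ge f)" "a = h \<otimes>\<^bsub>G (r f)\<^esub> \<alpha> f k" "e = f"
      unfolding trans_cell_def i by auto
    then have "rot (r f) h i = Some (\<alpha> f k, f, w)"
      using \<alpha>_closed[OF f k(1)] h f by (simp add: rot_def i flip: m_assoc)
    moreover have "(\<alpha> f k, f, w) \<in> range_cell f" using k by (auto simp: range_cell_def)
    moreover have "rot (r f) (inv\<^bsub>G (r f)\<^esub> h) (\<alpha> f k, f, w) = Some i"
      using rot_iff[OF x h] calculation by simp
    ultimately show ?thesis using True by (simp add: map_comp_def partial_id_def)
  next
    case False
    have "j \<notin> range_cell f" if "rot (r f) h i = Some j" for j
    proof
      assume "j \<in> range_cell f"
      then obtain k w' where k: "k \<in> carrier (Ge f)" "j = (\<alpha> f k, f, w')" by (auto simp: range_cell_def)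
      have "rot (r f) (inv\<^bsub>G (r f)\<^esub> h) j = Some i" using that rot_iff[OF x h] by simp
      then have "i = (h \<otimes>\<^bsub>G (r f)\<^esub> \<alpha> f k, f, w')" using k h f by (auto simp: rot_def split: if_splits)
      then show False using False k by (auto simp: trans_cell_def)
    qed
    then show ?thesis using False by (auto simp: map_comp_def partial_id_def split: option.splits)
  qed
qed

lemma trans_cell_disjoint:
  assumes "(h, f) \<in> star x" "(h', f') \<in> star x" "(h, f) \<noteq> (h', f')"
  shows "trans_cell h f \<inter> trans_cell h' f' = {}"
  using assms \<Sigma>_cancel[of f h h'] by (auto simp: trans_cell_def star_def)

text \<open>Each element of G_x has a coset representative for every edge with range x. With
  \<open>trans_cell_disjoint\<close> this partitions the cell, which yields (G4) once the letter of
  the reversed edge is removed.\<close>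

lemma trans_cell_Union: "(\<Union>(h, f)\<in>star x. trans_cell h f) = cell x"
proof (intro equalityI subsetI)
  fix i assume "i \<in> (\<Union>(h, f)\<in>star x. trans_cell h f)"
  then obtain h f k w where i: "f \<in> edges" "r f = x" "h \<in> \<Sigma> f" "k \<in> carrier (Ge f)"
      "i = (h \<otimes>\<^bsub>G (r f)\<^esub> \<alpha> f k, f, w)"
    by (auto simp: trans_cell_def star_def)
  interpret group "G (r f)" by (rule Gr_group[OF i(1)])
  show "i \<in> cell x" using i \<Sigma>_closed[OF i(1,3)] \<alpha>_closed[OF i(1,4)] by (auto simp: cell_def)
next
  fix i assume "i \<in> cell x"
  then obtain a f w where i: "i = (a, f, w)" "f \<in> edges" "r f = x" "a \<in> carrier (G (r f))"
    by (auto simp: cell_def)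
  obtain h k where "h \<in> \<Sigma> f" "k \<in> carrier (Ge f)" "a = h \<otimes>\<^bsub>G (r f)\<^esub> \<alpha> f k"
    using \<Sigma>_decompose[OF i(2,4)] by blast
  then have "(h, f) \<in> star x" "i \<in> trans_cell h f" using i by (auto simp: star_def trans_cell_def)
  then show "i \<in> (\<Union>(h, f)\<in>star x. trans_cell h f)" by blast
qed

lemma g_family_ell2:
  "g_family \<G> \<Sigma> ell2_operators (\<lambda>x g. pull_op (rot x g)) (\<lambda>e. pull_op (shift e))"
  unfolding g_family_def
proof (intro conjI ballI impI)
  fix e assume e: "e \<in> edges"
  have be: "ebar e \<in> edges" "r (ebar e) = s e" "s e \<in> verts (gr \<G>)" using e by auto
  show "partial_isometry ell2_operators (pull_op (shift e))"
    by (rule partial_isometry_pull_op[OF pinj_shift[OF e]])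
  have src: "(pull_op (shift e))\<^sup>\<star>\<^bsub>ell2_operators\<^esub> \<otimes>\<^bsub>ell2_operators\<^esub> pull_op (shift e)
      = pull_op (partial_id (cell (s e) - range_cell (ebar e)))"
    using pinj_shift[OF e] by (simp add: pull_op_adj pull_op_mult pinj_pinv map_comp_pinv ran_shift[OF e])
  have rng: "pull_op (shift f) \<otimes>\<^bsub>ell2_operators\<^esub> (pull_op (shift f))\<^sup>\<star>\<^bsub>ell2_operators\<^esub>
      = pull_op (partial_id (range_cell f))" if f: "f \<in> edges" for f
    using pinj_shift[OF f] by (simp add: pull_op_adj pull_op_mult pinj_pinv map_comp_pinv dom_shift[OF f])
  have "cell (s e) - range_cell (ebar e) \<union> range_cell (ebar e) = cell (s e)"
    using range_cell_subset[OF be(1)] be by auto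
  then show "pull_op (rot (s e) \<one>\<^bsub>G (s e)\<^esub>) = (pull_op (shift e))\<^sup>\<star>\<^bsub>ell2_operators\<^esub> \<otimes>\<^bsub>ell2_operators\<^esub> pull_op (shift e)
      \<oplus>\<^bsub>ell2_operators\<^esub> pull_op (shift (ebar e)) \<otimes>\<^bsub>ell2_operators\<^esub> (pull_op (shift (ebar e)))\<^sup>\<star>\<^bsub>ell2_operators\<^esub>"
    unfolding src rng[OF be(1)] rot_one[OF be(3)] by (subst pull_op_add) auto
  let ?F = "\<lambda>(h, f). pull_op (rot (s e) h) \<otimes>\<^bsub>ell2_operators\<^esub> pull_op (shift f) \<otimes>\<^bsub>ell2_operators\<^esub>
    (pull_op (shift f))\<^sup>\<star>\<^bsub>ell2_operators\<^esub> \<otimes>\<^bsub>ell2_operators\<^esub> (pull_op (rot (s e) h))\<^sup>\<star>\<^bsub>ell2_operators\<^esub>"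
  interpret L: cstar_algebra "ell2_operators :: (('g \<times> 'e \<times> nat) ell2 \<Rightarrow>\<^sub>L ('g \<times> 'e \<times> nat) ell2) cstar"
    by (rule cstar_algebra_ell2_operators)
  have F: "?F k = pull_op (partial_id (case k of (h, f) \<Rightarrow> trans_cell h f))" if k: "k \<in> follow e" for k
  proof -
    obtain h f where hf: "k = (h, f)" "f \<in> edges" "r f = s e" "h \<in> \<Sigma> f" using k by (auto simp: follow_def)
    have h: "h \<in> carrier (G (s e))" using \<Sigma>_closed[OF hf(2,4)] hf by simp
    note p = pinj_rot[OF be(3) h] pinj_shift[OF hf(2)]
    have "?F k = pull_op (rot (s e) h) \<otimes>\<^bsub>ell2_operators\<^esub> (pull_op (shift f) \<otimes>\<^bsub>ell2_operators\<^esub>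
        (pull_op (shift f))\<^sup>\<star>\<^bsub>ell2_operators\<^esub>) \<otimes>\<^bsub>ell2_operators\<^esub> (pull_op (rot (s e) h))\<^sup>\<star>\<^bsub>ell2_operators\<^esub>"
      using p by (simp add: hf(1) L.m_assoc pull_op_closed)
    also have "\<dots> = pull_op (rot (s e) (inv\<^bsub>G (s e)\<^esub> h) \<circ>\<^sub>m (partial_id (range_cell f) \<circ>\<^sub>m rot (s e) h))"
      unfolding rng[OF hf(2)] using p pinj_pinv[OF p(1)]
      by (simp add: pull_op_adj pull_op_mult pinj_partial_id pinj_map_comp)
    also have "\<dots> = pull_op (partial_id (trans_cell h f))" using rot_translate[OF hf(2), of h] h hf(3) by simp
    finally show ?thesis by (simp add: hf(1))
  qed
  have "finsum ell2_operators ?F (follow e)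
      = finsum ell2_operators (\<lambda>k. pull_op (partial_id (case k of (h, f) \<Rightarrow> trans_cell h f))) (follow e)"
    by (rule L.finsum_cong') (auto simp: F pull_op_closed pinj_partial_id simp del: case_prod_conv split_paired_All)
  also have "\<dots> = pull_op (partial_id (\<Union>(h, f)\<in>follow e. trans_cell h f))"
  proof (rule pull_op_finsum[OF finite_follow[OF e]])
    fix k l assume kl: "k \<in> follow e" "l \<in> follow e" "k \<noteq> l"
    obtain h f h' f' where "k = (h, f)" "l = (h', f')" by (metis surj_pair)
    then show "(case k of (h, f) \<Rightarrow> trans_cell h f) \<inter> (case l of (h, f) \<Rightarrow> trans_cell h f) = {}"
      using kl trans_cell_disjoint[of h f "s e" h' f'] by (simp add: follow_eq)
  qed
  \<comment> \<open>Omitting the letter (1, \<open>ebar e\<close>) from the partition of the cell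
    removes its coset \<open>range_cell (ebar e)\<close>; what remains is the range of
    \<open>shift e\<close>.\<close>
  also have "(\<Union>(h, f)\<in>follow e. trans_cell h f) = cell (s e) - range_cell (ebar e)"
  proof -
    have "star (s e) = insert (\<one>\<^bsub>G (s e)\<^esub>, ebar e) (follow e)"
      using bar_in_star[OF e] by (auto simp: follow_eq)
    then have "cell (s e) = trans_cell \<one>\<^bsub>G (s e)\<^esub> (ebar e) \<union> (\<Union>(h, f)\<in>follow e. trans_cell h f)"
      using trans_cell_Union[of "s e"] by simp
    moreover have "trans_cell \<one>\<^bsub>G (s e)\<^esub> (ebar e) = range_cell (ebar e)"
      using trans_cell_one[OF be(1)] be by simp
    moreover have "trans_cell \<one>\<^bsub>G (s e)\<^esub> (ebar e) \<inter> trans_cell h f = {}" if "(h, f) \<in> follow e" for h f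
      using that bar_in_star[OF e] by (intro trans_cell_disjoint[of _ _ "s e"]) (auto simp: follow_eq)
    ultimately show ?thesis by blast
  qed
  finally show "(pull_op (shift e))\<^sup>\<star>\<^bsub>ell2_operators\<^esub> \<otimes>\<^bsub>ell2_operators\<^esub> pull_op (shift e) = finsum ell2_operators ?F
      {(h, f). f \<in> edges \<and> r f = s e \<and> h \<in> \<Sigma> f \<and> (h, f) \<noteq> (\<one>\<^bsub>G (s e)\<^esub>, ebar e)}"
    unfolding src follow_def by simp
  fix g assume g: "g \<in> carrier (Ge e)"
  have "r e \<in> verts (gr \<G>)" using e by simp
  then show "pull_op (rot (r e) (\<alpha> e g)) \<otimes>\<^bsub>ell2_operators\<^esub> pull_op (shift e)
      = pull_op (shift e) \<otimes>\<^bsub>ell2_operators\<^esub> pull_op (rot (s e) (\<alpha> (ebar e) g))"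
    using pinj_rot(1)[OF _ \<alpha>_closed[OF e g]] pinj_rot(1)[OF be(3) \<alpha>_bar(1)[OF e g]] pinj_shift[OF e]
    by (simp add: pull_op_mult rot_shift[OF e g])
next
  fix x assume x: "x \<in> verts (gr \<G>)"
  interpret group "G x" by (rule G_group[OF x])
  show "projection ell2_operators (pull_op (rot x \<one>\<^bsub>G x\<^esub>))"
    unfolding rot_one[OF x] by (rule projection_pull_op)
  have mult: "pull_op (rot x g) \<otimes>\<^bsub>ell2_operators\<^esub> pull_op (rot x h) = pull_op (rot x (g \<otimes>\<^bsub>G x\<^esub> h))"
    if "g \<in> carrier (G x)" "h \<in> carrier (G x)" for g h
    using that pinj_rot(1)[OF x] by (simp add: pull_op_mult rot_comp[OF x])
  fix g assume g: "g \<in> carrier (G x)"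
  show "corner_unitary ell2_operators (pull_op (rot x \<one>\<^bsub>G x\<^esub>)) (pull_op (rot x g))"
    unfolding corner_unitary_def using g pinj_rot[OF x g]
    by (simp add: pull_op_closed mult pull_op_adj)
  fix h assume h: "h \<in> carrier (G x)"
  show "pull_op (rot x (g \<otimes>\<^bsub>G x\<^esub> h)) = pull_op (rot x g) \<otimes>\<^bsub>ell2_operators\<^esub> pull_op (rot x h)"
    using mult g h by simp
next
  fix x y assume "x \<in> verts (gr \<G>)" "y \<in> verts (gr \<G>)" "x \<noteq> y"
  moreover have "cell x \<inter> cell y = {}" if "x \<noteq> y" using that by (auto simp: cell_def)
  ultimately show "pull_op (rot x \<one>\<^bsub>G x\<^esub>) \<otimes>\<^bsub>ell2_operators\<^esub> pull_op (rot y \<one>\<^bsub>G y\<^esub>) = \<zero>\<^bsub>ell2_operators\<^esub>"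
    by (simp add: rot_one pull_op_mult pinj_partial_id partial_id_comp Int_commute pull_op_empty)
qed

text \<open>The purpose of the operator representation: the universal s_e is mapped to this
  operator, so it does not vanish either.\<close>

lemma shift_nonzero:
  assumes e: "e \<in> edges" shows "pull_op (shift e) \<noteq> \<zero>\<^bsub>ell2_operators\<^esub>"
proof -
  interpret E: group "Ge e" by (rule Ge_group[OF e])
  have "(\<alpha> e \<one>\<^bsub>Ge e\<^esub>, e, 0) \<in> dom (shift e)" unfolding dom_shift[OF e] range_cell_def by auto
  then show ?thesis using pull_op_nonzero[OF pinj_shift[OF e]] by blast
qed

end

section \<open>The embedding\<close>

locale g_family_setup = graph_of_groups_setup \<G> \<Sigma> + cstar_algebra A
  for \<G> :: "('v, 'e, 'g, 'h) gog" and \<Sigma> and A :: "'a cstar" (structure) +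
  fixes U :: "'v \<Rightarrow> 'g \<Rightarrow> 'a" and S :: "'e \<Rightarrow> 'a"
  assumes fam: "g_family \<G> \<Sigma> A U S"
begin

lemma S_partial: "e \<in> edges \<Longrightarrow> partial_isometry A (S e)"
  and U_projection: "x \<in> verts (gr \<G>) \<Longrightarrow> projection A (U x \<one>\<^bsub>G x\<^esub>)"
  and U_corner: "\<lbrakk>x \<in> verts (gr \<G>); g \<in> carrier (G x)\<rbrakk> \<Longrightarrow> corner_unitary A (U x \<one>\<^bsub>G x\<^esub>) (U x g)"
  and U_mult: "\<lbrakk>x \<in> verts (gr \<G>); g \<in> carrier (G x); h \<in> carrier (G x)\<rbrakk> \<Longrightarrow>
    U x (g \<otimes>\<^bsub>G x\<^esub> h) = U x g \<otimes> U x h"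
  and U_orthogonal: "\<lbrakk>x \<in> verts (gr \<G>); y \<in> verts (gr \<G>); x \<noteq> y\<rbrakk> \<Longrightarrow>
    U x \<one>\<^bsub>G x\<^esub> \<otimes> U y \<one>\<^bsub>G y\<^esub> = \<zero>"
  and G2: "\<lbrakk>e \<in> edges; k \<in> carrier (Ge e)\<rbrakk> \<Longrightarrow> U (r e) (\<alpha> e k) \<otimes> S e = S e \<otimes> U (s e) (\<alpha> (ebar e) k)"
  and G3: "e \<in> edges \<Longrightarrow> U (s e) \<one>\<^bsub>G (s e)\<^esub> = (S e)\<^sup>\<star> \<otimes> S e \<oplus> S (ebar e) \<otimes> (S (ebar e))\<^sup>\<star>"
  and G4: "e \<in> edges \<Longrightarrow> (S e)\<^sup>\<star> \<otimes> S e =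
    finsum A (\<lambda>(h, f). U (s e) h \<otimes> S f \<otimes> (S f)\<^sup>\<star> \<otimes> (U (s e) h)\<^sup>\<star>) (follow e)"
proof -
  note f = fam[unfolded g_family_def, folded follow_def]
  note f1 = f[THEN conjunct1] and f2 = f[THEN conjunct2, THEN conjunct1]
    and f3 = f[THEN conjunct2, THEN conjunct2, THEN conjunct1]
    and f4 = f[THEN conjunct2, THEN conjunct2, THEN conjunct2, THEN conjunct1]
    and f5 = f[THEN conjunct2, THEN conjunct2, THEN conjunct2, THEN conjunct2, THEN conjunct1]
    and f6 = f[THEN conjunct2, THEN conjunct2, THEN conjunct2, THEN conjunct2, THEN conjunct2]
  show "e \<in> edges \<Longrightarrow> partial_isometry A (S e)" by (rule bspec[OF f1])
  show "x \<in> verts (gr \<G>) \<Longrightarrow> projection A (U x \<one>\<^bsub>G x\<^esub>)" by (rule bspec[OF f2, THEN conjunct1])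
  show "\<lbrakk>x \<in> verts (gr \<G>); g \<in> carrier (G x)\<rbrakk> \<Longrightarrow> corner_unitary A (U x \<one>\<^bsub>G x\<^esub>) (U x g)"
    by (rule bspec[OF bspec[OF f2, THEN conjunct2, THEN conjunct1]])
  show "\<lbrakk>x \<in> verts (gr \<G>); g \<in> carrier (G x); h \<in> carrier (G x)\<rbrakk> \<Longrightarrow>
      U x (g \<otimes>\<^bsub>G x\<^esub> h) = U x g \<otimes> U x h"
    by (rule bspec[OF bspec[OF bspec[OF f2, THEN conjunct2, THEN conjunct2]]])
  show "\<lbrakk>x \<in> verts (gr \<G>); y \<in> verts (gr \<G>); x \<noteq> y\<rbrakk> \<Longrightarrow> U x \<one>\<^bsub>G x\<^esub> \<otimes> U y \<one>\<^bsub>G y\<^esub> = \<zero>"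
    by (rule bspec[OF bspec[OF f3], THEN mp])
  show "\<lbrakk>e \<in> edges; k \<in> carrier (Ge e)\<rbrakk> \<Longrightarrow> U (r e) (\<alpha> e k) \<otimes> S e = S e \<otimes> U (s e) (\<alpha> (ebar e) k)"
    by (rule bspec[OF bspec[OF f4]])
  show "e \<in> edges \<Longrightarrow> U (s e) \<one>\<^bsub>G (s e)\<^esub> = (S e)\<^sup>\<star> \<otimes> S e \<oplus> S (ebar e) \<otimes> (S (ebar e))\<^sup>\<star>"
    by (rule bspec[OF f5])
  show "e \<in> edges \<Longrightarrow> (S e)\<^sup>\<star> \<otimes> S e =
      finsum A (\<lambda>(h, f). U (s e) h \<otimes> S f \<otimes> (S f)\<^sup>\<star> \<otimes> (U (s e) h)\<^sup>\<star>) (follow e)"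
    by (rule bspec[OF f6])
qed

lemma S_closed [simp, intro]: "e \<in> edges \<Longrightarrow> S e \<in> carrier A"
  using S_partial by (auto simp: partial_isometry_def)

lemma S_S_adj_S: "e \<in> edges \<Longrightarrow> S e \<otimes> ((S e)\<^sup>\<star> \<otimes> S e) = S e"
  using S_partial[of e] m_assoc[of "S e" "(S e)\<^sup>\<star>" "S e"] by (simp add: partial_isometry_def)

lemma U_closed [simp, intro]: "\<lbrakk>x \<in> verts (gr \<G>); g \<in> carrier (G x)\<rbrakk> \<Longrightarrow> U x g \<in> carrier A"
  and U_adj_U: "\<lbrakk>x \<in> verts (gr \<G>); g \<in> carrier (G x)\<rbrakk> \<Longrightarrow> (U x g)\<^sup>\<star> \<otimes> U x g = U x \<one>\<^bsub>G x\<^esub>"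
  using U_corner by (auto simp: corner_unitary_def)

lemma U_one: "x \<in> verts (gr \<G>) \<Longrightarrow> U x \<one>\<^bsub>G x\<^esub> \<in> carrier A"
  "x \<in> verts (gr \<G>) \<Longrightarrow> U x \<one>\<^bsub>G x\<^esub> \<otimes> U x \<one>\<^bsub>G x\<^esub> = U x \<one>\<^bsub>G x\<^esub>"
  "x \<in> verts (gr \<G>) \<Longrightarrow> (U x \<one>\<^bsub>G x\<^esub>)\<^sup>\<star> = U x \<one>\<^bsub>G x\<^esub>"
  using U_projection by (auto simp: projection_def)

lemma U_one_mult: 
  assumes "x \<in> verts (gr \<G>)" "g \<in> carrier (G x)"
  shows "U x \<one>\<^bsub>G x\<^esub> \<otimes> U x g = U x g" "U x g \<otimes> U x \<one>\<^bsub>G x\<^esub> = U x g"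
proof -
  interpret group "G x" by (rule G_group[OF assms(1)])
  show "U x \<one>\<^bsub>G x\<^esub> \<otimes> U x g = U x g" "U x g \<otimes> U x \<one>\<^bsub>G x\<^esub> = U x g"
    using assms by (simp_all flip: U_mult)
qed

text \<open>The two summands of (G3) are projections whose sum is a projection, so each of them is
  absorbed by the sum.\<close>

lemma S_mult_U_one:
  assumes e: "e \<in> edges" shows "S e \<otimes> U (s e) \<one>\<^bsub>G (s e)\<^esub> = S e"
proof -
  have be: "ebar e \<in> edges" and x: "s e \<in> verts (gr \<G>)" using e by auto
  let ?P = "\<lambda>b. if b then (S e)\<^sup>\<star> \<otimes> S e else S (ebar e) \<otimes> (S (ebar e))\<^sup>\<star>"
  have sum: "finsum A ?P {True, False} = U (s e) \<one>\<^bsub>G (s e)\<^esub>"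
    using e be by (subst finsum_insert) (auto simp: G3)
  have "?P True \<otimes> finsum A ?P {True, False} = ?P True"
    using partial_isometry_source[OF S_partial[OF e]] partial_isometry_range[OF S_partial[OF be]]
      U_projection[OF x]
    by (intro finsum_projections_absorb(2)) (auto simp: sum simp del: insert_iff)
  then have "S e \<otimes> ((S e)\<^sup>\<star> \<otimes> S e \<otimes> U (s e) \<one>\<^bsub>G (s e)\<^esub>) = S e \<otimes> ((S e)\<^sup>\<star> \<otimes> S e)" by (simp add: sum)
  moreover have "S e \<otimes> ((S e)\<^sup>\<star> \<otimes> S e \<otimes> U (s e) \<one>\<^bsub>G (s e)\<^esub>)
      = S e \<otimes> ((S e)\<^sup>\<star> \<otimes> S e) \<otimes> U (s e) \<one>\<^bsub>G (s e)\<^esub>"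
    using e U_one(1)[OF x] by (simp add: m_assoc)
  ultimately show ?thesis using S_S_adj_S[OF e] by simp
qed

text \<open>(G2) at the identity of G_e carries the vertex projection from the left of S_e to its
  right, where \<open>S_mult_U_one\<close> absorbs it.\<close>

lemma U_one_mult_S:
  assumes e: "e \<in> edges" shows "U (r e) \<one>\<^bsub>G (r e)\<^esub> \<otimes> S e = S e"
proof -
  interpret E: group "Ge e" by (rule Ge_group[OF e])
  have "\<alpha> (ebar e) \<one>\<^bsub>Ge e\<^esub> = \<one>\<^bsub>G (s e)\<^esub>" using \<alpha>_one[of "ebar e"] e by simp
  then show ?thesis using G2[OF e E.one_closed] \<alpha>_one[OF e] S_mult_U_one[OF e] by simp
qed

definition elt :: "'g \<times> 'e \<Rightarrow> 'a" where
  "elt i = U (r (snd i)) (fst i) \<otimes> S (snd i)"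

definition Q :: "'g \<times> 'e \<Rightarrow> 'a" where
  "Q i = elt i \<otimes> (elt i)\<^sup>\<star>"

definition letters :: "('g \<times> 'e) set" where
  "letters = {(g, e). e \<in> edges \<and> g \<in> \<Sigma> e}"

lemma letters_U [simp, intro]:
  assumes "i \<in> letters"
  shows "U (r (snd i)) (fst i) \<in> carrier A" "S (snd i) \<in> carrier A"
  using assms \<Sigma>_closed by (auto simp: letters_def)

lemma elt_closed [simp, intro]: "i \<in> letters \<Longrightarrow> elt i \<in> carrier A"
  by (simp add: elt_def)

lemma Q_closed [simp, intro]: "i \<in> letters \<Longrightarrow> Q i \<in> carrier A"
  by (simp add: Q_def)

lemma elt_source: 
  assumes i: "i \<in> letters" shows "(elt i)\<^sup>\<star> \<otimes> elt i = (S (snd i))\<^sup>\<star> \<otimes> S (snd i)"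
proof -
  obtain g e where ge: "i = (g, e)" "e \<in> edges" "g \<in> carrier (G (r e))"
    using i \<Sigma>_closed by (auto simp: letters_def)
  have x: "r e \<in> verts (gr \<G>)" using ge by simp
  note c = U_closed[OF x ge(3)] S_closed[OF ge(2)] U_one(1)[OF x]
  have "(elt i)\<^sup>\<star> \<otimes> elt i = (S e)\<^sup>\<star> \<otimes> ((U (r e) g)\<^sup>\<star> \<otimes> U (r e) g \<otimes> S e)"
    using c by (simp add: elt_def ge(1) adj_mult m_assoc)
  also have "\<dots> = (S e)\<^sup>\<star> \<otimes> S e" by (simp add: U_adj_U[OF x ge(3)] U_one_mult_S[OF ge(2)])
  finally show ?thesis by (simp add: ge(1))
qed

lemma elt_partial: 
  assumes i: "i \<in> letters" shows "partial_isometry A (elt i)"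
proof -
  have e: "snd i \<in> edges" using i by (auto simp: letters_def)
  have "elt i \<otimes> ((elt i)\<^sup>\<star> \<otimes> elt i) = U (r (snd i)) (fst i) \<otimes> (S (snd i) \<otimes> ((S (snd i))\<^sup>\<star> \<otimes> S (snd i)))"
    unfolding elt_source[OF i] using i e by (simp add: elt_def m_assoc)
  also have "\<dots> = elt i" by (simp add: S_S_adj_S[OF e] elt_def)
  finally show ?thesis using i by (simp add: partial_isometry_def m_assoc)
qed

lemma Q_projection: "i \<in> letters \<Longrightarrow> projection A (Q i)"
  unfolding Q_def by (rule partial_isometry_range[OF elt_partial])

lemma Q_sa: "i \<in> letters \<Longrightarrow> (Q i)\<^sup>\<star> = Q i"
  and Q_idem: "i \<in> letters \<Longrightarrow> Q i \<otimes> Q i = Q i"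
  using Q_projection by (auto simp: projection_def)

lemma star_letters: "star x \<subseteq> letters"
  and follow_letters: "follow e \<subseteq> letters"
  by (auto simp: star_def follow_def letters_def)

lemma in_letters: "i \<in> follow e \<Longrightarrow> i \<in> letters"
  using follow_letters by blast

lemma Q_alt:
  assumes "i \<in> letters" "r (snd i) = x"
  shows "Q i = U x (fst i) \<otimes> S (snd i) \<otimes> (S (snd i))\<^sup>\<star> \<otimes> (U x (fst i))\<^sup>\<star>"
  using letters_U[OF assms(1)] assms(2) by (simp add: Q_def elt_def adj_mult m_assoc)

lemma source_sum: 
  assumes e: "e \<in> edges" shows "(S e)\<^sup>\<star> \<otimes> S e = finsum A Q (follow e)"
proof -
  have "finsum A (\<lambda>(h, f). U (s e) h \<otimes> S f \<otimes> (S f)\<^sup>\<star> \<otimes> (U (s e) h)\<^sup>\<star>) (follow e) = finsum A Q (follow e)"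
  proof (rule finsum_cong'[OF refl])
    show "Q \<in> follow e \<rightarrow> carrier A" using follow_letters by auto
    fix i assume i: "i \<in> follow e"
    then have "i \<in> letters" "r (snd i) = s e" using follow_letters by (auto simp: follow_def)
    from Q_alt[OF this] show "(case i of (h, f) \<Rightarrow> U (s e) h \<otimes> S f \<otimes> (S f)\<^sup>\<star> \<otimes> (U (s e) h)\<^sup>\<star>) = Q i"
      by (simp add: case_prod_unfold)
  qed
  then show ?thesis using G4[OF e] by simp
qed

text \<open>(G3) is applied to the reversed edge. Its second summand is then \<open>Q\<close> of the
  letter (1, e), precisely the letter that (G4) leaves out of the expansion of the first
  summand.\<close>

lemma star_sum:
  assumes e: "e \<in> edges" shows "U (r e) \<one>\<^bsub>G (r e)\<^esub> = finsum A Q (star (r e))"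
proof -
  let ?d = "ebar e" and ?i = "(\<one>\<^bsub>G (r e)\<^esub>, e)"
  have d: "?d \<in> edges" "s ?d = r e" "ebar ?d = e" using e by auto
  have x: "r e \<in> verts (gr \<G>)" using e by simp
  have i: "?i \<in> letters" using e \<Sigma>_one by (auto simp: letters_def)
  have "Q ?i = S e \<otimes> (S e)\<^sup>\<star>"
    using U_one_mult_S[OF e] by (simp add: Q_def elt_def)
  moreover have "star (r e) = insert ?i (follow ?d)" "?i \<notin> follow ?d"
    using bar_in_star[OF d(1)] d by (auto simp: follow_eq)
  moreover have "finsum A Q (insert ?i (follow ?d)) = Q ?i \<oplus> finsum A Q (follow ?d)"
    using finite_follow[OF d(1)] calculation(3) follow_letters i by (intro finsum_insert) auto
  ultimately show ?thesis
    using G3[OF d(1)] source_sum[OF d(1)] d Q_closed[OF i] e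
    by (simp add: a_comm) (metis S_closed a_comm adj_closed d(1) m_closed)
qed

text \<open>Letters with a common range are summands of one projection by \<open>star_sum\<close>.
  For different ranges (G1) is inserted between the two factors.\<close>

lemma Q_orthogonal:
  assumes "i \<in> letters" "j \<in> letters" "i \<noteq> j"
  shows "Q i \<otimes> Q j = \<zero>"
proof (cases "r (snd i) = r (snd j)")
  case True
  let ?x = "r (snd i)"
  have e: "snd i \<in> edges" using assms by (auto simp: letters_def)
  have ij: "i \<in> star ?x" "j \<in> star ?x" using assms True by (auto simp: letters_def star_def)
  have "projection A (finsum A Q (star ?x))"
    using star_sum[OF e] U_projection[OF head_in_verts[OF e]] by (rule subst)
  then show ?thesis
    using projections_orthogonal[of "star ?x" Q i j] finite_star Q_projection star_letters ij assms(3) e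
    by (meson head_in_verts subsetD)
next
  case False
  have e: "snd i \<in> edges" "snd j \<in> edges" using assms by (auto simp: letters_def)
  have g: "fst i \<in> carrier (G (r (snd i)))" "fst j \<in> carrier (G (r (snd j)))"
    using assms \<Sigma>_closed by (auto simp: letters_def)
  let ?p = "\<lambda>i. U (r (snd i)) \<one>\<^bsub>G (r (snd i))\<^esub>"
  have x: "r (snd i) \<in> verts (gr \<G>)" "r (snd j) \<in> verts (gr \<G>)" using e by auto
  have pQ: "?p k \<otimes> Q k = Q k" if "k \<in> {i, j}" for k
  proof -
    have "?p k \<otimes> elt k = elt k"
      unfolding elt_def using that U_one_mult(1)[OF x(1) g(1)] U_one_mult(1)[OF x(2) g(2)]
        U_closed[OF x(1) g(1)] U_closed[OF x(2) g(2)] U_one(1)[OF x(1)] U_one(1)[OF x(2)] e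
      by (auto simp flip: m_assoc)
    then show ?thesis unfolding Q_def using that assms U_one(1)[OF x(1)] U_one(1)[OF x(2)]
      by (auto simp flip: m_assoc)
  qed
  have "Q i \<otimes> ?p i = Q i"
    using arg_cong[OF pQ[of i], of "adj A"] assms(1) x U_one[OF x(1)] by (simp add: adj_mult Q_sa)
  then have "Q i \<otimes> Q j = (Q i \<otimes> ?p i) \<otimes> (?p j \<otimes> Q j)" using pQ[of j] by simp
  also have "\<dots> = Q i \<otimes> (?p i \<otimes> ?p j) \<otimes> Q j"
    using assms U_one(1)[OF x(1)] U_one(1)[OF x(2)] by (simp add: m_assoc)
  also have "\<dots> = \<zero>" using U_orthogonal[OF x False] assms by simp
  finally show ?thesis .
qed

lemma source_absorb:
  assumes e: "e \<in> edges" and j: "j \<in> follow e"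
  shows "(S e)\<^sup>\<star> \<otimes> S e \<otimes> Q j = Q j"
proof -
  have "projection A (finsum A Q (follow e))"
    using partial_isometry_source[OF S_partial[OF e]] source_sum[OF e] by simp
  then show ?thesis
    unfolding source_sum[OF e]
    using finsum_projections_absorb(1)[of "follow e" Q j] finite_follow[OF e] Q_projection follow_letters j
    by blast
qed

lemma elt_Q_elt:
  assumes i: "i \<in> letters" and j: "j \<in> follow (snd i)"
  shows "(elt i \<otimes> Q j)\<^sup>\<star> \<otimes> (elt i \<otimes> Q j) = Q j"
proof -
  have e: "snd i \<in> edges" using i by (auto simp: letters_def)
  have j': "j \<in> letters" using j follow_letters by blast
  have "(elt i \<otimes> Q j)\<^sup>\<star> \<otimes> (elt i \<otimes> Q j) = Q j \<otimes> (((elt i)\<^sup>\<star> \<otimes> elt i) \<otimes> Q j)"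
    using i j' by (simp add: adj_mult Q_sa m_assoc)
  then show ?thesis unfolding elt_source[OF i] source_absorb[OF e j] by (simp add: Q_idem j')
qed

text \<open>Inserting the projection \<open>S\<^sub>e\<^sup>\<star>S\<^sub>e\<close> between \<open>elt i\<close> and \<open>(elt i')\<^sup>\<star>\<close> and expanding it by (G4).\<close>

lemma elt_elt_adj_sum:
  assumes i: "i \<in> letters" "i' \<in> letters" "snd i' = snd i"
  shows "elt i \<otimes> (elt i')\<^sup>\<star> = finsum A (\<lambda>j. (elt i \<otimes> Q j) \<otimes> (elt i' \<otimes> Q j)\<^sup>\<star>) (follow (snd i))"
proof -
  have e: "snd i \<in> edges" using i by (auto simp: letters_def)
  have fQ: "Q \<in> follow (snd i) \<rightarrow> carrier A" using follow_letters by auto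
  have "elt i \<otimes> (elt i')\<^sup>\<star> = elt i \<otimes> ((elt i)\<^sup>\<star> \<otimes> elt i) \<otimes> (elt i')\<^sup>\<star>"
    using elt_partial[OF i(1)] i by (simp add: partial_isometry_def m_assoc)
  also have "\<dots> = elt i \<otimes> finsum A Q (follow (snd i)) \<otimes> (elt i')\<^sup>\<star>"
    by (simp add: elt_source[OF i(1)] source_sum[OF e])
  also have "\<dots> = finsum A (\<lambda>j. elt i \<otimes> Q j \<otimes> (elt i')\<^sup>\<star>) (follow (snd i))"
    using i fQ by (subst finsum_mult_left, simp_all, subst finsum_mult_right) auto
  also have "\<dots> = finsum A (\<lambda>j. (elt i \<otimes> Q j) \<otimes> (elt i' \<otimes> Q j)\<^sup>\<star>) (follow (snd i))"
  proof (rule finsum_cong'[OF refl])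
    show "(\<lambda>j. (elt i \<otimes> Q j) \<otimes> (elt i' \<otimes> Q j)\<^sup>\<star>) \<in> follow (snd i) \<rightarrow> carrier A"
      using i by (intro Pi_I m_closed adj_closed elt_closed Q_closed) (auto intro: in_letters)
    fix j assume "j \<in> follow (snd i)"
    then have j: "j \<in> letters" using follow_letters by blast
    have "(elt i \<otimes> Q j) \<otimes> (elt i' \<otimes> Q j)\<^sup>\<star> = elt i \<otimes> (Q j \<otimes> Q j) \<otimes> (elt i')\<^sup>\<star>"
      using i j by (simp add: adj_mult Q_sa m_assoc)
    then show "elt i \<otimes> Q j \<otimes> (elt i')\<^sup>\<star> = (elt i \<otimes> Q j) \<otimes> (elt i' \<otimes> Q j)\<^sup>\<star>" using j by (simp add: Q_idem)
  qed
  finally show ?thesis .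
qed

lemma path_elt_1: "path_elt \<G> A U S [i] = elt i"
  by (cases i) (simp add: elt_def)

lemma path_elt_2:
  "\<lbrakk>i \<in> letters; j \<in> letters\<rbrakk> \<Longrightarrow> path_elt \<G> A U S [i, j] \<otimes> (path_elt \<G> A U S [j])\<^sup>\<star> = elt i \<otimes> Q j"
proof -
  assume i: "i \<in> letters" and j: "j \<in> letters"
  have "path_elt \<G> A U S [i, j] = elt i \<otimes> elt j" by (cases i; cases j) (simp add: elt_def)
  then show ?thesis using i j m_assoc[of "elt i" "elt j" "(elt j)\<^sup>\<star>"] by (simp add: path_elt_1 Q_def)
qed

lemma verts_EG: "verts EG = (\<lambda>i. [i]) ` letters"
  and arcs_EG: "arcs EG = {[i, j] | i j. i \<in> letters \<and> j \<in> follow (snd i)}"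
  by (auto simp: letters_def image_iff)

definition P_EG :: "('g \<times> 'e) list \<Rightarrow> 'a" where
  "P_EG xs = path_elt \<G> A U S xs \<otimes> (path_elt \<G> A U S xs)\<^sup>\<star>"

definition T_EG :: "('g \<times> 'e) list \<Rightarrow> 'a" where
  "T_EG xs = path_elt \<G> A U S xs \<otimes> (path_elt \<G> A U S (tail EG xs))\<^sup>\<star>"

lemma P_EG_eq: "P_EG [i] = Q i"
  by (simp only: P_EG_def path_elt_1 Q_def)

lemma T_EG_eq: "\<lbrakk>i \<in> letters; j \<in> follow (snd i)\<rbrakk> \<Longrightarrow> T_EG [i, j] = elt i \<otimes> Q j"
  using path_elt_2[of i j] follow_letters by (auto simp: T_EG_def)

text \<open>The edge [i, j] is sent to \<open>elt i \<otimes> Q j\<close>. Its source projection is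
  \<open>Q j\<close>, since \<open>Q j\<close> lies below the source projection of
  \<open>elt i\<close>, and for fixed i the range projections add up to \<open>Q i\<close> by
  (G4).\<close>

lemma ck_family_EG: "ck_family EG A P_EG T_EG"
proof -
  have pi: "partial_isometry A (T_EG [i, j]) \<and> (T_EG [i, j])\<^sup>\<star> \<otimes> T_EG [i, j] = P_EG [j]"
    if ij: "i \<in> letters" "j \<in> follow (snd i)" for i j
  proof -
    have j': "j \<in> letters" using ij follow_letters by blast
    have TT: "(elt i \<otimes> Q j)\<^sup>\<star> \<otimes> (elt i \<otimes> Q j) = Q j" by (rule elt_Q_elt[OF ij])
    have "(elt i \<otimes> Q j) \<otimes> (elt i \<otimes> Q j)\<^sup>\<star> \<otimes> (elt i \<otimes> Q j)
        = (elt i \<otimes> Q j) \<otimes> ((elt i \<otimes> Q j)\<^sup>\<star> \<otimes> (elt i \<otimes> Q j))"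
      using ij(1) j' by (intro m_assoc) auto
    also have "\<dots> = elt i \<otimes> (Q j \<otimes> Q j)" unfolding TT using ij(1) j' by (simp add: m_assoc)
    finally show ?thesis
      unfolding T_EG_eq[OF ij] P_EG_eq partial_isometry_def using TT ij(1) j' by (simp add: Q_idem)
  qed
  have sum: "P_EG [i] = finsum A (\<lambda>\<mu>. T_EG \<mu> \<otimes> (T_EG \<mu>)\<^sup>\<star>) {\<mu> \<in> arcs EG. head EG \<mu> = [i]}"
    if i: "i \<in> letters" for i
  proof -
    have e: "snd i \<in> edges" using i by (auto simp: letters_def)
    have eq: "{\<mu> \<in> arcs EG. head EG \<mu> = [i]} = (\<lambda>j. [i, j]) ` follow (snd i)"
      using in_arcs_EG[of "snd i" "fst i"] i unfolding letters_def by (auto simp del: EG_sel simp: case_prod_unfold)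
    have c: "(\<lambda>\<mu>. T_EG \<mu> \<otimes> (T_EG \<mu>)\<^sup>\<star>) \<in> (\<lambda>j. [i, j]) ` follow (snd i) \<rightarrow> carrier A"
      using i by (auto simp: T_EG_eq intro!: m_closed adj_closed elt_closed Q_closed intro: in_letters
          simp del: split_paired_All)
    have "finsum A (\<lambda>\<mu>. T_EG \<mu> \<otimes> (T_EG \<mu>)\<^sup>\<star>) {\<mu> \<in> arcs EG. head EG \<mu> = [i]}
        = finsum A (\<lambda>j. T_EG [i, j] \<otimes> (T_EG [i, j])\<^sup>\<star>) (follow (snd i))"
      unfolding eq using c by (intro finsum_reindex) (auto simp: inj_on_def)
    also have "\<dots> = finsum A (\<lambda>j. (elt i \<otimes> Q j) \<otimes> (elt i \<otimes> Q j)\<^sup>\<star>) (follow (snd i))"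
      using i by (intro finsum_cong') (auto simp: T_EG_eq intro!: m_closed adj_closed elt_closed Q_closed
          intro: in_letters)
    also have "\<dots> = Q i" using elt_elt_adj_sum[OF i i refl] by (simp add: Q_def)
    finally show ?thesis by (simp add: P_EG_eq)
  qed
  show ?thesis unfolding ck_family_def verts_EG
  proof (intro conjI ballI impI)
    fix a assume "a \<in> arcs EG"
    then obtain i j where "a = [i, j]" "i \<in> letters" "j \<in> follow (snd i)" unfolding arcs_EG by blast
    then show "partial_isometry A (T_EG a)" "(T_EG a)\<^sup>\<star> \<otimes> T_EG a = P_EG (tail EG a)"
      using pi by auto
  next
    fix v assume "v \<in> (\<lambda>i. [i]) ` letters"
    then obtain i where i: "v = [i]" "i \<in> letters" by blast
    show "projection A (P_EG v)" using i by (simp add: P_EG_eq Q_projection)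
    show "P_EG v = finsum A (\<lambda>a. T_EG a \<otimes> (T_EG a)\<^sup>\<star>) {a \<in> arcs EG. head EG a = v}"
      unfolding i(1) by (rule sum[OF i(2)])
    fix w assume "w \<in> (\<lambda>i. [i]) ` letters" "v \<noteq> w"
    then obtain j where j: "w = [j]" "j \<in> letters" "i \<noteq> j" using i(1) by blast
    show "P_EG v \<otimes> P_EG w = \<zero>" using i j Q_orthogonal[of i j] by (simp add: P_EG_eq)
  qed
qed

text \<open>In (G3), in (G4) and in the partial isometry relation z cancels against its conjugate,
  and (G2) is linear in S_e.\<close>

lemma gauge_g_family:
  assumes z: "cmod z = 1" shows "g_family \<G> \<Sigma> A U (\<lambda>e. z \<odot> S e)"
proof -
  have zz: "cnj z * z = 1" "z * cnj z = 1" using z by (simp_all add: complex_norm_square[symmetric] mult.commute)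
  have src: "(z \<odot> S e)\<^sup>\<star> \<otimes> (z \<odot> S e) = (S e)\<^sup>\<star> \<otimes> S e"
    and rng: "(z \<odot> S e) \<otimes> (z \<odot> S e)\<^sup>\<star> = S e \<otimes> (S e)\<^sup>\<star>" if "e \<in> edges" for e
    using that by (simp_all add: adj_smult smult_m_l smult_m_r zz flip: smult_assoc)
  have sum: "(S e)\<^sup>\<star> \<otimes> S e = finsum A (\<lambda>(h, f). U (s e) h \<otimes> (z \<odot> S f) \<otimes> (z \<odot> S f)\<^sup>\<star> \<otimes> (U (s e) h)\<^sup>\<star>) (follow e)"
    if e: "e \<in> edges" for e
    unfolding G4[OF e]
  proof (rule finsum_cong'[OF refl])
    have c: "U (s e) h \<in> carrier A \<and> S f \<in> carrier A" if "(h, f) \<in> follow e" for h f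
      using that e \<Sigma>_closed[of f h] by (auto simp: follow_def)
    show "(\<lambda>(h, f). U (s e) h \<otimes> (z \<odot> S f) \<otimes> (z \<odot> S f)\<^sup>\<star> \<otimes> (U (s e) h)\<^sup>\<star>) \<in> follow e \<rightarrow> carrier A"
      using c by auto
    fix i assume i: "i \<in> follow e"
    obtain h f where hf: "i = (h, f)" by (metis surj_pair)
    have f: "f \<in> edges" using i by (auto simp: hf follow_def)
    have "U (s e) h \<otimes> (z \<odot> S f) \<otimes> (z \<odot> S f)\<^sup>\<star> = U (s e) h \<otimes> ((z \<odot> S f) \<otimes> (z \<odot> S f)\<^sup>\<star>)"
      using c[of h f] i f by (intro m_assoc) (auto simp: hf)
    also have "\<dots> = U (s e) h \<otimes> S f \<otimes> (S f)\<^sup>\<star>" using c[of h f] i f by (simp add: hf rng m_assoc)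
    finally show "(case i of (h, f) \<Rightarrow> U (s e) h \<otimes> S f \<otimes> (S f)\<^sup>\<star> \<otimes> (U (s e) h)\<^sup>\<star>) =
        (case i of (h, f) \<Rightarrow> U (s e) h \<otimes> (z \<odot> S f) \<otimes> (z \<odot> S f)\<^sup>\<star> \<otimes> (U (s e) h)\<^sup>\<star>)"
      by (simp add: hf)
  qed
  show ?thesis unfolding g_family_def follow_def[symmetric]
  proof (intro conjI ballI impI)
    fix e assume e: "e \<in> edges"
    show "partial_isometry A (z \<odot> S e)"
    proof -
      have "(z \<odot> S e) \<otimes> (z \<odot> S e)\<^sup>\<star> \<otimes> (z \<odot> S e) = z \<odot> (S e \<otimes> (S e)\<^sup>\<star> \<otimes> S e)"
        unfolding rng[OF e] using e by (simp add: smult_m_r)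
      then show ?thesis using S_partial[OF e] e by (simp add: partial_isometry_def)
    qed
    show "U (s e) \<one>\<^bsub>G (s e)\<^esub> = (z \<odot> S e)\<^sup>\<star> \<otimes> (z \<odot> S e) \<oplus> (z \<odot> S (ebar e)) \<otimes> (z \<odot> S (ebar e))\<^sup>\<star>"
      using e by (simp add: src rng G3)
    show "(z \<odot> S e)\<^sup>\<star> \<otimes> (z \<odot> S e) =
        finsum A (\<lambda>(h, f). U (s e) h \<otimes> (z \<odot> S f) \<otimes> (z \<odot> S f)\<^sup>\<star> \<otimes> (U (s e) h)\<^sup>\<star>) (follow e)"
      unfolding src[OF e] by (rule sum[OF e])
    fix k assume k: "k \<in> carrier (Ge e)"
    have "U (r e) (\<alpha> e k) \<in> carrier A" "U (s e) (\<alpha> (ebar e) k) \<in> carrier A"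
      using e \<alpha>_closed[OF e k] \<alpha>_bar(1)[OF e k] by auto
    then show "U (r e) (\<alpha> e k) \<otimes> (z \<odot> S e) = (z \<odot> S e) \<otimes> U (s e) (\<alpha> (ebar e) k)"
      using e G2[OF e k] by (simp add: smult_m_l smult_m_r)
  qed (simp_all add: U_projection U_corner U_mult U_orthogonal)
qed


lemma Q_nonzero:
  assumes i: "i \<in> letters" and nz: "S (snd i) \<noteq> \<zero>" shows "Q i \<noteq> \<zero>"
proof
  assume "Q i = \<zero>"
  then have "\<parallel>elt i\<parallel>\<^sup>2 = 0" using cstar_identity'[OF elt_closed[OF i]] by (simp add: Q_def)
  then have "elt i = \<zero>" using nrm_eq_0[OF elt_closed[OF i]] by simp
  then have "(S (snd i))\<^sup>\<star> \<otimes> S (snd i) = \<zero>" using elt_source[OF i] by simp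
  then show False using nz letters_U[OF i] by (simp add: adj_mult_self_eq_0)
qed

end

section \<open>Surjectivity for trivial edge groups\<close>

lemma (in cstar_algebra) finsum_mem_subalgebra:
  assumes "cstar_subalgebra A I" "\<And>k. k \<in> K \<Longrightarrow> f k \<in> I"
  shows "finsum A f K \<in> I"
  using assms(2)
proof (induction K rule: infinite_finite_induct)
  case (insert k K)
  have sub: "I \<subseteq> carrier A" using assms(1) by (simp add: cstar_subalgebra_def)
  have "f k \<in> I" "finsum A f K \<in> I" using insert by auto
  then have "f k \<oplus> finsum A f K \<in> I" using assms(1) by (simp add: cstar_subalgebra_def)
  moreover have "f k \<in> carrier A" "f \<in> K \<rightarrow> carrier A" using insert.prems sub by auto
  ultimately show ?case using insert.hyps by (simp add: finsum_insert)
qed (use assms(1) in \<open>simp_all add: cstar_subalgebra_def finsum_infinite\<close>)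

context graph_of_groups_setup
begin

text \<open>\<open>connected\<close> speaks about the symmetrized graph: a path from x to the range
  of some edge starts with an edge at x, which is reversed if x is its source. It supplies the edge
  that \<open>star_sum\<close> needs to expand the projection of x over letters.\<close>

lemma vertex_has_edge:
  assumes x: "x \<in> verts (gr \<G>)" and ne: "edges \<noteq> {}"
  shows "\<exists>f\<in>edges. r f = x"
proof -
  obtain f where f: "f \<in> edges" using ne by blast
  show ?thesis
  proof (cases "r f = x")
    case False
    have "strongly_connected (mk_symmetric (gr \<G>))"
      using gog by (simp add: graph_of_groups_def connected_def)
    then have "x \<rightarrow>\<^sup>*\<^bsub>with_proj (mk_symmetric (gr \<G>))\<^esub> r f"
      using x f unfolding strongly_connected_def by simp
    then obtain y where "(x, y) \<in> parcs (mk_symmetric (gr \<G>))"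
      using False by (cases rule: pre_digraph.converse_reachable_cases) auto
    then obtain e where e: "e \<in> edges" "x = s e \<or> x = r e" by (auto simp: parcs_mk_symmetric)
    then show ?thesis using head_arev[of e] arev_in_arcs[of e] by metis
  qed (use f in blast)
qed

end

context g_family_setup
begin

text \<open>\<open>elt_elt_adj_sum\<close> puts products of \<open>elt i\<close> with adjoints for
  the same edge into \<open>I\<close>, and S_e is the sum of the edges of the path digraph that
  start with (1, e). For a group element g at x, the product of \<open>U x g\<close> with
  \<open>Q\<close> at (h, f) is \<open>elt\<close> at (gh, f) times the adjoint of
  \<open>elt\<close> at (h, f); summing over all letters at x gives \<open>U x g\<close>.\<close>

lemma generators_mem:
  assumes I: "cstar_subalgebra A I" and T: "T_EG ` arcs EG \<subseteq> I"
    and ne: "edges \<noteq> {}" and triv: "\<And>e. e \<in> edges \<Longrightarrow> carrier (Ge e) = {\<one>\<^bsub>Ge e\<^esub>}"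
  shows "(\<Union>x\<in>verts (gr \<G>). U x ` carrier (G x)) \<union> S ` edges \<subseteq> I"
proof -
  have TI: "elt i \<otimes> Q j \<in> I" if "i \<in> letters" "j \<in> follow (snd i)" for i j
  proof -
    have "[i, j] \<in> arcs EG" unfolding arcs_EG using that by blast
    then show ?thesis using T T_EG_eq[OF that] by (metis image_subset_iff)
  qed
  have mI: "x \<otimes> y \<in> I" "x\<^sup>\<star> \<in> I" if "x \<in> I" "y \<in> I" for x y
    using I that by (auto simp: cstar_subalgebra_def)
  have EI: "elt i \<otimes> (elt i')\<^sup>\<star> \<in> I" if "i \<in> letters" "i' \<in> letters" "snd i' = snd i" for i i'
    unfolding elt_elt_adj_sum[OF that]
    using TI that mI by (intro finsum_mem_subalgebra[OF I]) metis
  have SI: "S e \<in> I" if e: "e \<in> edges" for e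
  proof -
    let ?i = "(\<one>\<^bsub>G (r e)\<^esub>, e)"
    have i: "?i \<in> letters" using e \<Sigma>_one by (simp add: letters_def)
    have "elt ?i = S e" using U_one_mult_S[OF e] by (simp add: elt_def)
    then have "S e = elt ?i \<otimes> finsum A Q (follow e)" using S_S_adj_S[OF e] source_sum[OF e] by simp
    also have "\<dots> = finsum A (\<lambda>j. elt ?i \<otimes> Q j) (follow e)"
      using i by (intro finsum_mult_left) (auto intro: in_letters)
    also have "\<dots> \<in> I" using TI[OF i] by (intro finsum_mem_subalgebra[OF I]) simp
    finally show ?thesis .
  qed
  have UI: "U x g \<in> I" if x: "x \<in> verts (gr \<G>)" and g: "g \<in> carrier (G x)" for x g
  proof -
    interpret Gx: group "G x" by (rule G_group[OF x])
    obtain f0 where f0: "f0 \<in> edges" "r f0 = x" using vertex_has_edge[OF x ne] by blast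
    have "U x g = U x g \<otimes> finsum A Q (star x)"
      using U_one_mult(2)[OF x g] star_sum[OF f0(1)] f0(2) by simp
    also have "\<dots> = finsum A (\<lambda>i. U x g \<otimes> Q i) (star x)"
      using U_closed[OF x g] star_letters by (intro finsum_mult_left) (auto intro!: Q_closed)
    also have "\<dots> \<in> I"
    proof (rule finsum_mem_subalgebra[OF I])
      fix i assume i: "i \<in> star x"
      obtain h f where hf: "i = (h, f)" "f \<in> edges" "r f = x" "h \<in> \<Sigma> f" using i by (auto simp: star_def)
      have hc: "h \<in> carrier (G x)" using \<Sigma>_closed[OF hf(2,4)] hf(3) by simp
      have il: "i \<in> letters" using i star_letters by blast
      \<comment> \<open>Trivial edge groups enter here: every coset is a single element, so gh is
        its own representative.\<close>
      have "g \<otimes>\<^bsub>G x\<^esub> h \<in> \<Sigma> f"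
      proof -
        obtain h' k where k: "h' \<in> \<Sigma> f" "k \<in> carrier (Ge f)" "g \<otimes>\<^bsub>G x\<^esub> h = h' \<otimes>\<^bsub>G x\<^esub> \<alpha> f k"
          using \<Sigma>_decompose[OF hf(2), of "g \<otimes>\<^bsub>G x\<^esub> h"] g hc hf(3) by auto
        have "k = \<one>\<^bsub>Ge f\<^esub>" using k(2) triv[OF hf(2)] by simp
        then have "\<alpha> f k = \<one>\<^bsub>G x\<^esub>" using \<alpha>_one[OF hf(2)] hf(3) by simp
        then show ?thesis using k \<Sigma>_closed[OF hf(2) k(1)] hf(3) by simp
      qed
      then have l: "(g \<otimes>\<^bsub>G x\<^esub> h, f) \<in> letters" using hf(2) by (simp add: letters_def)
      have "U x g \<otimes> Q i = elt (g \<otimes>\<^bsub>G x\<^esub> h, f) \<otimes> (elt i)\<^sup>\<star>"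
      proof -
        have "elt (g \<otimes>\<^bsub>G x\<^esub> h, f) = U x g \<otimes> elt i"
          using hf U_mult[OF x g hc] m_assoc[OF U_closed[OF x g] U_closed[OF x hc] S_closed[OF hf(2)]]
          by (simp add: elt_def)
        then show ?thesis using il U_closed[OF x g] by (simp add: Q_def m_assoc)
      qed
      then show "U x g \<otimes> Q i \<in> I" using EI[OF l il] hf(1) by simp
    qed
    finally show ?thesis .
  qed
  show ?thesis using SI UI by blast
qed

end

text \<open>Surjectivity carries the condition that there is an edge because of the graph with one
  vertex x and no edges. It satisfies the other hypotheses, but there the path digraph is empty and
  its algebra is zero, whereas C*(\<G>) is the full group C*-algebra of G_x. Universality of
  \<open>B\<close> produces \<phi>; universality of \<open>A\<close> produces the gauge action and
  the nonvanishing of the vertex projections.\<close>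

theorem theorem3p6:
  fixes \<G> :: "('v, 'e, 'g, 'h) gog"
    and \<Sigma> :: "'e \<Rightarrow> 'g set"
  assumes "graph_of_groups \<G>"
    and "locally_finite \<G>"
    and "nonsingular \<G>"
    and "countable_groups \<G>"
    and "transversals \<G> \<Sigma>"
  shows "wf_digraph (path_digraph \<G> \<Sigma>) \<and> row_finite (path_digraph \<G> \<Sigma>) \<and>
    no_sources (path_digraph \<G> \<Sigma>) \<and>
    (\<forall>(B :: 'b cstar) p t (A :: 'a cstar) u s.
       is_graph_algebra (path_digraph \<G> \<Sigma>) B p t \<and> is_gog_algebra \<G> \<Sigma> A u s \<longrightarrow>
       (\<exists>\<phi>\<in>star_hom B A. inj_on \<phi> (carrier B) \<and>
          (\<forall>\<nu>\<in>verts (path_digraph \<G> \<Sigma>).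
             \<phi> (p \<nu>) = path_elt \<G> A u s \<nu> \<otimes>\<^bsub>A\<^esub> (path_elt \<G> A u s \<nu>)\<^sup>\<star>\<^bsub>A\<^esub>) \<and>
          (\<forall>\<mu>\<in>arcs (path_digraph \<G> \<Sigma>).
             \<phi> (t \<mu>) = path_elt \<G> A u s \<mu> \<otimes>\<^bsub>A\<^esub>
               (path_elt \<G> A u s (tail (path_digraph \<G> \<Sigma>) \<mu>))\<^sup>\<star>\<^bsub>A\<^esub>) \<and>
          (arcs (gr \<G>) \<noteq> {} \<and>
             (\<forall>e\<in>arcs (gr \<G>). carrier (egrp \<G> e) = {\<one>\<^bsub>egrp \<G> e\<^esub>}) \<longrightarrow>
           \<phi> ` carrier B = carrier A)))"
proof -
  interpret graph_of_groups_setup \<G> \<Sigma> by unfold_locales (rule assms)+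
  have "\<exists>\<phi>\<in>star_hom B A. inj_on \<phi> (carrier B) \<and>
      (\<forall>\<nu>\<in>verts EG. \<phi> (p \<nu>) = path_elt \<G> A u s \<nu> \<otimes>\<^bsub>A\<^esub> (path_elt \<G> A u s \<nu>)\<^sup>\<star>\<^bsub>A\<^esub>) \<and>
      (\<forall>\<mu>\<in>arcs EG. \<phi> (t \<mu>) = path_elt \<G> A u s \<mu> \<otimes>\<^bsub>A\<^esub> (path_elt \<G> A u s (tail EG \<mu>))\<^sup>\<star>\<^bsub>A\<^esub>) \<and>
      (arcs (gr \<G>) \<noteq> {} \<and> (\<forall>e\<in>arcs (gr \<G>). carrier (egrp \<G> e) = {\<one>\<^bsub>egrp \<G> e\<^esub>}) \<longrightarrow>
        \<phi> ` carrier B = carrier A)"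
    if B: "is_graph_algebra EG B p t" and A: "is_gog_algebra \<G> \<Sigma> A u s"
    for B :: "'b cstar" and p t and A :: "'a cstar" and u s
  proof -
    have cA: "cstar_algebra A" and fam: "g_family \<G> \<Sigma> A u s"
      and genA: "cstar_generated_by A ((\<Union>x\<in>verts (gr \<G>). u x ` carrier (vgrp \<G> x)) \<union> s ` arcs (gr \<G>))"
      using A by (simp_all add: is_gog_algebra_def)
    have cB: "cstar_algebra B" and ckB: "ck_family EG B p t"
      and genB: "cstar_generated_by B (p ` verts EG \<union> t ` arcs EG)"
      using B by (simp_all only: is_graph_algebra_def)
    interpret A: cstar_algebra A by (rule cA)
    interpret g: g_family_setup \<G> \<Sigma> A u s
      by (intro g_family_setup.intro graph_of_groups_setup_axioms cA g_family_setup_axioms.intro fam)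
    obtain \<phi> where \<phi>: "\<phi> \<in> star_hom B A" "\<And>\<nu>. \<nu> \<in> verts EG \<Longrightarrow> \<phi> (p \<nu>) = g.P_EG \<nu>"
        "\<And>\<mu>. \<mu> \<in> arcs EG \<Longrightarrow> \<phi> (t \<mu>) = g.T_EG \<mu>"
      using graph_algebra_universal[OF B wf_EG countable_EG cA g.ck_family_EG] by blast
    obtain \<psi> where \<psi>: "\<psi> \<in> star_hom A ell2_operators" "\<And>e. e \<in> edges \<Longrightarrow> \<psi> (s e) = pull_op (shift e)"
      using gog_algebra_universal[OF A assms(1,4,5) cstar_algebra_ell2_operators g_family_ell2] by blast
    interpret \<psi>: cstar_hom A ell2_operators \<psi>
      by (intro cstar_hom.intro cstar_hom_axioms.intro cA cstar_algebra_ell2_operators \<psi>(1))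
    have s0: "s e \<noteq> \<zero>\<^bsub>A\<^esub>" if "e \<in> edges" for e
      using shift_nonzero[OF that] \<psi>(2)[OF that] \<psi>.zero by metis
    interpret ge: gauge_equivariant EG B A p t \<phi>
    proof (intro gauge_equivariant.intro ck_representation.intro wf_EG cB ck_representation_axioms.intro
        ckB row_finite_EG no_sources_EG cstar_hom.intro cA cstar_hom_axioms.intro \<phi>(1) gauge_equivariant_axioms.intro)
      fix v assume v: "v \<in> verts EG"
      then obtain i where i: "v = [i]" "i \<in> g.letters" unfolding g.verts_EG by blast
      have "snd i \<in> edges" using i(2) by (auto simp: g.letters_def)
      then show "\<phi> (p v) \<noteq> \<zero>\<^bsub>A\<^esub>"
        using \<phi>(2)[OF v] g.Q_nonzero[OF i(2) s0] i(1) by (simp add: g.P_EG_eq)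
    next
      fix z :: complex assume z: "cmod z = 1"
      \<comment> \<open>The gauge automorphism comes from universality of \<open>A\<close>, applied
        to the family in which every s_e is multiplied by z. It multiplies \<open>elt\<close> by z
        and fixes \<open>Q\<close>, hence multiplies the image of every \<open>t a\<close> by
        z.\<close>
      obtain \<gamma> where \<gamma>: "\<gamma> \<in> star_hom A A"
          "\<And>x g. \<lbrakk>x \<in> verts (gr \<G>); g \<in> carrier (G x)\<rbrakk> \<Longrightarrow> \<gamma> (u x g) = u x g"
          "\<And>e. e \<in> edges \<Longrightarrow> \<gamma> (s e) = z \<odot>\<^bsub>A\<^esub> s e"
        using gog_algebra_universal[OF A assms(1,4,5) cA g.gauge_g_family[OF z]] by blast
      interpret \<gamma>: cstar_hom A A \<gamma>
        by (intro cstar_hom.intro cstar_hom_axioms.intro cA \<gamma>(1))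
      have elt: "\<gamma> (g.elt i) = z \<odot>\<^bsub>A\<^esub> g.elt i" if i: "i \<in> g.letters" for i
      proof -
        have "snd i \<in> edges" "fst i \<in> carrier (G (r (snd i)))"
          using i \<Sigma>_closed by (auto simp: g.letters_def)
        then show ?thesis using g.letters_U[OF i]
          by (simp add: g.elt_def \<gamma>.mult \<gamma>(2,3) A.smult_m_r)
      qed
      have zz: "z * cnj z = 1" using z by (simp add: complex_norm_square[symmetric])
      have Q: "\<gamma> (g.Q i) = g.Q i" if i: "i \<in> g.letters" for i
        using i by (simp add: g.Q_def \<gamma>.mult \<gamma>.adj elt A.adj_smult A.smult_m_l A.smult_m_r zz mult.commute
            flip: A.smult_assoc)
      show "\<exists>\<gamma>\<in>star_hom A A. (\<forall>v\<in>verts EG. \<gamma> (\<phi> (p v)) = \<phi> (p v)) \<and>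
          (\<forall>a\<in>arcs EG. \<gamma> (\<phi> (t a)) = z \<odot>\<^bsub>A\<^esub> \<phi> (t a))"
      proof (intro bexI[OF _ \<gamma>(1)] conjI ballI)
        fix v assume v: "v \<in> verts EG"
        then obtain i where i: "v = [i]" "i \<in> g.letters" unfolding g.verts_EG by blast
        then show "\<gamma> (\<phi> (p v)) = \<phi> (p v)" using \<phi>(2)[OF v] Q by (simp add: g.P_EG_eq)
      next
        fix a assume a: "a \<in> arcs EG"
        then obtain i j where ij: "a = [i, j]" "i \<in> g.letters" "j \<in> follow (snd i)"
          unfolding g.arcs_EG by blast
        then show "\<gamma> (\<phi> (t a)) = z \<odot>\<^bsub>A\<^esub> \<phi> (t a)"
          using \<phi>(3)[OF a] g.in_letters[OF ij(3)]
          by (simp add: g.T_EG_eq \<gamma>.mult elt Q A.smult_m_l)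
      qed
    qed
    note iso = ge.isometric[OF genB]
    have inj: "inj_on \<phi> (carrier B)"
    proof (rule inj_onI)
      fix x y assume xy: "x \<in> carrier B" "y \<in> carrier B" "\<phi> x = \<phi> y"
      then have "\<phi> (x \<ominus>\<^bsub>B\<^esub> y) = \<zero>\<^bsub>A\<^esub>" by (simp add: ge.phi.diff)
      then have "\<parallel>x \<ominus>\<^bsub>B\<^esub> y\<parallel>\<^bsub>B\<^esub> = 0" using iso[of "x \<ominus>\<^bsub>B\<^esub> y"] xy by simp
      then show "x = y" using xy by (simp add: ge.nrm_eq_0 ge.diff_eq_zero_iff)
    qed
    have onto: "\<phi> ` carrier B = carrier A"
      if "arcs (gr \<G>) \<noteq> {}" "\<forall>e\<in>arcs (gr \<G>). carrier (egrp \<G> e) = {\<one>\<^bsub>egrp \<G> e\<^esub>}"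
    proof -
      have sub: "cstar_subalgebra A (\<phi> ` carrier B)"
        by (rule ge.phi.image_subalgebra_if_isometric[OF iso])
      have "g.T_EG ` arcs EG \<subseteq> \<phi> ` carrier B"
        using \<phi>(3) ge.t_closed by (metis image_eqI image_subsetI)
      from g.generators_mem[OF sub this] that
      have "(\<Union>x\<in>verts (gr \<G>). u x ` carrier (vgrp \<G> x)) \<union> s ` arcs (gr \<G>) \<subseteq> \<phi> ` carrier B" by blast
      then show ?thesis using genA sub unfolding cstar_generated_by_def by blast
    qed
    show ?thesis
      using inj onto \<phi>(2,3) by (intro bexI[OF _ \<phi>(1)] conjI ballI impI) (auto simp: g.P_EG_def g.T_EG_def)
  qed
  then show ?thesis
    using wf_EG row_finite_EG no_sources_EG unfolding EG_def by blast
qed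

end
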